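(* Let $\{V_j\}$ be a GMRA (relative to a representation $\pi$ of $\Gamma$ and a unitary operator $\delta$ on a separable Hilbert space), whose associated measures are absolutely continuous with respect to Haar measure and whose associated multiplicity function $m$ is finite (almost everywhere). Let $H=[h_{i,j}]$ be a filter constructed from the GMRA using a unitary map $J$, and let $G$ be a complementary filter to $H$. Then the GMRA $\{V_j\}$ is equivalent to the canonical GMRA $\{V_j^{m,H,G}\}$.
   Context: Setting: $\Gamma$ is a countable (discrete) abelian group, $\alpha:\Gamma\to\Gamma$ is an injective homomorphism whose image has finite index $N>1$ in $\Gamma$, and $\bigcap_{n}\alpha^n(\Gamma)=\{0\}$. $\widehat\Gamma$ is the (compact) dual group, written multiplicatively, with Haar measure $\mu$. The dual endomorphism $\alpha^*:\widehat\Gamma\to\widehat\Gamma$, $[\alpha^*(\omega)](\gamma)=\omega(\alpha(\gamma))$, is onto and its kernel has exactly $N$ elements. Sets and functions on $\widehat\Gamma$ are considered up to Haar-null sets, identities are understood almost everywhere, and $L^2(\sigma)$ for Borel $\sigma\subseteq\widehat\Gamma$ is taken with respect to Haar measure restricted to $\sigma$. GMRA: let $\pi$ be a unitary representation of $\Gamma$ and $\delta$ a unitary operator on a separable Hilbert space $\mathcal H$ with $\delta^{-1}\pi_\gamma\delta=\pi_{\alpha(\gamma)}$ for all $\gamma$. A collection $\{V_j\}_{j\in\mathbb Z}$ of closed subspaces is a GMRA relative to $\pi$ and $\delta$ if $V_j\subseteq V_{j+1}$ and $V_{j+1}=\delta(V_j)$ for all $j$, $\bigcap_jV_j=\{0\}$,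 $\bigcup_jV_j$ is dense in $\mathcal H$, and $V_0$ is invariant under $\pi$. The associated measures are the measures on $\widehat\Gamma$ attached by Stone's theorem to the restrictions of $\pi$ to $V_0$ and to $W_0=V_1\ominus V_0$. When these are absolutely continuous with respect to Haar measure there are Borel sets $\sigma_1\supseteq\sigma_2\supseteq\cdots$ (unique up to null sets) and a (not necessarily unique) unitary $J:V_0\to\bigoplus_iL^2(\sigma_i)$ with $[J(\pi_\gamma f)](\omega)=\omega(\gamma)[J(f)](\omega)$; $m=\sum_i\chi_{\sigma_i}$ is the associated multiplicity function. It satisfies $m(\omega)\le\sum_{\alpha^*(\zeta)=\omega}m(\zeta)$. The filter constructed from the GMRA using $J$ is the matrix $H=[h_{i,j}]$ with $\bigoplus_jh_{i,j}=J(\delta^{-1}(J^{-1}(C_i)))$, where $C_i\in\bigoplus_jL^2(\sigma_j)$ has $i$th coordinate $\chi_{\sigma_i}$ and other coordinates $0$. One has $J\circ\delta^{-1}\circ J^{-1}=S_H$ (defined below), which is a pure isometry, meaning $\bigcap_{n\ge0}S_H^n(\bigoplus_iL^2(\sigma_i))=\{0\}$. Filters: let $\widetilde m(\omega)=\sum_{\alpha^*(\zeta)=\omega}m(\zeta)-m(\omega)$ and $\widetilde\sigma_k=\{\omega:\widetilde m(\omega)\ge k\}$. A filter relative to $m$ and $\alpha^*$ is a (possibly infinite) matrix $H=[h_{i,j}]$ of Borel complex-valued functions on $\widehat\Gamma$, $h_{i,j}$ supported in $\sigma_j$, with $\sum_{\alpha^*(\zeta)=\omega}\sum_j h_{i,j}(\zeta)\overline{h_{i',j}(\zeta)}=N\delta_{i,i'}\chi_{\sigma_i}(\omega)$.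 (A filter constructed from a GMRA is such a filter.) A complementary filter to $H$ is a matrix $G=[g_{k,j}]$ of Borel complex-valued functions, $g_{k,j}$ supported in $\sigma_j$, with $\sum_{\alpha^*(\zeta)=\omega}\sum_j g_{k,j}(\zeta)\overline{g_{k',j}(\zeta)}=N\delta_{k,k'}\chi_{\widetilde\sigma_k}(\omega)$ and $\sum_{\alpha^*(\zeta)=\omega}\sum_j g_{k,j}(\zeta)\overline{h_{i,j}(\zeta)}=0$. The Ruelle operators are $S_H$ on $\bigoplus_iL^2(\sigma_i)$, $[S_H(f)](\omega)=H^t(\omega)f(\alpha^*(\omega))$, and $S_G:\bigoplus_kL^2(\widetilde\sigma_k)\to\bigoplus_iL^2(\sigma_i)$, $[S_G(f)](\omega)=G^t(\omega)f(\alpha^*(\omega))$. Dilation by $\alpha^*$: fix a Borel cross-section $c$ of $\alpha^*$ (so $\alpha^*(c(\omega))=\omega$) and let $\tau(\omega)=c(\alpha^*(\omega))\omega^{-1}\in\ker\alpha^*$. Given $\mathcal K=\bigoplus_iL^2(E_i,\nu_i)$ (countable direct sum, $E_i\subseteq\widehat\Gamma$ Borel, $\nu_i$ a finite Borel measure on $E_i$), for $\zeta\in\ker\alpha^*$ put $E_{i,\zeta}=\{\omega\in E_i:\tau(\omega)=\zeta\}$, $E'_{i,\zeta}=\alpha^*(E_{i,\zeta})$, $\nu'_{i,\zeta}(F)=N\nu_i(E_{i,\zeta}\cap{\alpha^*}^{-1}(F))$, and $\mathcal D(\mathcal K)=\bigoplus_{i,\zeta}L^2(E'_{i,\zeta},\nu'_{i,\zeta})$,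 with $\mathcal D:\mathcal K\to\mathcal D(\mathcal K)$ the surjective isometry $[\mathcal D(f)]_{i,\zeta}(\omega)=\frac1{\sqrt N}f_i(\zeta^{-1}c(\omega))$. Canonical GMRA: for $m$ a multiplicity function, $H$ a filter relative to $m$ and $\alpha^*$ with $S_H$ a pure isometry, and $G$ complementary to $H$, let $\mathcal V_0=\bigoplus_iL^2(\sigma_i)$, $\mathcal W_0=\bigoplus_kL^2(\widetilde\sigma_k)$, $\mathcal W_n=\mathcal D(\mathcal W_{n-1})$ for $n\ge1$, $\mathcal H=\mathcal V_0\oplus\bigoplus_{n\ge0}\mathcal W_n$; let $\Gamma$ act by $[\pi_\gamma(f)](\omega)=\omega(\gamma)f(\omega)$ and let $T$ be the unitary on $\mathcal H$ with $[T(f)]_{\mathcal V_0}=S_H(f_{\mathcal V_0})+S_G(f_{\mathcal W_0})$ and $[T(f)]_{\mathcal W_n}=\mathcal D^{-1}(f_{\mathcal W_{n+1}})$ for $n\ge0$. Then $V_j^{m,H,G}=T^{-j}(\mathcal V_0)$, $j\in\mathbb Z$, is a GMRA relative to $\pi$ and $\delta=T^{-1}$, called the canonical GMRA with these parameters. Equivalence: GMRAs $\{V_j\}$ (in $\mathcal H$, relative to $\pi,\delta$) and $\{V'_j\}$ (in $\mathcal H'$, relative to $\pi',\delta'$) are equivalent if there is a unitary $U:\mathcal H\to\mathcal H'$ with $U(V_j)=V'_j$ for all $j$, $U\circ\pi_\gamma=\pi'_\gamma\circ U$ for all $\gamma\in\Gamma$, and $U\circ\delta=\delta'\circ U$. 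*)

theory Defs
  imports "HOL-Probability.Probability_Measure" "HOL-Analysis.Analysis"
begin

section \<open>Complex Hilbert spaces on explicit carriers\<close>

record 'a hspace =
  hcarrier :: "'a set"
  hadd :: "'a \<Rightarrow> 'a \<Rightarrow> 'a"
  hzero :: 'a
  hscale :: "complex \<Rightarrow> 'a \<Rightarrow> 'a"
  hinner :: "'a \<Rightarrow> 'a \<Rightarrow> complex"

definition hnorm :: "'a hspace \<Rightarrow> 'a \<Rightarrow> real" where
  "hnorm H f = sqrt (Re (hinner H f f))"

definition hdist :: "'a hspace \<Rightarrow> 'a \<Rightarrow> 'a \<Rightarrow> real" where
  "hdist H f g = hnorm H (hadd H f (hscale H (-1) g))"

locale hilbert_space =
  fixes H :: "'a hspace"
  assumes add_closed: "\<lbrakk>f \<in> hcarrier H; g \<in> hcarrier H\<rbrakk> \<Longrightarrow> hadd H f g \<in> hcarrier H"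
    and zero_closed: "hzero H \<in> hcarrier H"
    and scale_closed: "f \<in> hcarrier H \<Longrightarrow> hscale H a f \<in> hcarrier H"
    and add_assoc: "\<lbrakk>f \<in> hcarrier H; g \<in> hcarrier H; k \<in> hcarrier H\<rbrakk>
          \<Longrightarrow> hadd H (hadd H f g) k = hadd H f (hadd H g k)"
    and add_commute: "\<lbrakk>f \<in> hcarrier H; g \<in> hcarrier H\<rbrakk> \<Longrightarrow> hadd H f g = hadd H g f"
    and add_zero: "f \<in> hcarrier H \<Longrightarrow> hadd H f (hzero H) = f"
    and add_inverse: "f \<in> hcarrier H \<Longrightarrow> hadd H f (hscale H (-1) f) = hzero H"
    and scale_add_right: "\<lbrakk>f \<in> hcarrier H; g \<in> hcarrier H\<rbrakk>
          \<Longrightarrow> hscale H a (hadd H f g) = hadd H (hscale H a f) (hscale H a g)"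
    and scale_add_left: "f \<in> hcarrier H
          \<Longrightarrow> hscale H (a + b) f = hadd H (hscale H a f) (hscale H b f)"
    and scale_scale: "f \<in> hcarrier H \<Longrightarrow> hscale H a (hscale H b f) = hscale H (a * b) f"
    and scale_one: "f \<in> hcarrier H \<Longrightarrow> hscale H 1 f = f"
    and inner_add: "\<lbrakk>f \<in> hcarrier H; g \<in> hcarrier H; k \<in> hcarrier H\<rbrakk>
          \<Longrightarrow> hinner H (hadd H f g) k = hinner H f k + hinner H g k"
    and inner_scale: "\<lbrakk>f \<in> hcarrier H; g \<in> hcarrier H\<rbrakk>
          \<Longrightarrow> hinner H (hscale H a f) g = a * hinner H f g"
    and inner_cnj: "\<lbrakk>f \<in> hcarrier H; g \<in> hcarrier H\<rbrakk> \<Longrightarrow> hinner H g f = cnj (hinner H f g)"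
    and inner_nonneg: "f \<in> hcarrier H \<Longrightarrow> 0 \<le> Re (hinner H f f)"
    and inner_definite: "\<lbrakk>f \<in> hcarrier H; hinner H f f = 0\<rbrakk> \<Longrightarrow> f = hzero H"
    and complete: "\<lbrakk>\<And>n :: nat. X n \<in> hcarrier H;
          \<And>\<epsilon>. 0 < \<epsilon> \<Longrightarrow> \<exists>M. \<forall>m\<ge>M. \<forall>n\<ge>M. hdist H (X m) (X n) < \<epsilon>\<rbrakk>
          \<Longrightarrow> \<exists>f\<in>hcarrier H. (\<lambda>n. hdist H (X n) f) \<longlonglongrightarrow> 0"

definition separable_hspace :: "'a hspace \<Rightarrow> bool" where
  "separable_hspace H \<longleftrightarrow>
     (\<exists>S. countable S \<and> S \<subseteq> hcarrier H \<and>
          (\<forall>f\<in>hcarrier H. \<forall>\<epsilon>>0. \<exists>g\<in>S. hdist H f g < \<epsilon>))"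

definition closed_subspace :: "'a hspace \<Rightarrow> 'a set \<Rightarrow> bool" where
  "closed_subspace H S \<longleftrightarrow>
     S \<subseteq> hcarrier H \<and> hzero H \<in> S \<and>
     (\<forall>f\<in>S. \<forall>g\<in>S. hadd H f g \<in> S) \<and>
     (\<forall>a. \<forall>f\<in>S. hscale H a f \<in> S) \<and>
     (\<forall>X f. (\<forall>n :: nat. X n \<in> S) \<longrightarrow> f \<in> hcarrier H \<longrightarrow>
        (\<lambda>n. hdist H (X n) f) \<longlonglongrightarrow> 0 \<longrightarrow> f \<in> S)"

abbreviation subspace_hspace :: "'a hspace \<Rightarrow> 'a set \<Rightarrow> 'a hspace" where
  "subspace_hspace H S \<equiv> H\<lparr>hcarrier := S\<rparr>"

definition ortho_compl_in :: "'a hspace \<Rightarrow> 'a set \<Rightarrow> 'a set \<Rightarrow> 'a set" where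
  "ortho_compl_in H S R = {f \<in> S. \<forall>g\<in>R. hinner H f g = 0}"

definition unitary_map :: "'a hspace \<Rightarrow> 'b hspace \<Rightarrow> ('a \<Rightarrow> 'b) \<Rightarrow> bool" where
  "unitary_map H K U \<longleftrightarrow>
     bij_betw U (hcarrier H) (hcarrier K) \<and>
     (\<forall>f\<in>hcarrier H. \<forall>g\<in>hcarrier H. U (hadd H f g) = hadd K (U f) (U g)) \<and>
     (\<forall>a. \<forall>f\<in>hcarrier H. U (hscale H a f) = hscale K a (U f)) \<and>
     (\<forall>f\<in>hcarrier H. \<forall>g\<in>hcarrier H. hinner K (U f) (U g) = hinner H f g)"

definition unitary_rep :: "'a hspace \<Rightarrow> ('g :: ab_group_add \<Rightarrow> 'a \<Rightarrow> 'a) \<Rightarrow> bool" where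
  "unitary_rep H \<pi> \<longleftrightarrow>
     (\<forall>\<gamma>. unitary_map H H (\<pi> \<gamma>)) \<and>
     (\<forall>f\<in>hcarrier H. \<pi> 0 f = f) \<and>
     (\<forall>\<gamma> \<gamma>'. \<forall>f\<in>hcarrier H. \<pi> (\<gamma> + \<gamma>') f = \<pi> \<gamma> (\<pi> \<gamma>' f))"

definition hsum :: "'a hspace \<Rightarrow> (nat \<Rightarrow> 'b hspace) \<Rightarrow> ('a \<times> (nat \<Rightarrow> 'b)) hspace" where
  "hsum V W = \<lparr>
     hcarrier = {(v, w). v \<in> hcarrier V \<and> (\<forall>n. w n \<in> hcarrier (W n)) \<and>
                         summable (\<lambda>n. (hnorm (W n) (w n))\<^sup>2)},
     hadd = (\<lambda>(v, w) (v', w'). (hadd V v v', \<lambda>n. hadd (W n) (w n) (w' n))),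
     hzero = (hzero V, \<lambda>n. hzero (W n)),
     hscale = (\<lambda>a (v, w). (hscale V a v, \<lambda>n. hscale (W n) a (w n))),
     hinner = (\<lambda>(v, w) (v', w'). hinner V v v' + (\<Sum>n. hinner (W n) (w n) (w' n))) \<rparr>"

text \<open>Powers \<open>U^j\<close>, \<open>j \<in> \<int>\<close>, of a bijection \<open>U\<close> of the set \<open>C\<close>.\<close>

definition int_power :: "'a set \<Rightarrow> ('a \<Rightarrow> 'a) \<Rightarrow> int \<Rightarrow> 'a \<Rightarrow> 'a" where
  "int_power C U j = (if 0 \<le> j then U ^^ nat j else inv_into C U ^^ nat (- j))"


section \<open>Direct sums of \<open>L\<^sup>2\<close>-spaces\<close>

text \<open>
  \<open>L2_sum I M\<close> is the direct sum over \<open>i \<in> I\<close> of \<open>L\<^sup>2(E\<^sub>i, \<nu>\<^sub>i)\<close>, where the measure \<open>M i\<close> carries both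
  \<open>E\<^sub>i = space (M i)\<close> and \<open>\<nu>\<^sub>i\<close>.  Its elements are genuine almost-everywhere classes of families of
  functions; values of \<open>f i\<close> off \<open>E\<^sub>i\<close>, and values at indices outside \<open>I\<close>, are irrelevant.
\<close>

definition L2_families :: "'i set \<Rightarrow> ('i \<Rightarrow> 'x measure) \<Rightarrow> ('i \<Rightarrow> 'x \<Rightarrow> complex) set" where
  "L2_families I M =
     {f. (\<forall>i\<in>I. f i \<in> borel_measurable (M i) \<and> integrable (M i) (\<lambda>x. (cmod (f i x))\<^sup>2)) \<and>
         (\<lambda>i. \<integral>x. (cmod (f i x))\<^sup>2 \<partial>M i) summable_on I}"

definition L2_class ::
  "'i set \<Rightarrow> ('i \<Rightarrow> 'x measure) \<Rightarrow> ('i \<Rightarrow> 'x \<Rightarrow> complex) \<Rightarrow> ('i \<Rightarrow> 'x \<Rightarrow> complex) set" where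
  "L2_class I M f = {g \<in> L2_families I M. \<forall>i\<in>I. AE x in M i. g i x = f i x}"

definition L2_rep :: "('i \<Rightarrow> 'x \<Rightarrow> complex) set \<Rightarrow> 'i \<Rightarrow> 'x \<Rightarrow> complex" where
  "L2_rep F = (SOME f. f \<in> F)"

definition L2_sum :: "'i set \<Rightarrow> ('i \<Rightarrow> 'x measure) \<Rightarrow> ('i \<Rightarrow> 'x \<Rightarrow> complex) set hspace" where
  "L2_sum I M = \<lparr>
     hcarrier = L2_class I M ` L2_families I M,
     hadd = (\<lambda>F G. L2_class I M (\<lambda>i x. L2_rep F i x + L2_rep G i x)),
     hzero = L2_class I M (\<lambda>i x. 0),
     hscale = (\<lambda>a F. L2_class I M (\<lambda>i x. a * L2_rep F i x)),
     hinner = (\<lambda>F G. \<Sum>\<^sub>\<infinity>i\<in>I. \<integral>x. L2_rep F i x * cnj (L2_rep G i x) \<partial>M i) \<rparr>"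


section \<open>The dual group and the dual endomorphism\<close>

type_synonym 'g character = "'g \<Rightarrow> complex"

definition dual_group :: "('g :: ab_group_add) character set" where
  "dual_group = {\<omega>. (\<forall>\<gamma> \<gamma>'. \<omega> (\<gamma> + \<gamma>') = \<omega> \<gamma> * \<omega> \<gamma>') \<and> (\<forall>\<gamma>. cmod (\<omega> \<gamma>) = 1)}"

definition char_mult :: "'g character \<Rightarrow> 'g character \<Rightarrow> 'g character" where
  "char_mult \<omega> \<zeta> = (\<lambda>\<gamma>. \<omega> \<gamma> * \<zeta> \<gamma>)"

definition char_inverse :: "'g character \<Rightarrow> 'g character" where
  "char_inverse \<omega> = (\<lambda>\<gamma>. inverse (\<omega> \<gamma>))"

text \<open>
  The dual of a discrete group carries the topology of pointwise convergence, which is the subspace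
  topology inherited from the product topology on functions.
\<close>

definition dual_borel :: "('g :: ab_group_add) character measure" where
  "dual_borel = restrict_space borel dual_group"

text \<open>Haar measure of the compact dual group, normalised to total mass one.\<close>

definition haar_measure :: "('g :: ab_group_add) character measure \<Rightarrow> bool" where
  "haar_measure \<mu> \<longleftrightarrow>
     prob_space \<mu> \<and> sets \<mu> = sets dual_borel \<and>
     (\<forall>\<zeta>\<in>dual_group. distr \<mu> \<mu> (char_mult \<zeta>) = \<mu>)"

definition image_index :: "('g :: ab_group_add \<Rightarrow> 'g) \<Rightarrow> nat" where
  "image_index \<alpha> = card (range (\<lambda>\<gamma>. (\<lambda>x. \<gamma> + \<alpha> x) ` UNIV))"

text \<open>
  The index of the image is required to be a finite number \<open>N > 1\<close>; finiteness is part of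
  \<open>image_index \<alpha> > 1\<close>, because \<open>card\<close> of an infinite set is \<open>0\<close>.
\<close>

definition admissible_endo :: "('g :: ab_group_add \<Rightarrow> 'g) \<Rightarrow> bool" where
  "admissible_endo \<alpha> \<longleftrightarrow>
     (\<forall>x y. \<alpha> (x + y) = \<alpha> x + \<alpha> y) \<and> inj \<alpha> \<and> image_index \<alpha> > 1 \<and>
     (\<Inter>n :: nat. range (\<alpha> ^^ n)) = {0}"

definition dual_endo :: "('g \<Rightarrow> 'g) \<Rightarrow> 'g character \<Rightarrow> 'g character" where
  "dual_endo \<alpha> \<omega> = (\<lambda>\<gamma>. \<omega> (\<alpha> \<gamma>))"

definition dual_ker :: "('g :: ab_group_add \<Rightarrow> 'g) \<Rightarrow> 'g character set" where
  "dual_ker \<alpha> = {\<zeta> \<in> dual_group. dual_endo \<alpha> \<zeta> = (\<lambda>_. 1)}"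

definition fibre :: "('g :: ab_group_add \<Rightarrow> 'g) \<Rightarrow> 'g character \<Rightarrow> 'g character set" where
  "fibre \<alpha> \<omega> = {\<zeta> \<in> dual_group. dual_endo \<alpha> \<zeta> = \<omega>}"

definition cross_section ::
  "('g :: ab_group_add \<Rightarrow> 'g) \<Rightarrow> ('g character \<Rightarrow> 'g character) \<Rightarrow> bool" where
  "cross_section \<alpha> c \<longleftrightarrow>
     c \<in> measurable dual_borel dual_borel \<and> (\<forall>\<omega>\<in>dual_group. dual_endo \<alpha> (c \<omega>) = \<omega>)"

definition cs_defect ::
  "('g \<Rightarrow> 'g) \<Rightarrow> ('g character \<Rightarrow> 'g character) \<Rightarrow> 'g character \<Rightarrow> 'g character" where
  "cs_defect \<alpha> c \<omega> = char_mult (c (dual_endo \<alpha> \<omega>)) (char_inverse \<omega>)"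


section \<open>Generalized multiresolution analyses\<close>

locale gmra = hilbert_space H
  for H :: "'a hspace" +
  fixes \<alpha> :: "'g :: ab_group_add \<Rightarrow> 'g"
    and \<pi> :: "'g \<Rightarrow> 'a \<Rightarrow> 'a"
    and \<delta> :: "'a \<Rightarrow> 'a"
    and V :: "int \<Rightarrow> 'a set"
  assumes separable: "separable_hspace H"
    and rep: "unitary_rep H \<pi>"
    and unitary: "unitary_map H H \<delta>"
    and dilation: "f \<in> hcarrier H \<Longrightarrow> inv_into (hcarrier H) \<delta> (\<pi> \<gamma> (\<delta> f)) = \<pi> (\<alpha> \<gamma>) f"
    and closed: "closed_subspace H (V j)"
    and nested: "V j \<subseteq> V (j + 1)"
    and dilate: "V (j + 1) = \<delta> ` V j"
    and trivial_inter: "(\<Inter>j. V j) = {hzero H}"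
    and dense_union: "\<lbrakk>f \<in> hcarrier H; 0 < \<epsilon>\<rbrakk> \<Longrightarrow> \<exists>g\<in>(\<Union>j. V j). hdist H f g < \<epsilon>"
    and invariant: "f \<in> V 0 \<Longrightarrow> \<pi> \<gamma> f \<in> V 0"

definition gmra_equivalent ::
  "('g :: ab_group_add \<Rightarrow> 'g)
    \<Rightarrow> 'a hspace \<Rightarrow> ('g \<Rightarrow> 'a \<Rightarrow> 'a) \<Rightarrow> ('a \<Rightarrow> 'a) \<Rightarrow> (int \<Rightarrow> 'a set)
    \<Rightarrow> 'b hspace \<Rightarrow> ('g \<Rightarrow> 'b \<Rightarrow> 'b) \<Rightarrow> ('b \<Rightarrow> 'b) \<Rightarrow> (int \<Rightarrow> 'b set) \<Rightarrow> bool" where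
  "gmra_equivalent \<alpha> H \<pi> \<delta> V H' \<pi>' \<delta>' V' \<longleftrightarrow>
     gmra H \<alpha> \<pi> \<delta> V \<and> gmra H' \<alpha> \<pi>' \<delta>' V' \<and>
     (\<exists>U. unitary_map H H' U \<and>
          (\<forall>j. U ` V j = V' j) \<and>
          (\<forall>\<gamma>. \<forall>f\<in>hcarrier H. U (\<pi> \<gamma> f) = \<pi>' \<gamma> (U f)) \<and>
          (\<forall>f\<in>hcarrier H. U (\<delta> f) = \<delta>' (U f)))"


section \<open>Associated measures and multiplicity functions\<close>

text \<open>
  Each \<open>P E\<close> is an orthogonal projection: on a Hilbert space a symmetric idempotent map defined
  everywhere is automatically linear and bounded.  For projections, countable additivity of the
  quadratic forms is equivalent to strong countable additivity.
\<close>

definition projection_valued_measure ::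
  "'a hspace \<Rightarrow> (('g :: ab_group_add) character set \<Rightarrow> 'a \<Rightarrow> 'a) \<Rightarrow> bool" where
  "projection_valued_measure K P \<longleftrightarrow>
     (\<forall>E\<in>sets dual_borel. \<forall>f\<in>hcarrier K.
        P E f \<in> hcarrier K \<and> P E (P E f) = P E f \<and>
        (\<forall>g\<in>hcarrier K. hinner K (P E f) g = hinner K f (P E g))) \<and>
     (\<forall>f\<in>hcarrier K. P dual_group f = f) \<and>
     (\<forall>E\<in>sets dual_borel. \<forall>F\<in>sets dual_borel. \<forall>f\<in>hcarrier K. P (E \<inter> F) f = P E (P F f)) \<and>
     (\<forall>A f. range A \<subseteq> sets dual_borel \<longrightarrow> disjoint_family A \<longrightarrow> f \<in> hcarrier K \<longrightarrow>
        (\<lambda>n :: nat. hinner K (P (A n) f) f) sums hinner K (P (\<Union>n. A n) f) f)"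

definition pvm_scalar_measure ::
  "'a hspace \<Rightarrow> (('g :: ab_group_add) character set \<Rightarrow> 'a \<Rightarrow> 'a) \<Rightarrow> 'a \<Rightarrow> 'g character measure" where
  "pvm_scalar_measure K P f =
     measure_of dual_group (sets dual_borel) (\<lambda>E. ennreal (Re (hinner K (P E f) f)))"

text \<open>Stone's theorem: \<open>\<pi>\<^sub>\<gamma> = \<integral> \<omega>(\<gamma>) dP(\<omega>)\<close>, expressed through the quadratic forms.\<close>

definition stone_pvm ::
  "'a hspace \<Rightarrow> ('g :: ab_group_add \<Rightarrow> 'a \<Rightarrow> 'a) \<Rightarrow> ('g character set \<Rightarrow> 'a \<Rightarrow> 'a) \<Rightarrow> bool" where
  "stone_pvm K \<pi> P \<longleftrightarrow>
     projection_valued_measure K P \<and>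
     (\<forall>\<gamma>. \<forall>f\<in>hcarrier K.
        hinner K (\<pi> \<gamma> f) f = (\<integral>\<omega>. \<omega> \<gamma> \<partial>pvm_scalar_measure K P f))"

text \<open>
  Stone's theorem determines the associated measure only up to equivalence: it is any finite Borel
  measure with the same null sets as the projection-valued measure.
\<close>

definition associated_measure ::
  "'a hspace \<Rightarrow> ('g :: ab_group_add \<Rightarrow> 'a \<Rightarrow> 'a) \<Rightarrow> 'g character measure \<Rightarrow> bool" where
  "associated_measure K \<pi> \<nu> \<longleftrightarrow>
     finite_measure \<nu> \<and> sets \<nu> = sets dual_borel \<and>
     (\<exists>P. stone_pvm K \<pi> P \<and>
          (\<forall>E\<in>sets dual_borel. emeasure \<nu> E = 0 \<longleftrightarrow> (\<forall>f\<in>hcarrier K. P E f = hzero K)))"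

text \<open>
  From here on, the coordinates \<open>1, 2, 3, \<dots>\<close> of the infinite direct sums and matrices are numbered
  \<open>0, 1, 2, \<dots>\<close>, so \<open>\<sigma> i\<close> stands for the set with index \<open>i + 1\<close>, and \<open>level_set m i\<close> is
  the set where \<open>m \<ge> i + 1\<close>.
\<close>

definition V0_measure ::
  "'g character measure \<Rightarrow> (nat \<Rightarrow> 'g character set) \<Rightarrow> nat \<Rightarrow> 'g character measure" where
  "V0_measure \<mu> \<sigma> i = restrict_space \<mu> (\<sigma> i)"

definition V0_space ::
  "'g character measure \<Rightarrow> (nat \<Rightarrow> 'g character set)
    \<Rightarrow> (nat \<Rightarrow> 'g character \<Rightarrow> complex) set hspace" where
  "V0_space \<mu> \<sigma> = L2_sum UNIV (V0_measure \<mu> \<sigma>)"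

definition modulate ::
  "'i set \<Rightarrow> ('i \<Rightarrow> 'g character measure) \<Rightarrow> 'g
    \<Rightarrow> ('i \<Rightarrow> 'g character \<Rightarrow> complex) set \<Rightarrow> ('i \<Rightarrow> 'g character \<Rightarrow> complex) set" where
  "modulate I M \<gamma> F = L2_class I M (\<lambda>i \<omega>. \<omega> \<gamma> * L2_rep F i \<omega>)"

definition multiplicity_model ::
  "'g character measure \<Rightarrow> 'a hspace \<Rightarrow> ('g :: ab_group_add \<Rightarrow> 'a \<Rightarrow> 'a) \<Rightarrow> 'a set
    \<Rightarrow> (nat \<Rightarrow> 'g character set) \<Rightarrow> ('a \<Rightarrow> (nat \<Rightarrow> 'g character \<Rightarrow> complex) set) \<Rightarrow> bool" where
  "multiplicity_model \<mu> H \<pi> V0 \<sigma> J \<longleftrightarrow>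
     (\<forall>i. \<sigma> i \<in> sets dual_borel) \<and> decseq \<sigma> \<and>
     unitary_map (subspace_hspace H V0) (V0_space \<mu> \<sigma>) J \<and>
     (\<forall>\<gamma>. \<forall>f\<in>V0. J (\<pi> \<gamma> f) = modulate UNIV (V0_measure \<mu> \<sigma>) \<gamma> (J f))"

definition multiplicity_fun :: "(nat \<Rightarrow> 'g character set) \<Rightarrow> 'g character \<Rightarrow> enat" where
  "multiplicity_fun \<sigma> \<omega> = (\<Sum>i. if \<omega> \<in> \<sigma> i then 1 else 0)"

definition level_set ::
  "(('g :: ab_group_add) character \<Rightarrow> enat) \<Rightarrow> nat \<Rightarrow> 'g character set" where
  "level_set m i = {\<omega> \<in> dual_group. enat (Suc i) \<le> m \<omega>}"

text \<open>
  Subtraction on \<^typ>\<open>enat\<close> is truncated; this is harmless because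
  \<open>m \<omega> \<le> (\<Sum>\<zeta>\<in>fibre \<alpha> \<omega>. m \<zeta>)\<close> almost everywhere for the multiplicity function of a GMRA.
\<close>

definition compl_multiplicity ::
  "('g :: ab_group_add \<Rightarrow> 'g) \<Rightarrow> ('g character \<Rightarrow> enat) \<Rightarrow> 'g character \<Rightarrow> enat" where
  "compl_multiplicity \<alpha> m \<omega> = (\<Sum>\<zeta>\<in>fibre \<alpha> \<omega>. m \<zeta>) - m \<omega>"


section \<open>Filters and Ruelle operators\<close>

type_synonym 'g filter_matrix = "nat \<Rightarrow> nat \<Rightarrow> 'g character \<Rightarrow> complex"

definition supported_matrix ::
  "('g :: ab_group_add) character measure \<Rightarrow> (nat \<Rightarrow> 'g character set) \<Rightarrow> 'g filter_matrix \<Rightarrow> bool" where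
  "supported_matrix \<mu> \<sigma> A \<longleftrightarrow>
     (\<forall>i j. A i j \<in> borel_measurable dual_borel \<and> (AE \<omega> in \<mu>. \<omega> \<notin> \<sigma> j \<longrightarrow> A i j \<omega> = 0))"

definition unit_vector ::
  "'g character measure \<Rightarrow> (nat \<Rightarrow> 'g character set) \<Rightarrow> nat
    \<Rightarrow> (nat \<Rightarrow> 'g character \<Rightarrow> complex) set" where
  "unit_vector \<mu> \<sigma> i =
     L2_class UNIV (V0_measure \<mu> \<sigma>) (\<lambda>j \<omega>. if j = i \<and> \<omega> \<in> \<sigma> i then 1 else 0)"

definition constructed_filter ::
  "('g :: ab_group_add) character measure \<Rightarrow> 'a hspace \<Rightarrow> ('a \<Rightarrow> 'a) \<Rightarrow> 'a set
    \<Rightarrow> (nat \<Rightarrow> 'g character set) \<Rightarrow> ('a \<Rightarrow> (nat \<Rightarrow> 'g character \<Rightarrow> complex) set)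
    \<Rightarrow> 'g filter_matrix \<Rightarrow> bool" where
  "constructed_filter \<mu> H \<delta> V0 \<sigma> J h \<longleftrightarrow>
     supported_matrix \<mu> \<sigma> h \<and>
     (\<forall>i. L2_class UNIV (V0_measure \<mu> \<sigma>) (h i) =
          J (inv_into (hcarrier H) \<delta> (inv_into V0 J (unit_vector \<mu> \<sigma> i))))"

definition complementary_filter ::
  "('g :: ab_group_add \<Rightarrow> 'g) \<Rightarrow> 'g character measure \<Rightarrow> ('g character \<Rightarrow> enat)
    \<Rightarrow> 'g filter_matrix \<Rightarrow> 'g filter_matrix \<Rightarrow> bool" where
  "complementary_filter \<alpha> \<mu> m h g \<longleftrightarrow>
     supported_matrix \<mu> (level_set m) g \<and>
     (\<forall>k k'. AE \<omega> in \<mu>.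
        (\<Sum>\<zeta>\<in>fibre \<alpha> \<omega>. \<Sum>j. g k j \<zeta> * cnj (g k' j \<zeta>)) =
        (if k = k' \<and> \<omega> \<in> level_set (compl_multiplicity \<alpha> m) k
         then of_nat (image_index \<alpha>) else 0)) \<and>
     (\<forall>k i. AE \<omega> in \<mu>. (\<Sum>\<zeta>\<in>fibre \<alpha> \<omega>. \<Sum>j. g k j \<zeta> * cnj (h i j \<zeta>)) = 0)"

text \<open>
  \<open>\<omega> \<mapsto> A\<^sup>t(\<omega>) f(\<alpha>\<^sup>* \<omega>)\<close>, where the coordinate \<open>f k\<close> is extended by \<open>0\<close> off \<open>E k\<close>; the series is a
  finite sum wherever \<open>\<alpha>\<^sup>* \<omega>\<close> lies in only finitely many \<open>E k\<close>.
\<close>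

definition ruelle_fun ::
  "('g \<Rightarrow> 'g) \<Rightarrow> (nat \<Rightarrow> 'g character set) \<Rightarrow> 'g filter_matrix
    \<Rightarrow> (nat \<Rightarrow> 'g character \<Rightarrow> complex) \<Rightarrow> nat \<Rightarrow> 'g character \<Rightarrow> complex" where
  "ruelle_fun \<alpha> E A f j \<omega> =
     (\<Sum>k. A k j \<omega> * (if dual_endo \<alpha> \<omega> \<in> E k then f k (dual_endo \<alpha> \<omega>) else 0))"


section \<open>Dilation by \<open>\<alpha>\<^sup>*\<close>\<close>

text \<open>
  Dilating a family indexed by \<open>i\<close> gives a family indexed by pairs \<open>(i, \<zeta>)\<close>.  To iterate within one
  type, indices have the form \<open>(k, [\<zeta>\<^sub>n, \<dots>, \<zeta>\<^sub>1])\<close>, and the pair of \<open>(k, zs)\<close> and \<open>\<zeta>\<close> is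
  encoded as \<open>(k, \<zeta> # zs)\<close>.
\<close>

type_synonym 'g dil_index = "nat \<times> 'g character list"

definition dil_indices ::
  "('g :: ab_group_add \<Rightarrow> 'g) \<Rightarrow> 'g dil_index set \<Rightarrow> 'g dil_index set" where
  "dil_indices \<alpha> I = {(k, \<zeta> # zs) | k \<zeta> zs. (k, zs) \<in> I \<and> \<zeta> \<in> dual_ker \<alpha>}"

text \<open>The measure \<open>\<nu>'\<^sub>\<zeta>\<close> on \<open>E'\<^sub>\<zeta> = \<alpha>\<^sup>*(E\<^sub>\<zeta>)\<close> obtained from \<open>\<nu>\<close> on \<open>E = space \<nu>\<close>.\<close>

definition dil_measure ::
  "('g :: ab_group_add \<Rightarrow> 'g) \<Rightarrow> ('g character \<Rightarrow> 'g character)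
    \<Rightarrow> 'g character measure \<Rightarrow> 'g character \<Rightarrow> 'g character measure" where
  "dil_measure \<alpha> c \<nu> \<zeta> =
     (let E\<zeta> = {\<omega> \<in> space \<nu>. cs_defect \<alpha> c \<omega> = \<zeta>} in
      scale_measure (of_nat (image_index \<alpha>))
        (distr (restrict_space \<nu> E\<zeta>)
               (restrict_space dual_borel (dual_endo \<alpha> ` E\<zeta>))
               (dual_endo \<alpha>)))"

definition dil_measures ::
  "('g :: ab_group_add \<Rightarrow> 'g) \<Rightarrow> ('g character \<Rightarrow> 'g character)
    \<Rightarrow> ('g dil_index \<Rightarrow> 'g character measure) \<Rightarrow> 'g dil_index \<Rightarrow> 'g character measure" where
  "dil_measures \<alpha> c M = (\<lambda>(k, zs). dil_measure \<alpha> c (M (k, tl zs)) (hd zs))"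

definition dil_op ::
  "('g :: ab_group_add \<Rightarrow> 'g) \<Rightarrow> ('g character \<Rightarrow> 'g character)
    \<Rightarrow> 'g dil_index set \<Rightarrow> ('g dil_index \<Rightarrow> 'g character measure)
    \<Rightarrow> ('g dil_index \<Rightarrow> 'g character \<Rightarrow> complex) set
    \<Rightarrow> ('g dil_index \<Rightarrow> 'g character \<Rightarrow> complex) set" where
  "dil_op \<alpha> c I M F =
     L2_class (dil_indices \<alpha> I) (dil_measures \<alpha> c M)
       (\<lambda>(k, zs) \<omega>. L2_rep F (k, tl zs) (char_mult (char_inverse (hd zs)) (c \<omega>))
                      / of_real (sqrt (real (image_index \<alpha>))))"


section \<open>The canonical GMRA\<close>

text \<open>\<open>\<W>\<^sub>0\<close> is the direct sum of the spaces for \<open>level_set (compl_multiplicity \<alpha> m) k\<close>, indexed by \<open>(k, [])\<close>.\<close>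

primrec W_indices :: "('g :: ab_group_add \<Rightarrow> 'g) \<Rightarrow> nat \<Rightarrow> 'g dil_index set" where
  "W_indices \<alpha> 0 = UNIV \<times> {[]}"
| "W_indices \<alpha> (Suc n) = dil_indices \<alpha> (W_indices \<alpha> n)"

primrec W_measures ::
  "('g :: ab_group_add \<Rightarrow> 'g) \<Rightarrow> ('g character \<Rightarrow> 'g character) \<Rightarrow> 'g character measure
    \<Rightarrow> ('g character \<Rightarrow> enat) \<Rightarrow> nat \<Rightarrow> 'g dil_index \<Rightarrow> 'g character measure" where
  "W_measures \<alpha> c \<mu> m 0 =
     (\<lambda>(k, zs). restrict_space \<mu> (level_set (compl_multiplicity \<alpha> m) k))"
| "W_measures \<alpha> c \<mu> m (Suc n) = dil_measures \<alpha> c (W_measures \<alpha> c \<mu> m n)"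

definition W_space ::
  "('g :: ab_group_add \<Rightarrow> 'g) \<Rightarrow> ('g character \<Rightarrow> 'g character) \<Rightarrow> 'g character measure
    \<Rightarrow> ('g character \<Rightarrow> enat) \<Rightarrow> nat \<Rightarrow> ('g dil_index \<Rightarrow> 'g character \<Rightarrow> complex) set hspace" where
  "W_space \<alpha> c \<mu> m n = L2_sum (W_indices \<alpha> n) (W_measures \<alpha> c \<mu> m n)"

type_synonym 'g can_vector =
  "(nat \<Rightarrow> 'g character \<Rightarrow> complex) set \<times> (nat \<Rightarrow> ('g dil_index \<Rightarrow> 'g character \<Rightarrow> complex) set)"

definition can_space ::
  "('g :: ab_group_add \<Rightarrow> 'g) \<Rightarrow> ('g character \<Rightarrow> 'g character) \<Rightarrow> 'g character measure
    \<Rightarrow> ('g character \<Rightarrow> enat) \<Rightarrow> 'g can_vector hspace" where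
  "can_space \<alpha> c \<mu> m = hsum (V0_space \<mu> (level_set m)) (W_space \<alpha> c \<mu> m)"

definition can_rep ::
  "('g :: ab_group_add \<Rightarrow> 'g) \<Rightarrow> ('g character \<Rightarrow> 'g character) \<Rightarrow> 'g character measure
    \<Rightarrow> ('g character \<Rightarrow> enat) \<Rightarrow> 'g \<Rightarrow> 'g can_vector \<Rightarrow> 'g can_vector" where
  "can_rep \<alpha> c \<mu> m \<gamma> =
     (\<lambda>(v, w). (modulate UNIV (V0_measure \<mu> (level_set m)) \<gamma> v,
                \<lambda>n. modulate (W_indices \<alpha> n) (W_measures \<alpha> c \<mu> m n) \<gamma> (w n)))"

definition S_H ::
  "('g :: ab_group_add \<Rightarrow> 'g) \<Rightarrow> 'g character measure \<Rightarrow> ('g character \<Rightarrow> enat) \<Rightarrow> 'g filter_matrix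
    \<Rightarrow> (nat \<Rightarrow> 'g character \<Rightarrow> complex) set \<Rightarrow> (nat \<Rightarrow> 'g character \<Rightarrow> complex) set" where
  "S_H \<alpha> \<mu> m h F =
     L2_class UNIV (V0_measure \<mu> (level_set m)) (ruelle_fun \<alpha> (level_set m) h (L2_rep F))"

definition S_G ::
  "('g :: ab_group_add \<Rightarrow> 'g) \<Rightarrow> 'g character measure \<Rightarrow> ('g character \<Rightarrow> enat) \<Rightarrow> 'g filter_matrix
    \<Rightarrow> ('g dil_index \<Rightarrow> 'g character \<Rightarrow> complex) set \<Rightarrow> (nat \<Rightarrow> 'g character \<Rightarrow> complex) set" where
  "S_G \<alpha> \<mu> m g F =
     L2_class UNIV (V0_measure \<mu> (level_set m))
       (ruelle_fun \<alpha> (level_set (compl_multiplicity \<alpha> m)) g (\<lambda>k. L2_rep F (k, [])))"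

definition can_T ::
  "('g :: ab_group_add \<Rightarrow> 'g) \<Rightarrow> ('g character \<Rightarrow> 'g character) \<Rightarrow> 'g character measure
    \<Rightarrow> ('g character \<Rightarrow> enat) \<Rightarrow> 'g filter_matrix \<Rightarrow> 'g filter_matrix
    \<Rightarrow> 'g can_vector \<Rightarrow> 'g can_vector" where
  "can_T \<alpha> c \<mu> m h g =
     (\<lambda>(v, w).
        (hadd (V0_space \<mu> (level_set m)) (S_H \<alpha> \<mu> m h v) (S_G \<alpha> \<mu> m g (w 0)),
         \<lambda>n. inv_into (hcarrier (W_space \<alpha> c \<mu> m n))
                (dil_op \<alpha> c (W_indices \<alpha> n) (W_measures \<alpha> c \<mu> m n)) (w (Suc n))))"

definition can_delta ::
  "('g :: ab_group_add \<Rightarrow> 'g) \<Rightarrow> ('g character \<Rightarrow> 'g character) \<Rightarrow> 'g character measure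
    \<Rightarrow> ('g character \<Rightarrow> enat) \<Rightarrow> 'g filter_matrix \<Rightarrow> 'g filter_matrix
    \<Rightarrow> 'g can_vector \<Rightarrow> 'g can_vector" where
  "can_delta \<alpha> c \<mu> m h g = inv_into (hcarrier (can_space \<alpha> c \<mu> m)) (can_T \<alpha> c \<mu> m h g)"

definition can_V ::
  "('g :: ab_group_add \<Rightarrow> 'g) \<Rightarrow> ('g character \<Rightarrow> 'g character) \<Rightarrow> 'g character measure
    \<Rightarrow> ('g character \<Rightarrow> enat) \<Rightarrow> 'g filter_matrix \<Rightarrow> 'g filter_matrix
    \<Rightarrow> int \<Rightarrow> 'g can_vector set" where
  "can_V \<alpha> c \<mu> m h g j =
     int_power (hcarrier (can_space \<alpha> c \<mu> m)) (can_T \<alpha> c \<mu> m h g) (- j) `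
       {(v, \<lambda>n. hzero (W_space \<alpha> c \<mu> m n)) | v. v \<in> hcarrier (V0_space \<mu> (level_set m))}"

end

theory Submission
  imports Defs
begin

text \<open>
  The analysis is decomposed into \<open>V\<^sub>0\<close> and the differences \<open>W\<^sub>n = V\<^sub>n\<^sub>+\<^sub>1 \<ominus> V\<^sub>n\<close>, \<open>n \<ge> 0\<close>, and each piece is
  identified with the corresponding summand of the canonical space.  On \<open>V\<^sub>0\<close> the identification is
  \<open>J\<close>.  On \<open>W\<^sub>0\<close> it is \<open>S\<^sub>G\<^sup>-\<^sup>1 J \<delta>\<^sup>-\<^sup>1\<close>, and each further application of \<open>\<delta>\<close> is matched with one
  application of the dilation by \<open>\<alpha>\<^sup>*\<close>.  The resulting map \<open>U\<close> satisfies \<open>U \<delta>\<^sup>-\<^sup>1 = T U\<close> and commutes with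
  the representations.  Since \<open>U\<close> is a bijective isometry, the canonical data inherit from the given
  analysis everything that is required of a generalized multiresolution analysis
  (\<open>gmra_transfer\<close>), including that their underlying space is a Hilbert space.

  Everything rests on two facts about Ruelle operators.  First, \<open>J \<delta>\<^sup>-\<^sup>1 J\<^sup>-\<^sup>1 = S\<^sub>H\<close> (\<open>S_eq_ruelle\<close>).  The left
  side is an isometry \<open>S\<close> that intertwines multiplication by characters with its composition with
  \<open>\<alpha>\<close>, and that sends the unit vectors to the rows of \<open>H\<close>.  Comparing Fourier coefficients of the
  inner products of such images gives the filter equation (\<open>filter_isometric\<close>) and the adjoint
  relation \<open>\<langle>S f, S\<^sub>H f\<rangle> = \<langle>f, f\<rangle>\<close>; as both operators are isometric, they agree.  This uses that an
  integrable function on the dual group with vanishing Fourier coefficients is null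
  (\<open>fourier_uniqueness\<close>).

  Second, \<open>S\<^sub>G\<close> is an isometry onto the orthogonal complement of the range of \<open>S\<^sub>H\<close> (\<open>SG_unitary\<close>).
  Haar measure is the average over the fibres of \<open>\<alpha>\<^sup>*\<close> (\<open>integral_fibre\<close>), so that a function in the
  direct sum may be regarded as a function whose value at \<open>\<omega>\<close> is the finite vector of all its
  values over the fibre of \<open>\<omega>\<close>.  There the rows of \<open>H\<close> and \<open>G\<close> are orthogonal vectors of equal length.
  Orthogonality alone shows \<open>m(\<omega>) \<le> \<Sum> m(\<zeta>)\<close>, so by the definition of the complementary multiplicity
  the rows are exactly as many as there are coordinates, and they form an orthogonal basis
  (\<open>orthogonal_complete\<close>).  The finiteness of \<open>m\<close> enters here.

  The fibre average needs that the kernel of \<open>\<alpha>\<^sup>*\<close> has as many elements as the image of \<open>\<alpha>\<close> has cosets.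
  This is a count of the extensions of a character from a subgroup of finite index
  (\<open>char_extensions_card\<close>).
\<close>

section \<open>Hilbert spaces on carriers: orthogonal projections\<close>

context hilbert_space
begin

abbreviation hsub :: "'a \<Rightarrow> 'a \<Rightarrow> 'a" where
  "hsub f g \<equiv> hadd H f (hscale H (- 1) g)"

lemma inner_add_right:
  "\<lbrakk>f \<in> hcarrier H; g \<in> hcarrier H; k \<in> hcarrier H\<rbrakk>
    \<Longrightarrow> hinner H k (hadd H f g) = hinner H k f + hinner H k g"
  by (metis add_closed complex_cnj_add inner_add inner_cnj)

lemma inner_scale_right:
  "\<lbrakk>f \<in> hcarrier H; g \<in> hcarrier H\<rbrakk> \<Longrightarrow> hinner H f (hscale H a g) = cnj a * hinner H f g"
  by (metis complex_cnj_mult inner_cnj inner_scale scale_closed)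

lemmas hilbert_simps = add_closed scale_closed zero_closed inner_add inner_scale
  inner_add_right inner_scale_right

lemma inner_zero_left: "f \<in> hcarrier H \<Longrightarrow> hinner H (hzero H) f = 0"
  by (metis add.right_inverse add_inverse inner_add inner_scale mult_minus1 scale_closed)

lemma inner_zero_right: "f \<in> hcarrier H \<Longrightarrow> hinner H f (hzero H) = 0"
  by (metis complex_cnj_zero inner_cnj inner_zero_left zero_closed)

text \<open>Vector identities are proved by testing against all vectors, which turns them into
  identities of complex numbers.\<close>

lemma vec_eqI:
  assumes "f \<in> hcarrier H" "g \<in> hcarrier H"
    and "\<And>k. k \<in> hcarrier H \<Longrightarrow> hinner H f k = hinner H g k"
  shows "f = g"
proof -
  have d: "hsub f g \<in> hcarrier H" using assms by (simp add: hilbert_simps)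
  have "hinner H (hsub f g) (hsub f g) = 0"
    using assms(3)[OF d] assms(1,2) d by (simp add: hilbert_simps algebra_simps)
  then have z: "hsub f g = hzero H" using d inner_definite by blast
  have "f = hadd H f (hsub g g)" using assms by (simp add: add_zero add_inverse)
  also have "\<dots> = hadd H (hsub f g) g"
    using assms by (metis add_assoc add_commute scale_closed)
  also have "\<dots> = g" using assms z by (metis add_commute add_zero zero_closed)
  finally show ?thesis .
qed

lemma inner_self_real: "f \<in> hcarrier H \<Longrightarrow> hinner H f f = of_real (Re (hinner H f f))"
  using inner_cnj[of f f] by (auto simp: complex_eq_iff)

lemma scale_zero: "f \<in> hcarrier H \<Longrightarrow> hscale H 0 f = hzero H"
  by (rule vec_eqI) (auto simp: hilbert_simps inner_zero_left)

lemma hnorm_power2: "f \<in> hcarrier H \<Longrightarrow> (hnorm H f)\<^sup>2 = Re (hinner H f f)"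
  by (simp add: hnorm_def inner_nonneg)

lemma hnorm_nonneg: "f \<in> hcarrier H \<Longrightarrow> 0 \<le> hnorm H f"
  by (simp add: hnorm_def inner_nonneg)

lemma hdist_nonneg: "\<lbrakk>f \<in> hcarrier H; g \<in> hcarrier H\<rbrakk> \<Longrightarrow> 0 \<le> hdist H f g"
  by (simp add: hdist_def hnorm_nonneg hilbert_simps)

lemma hdist_power2: "\<lbrakk>f \<in> hcarrier H; g \<in> hcarrier H\<rbrakk>
    \<Longrightarrow> (hdist H f g)\<^sup>2 = Re (hinner H (hsub f g) (hsub f g))"
  by (simp add: hdist_def hnorm_power2 hilbert_simps)

lemma hdist_zero_imp_eq:
  assumes "f \<in> hcarrier H" "g \<in> hcarrier H" "Re (hinner H (hsub f g) (hsub f g)) = 0"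
  shows "f = g"
proof -
  have d: "hsub f g \<in> hcarrier H" using assms by (simp add: hilbert_simps)
  have "hsub f g = hzero H"
    using inner_self_real[OF d] assms(3) d inner_definite by simp
  then have z: "hinner H (hsub f g) k = 0" if "k \<in> hcarrier H" for k
    using that by (simp add: inner_zero_left)
  show ?thesis
  proof (rule vec_eqI)
    fix k assume "k \<in> hcarrier H"
    then show "hinner H f k = hinner H g k" using z[of k] assms by (simp add: hilbert_simps)
  qed (use assms in auto)
qed

lemma cauchy_schwarz:
  assumes f: "f \<in> hcarrier H" and g: "g \<in> hcarrier H"
  shows "(cmod (hinner H f g))\<^sup>2 \<le> Re (hinner H f f) * Re (hinner H g g)"
proof (cases "hinner H g g = 0")
  case True
  then have "g = hzero H" using g inner_definite by blast
  then show ?thesis using f zero_closed by (simp add: inner_zero_right)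
next
  case False
  define G where "G = Re (hinner H g g)"
  have G: "hinner H g g = of_real G" unfolding G_def by (rule inner_self_real[OF g])
  have Gp: "G > 0" 
  proof -
    have "G \<noteq> 0" using False G by (metis of_real_0)
    moreover have "G \<ge> 0" using inner_nonneg[OF g] by (simp add: G_def)
    ultimately show ?thesis by simp
  qed
  define z where "z = hinner H f g"
  have zc: "hinner H g f = cnj z" using inner_cnj[OF f g] z_def by simp
  define t where "t = z / of_real G"
  have "0 \<le> Re (hinner H (hadd H f (hscale H (- t) g)) (hadd H f (hscale H (- t) g)))"
    by (rule inner_nonneg) (simp add: f g hilbert_simps)
  also have "hinner H (hadd H f (hscale H (- t) g)) (hadd H f (hscale H (- t) g))
      = hinner H f f - cnj t * z - t * cnj z + t * cnj t * of_real G"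
    using f g zc z_def G by (simp add: hilbert_simps algebra_simps)
  also have "\<dots> = hinner H f f - of_real ((cmod z)\<^sup>2 / G)"
  proof -
    have zz: "z * cnj z = of_real ((cmod z)\<^sup>2)" by (simp only: complex_norm_square)
    have "cnj t * z = of_real ((cmod z)\<^sup>2 / G)" "t * cnj z = of_real ((cmod z)\<^sup>2 / G)"
      unfolding t_def of_real_divide zz[symmetric] by (simp_all add: mult.commute)
    moreover have "t * cnj t * of_real G = of_real ((cmod z)\<^sup>2 / G)"
      using Gp unfolding t_def of_real_divide zz[symmetric] by simp
    ultimately show ?thesis by simp
  qed
  finally have "(cmod z)\<^sup>2 / G \<le> Re (hinner H f f)" by simp
  then have "(cmod z)\<^sup>2 \<le> Re (hinner H f f) * G" using Gp by (simp add: pos_divide_le_eq)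
  then show ?thesis unfolding z_def G_def .
qed

lemma cauchy_schwarz_norm:
  assumes "f \<in> hcarrier H" "g \<in> hcarrier H"
  shows "cmod (hinner H f g) \<le> hnorm H f * hnorm H g"
proof (rule power2_le_imp_le)
  show "(cmod (hinner H f g))\<^sup>2 \<le> (hnorm H f * hnorm H g)\<^sup>2"
    using cauchy_schwarz[OF assms] assms by (simp add: power_mult_distrib hnorm_power2)
qed (use assms hnorm_nonneg in simp)

text \<open>Weak continuity in the first argument is the Cauchy--Schwarz inequality.\<close>

lemma inner_tendsto:
  assumes X: "\<And>n. X n \<in> hcarrier H" and f: "f \<in> hcarrier H" and k: "k \<in> hcarrier H"
    and lim: "(\<lambda>n. hdist H (X n) f) \<longlonglongrightarrow> 0"
  shows "(\<lambda>n. hinner H (X n) k) \<longlonglongrightarrow> hinner H f k"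
proof -
  have "(\<lambda>n. hinner H (X n) k - hinner H f k) \<longlonglongrightarrow> 0"
  proof (rule Lim_null_comparison)
    show "\<forall>\<^sub>F n in sequentially. norm (hinner H (X n) k - hinner H f k)
        \<le> hdist H (X n) f * hnorm H k"
    proof (rule always_eventually, rule allI)
      fix n
      have "hinner H (X n) k - hinner H f k = hinner H (hsub (X n) f) k"
        using X f k by (simp add: hilbert_simps)
      then show "norm (hinner H (X n) k - hinner H f k) \<le> hdist H (X n) f * hnorm H k"
        unfolding hdist_def using cauchy_schwarz_norm[of "hsub (X n) f" k] X f k
        by (simp add: hilbert_simps)
    qed
    show "(\<lambda>n. hdist H (X n) f * hnorm H k) \<longlonglongrightarrow> 0"
      using tendsto_mult_right[OF lim, of "hnorm H k"] by simp
  qed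
  then show ?thesis by (simp add: LIM_zero_iff)
qed

text \<open>A minimising sequence \<open>X\<close> for the distance of \<open>f\<close> to \<open>V\<close> is Cauchy by the parallelogram
  law.  If the squared distance of \<open>X n\<close> to \<open>f\<close> exceeds the infimum by \<open>e\<close>, then moving \<open>X n\<close>
  along \<open>g \<in> V\<close> cannot gain more than \<open>e\<close>, which bounds the component of \<open>f - X n\<close> along \<open>g\<close>.\<close>

lemma projection_exists:
  assumes V: "closed_subspace H V" and f: "f \<in> hcarrier H"
  shows "\<exists>p\<in>V. \<forall>g\<in>V. hinner H (hsub f p) g = 0"
proof -
  have VH: "V \<subseteq> hcarrier H" and V0: "hzero H \<in> V"
    and Vadd: "\<And>g k. g \<in> V \<Longrightarrow> k \<in> V \<Longrightarrow> hadd H g k \<in> V"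
    and Vscale: "\<And>a g. g \<in> V \<Longrightarrow> hscale H a g \<in> V"
    and Vlim: "\<And>X g. (\<And>n :: nat. X n \<in> V) \<Longrightarrow> g \<in> hcarrier H \<Longrightarrow>
        (\<lambda>n. hdist H (X n) g) \<longlonglongrightarrow> 0 \<Longrightarrow> g \<in> V"
    using V unfolding closed_subspace_def by blast+
  define q where "q g = Re (hinner H (hsub f g) (hsub f g))" for g
  have q0: "0 \<le> q g" if "g \<in> V" for g
    unfolding q_def using that f VH by (intro inner_nonneg) (auto simp: hilbert_simps)
  define d where "d = Inf (q ` V)"
  have dle: "d \<le> q g" if "g \<in> V" for g
    unfolding d_def by (rule cInf_lower) (use that q0 in \<open>auto intro!: bdd_belowI[of _ 0]\<close>)
  have "\<exists>g\<in>V. q g < d + 1 / real (Suc n)" for n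
    using cInf_lessD[of "q ` V" "d + 1 / real (Suc n)"] V0 unfolding d_def by auto
  then obtain X where XV: "\<And>n. X n \<in> V" and Xq: "\<And>n. q (X n) < d + 1 / real (Suc n)" by metis
  have XH: "X n \<in> hcarrier H" for n using XV VH by blast
  have par: "(hdist H (X m) (X n))\<^sup>2 \<le> 2 / real (Suc m) + 2 / real (Suc n)" for m n
  proof -
    let ?h = "hscale H (1/2) (hadd H (X m) (X n))"
    have "complex_of_real ((hdist H (X m) (X n))\<^sup>2)
        = hinner H (hsub (X m) (X n)) (hsub (X m) (X n))"
      using inner_self_real[of "hsub (X m) (X n)"] XH by (simp add: hdist_power2 hilbert_simps)
    also have "\<dots> = 2 * hinner H (hsub f (X m)) (hsub f (X m))
        + 2 * hinner H (hsub f (X n)) (hsub f (X n)) - 4 * hinner H (hsub f ?h) (hsub f ?h)"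
      using f XH[of m] XH[of n] by (simp add: hilbert_simps algebra_simps)
    finally have "Re (complex_of_real ((hdist H (X m) (X n))\<^sup>2)) = Re (2 * hinner H (hsub f (X m)) (hsub f (X m))
        + 2 * hinner H (hsub f (X n)) (hsub f (X n)) - 4 * hinner H (hsub f ?h) (hsub f ?h))"
      by (rule arg_cong)
    then have "(hdist H (X m) (X n))\<^sup>2 = 2 * q (X m) + 2 * q (X n) - 4 * q ?h"
      unfolding q_def by simp
    moreover have "d \<le> q ?h" using XV by (intro dle Vscale Vadd)
    ultimately show ?thesis using Xq[of m] Xq[of n] by simp
  qed
  obtain p where pH: "p \<in> hcarrier H" and plim: "(\<lambda>n. hdist H (X n) p) \<longlonglongrightarrow> 0"
  proof -
    have "\<exists>M. \<forall>m\<ge>M. \<forall>n\<ge>M. hdist H (X m) (X n) < e" if e: "0 < e" for e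
    proof -
      obtain M where M: "real M > 4 / e\<^sup>2" using reals_Archimedean2 by blast
      have "hdist H (X m) (X n) < e" if "m \<ge> M" "n \<ge> M" for m n
      proof (rule power_less_imp_less_base)
        have b: "2 / real (Suc l) < e\<^sup>2 / 2" if "l \<ge> M" for l
        proof -
          have "real (Suc l) > 4 / e\<^sup>2" using that M by simp
          then show ?thesis using e by (simp add: field_simps)
        qed
        show "(hdist H (X m) (X n))\<^sup>2 < e\<^sup>2" using par[of m n] b[OF that(1)] b[OF that(2)] by simp
      qed (use e in simp)
      then show ?thesis by blast
    qed
    then show ?thesis using complete[of X] XH that by blast
  qed
  have pV: "p \<in> V" using Vlim XV pH plim by blast
  have "hinner H (hsub f p) g = 0" if g: "g \<in> V" for g
  proof -
    have gH: "g \<in> hcarrier H" using g VH by blast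
    define G where "G = Re (hinner H g g)"
    have G: "hinner H g g = of_real G" unfolding G_def by (rule inner_self_real[OF gH])
    have G0: "G \<ge> 0" using inner_nonneg[OF gH] G_def by simp
    define z where "z n = hinner H (hsub f (X n)) g" for n
    have bound: "(cmod (z n))\<^sup>2 \<le> (G + 1) / real (Suc n)" for n
    proof -
      define t where "t = z n / of_real (G + 1)"
      let ?k = "hadd H (X n) (hscale H t g)"
      have FH: "hsub f (X n) \<in> hcarrier H" using f XH by (simp add: hilbert_simps)
      have zc: "hinner H g (hsub f (X n)) = cnj (z n)"
        unfolding z_def using inner_cnj[OF FH gH] .
      have "hinner H (hsub f ?k) (hsub f ?k)
          = hinner H (hsub f (X n)) (hsub f (X n)) - cnj t * z n - t * cnj (z n) + t * cnj t * of_real G"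
        unfolding zc[symmetric] G[symmetric] unfolding z_def
        using f XH[of n] gH by (simp add: hilbert_simps algebra_simps)
      also have "\<dots> = hinner H (hsub f (X n)) (hsub f (X n))
          - of_real ((cmod (z n))\<^sup>2 * (G + 2) / (G + 1)\<^sup>2)"
      proof -
        define c where "c = (cmod (z n))\<^sup>2"
        have zz: "z n * cnj (z n) = of_real c" unfolding c_def by (simp only: complex_norm_square)
        have t1: "cnj t * z n = of_real (c / (G + 1))" "t * cnj (z n) = of_real (c / (G + 1))"
          unfolding t_def of_real_divide zz[symmetric] by (simp_all add: mult.commute)
        have t2: "t * cnj t * of_real G = of_real (c / (G + 1)\<^sup>2 * G)"
          unfolding t_def of_real_divide of_real_mult zz[symmetric] by (simp add: power2_eq_square)
        have t3: "c / (G + 1) + c / (G + 1) - c / (G + 1)\<^sup>2 * G = c * (G + 2) / (G + 1)\<^sup>2"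
        proof -
          have "G + 1 \<noteq> 0" using G0 by simp
          then have "c / (G + 1) = c * (G + 1) / (G + 1)\<^sup>2" by (simp add: power2_eq_square)
          then have "c / (G + 1) + c / (G + 1) - c / (G + 1)\<^sup>2 * G
              = (c * (G + 1) + c * (G + 1) - c * G) / (G + 1)\<^sup>2"
            by (simp add: add_divide_distrib diff_divide_distrib)
          then show ?thesis by (simp add: algebra_simps)
        qed
        show ?thesis unfolding t1 t2 c_def[symmetric] t3[symmetric] by simp
      qed
      finally have e1: "hinner H (hsub f ?k) (hsub f ?k) = hinner H (hsub f (X n)) (hsub f (X n))
          - of_real ((cmod (z n))\<^sup>2 * (G + 2) / (G + 1)\<^sup>2)" .
      have "q ?k = q (X n) - (cmod (z n))\<^sup>2 * (G + 2) / (G + 1)\<^sup>2"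
        unfolding q_def e1 by simp
      moreover have "d \<le> q ?k" using XV g by (intro dle Vadd Vscale)
      ultimately have "(cmod (z n))\<^sup>2 * (G + 2) / (G + 1)\<^sup>2 \<le> 1 / real (Suc n)"
        using Xq[of n] by simp
      moreover have "(cmod (z n))\<^sup>2 / (G + 1) \<le> (cmod (z n))\<^sup>2 * (G + 2) / (G + 1)\<^sup>2"
      proof -
        have "(cmod (z n))\<^sup>2 * (1 / (G + 1)) \<le> (cmod (z n))\<^sup>2 * ((G + 2) / (G + 1)\<^sup>2)"
        proof (intro mult_left_mono)
          have "(G + 1) * (G + 1) \<le> (G + 2) * (G + 1)" using G0 by (intro mult_right_mono) auto
          then show "1 / (G + 1) \<le> (G + 2) / (G + 1)\<^sup>2"
            using G0 by (simp add: divide_simps power2_eq_square)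
        qed simp
        then show ?thesis by simp
      qed
      ultimately have "(cmod (z n))\<^sup>2 / (G + 1) \<le> 1 / real (Suc n)" by linarith
      then show ?thesis using G0 by (simp add: field_simps)
    qed
    have "(\<lambda>n. (cmod (z n))\<^sup>2) \<longlonglongrightarrow> 0"
    proof (rule tendsto_sandwich[OF _ _ tendsto_const])
      show "(\<lambda>n. (G + 1) / real (Suc n)) \<longlonglongrightarrow> 0"
        using LIMSEQ_Suc[OF lim_const_over_n[of "G + 1"]] by simp
    qed (use bound in auto)
    then have "(\<lambda>n. sqrt ((cmod (z n))\<^sup>2)) \<longlonglongrightarrow> sqrt 0" by (intro tendsto_real_sqrt)
    then have "z \<longlonglongrightarrow> 0" by (simp add: tendsto_norm_zero_iff)
    moreover have "z \<longlonglongrightarrow> hinner H (hsub f p) g"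
    proof -
      have "z = (\<lambda>n. hinner H f g - hinner H (X n) g)"
        unfolding z_def using f XH gH by (simp add: hilbert_simps)
      moreover have "hinner H (hsub f p) g = hinner H f g - hinner H p g"
        using f pH gH by (simp add: hilbert_simps)
      ultimately show ?thesis using inner_tendsto[OF XH pH gH plim] by (auto intro: tendsto_intros)
    qed
    ultimately show ?thesis using LIMSEQ_unique by blast
  qed
  with pV show ?thesis by blast
qed

definition hproj :: "'a set \<Rightarrow> 'a \<Rightarrow> 'a" where
  "hproj V f = (SOME p. p \<in> V \<and> (\<forall>g\<in>V. hinner H (hsub f p) g = 0))"

lemma subspace_carrier: "closed_subspace H V \<Longrightarrow> f \<in> V \<Longrightarrow> f \<in> hcarrier H"
  unfolding closed_subspace_def by blast

lemma hproj:
  assumes "closed_subspace H V" "f \<in> hcarrier H"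
  shows hproj_in: "hproj V f \<in> V" and hproj_carrier: "hproj V f \<in> hcarrier H"
    and hproj_inner: "g \<in> V \<Longrightarrow> hinner H (hproj V f) g = hinner H f g"
proof -
  have *: "hproj V f \<in> V \<and> (\<forall>g\<in>V. hinner H (hsub f (hproj V f)) g = 0)"
    unfolding hproj_def by (rule someI_ex) (use projection_exists[OF assms] in blast)
  then show "hproj V f \<in> V" and c: "hproj V f \<in> hcarrier H"
    using subspace_carrier[OF assms(1)] by auto
  show "hinner H (hproj V f) g = hinner H f g" if "g \<in> V"
    using bspec[OF conjunct2[OF *] that] assms c subspace_carrier[OF assms(1) that]
    by (simp add: hilbert_simps)
qed

text \<open>Two elements of \<open>V\<close> with the same inner products against \<open>V\<close> coincide, which identifies projections in all later computations.\<close>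

lemma hproj_eqI:
  assumes V: "closed_subspace H V" and f: "f \<in> hcarrier H" and p: "p \<in> V"
    and orth: "\<And>g. g \<in> V \<Longrightarrow> hinner H p g = hinner H f g"
  shows "hproj V f = p"
proof -
  let ?P = "hproj V f"
  have mem: "?P \<in> hcarrier H" "p \<in> hcarrier H"
    using hproj_carrier[OF V f] subspace_carrier[OF V p] by auto
  have "hsub ?P p \<in> V"
    using V hproj_in[OF V f] p unfolding closed_subspace_def by blast
  then have "hinner H ?P (hsub ?P p) = hinner H p (hsub ?P p)"
    using orth hproj_inner[OF V f] by metis
  then have "hinner H (hsub ?P p) (hsub ?P p) = 0"
    using mem by (simp add: hilbert_simps algebra_simps)
  then show ?thesis using hdist_zero_imp_eq[OF mem] by simp
qed

lemma subspace_closed: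
  assumes "closed_subspace H V"
  shows "f \<in> V \<Longrightarrow> g \<in> V \<Longrightarrow> hadd H f g \<in> V" and "f \<in> V \<Longrightarrow> hscale H a f \<in> V"
  using assms unfolding closed_subspace_def by auto

lemma hproj_add:
  assumes V: "closed_subspace H V" and f: "f \<in> hcarrier H" and g: "g \<in> hcarrier H"
  shows "hproj V (hadd H f g) = hadd H (hproj V f) (hproj V g)"
proof (rule hproj_eqI[OF V])
  show "hadd H (hproj V f) (hproj V g) \<in> V"
    by (rule subspace_closed(1)[OF V hproj_in[OF V f] hproj_in[OF V g]])
  show "hadd H f g \<in> hcarrier H" using f g by (rule add_closed)
  fix k assume k: "k \<in> V"
  show "hinner H (hadd H (hproj V f) (hproj V g)) k = hinner H (hadd H f g) k"
    by (simp add: inner_add f g k hproj_carrier[OF V] subspace_carrier[OF V k] hproj_inner[OF V])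
qed

lemma hproj_scale:
  assumes V: "closed_subspace H V" and f: "f \<in> hcarrier H"
  shows "hproj V (hscale H a f) = hscale H a (hproj V f)"
proof (rule hproj_eqI[OF V])
  show "hscale H a (hproj V f) \<in> V"
    by (rule subspace_closed(2)[OF V hproj_in[OF V f]])
  show "hscale H a f \<in> hcarrier H" using f by (rule scale_closed)
  fix k assume k: "k \<in> V"
  show "hinner H (hscale H a (hproj V f)) k = hinner H (hscale H a f) k"
    by (simp add: inner_scale f k hproj_carrier[OF V] subspace_carrier[OF V k] hproj_inner[OF V])
qed

lemma hproj_ident: "closed_subspace H V \<Longrightarrow> f \<in> V \<Longrightarrow> hproj V f = f"
  by (rule hproj_eqI) (auto intro: subspace_carrier)

end

section \<open>Unitary maps\<close>

lemma unitary_mapD: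
  assumes "unitary_map H K U"
  shows "bij_betw U (hcarrier H) (hcarrier K)"
    and "f \<in> hcarrier H \<Longrightarrow> U f \<in> hcarrier K"
    and "f \<in> hcarrier H \<Longrightarrow> g \<in> hcarrier H \<Longrightarrow> U (hadd H f g) = hadd K (U f) (U g)"
    and "f \<in> hcarrier H \<Longrightarrow> U (hscale H a f) = hscale K a (U f)"
    and "f \<in> hcarrier H \<Longrightarrow> g \<in> hcarrier H \<Longrightarrow> hinner K (U f) (U g) = hinner H f g"
  using assms unfolding unitary_map_def bij_betw_def by auto

lemma unitary_map_comp:
  assumes "unitary_map H K U" "unitary_map K L U'"
  shows "unitary_map H L (\<lambda>f. U' (U f))"
proof -
  have "bij_betw (U' \<circ> U) (hcarrier H) (hcarrier L)"
    by (rule bij_betw_trans[OF unitary_mapD(1)[OF assms(1)] unitary_mapD(1)[OF assms(2)]])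
  then show ?thesis using unitary_mapD[OF assms(1)] unitary_mapD[OF assms(2)]
    unfolding unitary_map_def by (simp add: o_def)
qed

text \<open>The domain need not be known to be a Hilbert space: closure under the two operations is what makes the inverse linear.\<close>

lemma unitary_map_inv:
  assumes U: "unitary_map H K U"
    and add: "\<And>f g. f \<in> hcarrier H \<Longrightarrow> g \<in> hcarrier H \<Longrightarrow> hadd H f g \<in> hcarrier H"
    and scale: "\<And>a f. f \<in> hcarrier H \<Longrightarrow> hscale H a f \<in> hcarrier H"
  shows "unitary_map K H (inv_into (hcarrier H) U)"
proof -
  note D = unitary_mapD[OF U]
  let ?I = "inv_into (hcarrier H) U"
  have bij: "bij_betw ?I (hcarrier K) (hcarrier H)" using D(1) by (rule bij_betw_inv_into)
  have I: "?I f \<in> hcarrier H" if "f \<in> hcarrier K" for f using bij that by (auto simp: bij_betw_def)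
  have UI: "U (?I f) = f" if "f \<in> hcarrier K" for f
    using D(1) that by (simp add: bij_betw_inv_into_right)
  have IU: "?I (U f) = f" if "f \<in> hcarrier H" for f
    using D(1) that by (simp add: bij_betw_inv_into_left)
  have "?I (hadd K f g) = hadd H (?I f) (?I g)" if "f \<in> hcarrier K" "g \<in> hcarrier K" for f g
    using IU[OF add[OF I[OF that(1)] I[OF that(2)]]] D(3)[OF I[OF that(1)] I[OF that(2)]] UI that
    by simp
  moreover have "?I (hscale K a f) = hscale H a (?I f)" if "f \<in> hcarrier K" for a f
    using IU[OF scale[OF I[OF that]], of a] D(4)[OF I[OF that], of a] UI that by simp
  moreover have "hinner H (?I f) (?I g) = hinner K f g" if "f \<in> hcarrier K" "g \<in> hcarrier K" for f g
    using D(5)[OF I[OF that(1)] I[OF that(2)]] UI that by simp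
  ultimately show ?thesis using bij unfolding unitary_map_def by simp
qed

text \<open>Restrictions are used to cut a unitary map of the whole space down to matching orthogonal complements.\<close>

lemma unitary_map_restrict:
  assumes "unitary_map H K U" "S \<subseteq> hcarrier H" "U ` S = R"
  shows "unitary_map (subspace_hspace H S) (subspace_hspace K R) U"
proof -
  have "inj_on U (hcarrier H)" using unitary_mapD(1)[OF assms(1)] by (simp add: bij_betw_def)
  then have "bij_betw U S R" using assms(2,3) by (auto simp: bij_betw_def intro: inj_on_subset)
  then show ?thesis using unitary_mapD(3-5)[OF assms(1)] assms(2)
    unfolding unitary_map_def by (simp add: subset_iff)
qed

section \<open>Decomposition along a filtration\<close>

context hilbert_space
begin

text \<open>The coordinates of \<open>f\<close>: its projection to the first space of the filtration, and then the increments of its projections, each carried to a model space by the given maps.\<close>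

definition filtration_map ::
  "(nat \<Rightarrow> 'a set) \<Rightarrow> ('a \<Rightarrow> 'b) \<Rightarrow> (nat \<Rightarrow> 'a \<Rightarrow> 'c) \<Rightarrow> 'a \<Rightarrow> 'b \<times> (nat \<Rightarrow> 'c)" where
  "filtration_map V u r f =
     (u (hproj (V 0) f), \<lambda>n. r n (hsub (hproj (V (Suc n)) f) (hproj (V n) f)))"

text \<open>Pythagoras: the projection is a best approximation, so density of the union makes the projections converge strongly to the identity.\<close>

lemma hdist_hproj_le:
  assumes V: "closed_subspace H V" and f: "f \<in> hcarrier H" and g: "g \<in> V"
  shows "hdist H (hproj V f) f \<le> hdist H f g"
proof (rule power2_le_imp_le)
  let ?p = "hproj V f"
  have c: "?p \<in> hcarrier H" "g \<in> hcarrier H"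
    using hproj_carrier[OF V f] subspace_carrier[OF V g] by auto
  have e: "hinner H f ?p = hinner H ?p ?p" "hinner H f g = hinner H ?p g"
    using hproj_inner[OF V f hproj_in[OF V f]] hproj_inner[OF V f g] by simp_all
  have e': "hinner H ?p f = hinner H ?p ?p" "hinner H g f = hinner H g ?p"
    using inner_cnj[OF f c(1)] inner_cnj[OF c(1) c(1)] inner_cnj[OF f c(2)] inner_cnj[OF c(1) c(2)] e
    by auto
  have "hinner H (hsub f g) (hsub f g)
      = hinner H (hsub ?p f) (hsub ?p f) + hinner H (hsub ?p g) (hsub ?p g)"
    using f c e e' by (simp add: hilbert_simps)
  then have "(hdist H f g)\<^sup>2 = (hdist H ?p f)\<^sup>2 + Re (hinner H (hsub ?p g) (hsub ?p g))"
    using f c by (simp add: hdist_power2)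
  moreover have "0 \<le> Re (hinner H (hsub ?p g) (hsub ?p g))"
    using c by (intro inner_nonneg) (simp add: hilbert_simps)
  ultimately show "(hdist H ?p f)\<^sup>2 \<le> (hdist H f g)\<^sup>2" by simp
qed (use f subspace_carrier[OF V g] hdist_nonneg in simp)

text \<open>The inner products of the increments of the projections telescope, and the projections
  themselves converge strongly to the identity because the union is dense; this gives the
  isometry.  Conversely the partial sums of a square-summable family of increments form a Cauchy
  sequence, and the projections of its limit are these partial sums.\<close>

lemma filtration_unitary:
  assumes cl: "\<And>n. closed_subspace H (V n)" and nest: "\<And>n :: nat. V n \<subseteq> V (Suc n)"
    and dense: "\<And>f e. f \<in> hcarrier H \<Longrightarrow> 0 < e \<Longrightarrow> \<exists>g\<in>(\<Union>n. V n). hdist H f g < e"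
    and u: "unitary_map (subspace_hspace H (V 0)) K u"
    and r: "\<And>n. unitary_map (subspace_hspace H (ortho_compl_in H (V (Suc n)) (V n))) (L n) (r n)"
  shows "unitary_map H (hsum K L) (filtration_map V u r)"
proof -
  define P where "P n f = hproj (V n) f" for n f
  define Q where "Q n f = hsub (P (Suc n) f) (P n f)" for n f
  define W where "W n = ortho_compl_in H (V (Suc n)) (V n)" for n
  note r = r[folded W_def]
  have mono: "V m \<subseteq> V n" if "m \<le> n" for m n
    using lift_Suc_mono_le[of V m n] nest that by blast
  have VC: "V n \<subseteq> hcarrier H" for n using subspace_carrier[OF cl] by blast
  have WV: "W n \<subseteq> V (Suc n)" for n unfolding W_def ortho_compl_in_def by blast
  have WC: "W n \<subseteq> hcarrier H" for n using WV VC by blast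
  have Worth: "hinner H f g = 0" if "f \<in> W n" "g \<in> V n" for f g n
    using that unfolding W_def ortho_compl_in_def by blast
  have P: "P n f \<in> V n" "P n f \<in> hcarrier H" "\<And>g. g \<in> V n \<Longrightarrow> hinner H (P n f) g = hinner H f g"
    if "f \<in> hcarrier H" for n f
    unfolding P_def using hproj[OF cl that] by auto
  have Padd: "P n (hadd H f g) = hadd H (P n f) (P n g)"
    if "f \<in> hcarrier H" "g \<in> hcarrier H" for n f g unfolding P_def using hproj_add[OF cl that] .
  have Pscale: "P n (hscale H a f) = hscale H a (P n f)" if "f \<in> hcarrier H" for n a f
    unfolding P_def using hproj_scale[OF cl that] .
  have PVP: "hinner H (P m f) (P n g) = hinner H (P m f) (P m g)"
    if "f \<in> hcarrier H" "g \<in> hcarrier H" "m \<le> n" for m n f g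
  proof -
    have "P m f \<in> V n" using P(1)[OF that(1)] mono[OF that(3)] by blast
    then have "hinner H (P n g) (P m f) = hinner H g (P m f)" using P(3)[OF that(2)] by simp
    also have "\<dots> = hinner H (P m g) (P m f)" using P(3)[OF that(2) P(1)[OF that(1)]] by simp
    finally show ?thesis using that P(2) by (metis inner_cnj)
  qed
  have PPV: "hinner H (P n f) (P m g) = hinner H (P m f) (P m g)"
    if "f \<in> hcarrier H" "g \<in> hcarrier H" "m \<le> n" for m n f g
    using PVP[OF that(2) that(1) that(3)] that P(2) by (metis inner_cnj)
  have QC: "Q n f \<in> hcarrier H" if "f \<in> hcarrier H" for n f
    unfolding Q_def using P(2)[OF that] by (simp add: hilbert_simps)
  have QW: "Q n f \<in> W n" if f: "f \<in> hcarrier H" for n f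
  proof -
    have "Q n f \<in> V (Suc n)" unfolding Q_def
      using P(1)[OF f] nest by (intro subspace_closed[OF cl]) auto
    moreover have "hinner H (Q n f) g = 0" if g: "g \<in> V n" for g
    proof -
      have "g \<in> V (Suc n)" using g nest by blast
      then have "hinner H (P (Suc n) f) g = hinner H (P n f) g" using P(3)[OF f] g by simp
      then show ?thesis unfolding Q_def using P(2)[OF f] g VC
        by (simp add: hilbert_simps subset_iff)
    qed
    ultimately show ?thesis unfolding W_def ortho_compl_in_def by blast
  qed
  have Qinner: "hinner H (Q n f) (Q n g)
      = hinner H (P (Suc n) f) (P (Suc n) g) - hinner H (P n f) (P n g)"
    if f: "f \<in> hcarrier H" and g: "g \<in> hcarrier H" for n f g
    unfolding Q_def using P(2)[OF f] P(2)[OF g] PVP[OF f g, of n "Suc n"] PPV[OF f g, of n "Suc n"]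
    by (simp add: hilbert_simps)
  have Pconv: "(\<lambda>n. hdist H (P n f) f) \<longlonglongrightarrow> 0" if f: "f \<in> hcarrier H" for f
  proof (rule LIMSEQ_I)
    fix e :: real assume "0 < e"
    then obtain g N where g: "g \<in> V N" "hdist H f g < e" using dense[OF f] by blast
    have "norm (hdist H (P n f) f - 0) < e" if "n \<ge> N" for n
    proof -
      have "hdist H (P n f) f \<le> hdist H f g"
        unfolding P_def by (rule hdist_hproj_le[OF cl f]) (use g mono[OF that] in blast)
      then show ?thesis using g(2) hdist_nonneg[OF P(2)[OF f] f] by simp
    qed
    then show "\<exists>N. \<forall>n\<ge>N. norm (hdist H (P n f) f - 0) < e" by blast
  qed
  have Pinner: "(\<lambda>n. hinner H (P n f) (P n g)) \<longlonglongrightarrow> hinner H f g"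
    if f: "f \<in> hcarrier H" and g: "g \<in> hcarrier H" for f g
  proof -
    have "hinner H (P n f) (P n g) = hinner H (P n f) g" for n
    proof -
      have "hinner H (P n g) (P n f) = hinner H g (P n f)" using P(3)[OF g P(1)[OF f]] .
      then show ?thesis using f g P(2) by (metis inner_cnj)
    qed
    then show ?thesis using inner_tendsto[OF P(2)[OF f] f g Pconv[OF f]] by simp
  qed
  have Qsums: "(\<lambda>n. hinner H (Q n f) (Q n g)) sums (hinner H f g - hinner H (P 0 f) (P 0 g))"
    if f: "f \<in> hcarrier H" and g: "g \<in> hcarrier H" for f g
    unfolding Qinner[OF f g] using telescope_sums[OF Pinner[OF f g]] .
  let ?U = "filtration_map V u r"
  have Udef: "?U f = (u (P 0 f), \<lambda>n. r n (Q n f))" for f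
    unfolding filtration_map_def P_def Q_def ..
  note uD = unitary_mapD[OF u, simplified] and rD = unitary_mapD[OF r, simplified]
  have rnorm: "(hnorm (L n) (r n a))\<^sup>2 = Re (hinner H a a)" if "a \<in> W n" for n a
    using rD(5)[OF that that] that WC inner_nonneg unfolding hnorm_def by (simp add: subset_iff)
  have UC: "?U f \<in> hcarrier (hsum K L)" if f: "f \<in> hcarrier H" for f
  proof -
    have "summable (\<lambda>n. Re (hinner H (Q n f) (Q n f)))"
      using Qsums[OF f f] by (intro summable_Re) (rule sums_summable)
    then have "summable (\<lambda>n. (hnorm (L n) (r n (Q n f)))\<^sup>2)" using rnorm[OF QW[OF f]] by simp
    then show ?thesis unfolding Udef hsum_def using uD(2) P(1)[OF f] rD(2) QW[OF f] by simp
  qed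
  have Uinner: "hinner (hsum K L) (?U f) (?U g) = hinner H f g"
    if f: "f \<in> hcarrier H" and g: "g \<in> hcarrier H" for f g
  proof -
    have "(\<Sum>n. hinner (L n) (r n (Q n f)) (r n (Q n g))) = hinner H f g - hinner H (P 0 f) (P 0 g)"
      using sums_unique[OF Qsums[OF f g]] rD(5)[OF QW[OF f] QW[OF g]] by simp
    then show ?thesis unfolding Udef hsum_def using uD(5) P(1)[OF f] P(1)[OF g] by simp
  qed
  have Uadd: "?U (hadd H f g) = hadd (hsum K L) (?U f) (?U g)"
    if f: "f \<in> hcarrier H" and g: "g \<in> hcarrier H" for f g
  proof -
    have "Q n (hadd H f g) = hadd H (Q n f) (Q n g)" for n
    proof (rule vec_eqI)
      fix k assume "k \<in> hcarrier H"
      then show "hinner H (Q n (hadd H f g)) k = hinner H (hadd H (Q n f) (Q n g)) k"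
        unfolding Q_def Padd[OF f g] using P(2)[OF f] P(2)[OF g] by (simp add: hilbert_simps)
    qed (use QC f g add_closed in auto)
    then show ?thesis unfolding Udef hsum_def
      using uD(3) P(1)[OF f] P(1)[OF g] Padd[OF f g] rD(3) QW[OF f] QW[OF g] by simp
  qed
  have Uscale: "?U (hscale H a f) = hscale (hsum K L) a (?U f)" if f: "f \<in> hcarrier H" for a f
  proof -
    have "Q n (hscale H a f) = hscale H a (Q n f)" for n
    proof (rule vec_eqI)
      fix k assume "k \<in> hcarrier H"
      then show "hinner H (Q n (hscale H a f)) k = hinner H (hscale H a (Q n f)) k"
        unfolding Q_def Pscale[OF f] using P(2)[OF f] by (simp add: hilbert_simps algebra_simps)
    qed (use QC f scale_closed in auto)
    then show ?thesis unfolding Udef hsum_def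
      using uD(4) P(1)[OF f] Pscale[OF f] rD(4) QW[OF f] by simp
  qed
  have inj: "inj_on ?U (hcarrier H)"
  proof (rule inj_onI)
    fix f g assume f: "f \<in> hcarrier H" and g: "g \<in> hcarrier H" and eq: "?U f = ?U g"
    show "f = g"
    proof (rule vec_eqI[OF f g])
      fix k assume k: "k \<in> hcarrier H"
      show "hinner H f k = hinner H g k" using Uinner[OF f k] Uinner[OF g k] eq by simp
    qed
  qed
  have surj: "y \<in> ?U ` hcarrier H" if y: "y \<in> hcarrier (hsum K L)" for y
  proof -
    obtain v w where yvw: "y = (v, w)" and v: "v \<in> hcarrier K"
      and w: "\<And>n. w n \<in> hcarrier (L n)" and sm: "summable (\<lambda>n. (hnorm (L n) (w n))\<^sup>2)"
      using y unfolding hsum_def by auto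
    have "v \<in> u ` V 0" using bij_betw_imp_surj_on[OF uD(1)] v by simp
    then obtain y0 where y0: "y0 \<in> V 0" "u y0 = v" by blast
    have "\<exists>a\<in>W n. r n a = w n" for n 
    proof -
      have "w n \<in> r n ` W n" using bij_betw_imp_surj_on[OF rD(1)] w by simp
      then show ?thesis by (metis imageE)
    qed
    then obtain a where aW: "\<And>n. a n \<in> W n" and ra: "\<And>n. r n (a n) = w n" by metis
    have aC: "a n \<in> hcarrier H" for n using aW WC by blast
    \<comment> \<open>The partial sums of the prescribed increments; they will be the projections of the preimage.\<close>
    define Y where "Y = rec_nat y0 (\<lambda>n y. hadd H y (a n))"
    have Y0: "Y 0 = y0" and YS: "Y (Suc n) = hadd H (Y n) (a n)" for n
      unfolding Y_def by simp_all
    have YV: "Y n \<in> V n" for n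
    proof (induction n)
      case (Suc n)
      then show ?case unfolding YS using nest[of n] aW[of n] WV[of n]
        by (intro subspace_closed[OF cl]) auto
    qed (use Y0 y0 in simp)
    have YC: "Y n \<in> hcarrier H" for n using YV VC by blast
    have Yinner: "hinner H (Y m) g = hinner H (Y n) g" if "n \<le> m" "g \<in> V n" for m n g
      using that(1)
    proof (induction m rule: dec_induct)
      case (step m)
      have "g \<in> V m" using that(2) mono[OF step.hyps(1)] by blast
      then have "hinner H (a m) g = 0" using Worth[OF aW] by blast
      then show ?case unfolding YS using step.IH YC aC that(2) VC
        by (simp add: hilbert_simps subset_iff)
    qed simp
    define s where "s n = Re (hinner H (Y n) (Y n))" for n
    have sS: "s (Suc n) = s n + (hnorm (L n) (w n))\<^sup>2" for n
    proof -
      have o: "hinner H (a n) (Y n) = 0" using Worth[OF aW YV] .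
      then have "hinner H (Y n) (a n) = 0" using inner_cnj[OF aC YC, of n n] by simp
      then show ?thesis unfolding s_def YS ra[symmetric] rnorm[OF aW] using o aC YC
        by (simp add: hilbert_simps)
    qed
    have seq: "s n = s 0 + (\<Sum>k<n. (hnorm (L k) (w k))\<^sup>2)" for n
      by (induction n) (simp_all add: sS)
    have "convergent (\<lambda>n. s 0 + (\<Sum>k<n. (hnorm (L k) (w k))\<^sup>2))"
      using sm by (intro convergent_add convergent_const) (simp add: summable_iff_convergent)
    then have "convergent s" by (simp flip: seq)
    then have sC: "Cauchy s" by (rule convergent_Cauchy)
    have Ydist0: "(hdist H (Y m) (Y n))\<^sup>2 = s m - s n" if "n \<le> m" for m n
    proof -
      have 1: "hinner H (Y m) (Y n) = hinner H (Y n) (Y n)" using Yinner[OF that YV] .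
      then have "hinner H (Y n) (Y m) = hinner H (Y n) (Y n)"
        using inner_cnj[OF YC YC, of m n] inner_cnj[OF YC YC, of n n] by (metis complex_cnj_cancel_iff)
      then show ?thesis unfolding s_def using 1 YC by (simp add: hdist_power2 hilbert_simps)
    qed
    have Ydist: "(hdist H (Y m) (Y n))\<^sup>2 = \<bar>s m - s n\<bar>" for m n
    proof (cases "n \<le> m")
      case True
      then show ?thesis using Ydist0[OF True] by (metis abs_of_nonneg zero_le_power2)
    next
      case False
      then have "n \<ge> m" by simp
      have "(hdist H (Y m) (Y n))\<^sup>2 = (hdist H (Y n) (Y m))\<^sup>2"
        using YC[of m] YC[of n] by (simp add: hdist_power2 hilbert_simps)
      then show ?thesis using Ydist0[OF \<open>n \<ge> m\<close>]
        by (metis abs_minus_commute abs_of_nonneg zero_le_power2)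
    qed
    have "\<exists>M. \<forall>m\<ge>M. \<forall>n\<ge>M. hdist H (Y m) (Y n) < e" if e: "0 < e" for e
    proof -
      obtain M where M: "\<And>m n. m \<ge> M \<Longrightarrow> n \<ge> M \<Longrightarrow> \<bar>s m - s n\<bar> < e\<^sup>2"
        using CauchyD[OF sC, of "e\<^sup>2"] e by auto
      have "hdist H (Y m) (Y n) < e" if "m \<ge> M" "n \<ge> M" for m n
        using M[OF that] e unfolding Ydist[symmetric] by (simp add: power_less_imp_less_base)
      then show ?thesis by blast
    qed
    then obtain f where f: "f \<in> hcarrier H" and flim: "(\<lambda>n. hdist H (Y n) f) \<longlonglongrightarrow> 0"
      using complete[of Y] YC by blast
    have PY: "P n f = Y n" for n
      unfolding P_def
    proof (rule hproj_eqI[OF cl f YV])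
      fix g assume g: "g \<in> V n"
      then have gC: "g \<in> hcarrier H" using VC by blast
      have lim: "(\<lambda>m. hinner H (Y m) g) \<longlonglongrightarrow> hinner H f g"
        by (rule inner_tendsto[OF YC f gC flim])
      have "\<forall>\<^sub>F m in sequentially. hinner H (Y m) g = hinner H (Y n) g"
        using Yinner[OF _ g] eventually_sequentially by blast
      then have "(\<lambda>m. hinner H (Y m) g) \<longlonglongrightarrow> hinner H (Y n) g"
        by (rule tendsto_eventually)
      then show "hinner H (Y n) g = hinner H f g" using lim by (rule LIMSEQ_unique)
    qed
    have "Q n f = a n" for n
      by (rule vec_eqI) (use QC f aC YC in \<open>auto simp: Q_def PY YS hilbert_simps\<close>)
    then have "?U f = y" unfolding Udef PY Y0 y0(2) yvw using ra by simp
    then show ?thesis using f by blast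
  qed
  have "bij_betw ?U (hcarrier H) (hcarrier (hsum K L))"
    unfolding bij_betw_def using inj UC surj by blast
  then show ?thesis unfolding unitary_map_def using Uadd Uscale Uinner by blast
qed

end

section \<open>Transport along a unitary map\<close>

text \<open>A target that is only known to be a bijective image is a Hilbert space: every axiom is an
  identity or a limit statement that can be pulled back.\<close>

lemma hilbert_space_transfer:
  assumes H: "hilbert_space H" and U: "unitary_map H K U" and z: "hzero K = U (hzero H)"
  shows "hilbert_space K"
proof -
  interpret hilbert_space H by (rule H)
  note D = unitary_mapD[OF U]
  have K: "hcarrier K = U ` hcarrier H" using D(1) by (simp add: bij_betw_def)
  have Kadd: "hadd K (U f) (U g) = U (hadd H f g)" if "f \<in> hcarrier H" "g \<in> hcarrier H" for f g
    using D(3)[OF that] by simp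
  have Kscale: "hscale K a (U f) = U (hscale H a f)" if "f \<in> hcarrier H" for a f
    using D(4)[OF that] by simp
  note S = Kadd Kscale D(5) z add_closed zero_closed scale_closed
  show ?thesis
  proof
    fix X :: "nat \<Rightarrow> 'b"
    assume X: "\<And>n. X n \<in> hcarrier K"
      and C: "\<And>e. 0 < e \<Longrightarrow> \<exists>M. \<forall>m\<ge>M. \<forall>n\<ge>M. hdist K (X m) (X n) < e"
    have "\<exists>x\<in>hcarrier H. X n = U x" for n using X[of n] K by auto
    then obtain x where x: "\<And>n. x n \<in> hcarrier H" and Xx: "\<And>n. X n = U (x n)" by metis
    have d: "hdist K (U f) (U g) = hdist H f g" if "f \<in> hcarrier H" "g \<in> hcarrier H" for f g
      using that by (simp add: hdist_def hnorm_def S)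
    have "\<exists>f\<in>hcarrier H. (\<lambda>n. hdist H (x n) f) \<longlonglongrightarrow> 0"
      using C by (intro complete[OF x]) (simp add: Xx d x)
    then show "\<exists>f\<in>hcarrier K. (\<lambda>n. hdist K (X n) f) \<longlonglongrightarrow> 0"
      unfolding K Xx using d[OF x] by auto
  next
    show "hadd K (hadd K f g) k = hadd K f (hadd K g k)"
      if "f \<in> hcarrier K" "g \<in> hcarrier K" "k \<in> hcarrier K" for f g k
      using that unfolding K by (auto simp: S add_assoc)
    show "hadd K f g = hadd K g f" if "f \<in> hcarrier K" "g \<in> hcarrier K" for f g
      using that unfolding K by (auto simp: S intro!: arg_cong[of _ _ U] add_commute)
    show "f = hzero K" if "f \<in> hcarrier K" "hinner K f f = 0" for f
      using that inner_definite unfolding K by (auto simp: S)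
    show "hscale K a (hadd K f g) = hadd K (hscale K a f) (hscale K a g)"
      if "f \<in> hcarrier K" "g \<in> hcarrier K" for a f g
      using that unfolding K by (auto simp: S scale_add_right)
    show "hscale K (a + b) f = hadd K (hscale K a f) (hscale K b f)" if "f \<in> hcarrier K" for a b f
      using that unfolding K by (auto simp: S scale_add_left)
    show "hinner K g f = cnj (hinner K f g)" if "f \<in> hcarrier K" "g \<in> hcarrier K" for f g
      using that unfolding K by (auto simp: S intro: inner_cnj)
  qed (auto simp: K S add_zero add_inverse scale_scale scale_one inner_add inner_scale inner_nonneg)
qed

lemma closed_subspace_transfer:
  assumes H: "hilbert_space H" and U: "unitary_map H K U" and z: "hzero K = U (hzero H)"
    and S: "closed_subspace H S"
  shows "closed_subspace K (U ` S)"
proof -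
  interpret hilbert_space H by (rule H)
  note D = unitary_mapD[OF U]
  have K: "hcarrier K = U ` hcarrier H" using D(1) by (simp add: bij_betw_def)
  have SC: "f \<in> hcarrier H" if "f \<in> S" for f using subspace_carrier[OF S that] .
  have d: "hdist K (U f) (U g) = hdist H f g" if "f \<in> hcarrier H" "g \<in> hcarrier H" for f g
    using that by (simp add: hdist_def hnorm_def D(3-5)[symmetric] scale_closed add_closed)
  have lim: "f \<in> U ` S"
    if X: "\<And>n :: nat. X n \<in> U ` S" and f: "f \<in> hcarrier K" and l: "(\<lambda>n. hdist K (X n) f) \<longlonglongrightarrow> 0"
    for X f
  proof -
    have "\<exists>x\<in>S. X n = U x" for n using X[of n] by auto
    then obtain x where x: "\<And>n. x n \<in> S" and Xx: "\<And>n. X n = U (x n)" by metis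
    obtain f' where f': "f' \<in> hcarrier H" "f = U f'" using f K by auto
    have "(\<lambda>n. hdist H (x n) f') \<longlonglongrightarrow> 0" using l unfolding Xx f'(2) using d[OF SC[OF x] f'(1)] by simp
    then have "f' \<in> S" using S x f'(1) unfolding closed_subspace_def by blast
    then show ?thesis using f'(2) by blast
  qed
  show ?thesis unfolding closed_subspace_def
  proof (intro conjI ballI allI impI)
    show "U ` S \<subseteq> hcarrier K" using SC K by auto
    show "hzero K \<in> U ` S" using z S unfolding closed_subspace_def by blast
    show "hadd K f g \<in> U ` S" if "f \<in> U ` S" "g \<in> U ` S" for f g
      using that by (auto simp: D(3)[symmetric] SC intro: subspace_closed[OF S])
    show "hscale K a f \<in> U ` S" if "f \<in> U ` S" for a f
      using that by (auto simp: D(4)[symmetric] SC intro: subspace_closed[OF S])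
  qed (use lim in blast)
qed

text \<open>All requirements on a generalized multiresolution analysis are expressed by the Hilbert space structure, the representation, the dilation and the subspaces, and a unitary map intertwining these data carries each requirement over.  No separate construction is therefore needed for the canonical analysis.\<close>

lemma gmra_transfer:
  fixes \<pi> :: "'g :: ab_group_add \<Rightarrow> 'a \<Rightarrow> 'a"
  assumes G: "gmra H \<alpha> \<pi> \<delta> V" and U: "unitary_map H K U" and z: "hzero K = U (hzero H)"
    and \<pi>': "\<And>\<gamma> f. f \<in> hcarrier H \<Longrightarrow> \<pi>' \<gamma> (U f) = U (\<pi> \<gamma> f)"
    and \<delta>': "\<And>f. f \<in> hcarrier H \<Longrightarrow> \<delta>' (U f) = U (\<delta> f)"
    and V': "\<And>j. V' j = U ` V j"
  shows "gmra K \<alpha> \<pi>' \<delta>' V'"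
proof -
  interpret gmra H \<alpha> \<pi> \<delta> V by (rule G)
  interpret K: hilbert_space K
    by (rule hilbert_space_transfer[OF _ U z]) (rule hilbert_space_axioms)
  note D = unitary_mapD[OF U]
  have C: "hcarrier K = U ` hcarrier H" using D(1) by (simp add: bij_betw_def)
  have inj: "inj_on U (hcarrier H)" using D(1) by (simp add: bij_betw_def)
  have VC: "f \<in> hcarrier H" if "f \<in> V j" for f j using subspace_carrier[OF closed that] .
  have d: "hdist K (U f) (U g) = hdist H f g" if "f \<in> hcarrier H" "g \<in> hcarrier H" for f g
    using that by (simp add: hdist_def hnorm_def D(3-5)[symmetric] scale_closed add_closed)
  have un: "unitary_map K K T'" if T: "unitary_map H H T" and e: "\<And>f. f \<in> hcarrier H \<Longrightarrow> T' (U f) = U (T f)" for T T'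
  proof -
    note TD = unitary_mapD[OF T]
    have "inj_on T' (hcarrier K)"
    proof (rule inj_onI)
      fix x y assume "x \<in> hcarrier K" "y \<in> hcarrier K" "T' x = T' y"
      then obtain f g where fg: "f \<in> hcarrier H" "g \<in> hcarrier H" "x = U f" "y = U g" "U (T f) = U (T g)"
        unfolding C using e by auto
      then have "T f = T g" using inj TD(2) by (meson inj_onD)
      then show "x = y" using fg TD(1) by (metis bij_betw_def inj_onD)
    qed
    moreover have "T' ` hcarrier K = hcarrier K"
    proof -
      have "T' ` hcarrier K = U ` (T ` hcarrier H)" unfolding C image_image using e by (intro image_cong) auto
      also have "T ` hcarrier H = hcarrier H" using TD(1) by (simp add: bij_betw_def)
      finally show ?thesis using C by simp
    qed
    ultimately have bij: "bij_betw T' (hcarrier K) (hcarrier K)" by (simp add: bij_betw_def)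
    show ?thesis unfolding unitary_map_def
    proof (intro conjI ballI allI)
      show "bij_betw T' (hcarrier K) (hcarrier K)" by (rule bij)
    qed (auto simp: C D(3-5)[symmetric] e TD add_closed scale_closed, simp_all add: D TD)
  qed
  have PU: "unitary_map H H (\<pi> \<gamma>)" for \<gamma> using rep unfolding unitary_rep_def by blast
  have \<pi>C: "\<pi> \<gamma> f \<in> hcarrier H" if "f \<in> hcarrier H" for \<gamma> f using unitary_mapD(2)[OF PU that] .
  have \<delta>C: "\<delta> f \<in> hcarrier H" if "f \<in> hcarrier H" for f using unitary_mapD(2)[OF unitary that] .
  have \<delta>K: "unitary_map K K \<delta>'" by (rule un[OF unitary \<delta>'])
  show ?thesis
  proof
    obtain S where S: "countable S" "S \<subseteq> hcarrier H" "\<And>f e. f \<in> hcarrier H \<Longrightarrow> 0 < e \<Longrightarrow> \<exists>g\<in>S. hdist H f g < e"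
      using separable unfolding separable_hspace_def by blast
    show "separable_hspace K" unfolding separable_hspace_def
    proof (intro exI[of _ "U ` S"] conjI ballI allI impI)
      fix f and e :: real assume "f \<in> hcarrier K" "0 < e"
      then obtain f' where f': "f' \<in> hcarrier H" "f = U f'" using C by auto
      obtain g where "g \<in> S" "hdist H f' g < e" using S(3)[OF f'(1) \<open>0 < e\<close>] by blast
      then show "\<exists>g\<in>U ` S. hdist K f g < e" using f' S(2) by (auto simp: d subset_iff)
    qed (use S C in auto)
    show "unitary_rep K \<pi>'" unfolding unitary_rep_def
    proof (intro conjI allI ballI)
      show "unitary_map K K (\<pi>' \<gamma>)" for \<gamma> by (rule un[OF PU \<pi>'])
      show "\<pi>' 0 f = f" if "f \<in> hcarrier K" for f
        using that rep unfolding C unitary_rep_def by (auto simp: \<pi>')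
      show "\<pi>' (\<gamma> + \<gamma>') f = \<pi>' \<gamma> (\<pi>' \<gamma>' f)" if "f \<in> hcarrier K" for \<gamma> \<gamma>' f
        using that rep unfolding C unitary_rep_def by (auto simp: \<pi>' \<pi>C)
    qed
    show "unitary_map K K \<delta>'" by (rule \<delta>K)
    show "inv_into (hcarrier K) \<delta>' (\<pi>' \<gamma> (\<delta>' f)) = \<pi>' (\<alpha> \<gamma>) f" if fK: "f \<in> hcarrier K" for f \<gamma>
    proof -
      obtain f' where f': "f' \<in> hcarrier H" "f = U f'" using fK unfolding C by blast
      have "\<pi> \<gamma> (\<delta> f') \<in> \<delta> ` hcarrier H"
        using unitary_mapD(1)[OF unitary] \<pi>C[OF \<delta>C[OF f'(1)]] by (simp add: bij_betw_def)
      then have "\<delta> (inv_into (hcarrier H) \<delta> (\<pi> \<gamma> (\<delta> f'))) = \<pi> \<gamma> (\<delta> f')" by (rule f_inv_into_f)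
      then have "\<delta> (\<pi> (\<alpha> \<gamma>) f') = \<pi> \<gamma> (\<delta> f')" using dilation[OF f'(1)] by simp
      then have "\<pi>' \<gamma> (\<delta>' f) = \<delta>' (\<pi>' (\<alpha> \<gamma>) f)"
        unfolding f'(2) by (simp add: \<pi>' \<delta>' \<pi>C \<delta>C f'(1))
      moreover have "\<pi>' (\<alpha> \<gamma>) f \<in> hcarrier K" unfolding f'(2) C by (simp add: \<pi>' \<pi>C f'(1))
      ultimately show ?thesis using unitary_mapD(1)[OF \<delta>K] by (simp add: bij_betw_inv_into_left)
    qed
    show "closed_subspace K (V' j)" for j
      unfolding V' by (rule closed_subspace_transfer[OF _ U z closed]) (rule hilbert_space_axioms)
    show "V' j \<subseteq> V' (j + 1)" for j unfolding V' using nested by (rule image_mono)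
    show "V' (j + 1) = \<delta>' ` V' j" for j
      unfolding V' dilate image_image using \<delta>'[OF VC] by (intro image_cong) auto
    have "(\<Inter>j. V' j) = U ` (\<Inter>j. V j)"
      unfolding V' using inj VC by (intro image_INT[symmetric, of U "hcarrier H"]) auto
    then show "(\<Inter>j. V' j) = {hzero K}" using trivial_inter z by simp
    show "\<exists>g\<in>(\<Union>j. V' j). hdist K f g < e" if "f \<in> hcarrier K" "0 < e" for f e
    proof -
      obtain f' where f': "f' \<in> hcarrier H" "f = U f'" using \<open>f \<in> hcarrier K\<close> unfolding C by blast
      obtain g j where "g \<in> V j" "hdist H f' g < e" using dense_union[OF f'(1) \<open>0 < e\<close>] by blast
      then show ?thesis unfolding V' f'(2) using d[OF f'(1) VC] by auto
    qed
    show "\<pi>' \<gamma> f \<in> V' 0" if "f \<in> V' 0" for f \<gamma>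
      using that unfolding V' by (auto simp: \<pi>' VC invariant)
  qed
qed

section \<open>Orthogonal systems of full cardinality\<close>

text \<open>Bessel's inequality for the coordinate vectors, summed over all coordinates, compares the two
  cardinalities; in the case of equality every instance of Bessel's inequality is an equality.\<close>

lemma bessel_coordinate:
  fixes u :: "'a \<Rightarrow> 'p \<Rightarrow> complex"
  assumes A: "finite A" and P: "finite P" and p: "p \<in> P" and c: "c > 0"
    and orth: "\<And>a b. a \<in> A \<Longrightarrow> b \<in> A
      \<Longrightarrow> (\<Sum>q\<in>P. u a q * cnj (u b q)) = (if a = b then of_real c else 0)"
  shows "of_real (c - (\<Sum>a\<in>A. (cmod (u a p))\<^sup>2))
    = c * (\<Sum>q\<in>P. ((if q = p then 1 else 0) - (\<Sum>a\<in>A. cnj (u a p) * u a q) / c)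
          * cnj ((if q = p then 1 else 0) - (\<Sum>a\<in>A. cnj (u a p) * u a q) / c))"
proof -
  define s where "s q = (\<Sum>a\<in>A. cnj (u a p) * u a q)" for q
  have sp: "s p = of_real (\<Sum>a\<in>A. (cmod (u a p))\<^sup>2)"
    unfolding s_def of_real_sum by (intro sum.cong) (simp_all add: complex_norm_square mult.commute del: of_real_power)
  have ss: "(\<Sum>q\<in>P. s q * cnj (s q)) = c * s p"
  proof -
    have "(\<Sum>q\<in>P. s q * cnj (s q))
        = (\<Sum>q\<in>P. \<Sum>a\<in>A. \<Sum>b\<in>A. cnj (u a p) * u b p * (u a q * cnj (u b q)))"
      unfolding s_def by (simp add: sum_product algebra_simps)
    also have "\<dots> = (\<Sum>a\<in>A. \<Sum>b\<in>A. \<Sum>q\<in>P. cnj (u a p) * u b p * (u a q * cnj (u b q)))"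
      by (subst sum.swap, rule sum.cong, simp, rule sum.swap)
    also have "\<dots> = (\<Sum>a\<in>A. \<Sum>b\<in>A. cnj (u a p) * u b p * (if a = b then of_real c else 0))"
      unfolding sum_distrib_left[symmetric] using orth by (intro sum.cong refl) simp
    also have "\<dots> = (\<Sum>a\<in>A. \<Sum>b\<in>A. if a = b then cnj (u a p) * u b p * of_real c else 0)"
      by (intro sum.cong refl) simp
    also have "\<dots> = c * s p"
      unfolding s_def by (simp add: A sum.delta sum_distrib_left mult.commute)
    finally show ?thesis .
  qed
  define e where "e q = (if q = p then 1 else 0 :: complex)" for q
  have "(\<Sum>q\<in>P. (e q - s q / c) * cnj (e q - s q / c))
      = (\<Sum>q\<in>P. e q * cnj (e q) - e q * cnj (s q) / c - s q * e q / c + s q * cnj (s q) / (c * c))"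
    by (intro sum.cong refl) (simp add: e_def algebra_simps)
  also have "\<dots> = (\<Sum>q\<in>P. e q * cnj (e q)) - (\<Sum>q\<in>P. e q * cnj (s q)) / c
      - (\<Sum>q\<in>P. s q * e q) / c + (\<Sum>q\<in>P. s q * cnj (s q)) / (c * c)"
    by (simp add: sum.distrib sum_subtractf sum_divide_distrib)
  also have "\<dots> = 1 - cnj (s p) / c - s p / c + c * s p / (c * c)"
    unfolding ss e_def using p P by (simp add: if_distrib if_distribR sum.delta cong: if_cong)
  also have "\<dots> = 1 - s p / c" unfolding sp using c by simp
  finally have "(\<Sum>q\<in>P. (e q - s q / c) * cnj (e q - s q / c)) = 1 - s p / c" .
  then have "c * (\<Sum>q\<in>P. (e q - s q / c) * cnj (e q - s q / c)) = c - s p"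
    using c by (simp add: right_diff_distrib)
  then show ?thesis unfolding of_real_diff sp[symmetric] s_def[symmetric] e_def[symmetric] by simp
qed

lemma bessel_coordinate_le:
  fixes u :: "'a \<Rightarrow> 'p \<Rightarrow> complex"
  assumes A: "finite A" and P: "finite P" and p: "p \<in> P" and c: "c > 0"
    and orth: "\<And>a b. a \<in> A \<Longrightarrow> b \<in> A
      \<Longrightarrow> (\<Sum>q\<in>P. u a q * cnj (u b q)) = (if a = b then of_real c else 0)"
  shows "(\<Sum>a\<in>A. (cmod (u a p))\<^sup>2) \<le> c"
    and "(\<Sum>a\<in>A. (cmod (u a p))\<^sup>2) = c \<Longrightarrow> q \<in> P
      \<Longrightarrow> (\<Sum>a\<in>A. cnj (u a p) * u a q) = (if q = p then of_real c else 0)"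
proof -
  define d where "d q = (if q = p then 1 else 0) - (\<Sum>a\<in>A. cnj (u a p) * u a q) / c" for q
  have "of_real (c - (\<Sum>a\<in>A. (cmod (u a p))\<^sup>2)) = c * (\<Sum>q\<in>P. d q * cnj (d q))"
    unfolding d_def by (rule bessel_coordinate[OF A P p c orth])
  also have "\<dots> = of_real (c * (\<Sum>q\<in>P. (cmod (d q))\<^sup>2))"
    unfolding of_real_mult of_real_sum
    by (intro arg_cong[of _ _ "\<lambda>x. of_real c * x"] sum.cong) (simp_all add: complex_norm_square del: of_real_power)
  finally have e: "c - (\<Sum>a\<in>A. (cmod (u a p))\<^sup>2) = c * (\<Sum>q\<in>P. (cmod (d q))\<^sup>2)"
    by (simp only: of_real_eq_iff)
  have "0 \<le> c * (\<Sum>q\<in>P. (cmod (d q))\<^sup>2)" using c by (simp add: sum_nonneg)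
  then show "(\<Sum>a\<in>A. (cmod (u a p))\<^sup>2) \<le> c" using e by linarith
  assume "(\<Sum>a\<in>A. (cmod (u a p))\<^sup>2) = c" and q: "q \<in> P"
  then have "(\<Sum>q\<in>P. (cmod (d q))\<^sup>2) = 0" using e c by simp
  then have "d q = 0" using q P by (simp add: sum_nonneg_eq_0_iff)
  then have "(\<Sum>a\<in>A. cnj (u a p) * u a q) / c = (if q = p then 1 else 0)" unfolding d_def by simp
  then show "(\<Sum>a\<in>A. cnj (u a p) * u a q) = (if q = p then of_real c else 0)"
    using c by (auto simp: field_simps split: if_splits)
qed

lemma orthogonal_card_le:
  fixes u :: "'a \<Rightarrow> 'p \<Rightarrow> complex"
  assumes A: "finite A" and P: "finite P" and c: "c > 0"
    and orth: "\<And>a b. a \<in> A \<Longrightarrow> b \<in> A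
      \<Longrightarrow> (\<Sum>q\<in>P. u a q * cnj (u b q)) = (if a = b then of_real c else 0)"
  shows "card A \<le> card P"
    and "card A = card P \<Longrightarrow> p \<in> P \<Longrightarrow> (\<Sum>a\<in>A. (cmod (u a p))\<^sup>2) = c"
proof -
  have norm: "(\<Sum>q\<in>P. (cmod (u a q))\<^sup>2) = c" if "a \<in> A" for a
  proof -
    have "complex_of_real (\<Sum>q\<in>P. (cmod (u a q))\<^sup>2) = (\<Sum>q\<in>P. u a q * cnj (u a q))"
      unfolding of_real_sum by (intro sum.cong) (simp_all add: complex_norm_square del: of_real_power)
    also have "\<dots> = of_real c" using orth[OF that that] by simp
    finally show ?thesis by (simp only: of_real_eq_iff)
  qed
  have "(\<Sum>p\<in>P. \<Sum>a\<in>A. (cmod (u a p))\<^sup>2) = (\<Sum>a\<in>A. \<Sum>p\<in>P. (cmod (u a p))\<^sup>2)" by (rule sum.swap)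
  also have "\<dots> = card A * c" using norm by simp
  finally have tot: "(\<Sum>p\<in>P. \<Sum>a\<in>A. (cmod (u a p))\<^sup>2) = card A * c" .
  note le = bessel_coordinate_le(1)[OF A P _ c orth]
  have "card A * c \<le> card P * c"
    unfolding tot[symmetric] using sum_mono[of P "\<lambda>p. \<Sum>a\<in>A. (cmod (u a p))\<^sup>2" "\<lambda>_. c"] le by simp
  then show "card A \<le> card P" using c by simp
  assume eq: "card A = card P" and p: "p \<in> P"
  have "(\<Sum>p\<in>P. c - (\<Sum>a\<in>A. (cmod (u a p))\<^sup>2)) = 0" using tot eq by (simp add: sum_subtractf)
  then have "c - (\<Sum>a\<in>A. (cmod (u a p))\<^sup>2) = 0"
    using le p P by (subst (asm) sum_nonneg_eq_0_iff) auto
  then show "(\<Sum>a\<in>A. (cmod (u a p))\<^sup>2) = c" by simp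
qed

text \<open>Orthogonal vectors of equal length \<open>sqrt c\<close>, as many as there are coordinates, expand every vector: Bessel's equality expresses the coordinate vectors, hence everything.\<close>

lemma orthogonal_complete:
  fixes u :: "'a \<Rightarrow> 'p \<Rightarrow> complex"
  assumes A: "finite A" and P: "finite P" and c: "c > 0"
    and orth: "\<And>a b. a \<in> A \<Longrightarrow> b \<in> A
      \<Longrightarrow> (\<Sum>q\<in>P. u a q * cnj (u b q)) = (if a = b then of_real c else 0)"
    and card: "card A = card P" and q: "q \<in> P"
  shows "of_real c * x q = (\<Sum>a\<in>A. (\<Sum>p\<in>P. x p * cnj (u a p)) * u a q)"
proof -
  have "(\<Sum>a\<in>A. (\<Sum>p\<in>P. x p * cnj (u a p)) * u a q)
      = (\<Sum>p\<in>P. x p * (\<Sum>a\<in>A. cnj (u a p) * u a q))"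
    by (simp add: sum_distrib_left sum_distrib_right mult.assoc) (rule sum.swap)
  also have "\<dots> = (\<Sum>p\<in>P. x p * (if q = p then of_real c else 0))"
    using bessel_coordinate_le(2)[OF A P _ c orth] orthogonal_card_le(2)[OF A P c orth card] q
    by (intro sum.cong refl) simp
  also have "\<dots> = (\<Sum>p\<in>P. if p = q then of_real c * x p else 0)" by (intro sum.cong) auto
  also have "\<dots> = of_real c * x q" using q P by simp
  finally show ?thesis ..
qed

section \<open>Calculus in direct sums of L2 spaces\<close>

lemma L2_familiesD:
  assumes "f \<in> L2_families I M" "i \<in> I"
  shows "f i \<in> borel_measurable (M i)" "integrable (M i) (\<lambda>x. (cmod (f i x))\<^sup>2)"
  using assms unfolding L2_families_def by auto

lemma L2_class_self: "f \<in> L2_families I M \<Longrightarrow> f \<in> L2_class I M f"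
  unfolding L2_class_def by simp

lemma L2_rep_class: "f \<in> L2_families I M \<Longrightarrow> L2_rep (L2_class I M f) \<in> L2_class I M f"
  unfolding L2_rep_def by (rule someI[of "\<lambda>g. g \<in> L2_class I M f"]) (rule L2_class_self)

lemma L2_rep_family: "f \<in> L2_families I M \<Longrightarrow> L2_rep (L2_class I M f) \<in> L2_families I M"
  using L2_rep_class unfolding L2_class_def by blast

lemma L2_rep_AE: "f \<in> L2_families I M \<Longrightarrow> i \<in> I \<Longrightarrow> AE x in M i. L2_rep (L2_class I M f) i x = f i x"
  using L2_rep_class unfolding L2_class_def by blast

text \<open>Almost everywhere equality of families is all that matters for their classes; this is how every well-definedness question about representatives is settled.\<close>

lemma L2_class_cong:
  assumes "\<And>i. i \<in> I \<Longrightarrow> AE x in M i. f i x = g i x"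
  shows "L2_class I M f = L2_class I M g"
proof -
  have "(AE x in M i. h i x = f i x) \<longleftrightarrow> (AE x in M i. h i x = g i x)" if "i \<in> I" for i and h :: "'a \<Rightarrow> 'b \<Rightarrow> complex"
  proof
    assume "AE x in M i. h i x = f i x"
    then show "AE x in M i. h i x = g i x" using assms[OF that] by eventually_elim simp
  next
    assume "AE x in M i. h i x = g i x"
    then show "AE x in M i. h i x = f i x" using assms[OF that] by eventually_elim simp
  qed
  then show ?thesis unfolding L2_class_def by auto
qed

lemma L2_class_eqD:
  assumes "f \<in> L2_families I M" "L2_class I M f = L2_class I M g" "i \<in> I"
  shows "AE x in M i. f i x = g i x"
  using L2_class_self[OF assms(1)] assms(2,3) unfolding L2_class_def by auto

lemma L2_families_cong:
  assumes f: "f \<in> L2_families I M" and g: "\<And>i. i \<in> I \<Longrightarrow> g i \<in> borel_measurable (M i)"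
    and e: "\<And>i. i \<in> I \<Longrightarrow> AE x in M i. cmod (g i x) = cmod (f i x)"
  shows "g \<in> L2_families I M"
proof -
  have m: "(\<lambda>x. (cmod (g i x))\<^sup>2) \<in> borel_measurable (M i)"
    "(\<lambda>x. (cmod (f i x))\<^sup>2) \<in> borel_measurable (M i)"
    "AE x in M i. (cmod (g i x))\<^sup>2 = (cmod (f i x))\<^sup>2" if "i \<in> I" for i
    using g[OF that] L2_familiesD(1)[OF f that] e[OF that] by auto
  have "integrable (M i) (\<lambda>x. (cmod (g i x))\<^sup>2)" if "i \<in> I" for i
    using integrable_cong_AE[OF m[OF that]] L2_familiesD(2)[OF f that] by blast
  moreover have "(\<integral>x. (cmod (g i x))\<^sup>2 \<partial>M i) = (\<integral>x. (cmod (f i x))\<^sup>2 \<partial>M i)" if "i \<in> I" for i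
    using integral_cong_AE[OF m[OF that]] .
  ultimately show ?thesis using f g unfolding L2_families_def
    by (simp cong: summable_on_cong)
qed

lemma cmod_add_power2_le: "(cmod (a + b))\<^sup>2 \<le> 2 * (cmod a)\<^sup>2 + 2 * (cmod b)\<^sup>2"
proof -
  have "(cmod (a + b))\<^sup>2 \<le> (cmod a + cmod b)\<^sup>2" by (intro power_mono norm_triangle_ineq) simp
  also have "\<dots> \<le> 2 * (cmod a)\<^sup>2 + 2 * (cmod b)\<^sup>2"
    using sum_squares_bound[of "cmod a" "cmod b"] by (simp add: power2_sum)
  finally show ?thesis .
qed

lemma L2_families_add:
  assumes f: "f \<in> L2_families I M" and g: "g \<in> L2_families I M"
  shows "(\<lambda>i x. f i x + g i x) \<in> L2_families I M"
proof -
  note [measurable] = L2_familiesD(1)[OF f] L2_familiesD(1)[OF g]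
  note int = L2_familiesD(2)[OF f] L2_familiesD(2)[OF g]
  have i: "integrable (M i) (\<lambda>x. (cmod (f i x + g i x))\<^sup>2)" if [simp]: "i \<in> I" for i
    by (rule Bochner_Integration.integrable_bound[of _ "\<lambda>x. 2 * (cmod (f i x))\<^sup>2 + 2 * (cmod (g i x))\<^sup>2"])
       (use int cmod_add_power2_le in \<open>auto intro!: Bochner_Integration.integrable_add\<close>)
  have "(\<integral>x. (cmod (f i x + g i x))\<^sup>2 \<partial>M i)
      \<le> 2 * (\<integral>x. (cmod (f i x))\<^sup>2 \<partial>M i) + 2 * (\<integral>x. (cmod (g i x))\<^sup>2 \<partial>M i)" if "i \<in> I" for i
  proof -
    have "(\<integral>x. (cmod (f i x + g i x))\<^sup>2 \<partial>M i)
        \<le> (\<integral>x. 2 * (cmod (f i x))\<^sup>2 + 2 * (cmod (g i x))\<^sup>2 \<partial>M i)"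
      using i[OF that] int that cmod_add_power2_le by (intro integral_mono) auto
    then show ?thesis using int that by simp
  qed
  moreover have "(\<lambda>i. 2 * (\<integral>x. (cmod (f i x))\<^sup>2 \<partial>M i) + 2 * (\<integral>x. (cmod (g i x))\<^sup>2 \<partial>M i)) summable_on I"
    using f g unfolding L2_families_def by (intro summable_on_add summable_on_cmult_right) auto
  ultimately have "(\<lambda>i. \<integral>x. (cmod (f i x + g i x))\<^sup>2 \<partial>M i) summable_on I"
    by (intro summable_on_comparison_test[of _ I "\<lambda>i. \<integral>x. (cmod (f i x + g i x))\<^sup>2 \<partial>M i"]) simp_all
  then show ?thesis using i L2_familiesD(1)[OF f] L2_familiesD(1)[OF g]
    unfolding L2_families_def by simp
qed

lemma L2_families_scale:
  assumes f: "f \<in> L2_families I M"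
  shows "(\<lambda>i x. a * f i x) \<in> L2_families I M"
  using f unfolding L2_families_def
  by (auto simp: norm_mult power_mult_distrib intro!: summable_on_cmult_right)

lemma cmod_mult_cnj_le: "cmod (a * cnj b) \<le> (cmod a)\<^sup>2 + (cmod b)\<^sup>2"
proof -
  have "2 * (cmod a * cmod b) \<le> (cmod a)\<^sup>2 + (cmod b)\<^sup>2"
    using sum_squares_bound[of "cmod a" "cmod b"] by (simp add: mult.assoc)
  moreover have "0 \<le> cmod a * cmod b" by simp
  ultimately have "cmod a * cmod b \<le> (cmod a)\<^sup>2 + (cmod b)\<^sup>2" by linarith
  then show ?thesis by (simp add: norm_mult)
qed

lemma borel_measurable_cnj [measurable (raw)]:
  "f \<in> borel_measurable M \<Longrightarrow> (\<lambda>x. cnj (f x)) \<in> borel_measurable M"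
  by (rule measurable_compose[of f M borel cnj])
     (auto intro: borel_measurable_continuous_onI continuous_intros)

lemma L2_inner_integrable:
  assumes f: "f \<in> L2_families I M" and g: "g \<in> L2_families I M" and i: "i \<in> I"
  shows "integrable (M i) (\<lambda>x. f i x * cnj (g i x))"
proof -
  note [measurable] = L2_familiesD(1)[OF f i] L2_familiesD(1)[OF g i]
  have "integrable (M i) (\<lambda>x. (cmod (f i x))\<^sup>2 + (cmod (g i x))\<^sup>2)"
    using L2_familiesD(2)[OF f i] L2_familiesD(2)[OF g i] by (rule Bochner_Integration.integrable_add)
  moreover have "(\<lambda>x. f i x * cnj (g i x)) \<in> borel_measurable (M i)" by measurable
  ultimately show ?thesis
  proof (rule Bochner_Integration.integrable_bound)
    show "AE x in M i. norm (f i x * cnj (g i x)) \<le> norm ((cmod (f i x))\<^sup>2 + (cmod (g i x))\<^sup>2)"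
      by (rule AE_I2, rule order_trans[OF cmod_mult_cnj_le]) simp
  qed
qed

text \<open>The elementary bound of a product by the sum of the two squares suffices: it gives absolute
  convergence of the inner product over the index set.\<close>

lemma L2_inner_abs_summable:
  assumes f: "f \<in> L2_families I M" and g: "g \<in> L2_families I M"
  shows "(\<lambda>i. \<integral>x. cmod (f i x * cnj (g i x)) \<partial>M i) summable_on I"
    and "(\<lambda>i. norm (\<integral>x. f i x * cnj (g i x) \<partial>M i)) summable_on I"
    and "(\<lambda>i. \<integral>x. f i x * cnj (g i x) \<partial>M i) summable_on I"
proof -
  have *: "(\<integral>x. cmod (f i x * cnj (g i x)) \<partial>M i)
      \<le> (\<integral>x. (cmod (f i x))\<^sup>2 \<partial>M i) + (\<integral>x. (cmod (g i x))\<^sup>2 \<partial>M i)" if i: "i \<in> I" for i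
  proof -
    have "(\<integral>x. cmod (f i x * cnj (g i x)) \<partial>M i) \<le> (\<integral>x. (cmod (f i x))\<^sup>2 + (cmod (g i x))\<^sup>2 \<partial>M i)"
      using L2_inner_integrable[OF f g i] L2_familiesD[OF f i] L2_familiesD[OF g i]
      by (intro integral_mono integrable_norm Bochner_Integration.integrable_add cmod_mult_cnj_le) auto
    then show ?thesis using L2_familiesD(2)[OF f i] L2_familiesD(2)[OF g i] by simp
  qed
  have "(\<lambda>i. (\<integral>x. (cmod (f i x))\<^sup>2 \<partial>M i) + (\<integral>x. (cmod (g i x))\<^sup>2 \<partial>M i)) summable_on I"
    using f g unfolding L2_families_def by (intro summable_on_add) auto
  then show 1: "(\<lambda>i. \<integral>x. cmod (f i x * cnj (g i x)) \<partial>M i) summable_on I"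
    using * by (rule summable_on_comparison_test) auto
  then show 2: "(\<lambda>i. norm (\<integral>x. f i x * cnj (g i x) \<partial>M i)) summable_on I"
    by (rule summable_on_comparison_test) (auto intro: integral_norm_bound)
  then show "(\<lambda>i. \<integral>x. f i x * cnj (g i x) \<partial>M i) summable_on I" by (rule abs_summable_summable)
qed

lemma L2_sum_carrier: "F \<in> hcarrier (L2_sum I M) \<longleftrightarrow> (\<exists>f\<in>L2_families I M. F = L2_class I M f)"
  unfolding L2_sum_def by auto

lemma L2_class_in_carrier: "f \<in> L2_families I M \<Longrightarrow> L2_class I M f \<in> hcarrier (L2_sum I M)"
  unfolding L2_sum_carrier by blast

lemma L2_class_rep:
  assumes "F \<in> hcarrier (L2_sum I M)"
  shows "L2_rep F \<in> L2_families I M" and "L2_class I M (L2_rep F) = F"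
proof -
  obtain f where f: "f \<in> L2_families I M" "F = L2_class I M f" using assms L2_sum_carrier by metis
  show "L2_rep F \<in> L2_families I M" unfolding f(2) by (rule L2_rep_family[OF f(1)])
  show "L2_class I M (L2_rep F) = F" unfolding f(2) by (rule L2_class_cong) (rule L2_rep_AE[OF f(1)])
qed

lemma L2_add_class:
  assumes f: "f \<in> L2_families I M" and g: "g \<in> L2_families I M"
  shows "hadd (L2_sum I M) (L2_class I M f) (L2_class I M g) = L2_class I M (\<lambda>i x. f i x + g i x)"
proof -
  have "AE x in M i. L2_rep (L2_class I M f) i x + L2_rep (L2_class I M g) i x = f i x + g i x"
    if "i \<in> I" for i
    using L2_rep_AE[OF f that] L2_rep_AE[OF g that] by eventually_elim simp
  then show ?thesis unfolding L2_sum_def hspace.simps by (rule L2_class_cong)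
qed

lemma L2_scale_class:
  assumes f: "f \<in> L2_families I M"
  shows "hscale (L2_sum I M) a (L2_class I M f) = L2_class I M (\<lambda>i x. a * f i x)"
proof -
  have "AE x in M i. a * L2_rep (L2_class I M f) i x = a * f i x" if "i \<in> I" for i
    using L2_rep_AE[OF f that] by eventually_elim simp
  then show ?thesis unfolding L2_sum_def hspace.simps by (rule L2_class_cong)
qed

lemma L2_zero_class: "hzero (L2_sum I M) = L2_class I M (\<lambda>i x. 0)"
  unfolding L2_sum_def by simp

lemma L2_inner_class:
  assumes f: "f \<in> L2_families I M" and g: "g \<in> L2_families I M"
  shows "hinner (L2_sum I M) (L2_class I M f) (L2_class I M g)
    = (\<Sum>\<^sub>\<infinity>i\<in>I. \<integral>x. f i x * cnj (g i x) \<partial>M i)"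
proof -
  have "(\<integral>x. L2_rep (L2_class I M f) i x * cnj (L2_rep (L2_class I M g) i x) \<partial>M i)
      = (\<integral>x. f i x * cnj (g i x) \<partial>M i)" if i: "i \<in> I" for i
  proof (rule integral_cong_AE)
    note [measurable] = L2_familiesD(1)[OF f i] L2_familiesD(1)[OF g i]
      L2_familiesD(1)[OF L2_rep_family[OF f] i] L2_familiesD(1)[OF L2_rep_family[OF g] i]
    show "(\<lambda>x. L2_rep (L2_class I M f) i x * cnj (L2_rep (L2_class I M g) i x)) \<in> borel_measurable (M i)"
      "(\<lambda>x. f i x * cnj (g i x)) \<in> borel_measurable (M i)" by measurable
    show "AE x in M i. L2_rep (L2_class I M f) i x * cnj (L2_rep (L2_class I M g) i x) = f i x * cnj (g i x)"
      using L2_rep_AE[OF f i] L2_rep_AE[OF g i] by eventually_elim simp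
  qed
  then show ?thesis unfolding L2_sum_def by (simp cong: infsum_cong)
qed

lemma L2_sum_closed:
  assumes F: "F \<in> hcarrier (L2_sum I M)"
  shows "G \<in> hcarrier (L2_sum I M) \<Longrightarrow> hadd (L2_sum I M) F G \<in> hcarrier (L2_sum I M)"
    and "hscale (L2_sum I M) a F \<in> hcarrier (L2_sum I M)"
proof -
  note f = L2_class_rep[OF F]
  show "hadd (L2_sum I M) F G \<in> hcarrier (L2_sum I M)" if "G \<in> hcarrier (L2_sum I M)"
    using L2_add_class[OF f(1) L2_class_rep(1)[OF that]] f(2) L2_class_rep[OF that]
      L2_class_in_carrier[OF L2_families_add[OF f(1) L2_class_rep(1)[OF that]]] by simp
  show "hscale (L2_sum I M) a F \<in> hcarrier (L2_sum I M)"
    using L2_scale_class[OF f(1), of a] f(2) L2_class_in_carrier[OF L2_families_scale[OF f(1)], of a] by simp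
qed

lemma L2_scale_zero:
  assumes F: "F \<in> hcarrier (L2_sum I M)"
  shows "hscale (L2_sum I M) 0 F = hzero (L2_sum I M)"
  using L2_scale_class[OF L2_class_rep(1)[OF F], of 0] L2_class_rep(2)[OF F] by (simp add: L2_zero_class)

lemma L2_inner_infsum_real:
  assumes f: "f \<in> L2_families I M"
  shows "(\<Sum>\<^sub>\<infinity>i\<in>I. \<integral>x. f i x * cnj (f i x) \<partial>M i) = of_real (\<Sum>\<^sub>\<infinity>i\<in>I. \<integral>x. (cmod (f i x))\<^sup>2 \<partial>M i)"
proof -
  have "(\<integral>x. f i x * cnj (f i x) \<partial>M i) = of_real (\<integral>x. (cmod (f i x))\<^sup>2 \<partial>M i)" for i
    unfolding integral_complex_of_real[symmetric] by (simp only: complex_norm_square)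
  moreover have "(\<lambda>i. \<integral>x. (cmod (f i x))\<^sup>2 \<partial>M i) summable_on I"
    using f unfolding L2_families_def by blast
  then have "((\<lambda>i. complex_of_real (\<integral>x. (cmod (f i x))\<^sup>2 \<partial>M i)) has_sum
      of_real (\<Sum>\<^sub>\<infinity>i\<in>I. \<integral>x. (cmod (f i x))\<^sup>2 \<partial>M i)) I"
    unfolding has_sum_of_real_iff by (rule has_sum_infsum)
  ultimately show ?thesis by (simp add: infsumI)
qed

text \<open>A vanishing sum of nonnegative integrals forces every integral, and hence every square, to vanish almost everywhere.\<close>

lemma L2_definite:
  assumes f: "f \<in> L2_families I M" and g: "g \<in> L2_families I M"
    and e: "(\<Sum>\<^sub>\<infinity>i\<in>I. \<integral>x. (f i x - g i x) * cnj (f i x - g i x) \<partial>M i) = 0"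
  shows "L2_class I M f = L2_class I M g"
proof (rule L2_class_cong)
  fix i assume i: "i \<in> I"
  define h where "h i x = f i x - g i x" for i x
  have "h = (\<lambda>i x. f i x + (-1) * g i x)" unfolding h_def by (intro ext) simp
  then have h: "h \<in> L2_families I M" using L2_families_add[OF f L2_families_scale[OF g, of "-1"]] by simp
  have "complex_of_real (\<Sum>\<^sub>\<infinity>i\<in>I. \<integral>x. (cmod (h i x))\<^sup>2 \<partial>M i) = 0"
    unfolding L2_inner_infsum_real[OF h, symmetric] using e unfolding h_def .
  then have "(\<Sum>\<^sub>\<infinity>i\<in>I. \<integral>x. (cmod (h i x))\<^sup>2 \<partial>M i) \<le> 0" by simp
  then have "(\<integral>x. (cmod (h i x))\<^sup>2 \<partial>M i) = 0"
    using h i unfolding L2_families_def by (intro nonneg_infsum_le_0D[of _ I]) auto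
  then have "AE x in M i. (cmod (h i x))\<^sup>2 = 0"
    using L2_familiesD(2)[OF h i] by (subst (asm) integral_nonneg_eq_0_iff_AE) auto
  then show "AE x in M i. f i x = g i x" unfolding h_def by eventually_elim simp
qed

section \<open>Extending characters from a subgroup of finite index\<close>

primrec nmult :: "nat \<Rightarrow> 'g :: ab_group_add \<Rightarrow> 'g" where
  "nmult 0 x = 0"
| "nmult (Suc k) x = x + nmult k x"

lemma nmult_add: "nmult (k + l) x = nmult k x + nmult l x"
  by (induction k) (simp_all add: add.assoc)

lemma nmult_mult: "nmult (k * l) x = nmult k (nmult l x)"
  by (induction k) (simp_all add: nmult_add)

definition add_subgroup :: "'g :: ab_group_add set \<Rightarrow> bool" where
  "add_subgroup B \<longleftrightarrow> 0 \<in> B \<and> (\<forall>x\<in>B. \<forall>y\<in>B. x + y \<in> B) \<and> (\<forall>x\<in>B. - x \<in> B)"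

lemma add_subgroupD:
  assumes "add_subgroup B"
  shows "0 \<in> B" and "x \<in> B \<Longrightarrow> y \<in> B \<Longrightarrow> x + y \<in> B" and "x \<in> B \<Longrightarrow> - x \<in> B"
    and "x \<in> B \<Longrightarrow> y \<in> B \<Longrightarrow> x - y \<in> B" and "x \<in> B \<Longrightarrow> nmult k x \<in> B"
proof -
  show 1: "0 \<in> B" "x \<in> B \<Longrightarrow> y \<in> B \<Longrightarrow> x + y \<in> B" "x \<in> B \<Longrightarrow> - x \<in> B" for x y
    using assms unfolding add_subgroup_def by auto
  show "x \<in> B \<Longrightarrow> y \<in> B \<Longrightarrow> x - y \<in> B" using 1(2)[of x "- y"] 1(3)[of y] by simp
  show "x \<in> B \<Longrightarrow> nmult k x \<in> B" by (induction k) (auto intro: 1)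
qed

text \<open>The index of a subgroup is measured by a set of coset representatives, because these can be regrouped when the subgroup is enlarged.\<close>

definition transversal :: "'g :: ab_group_add set \<Rightarrow> 'g set \<Rightarrow> bool" where
  "transversal R B \<longleftrightarrow> (\<forall>\<gamma>. \<exists>!r. r \<in> R \<and> \<gamma> - r \<in> B)"

definition character_on :: "'g :: ab_group_add set \<Rightarrow> 'g character \<Rightarrow> bool" where
  "character_on B \<theta> \<longleftrightarrow> (\<forall>x\<in>B. \<forall>y\<in>B. \<theta> (x + y) = \<theta> x * \<theta> y) \<and> (\<forall>x\<in>B. cmod (\<theta> x) = 1)"

definition char_extensions :: "'g :: ab_group_add set \<Rightarrow> 'g character \<Rightarrow> 'g character set" where
  "char_extensions B \<theta> = {\<omega> \<in> dual_group. \<forall>b\<in>B. \<omega> b = \<theta> b}"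

lemma dual_groupD:
  assumes "\<omega> \<in> dual_group"
  shows "\<omega> (\<gamma> + \<gamma>') = \<omega> \<gamma> * \<omega> \<gamma>'" and "cmod (\<omega> \<gamma>) = 1" and "\<omega> \<gamma> \<noteq> 0" and "\<omega> 0 = 1"
    and "\<omega> (- \<gamma>) = cnj (\<omega> \<gamma>)" and "\<omega> \<gamma> * cnj (\<omega> \<gamma>) = 1"
proof -
  show add: "\<omega> (\<gamma> + \<gamma>') = \<omega> \<gamma> * \<omega> \<gamma>'" and norm: "cmod (\<omega> \<gamma>) = 1" for \<gamma> \<gamma>'
    using assms unfolding dual_group_def by auto
  show nz: "\<omega> \<gamma> \<noteq> 0" for \<gamma> using norm[of \<gamma>] by auto
  have "\<omega> 0 * \<omega> 0 = \<omega> 0" using add[of 0 0] by simp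
  then show z: "\<omega> 0 = 1" using nz[of 0] by simp
  show u: "\<omega> \<gamma> * cnj (\<omega> \<gamma>) = 1" for \<gamma> using norm[of \<gamma>] by (simp add: complex_norm_square[symmetric])
  have "\<omega> \<gamma> * \<omega> (- \<gamma>) = \<omega> \<gamma> * cnj (\<omega> \<gamma>)" using add[of \<gamma> "- \<gamma>"] z u by simp
  then show "\<omega> (- \<gamma>) = cnj (\<omega> \<gamma>)" using nz[of \<gamma>] by simp
qed

lemma dual_group_nmult: "\<omega> \<in> dual_group \<Longrightarrow> \<omega> (nmult k x) = \<omega> x ^ k"
  by (induction k) (simp_all add: dual_groupD)

lemma character_on_nmult:
  assumes "character_on B \<theta>" "add_subgroup B" "x \<in> B"
  shows "\<theta> (nmult k x) = \<theta> x ^ k"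
proof (induction k)
  case 0
  have "\<theta> 0 * \<theta> 0 = \<theta> (0 + 0)" "cmod (\<theta> 0) = 1"
    using assms add_subgroupD(1)[OF assms(2)] unfolding character_on_def by metis+
  then have "\<theta> 0 * \<theta> 0 = \<theta> 0" "\<theta> 0 \<noteq> 0" by auto
  then show ?case by simp
next
  case (Suc k)
  have "\<theta> (x + nmult k x) = \<theta> x * \<theta> (nmult k x)"
    using assms add_subgroupD(5)[OF assms(2,3)] unfolding character_on_def by blast
  then show ?case using Suc by simp
qed

text \<open>One step of the extension: adjoin \<open>x\<close>, whose multiples first return to \<open>B\<close> at \<open>n\<close>.  A value
  \<open>z\<close> at \<open>x\<close> is admissible exactly if \<open>z\<close> is an \<open>n\<close>-th root of the prescribed value at \<open>n x\<close>.\<close>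

context
  fixes B :: "'g :: ab_group_add set" and x :: 'g and n :: nat
  assumes B: "add_subgroup B" and n: "0 < n" and nx: "nmult n x \<in> B"
    and least: "\<And>k. 0 < k \<Longrightarrow> nmult k x \<in> B \<Longrightarrow> n \<le> k"
begin

definition adjoin :: "'g set" where
  "adjoin = {b + nmult k x | b k. b \<in> B}"

lemma nmult_in_iff: "nmult k x \<in> B \<longleftrightarrow> n dvd k"
proof
  assume k: "nmult k x \<in> B"
  have "nmult k x = nmult (k div n) (nmult n x) + nmult (k mod n) x"
    by (simp only: nmult_mult[symmetric] nmult_add[symmetric] div_mult_mod_eq)
  then have "nmult (k mod n) x = nmult k x - nmult (k div n) (nmult n x)" by simp
  then have "nmult (k mod n) x \<in> B" using k nx add_subgroupD[OF B] by simp
  then have "k mod n = 0" using least[of "k mod n"] n by (metis gr0I mod_less_divisor not_le)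
  then show "n dvd k" by auto
next
  assume "n dvd k"
  then obtain q where "k = q * n" by (metis dvd_div_mult_self)
  then show "nmult k x \<in> B" using nx add_subgroupD[OF B] by (simp add: nmult_mult)
qed

lemma adjoinI: "b \<in> B \<Longrightarrow> b + nmult k x \<in> adjoin"
  unfolding adjoin_def by blast

lemma adjoinE:
  assumes "y \<in> adjoin" obtains b k where "b \<in> B" "k < n" "y = b + nmult k x"
proof -
  obtain b k where b: "b \<in> B" "y = b + nmult k x" using assms unfolding adjoin_def by blast
  have "nmult k x = nmult (k div n) (nmult n x) + nmult (k mod n) x"
    by (simp only: nmult_mult[symmetric] nmult_add[symmetric] div_mult_mod_eq)
  then have "y = (b + nmult (k div n) (nmult n x)) + nmult (k mod n) x"
    using b(2) by (simp add: add.assoc)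
  moreover have "b + nmult (k div n) (nmult n x) \<in> B" using b(1) nx add_subgroupD[OF B] by simp
  ultimately show ?thesis using that[of _ "k mod n"] n by simp
qed

lemma adjoinD: "y \<in> adjoin \<Longrightarrow> \<exists>b k. b \<in> B \<and> y = b + nmult k x"
  unfolding adjoin_def by blast

lemma adjoin_subset: "B \<subseteq> adjoin"
  using adjoinI[of _ 0] by auto

lemma adjoin_subgroup: "add_subgroup adjoin"
  unfolding add_subgroup_def
proof (intro conjI ballI)
  show "0 \<in> adjoin" using adjoin_subset add_subgroupD(1)[OF B] by blast
  show "y + y' \<in> adjoin" if yA: "y \<in> adjoin" "y' \<in> adjoin" for y y'
  proof -
    obtain b k b' k' where "b \<in> B" "y = b + nmult k x" "b' \<in> B" "y' = b' + nmult k' x"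
      using yA adjoinD by metis
    then have "y + y' = (b + b') + nmult (k + k') x" "b + b' \<in> B"
      using add_subgroupD[OF B] by (auto simp: nmult_add algebra_simps)
    then show ?thesis using adjoinI by metis
  qed
  show "- y \<in> adjoin" if "y \<in> adjoin" for y
  proof -
    obtain b k where b: "b \<in> B" "k < n" "y = b + nmult k x" using \<open>y \<in> adjoin\<close> by (rule adjoinE)
    have "nmult (n - k) x + nmult k x = nmult n x" using b(2) by (simp flip: nmult_add)
    then have "- y = (- b - nmult n x) + nmult (n - k) x" using b(3) by (simp add: algebra_simps)
    moreover have "- b - nmult n x \<in> B" using b(1) nx add_subgroupD[OF B] by blast
    ultimately show ?thesis using adjoinI by metis
  qed
qed

text \<open>Every representation of \<open>y\<close> as \<open>b + k x\<close> gives the same value if \<open>z\<close> is an admissible value at \<open>x\<close>, so the choice is harmless.\<close>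

definition adjoin_char :: "'g character \<Rightarrow> complex \<Rightarrow> 'g character" where
  "adjoin_char \<theta> z y = (SOME v. \<exists>b\<in>B. \<exists>k. y = b + nmult k x \<and> v = \<theta> b * z ^ k)"

text \<open>Two representations of one element differ by a multiple of \<open>n x\<close>, where the values of \<open>z ^ n\<close> and of \<open>\<theta>\<close> agree.\<close>

lemma adjoin_char_wd:
  assumes \<theta>: "character_on B \<theta>" and z: "z ^ n = \<theta> (nmult n x)"
    and b: "b \<in> B" "b' \<in> B" "b + nmult k x = b' + nmult k' x" and le: "k \<le> k'"
  shows "\<theta> b * z ^ k = \<theta> b' * z ^ k'"
proof -
  have "nmult k' x = nmult (k' - k) x + nmult k x" using le by (simp flip: nmult_add)
  then have d: "nmult (k' - k) x = b - b'" using b(3) by (simp add: algebra_simps)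
  then have "n dvd k' - k" using add_subgroupD(4)[OF B b(1,2)] nmult_in_iff by metis
  then obtain q where q: "k' - k = q * n" by (metis dvd_div_mult_self)
  have "b = b' + nmult q (nmult n x)" using d unfolding q nmult_mult by simp
  then have "\<theta> b = \<theta> b' * \<theta> (nmult q (nmult n x))"
    using \<theta> b(2) add_subgroupD(5)[OF B nx] unfolding character_on_def by metis
  also have "\<theta> (nmult q (nmult n x)) = z ^ (k' - k)"
    using character_on_nmult[OF \<theta> B nx] z unfolding q by (simp add: power_mult mult.commute)
  finally show ?thesis using le by (simp add: mult.assoc flip: power_add)
qed

lemma adjoin_char:
  assumes \<theta>: "character_on B \<theta>" and z: "z ^ n = \<theta> (nmult n x)" and b: "b \<in> B"
  shows "adjoin_char \<theta> z (b + nmult k x) = \<theta> b * z ^ k"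
proof -
  have "\<exists>v. \<exists>b'\<in>B. \<exists>k'. b + nmult k x = b' + nmult k' x \<and> v = \<theta> b' * z ^ k'" using b by blast
  from someI_ex[OF this] obtain b' k' where b': "b' \<in> B" "b + nmult k x = b' + nmult k' x"
    "adjoin_char \<theta> z (b + nmult k x) = \<theta> b' * z ^ k'" unfolding adjoin_char_def by blast
  show ?thesis
    using adjoin_char_wd[OF \<theta> z b b'(1,2)] adjoin_char_wd[OF \<theta> z b'(1) b b'(2)[symmetric]] b'(3)
    by (metis nat_le_linear)
qed

lemma adjoin_char_character:
  assumes \<theta>: "character_on B \<theta>" and z: "z ^ n = \<theta> (nmult n x)"
  shows "character_on adjoin (adjoin_char \<theta> z)"
proof -
  have "cmod z ^ n = 1" using z \<theta> nx unfolding character_on_def by (metis norm_power)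
  then have nz: "cmod z = 1" using n power_eq_imp_eq_base[of "cmod z" n 1] by simp
  show ?thesis unfolding character_on_def
  proof (intro conjI ballI)
    fix y y' assume "y \<in> adjoin" "y' \<in> adjoin"
    then obtain b k b' k' where b: "b \<in> B" "y = b + nmult k x" "b' \<in> B" "y' = b' + nmult k' x"
      using adjoinD by metis
    have "y + y' = (b + b') + nmult (k + k') x" using b by (simp add: nmult_add algebra_simps)
    then have "adjoin_char \<theta> z (y + y') = \<theta> (b + b') * z ^ (k + k')"
      using adjoin_char[OF \<theta> z] add_subgroupD(2)[OF B b(1,3)] by simp
    also have "\<theta> (b + b') = \<theta> b * \<theta> b'" using \<theta> b unfolding character_on_def by blast
    finally show "adjoin_char \<theta> z (y + y') = adjoin_char \<theta> z y * adjoin_char \<theta> z y'"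
      using adjoin_char[OF \<theta> z] b by (simp add: power_add)
  next
    fix y assume "y \<in> adjoin"
    then obtain b k where b: "b \<in> B" "y = b + nmult k x" using adjoinD by metis
    then show "cmod (adjoin_char \<theta> z y) = 1"
      using adjoin_char[OF \<theta> z b(1)] nz \<theta> unfolding character_on_def
      by (simp add: norm_mult norm_power)
  qed
qed

lemma char_extensions_adjoin:
  assumes \<theta>: "character_on B \<theta>"
  shows "char_extensions B \<theta>
    = (\<Union>z\<in>{z. z ^ n = \<theta> (nmult n x)}. char_extensions adjoin (adjoin_char \<theta> z))"
proof (intro equalityI subsetI)
  fix \<omega> assume "\<omega> \<in> char_extensions B \<theta>"
  then have \<omega>: "\<omega> \<in> dual_group" "\<And>b. b \<in> B \<Longrightarrow> \<omega> b = \<theta> b" unfolding char_extensions_def by auto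
  have z: "\<omega> x ^ n = \<theta> (nmult n x)" using \<omega>(2)[OF nx] dual_group_nmult[OF \<omega>(1)] by simp
  have "\<omega> y = adjoin_char \<theta> (\<omega> x) y" if yA: "y \<in> adjoin" for y
  proof -
    obtain b k where b: "b \<in> B" "y = b + nmult k x" using yA adjoinD by metis
    then show ?thesis
      using adjoin_char[OF \<theta> z b(1)] \<omega>(2)[OF b(1)] dual_groupD(1)[OF \<omega>(1)] dual_group_nmult[OF \<omega>(1)]
      by simp
  qed
  then have "\<omega> \<in> char_extensions adjoin (adjoin_char \<theta> (\<omega> x))"
    using \<omega>(1) unfolding char_extensions_def by simp
  then show "\<omega> \<in> (\<Union>z\<in>{z. z ^ n = \<theta> (nmult n x)}. char_extensions adjoin (adjoin_char \<theta> z))"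
    using z by blast
next
  fix \<omega> assume "\<omega> \<in> (\<Union>z\<in>{z. z ^ n = \<theta> (nmult n x)}. char_extensions adjoin (adjoin_char \<theta> z))"
  then obtain z where z: "z ^ n = \<theta> (nmult n x)" and \<omega>: "\<omega> \<in> char_extensions adjoin (adjoin_char \<theta> z)"
    by blast
  have "\<omega> b = \<theta> b" if "b \<in> B" for b
    using \<omega> adjoin_char[OF \<theta> z that, of 0] adjoin_subset that unfolding char_extensions_def by auto
  then show "\<omega> \<in> char_extensions B \<theta>" using \<omega> unfolding char_extensions_def by simp
qed

lemma char_extensions_adjoin_value:
  assumes \<theta>: "character_on B \<theta>" and z: "z ^ n = \<theta> (nmult n x)"
    and \<omega>: "\<omega> \<in> char_extensions adjoin (adjoin_char \<theta> z)"
  shows "\<omega> x = z"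
proof -
  have "\<theta> (nmult 0 (nmult n x)) = 1" using character_on_nmult[OF \<theta> B nx, of 0] by simp
  then have "adjoin_char \<theta> z (0 + nmult 1 x) = z"
    using adjoin_char[OF \<theta> z add_subgroupD(1)[OF B], of 1] by simp
  moreover have "0 + nmult 1 x \<in> adjoin" by (rule adjoinI[OF add_subgroupD(1)[OF B]])
  ultimately show ?thesis using \<omega> unfolding char_extensions_def by auto
qed

text \<open>Multiplicativity of the index: the translates of a transversal of the larger group by \<open>0, x, \<dots>, (n - 1) x\<close> form a transversal of \<open>B\<close>.\<close>

lemma transversal_adjoin:
  assumes fin: "finite R" and R: "transversal R B"
  shows "\<exists>R'. finite R' \<and> transversal R' adjoin \<and> card R = n * card R'"
proof -
  note A = add_subgroupD[OF adjoin_subgroup]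
  define f where "f r = (SOME r'. r' \<in> R \<and> r - r' \<in> adjoin)" for r
  have f: "f r \<in> R \<and> r - f r \<in> adjoin" if "r \<in> R" for r
    unfolding f_def by (rule someI[of _ r]) (use that A(1) in simp)
  have feq: "f r = f s" if "r - s \<in> adjoin" for r s
  proof -
    have "(r - r' \<in> adjoin) = (s - r' \<in> adjoin)" for r'
      using A(4)[of "r - r'" "r - s"] A(2)[of "r - s" "s - r'"] that by (auto simp: algebra_simps)
    then show ?thesis unfolding f_def by simp
  qed
  define R' where "R' = f ` R"
  have fin': "finite R'" unfolding R'_def using fin by simp
  have T': "\<exists>!r. r \<in> R' \<and> \<gamma> - r \<in> adjoin" for \<gamma>
  proof -
    obtain r where r: "r \<in> R" "\<gamma> - r \<in> B" using R unfolding transversal_def by blast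
    have "\<gamma> - f r = (\<gamma> - r) + (r - f r)" by simp
    then have "\<gamma> - f r \<in> adjoin" using A(2) f[OF r(1)] r(2) adjoin_subset by (metis subsetD)
    moreover have "s = f r" if s: "s \<in> R'" "\<gamma> - s \<in> adjoin" for s
    proof -
      obtain t where t: "t \<in> R" "s = f t" using s(1) unfolding R'_def by blast
      have "r - t = (r - f r) - (t - f t) + (\<gamma> - s) - (\<gamma> - f r)" using t(2) by simp
      then have "r - t \<in> adjoin"
        using f[OF r(1)] f[OF t(1)] s(2) \<open>\<gamma> - f r \<in> adjoin\<close> A(2,4) by metis
      then show ?thesis using feq t(2) by metis
    qed
    ultimately show ?thesis using r(1) R'_def by (intro ex1I[of _ "f r"]) auto
  qed
  have uniq: "r = s" if "r \<in> R" "s \<in> R" "\<gamma> - r \<in> B" "\<gamma> - s \<in> B" for r s \<gamma>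
    using R that unfolding transversal_def by metis
  have uniq': "r = s" if "r \<in> R'" "s \<in> R'" "\<gamma> - r \<in> adjoin" "\<gamma> - s \<in> adjoin" for r s \<gamma>
    using T' that by metis
  \<comment> \<open>The representative in \<open>R\<close> of the coset of \<open>r' + k x\<close>; this map is the bijection that compares the two transversals.\<close>
  define g where "g = (\<lambda>(k, r'). THE r. r \<in> R \<and> (r' + nmult k x) - r \<in> B)"
  have g: "g (k, r') \<in> R \<and> (r' + nmult k x) - g (k, r') \<in> B" for k r'
    unfolding g_def using theI'[of "\<lambda>r. r \<in> R \<and> (r' + nmult k x) - r \<in> B"] R
    unfolding transversal_def by simp
  have g_eq: "g (k, r') = r" if "r \<in> R" "(r' + nmult k x) - r \<in> B" for k r' r
    using uniq[OF _ that(1) _ that(2)] g[of k r'] by metis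
  have "inj_on g ({..<n} \<times> R')"
  proof (rule inj_onI, clarify)
    fix k r k' r' assume k: "k < n" "k' < n" and r: "r \<in> R'" "r' \<in> R'" and e: "g (k, r) = g (k', r')"
    have d: "(r + nmult k x) - (r' + nmult k' x) \<in> B"
      using g[of k r] g[of k' r'] e add_subgroupD(4)[OF B, of "(r + nmult k x) - g (k, r)" "(r' + nmult k' x) - g (k, r)"]
      by simp
    have "r - r' = ((r + nmult k x) - (r' + nmult k' x)) + ((0 + nmult k' x) - (0 + nmult k x))" by simp
    then have "r - r' \<in> adjoin"
      using d adjoin_subset adjoinI[OF add_subgroupD(1)[OF B]] A(2,4) by (metis subsetD)
    then have rr: "r = r'" using uniq'[OF r, of r] A(1) by simp
    have kkeq: "k = k'" if kk: "k \<le> k'" "k' < n" "nmult k x - nmult k' x \<in> B \<or> nmult k' x - nmult k x \<in> B" for k k'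
    proof -
      have "nmult k' x = nmult (k' - k) x + nmult k x" using kk(1) by (simp flip: nmult_add)
      moreover have "nmult k' x - nmult k x \<in> B" using kk(3) add_subgroupD(3)[OF B] by (metis minus_diff_eq)
      ultimately have dv: "n dvd k' - k" using nmult_in_iff by simp
      have "\<not> 0 < k' - k" using dvd_imp_le[OF dv] kk(2) by linarith
      then show ?thesis using kk(1) by simp
    qed
    have d': "nmult k x - nmult k' x \<in> B" using d unfolding rr by simp
    show "k = k' \<and> r = r'"
    proof (cases "k \<le> k'")
      case True
      then show ?thesis using kkeq[OF True k(2)] d' rr by simp
    next
      case False
      then show ?thesis using kkeq[of k' k] k(1) d' rr by simp
    qed
  qed
  moreover have "g ` ({..<n} \<times> R') = R"
  proof (intro equalityI subsetI)
    fix r assume r: "r \<in> R"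
    obtain r' where r': "r' \<in> R'" "r - r' \<in> adjoin" using T' by metis
    obtain b k where b: "b \<in> B" "k < n" "r - r' = b + nmult k x" using adjoinE[OF r'(2)] .
    have "(r' + nmult k x) - r = - b" using b(3) by (simp add: algebra_simps)
    then have "g (k, r') = r" using g_eq[OF r] b(1) add_subgroupD(3)[OF B] by simp
    then show "r \<in> g ` ({..<n} \<times> R')"
      using b(2) r'(1) by (intro image_eqI[of _ _ "(k, r')"]) simp_all
  qed (use g in auto)
  ultimately have "card R = card ({..<n} \<times> R')" using card_image[of g "{..<n} \<times> R'"] by simp
  then show ?thesis using fin' T' unfolding transversal_def by (intro exI[of _ R']) (auto simp: card_cartesian_product)
qed

end

text \<open>A character of a subgroup of finite index has as many extensions to the whole group as the index says.  Induction on the index: adjoining one element \<open>x\<close> of relative order \<open>n\<close> divides the index by \<open>n\<close>, and there are exactly \<open>n\<close> admissible values at \<open>x\<close>.\<close>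

lemma char_extensions_card:
  fixes B :: "'g :: ab_group_add set"
  assumes "finite R" "transversal R B" "add_subgroup B" "character_on B \<theta>"
  shows "finite (char_extensions B \<theta>) \<and> card (char_extensions B \<theta>) = card R"
  using assms
proof (induction "card R" arbitrary: R B \<theta> rule: less_induct)
  case less
  note fin = less.prems(1) and R = less.prems(2) and B = less.prems(3) and \<theta> = less.prems(4)
  show ?case
  proof (cases "B = UNIV")
    case True
    have "char_extensions B \<theta> = {\<theta>}"
      using \<theta> unfolding True char_extensions_def dual_group_def character_on_def by auto
    moreover obtain r where "R = {r}"
    proof -
      have "\<exists>!r. r \<in> R" using R unfolding transversal_def True by simp
      then show ?thesis using that by auto
    qed
    ultimately show ?thesis by simp
  next
    case False
    then obtain x where x: "x \<notin> B" by blast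
    have "\<exists>k>0. nmult k x \<in> B"
    proof -
      \<comment> \<open>Finitely many cosets, so two multiples of \<open>x\<close> lie in the same one.\<close>
      define f where "f k = (THE r. r \<in> R \<and> nmult k x - r \<in> B)" for k
      have f: "f k \<in> R \<and> nmult k x - f k \<in> B" for k
        unfolding f_def using theI'[of "\<lambda>r. r \<in> R \<and> nmult k x - r \<in> B"] R
        unfolding transversal_def by simp
      have "\<not> inj f"
      proof
        assume "inj f"
        then have "finite (UNIV :: nat set)" using finite_subset[of "range f" R] f fin
          by (meson finite_imageD image_subsetI)
        then show False by simp
      qed
      then obtain i j where "i \<noteq> j" "f i = f j" unfolding inj_def by blast
      then obtain i j where ij: "i < j" "f i = f j" by (metis linorder_neqE_nat)
      have "nmult j x = nmult (j - i) x + nmult i x" using ij(1) by (simp flip: nmult_add)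
      then have "nmult (j - i) x = (nmult j x - f j) - (nmult i x - f i)" using ij(2) by simp
      then have "nmult (j - i) x \<in> B" using f add_subgroupD(4)[OF B] by metis
      then show ?thesis using ij(1) by (intro exI[of _ "j - i"]) simp
    qed
    define n where "n = (LEAST k. 0 < k \<and> nmult k x \<in> B)"
    have n: "0 < n" "nmult n x \<in> B"
      using LeastI_ex[OF \<open>\<exists>k>0. nmult k x \<in> B\<close>] unfolding n_def by auto
    have least: "\<And>k. 0 < k \<Longrightarrow> nmult k x \<in> B \<Longrightarrow> n \<le> k" unfolding n_def by (simp add: Least_le)
    have "n \<noteq> 1" using n(2) x by auto
    then have n2: "2 \<le> n" using n(1) by simp
    note ctx = B n(1,2) least
    let ?A = "adjoin B x" and ?c = "adjoin_char B x \<theta>"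
    obtain R' where R': "finite R'" "transversal R' ?A" "card R = n * card R'"
      using transversal_adjoin[OF ctx fin R] by blast
    have "R' \<noteq> {}" using R'(2) unfolding transversal_def by blast
    then have "card R' > 0" using R'(1) by (simp add: card_gt_0_iff)
    then have lt: "card R' < card R" using R'(3) n2 by simp
    let ?Z = "{z. z ^ n = \<theta> (nmult n x)}"
    have E: "finite (char_extensions ?A (?c z)) \<and> card (char_extensions ?A (?c z)) = card R'" if "z \<in> ?Z" for z
      using less.hyps[OF lt R'(1,2) adjoin_subgroup[OF ctx] adjoin_char_character[OF ctx \<theta>]] that by simp
    have nz: "\<theta> (nmult n x) \<noteq> 0" using \<theta> n(2) unfolding character_on_def by force
    have Z: "card ?Z = n" using card_nth_roots[OF nz n(1)] .
    then have finZ: "finite ?Z" using n(1) card_ge_0_finite by metis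
    have "card (\<Union>z\<in>?Z. char_extensions ?A (?c z)) = (\<Sum>z\<in>?Z. card (char_extensions ?A (?c z)))"
    proof (rule card_UN_disjoint[OF finZ])
      show "\<forall>z\<in>?Z. finite (char_extensions ?A (?c z))" using E by blast
      show "\<forall>z\<in>?Z. \<forall>w\<in>?Z. z \<noteq> w \<longrightarrow> char_extensions ?A (?c z) \<inter> char_extensions ?A (?c w) = {}"
        using char_extensions_adjoin_value[OF ctx \<theta>] by blast
    qed
    also have "\<dots> = card R" using E Z R'(3) by simp
    finally have c: "card (\<Union>z\<in>?Z. char_extensions ?A (?c z)) = card R" .
    have "char_extensions B \<theta> = (\<Union>z\<in>?Z. char_extensions ?A (?c z))"
      by (rule char_extensions_adjoin[OF ctx \<theta>])
    moreover have "finite (\<Union>z\<in>?Z. char_extensions ?A (?c z))" using finZ E by (intro finite_UN_I) auto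
    ultimately show ?thesis using c by simp
  qed
qed

text \<open>The kernel of the dual endomorphism consists of the extensions of the trivial character of the image.\<close>

lemma dual_ker_card:
  assumes \<alpha>: "admissible_endo \<alpha>"
  shows "finite (dual_ker \<alpha>)" and "card (dual_ker \<alpha>) = image_index \<alpha>"
proof -
  have hom: "\<And>x y. \<alpha> (x + y) = \<alpha> x + \<alpha> y" and idx: "image_index \<alpha> > 1"
    using \<alpha> unfolding admissible_endo_def by auto
  have \<alpha>0: "\<alpha> 0 = 0" using hom[of 0 0] by simp
  have \<alpha>m: "\<alpha> (- x) = - \<alpha> x" for x using hom[of x "- x"] \<alpha>0 by (simp add: eq_neg_iff_add_eq_0 add.commute)
  let ?B = "range \<alpha>"
  have B: "add_subgroup ?B"
    unfolding add_subgroup_def by (auto simp flip: hom \<alpha>m intro: range_eqI[of _ _ 0] simp: \<alpha>0)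
  define coset where "coset \<gamma> = (\<lambda>x. \<gamma> + \<alpha> x) ` UNIV" for \<gamma>
  have mem: "\<gamma>' \<in> coset \<gamma> \<longleftrightarrow> \<gamma>' - \<gamma> \<in> ?B" for \<gamma> \<gamma>'
  proof -
    have "\<gamma>' \<in> coset \<gamma> \<longleftrightarrow> (\<exists>x. \<gamma>' = \<gamma> + \<alpha> x)" unfolding coset_def by auto
    also have "\<dots> \<longleftrightarrow> (\<exists>x. \<gamma>' - \<gamma> = \<alpha> x)" by (simp add: diff_eq_eq add.commute)
    finally show ?thesis by auto
  qed
  have coset_eq: "coset \<gamma> = coset \<gamma>'" if "\<gamma> - \<gamma>' \<in> ?B" for \<gamma> \<gamma>'
  proof (rule set_eqI)
    fix \<delta>
    have "\<delta> - \<gamma>' = (\<delta> - \<gamma>) + (\<gamma> - \<gamma>')" "\<delta> - \<gamma> = (\<delta> - \<gamma>') - (\<gamma> - \<gamma>')" by simp_all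
    then show "\<delta> \<in> coset \<gamma> \<longleftrightarrow> \<delta> \<in> coset \<gamma>'"
      unfolding mem using that add_subgroupD(2,4)[OF B] by metis
  qed
  define p where "p C = (SOME \<gamma>. \<gamma> \<in> C)" for C :: "'a set"
  have p: "p (coset \<gamma>) - \<gamma> \<in> ?B" for \<gamma>
  proof -
    have "\<gamma> \<in> coset \<gamma>" unfolding mem using add_subgroupD(1)[OF B] by simp
    then have "p (coset \<gamma>) \<in> coset \<gamma>" unfolding p_def by (rule someI)
    then show ?thesis unfolding mem .
  qed
  have idx': "image_index \<alpha> = card (range coset)" unfolding image_index_def coset_def ..
  have inj: "inj_on p (range coset)"
  proof (rule inj_onI, clarify)
    fix \<gamma> \<gamma>' assume "p (coset \<gamma>) = p (coset \<gamma>')"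
    then have "\<gamma> - \<gamma>' = (p (coset \<gamma>') - \<gamma>') - (p (coset \<gamma>) - \<gamma>)" by simp
    then show "coset \<gamma> = coset \<gamma>'" using p coset_eq add_subgroupD(4)[OF B] by metis
  qed
  let ?R = "p ` range coset"
  have "transversal ?R ?B" unfolding transversal_def
  proof (intro allI ex1I[of _ "p (coset \<gamma>)" for \<gamma>] conjI)
    fix \<gamma>
    show "p (coset \<gamma>) \<in> ?R" by blast
    show "\<gamma> - p (coset \<gamma>) \<in> ?B" using add_subgroupD(3)[OF B p[of \<gamma>]] by simp
    fix r assume r: "r \<in> ?R \<and> \<gamma> - r \<in> ?B"
    then obtain \<gamma>' where \<gamma>': "r = p (coset \<gamma>')" by blast
    have "\<gamma> - \<gamma>' = (\<gamma> - r) + (p (coset \<gamma>') - \<gamma>')" using \<gamma>' by simp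
    then have "coset \<gamma> = coset \<gamma>'" using coset_eq add_subgroupD(2)[OF B] r p by metis
    then show "r = p (coset \<gamma>)" using \<gamma>' by simp
  qed
  moreover have "finite ?R" using idx idx' card_ge_0_finite[of "range coset"] by simp
  moreover have "character_on ?B (\<lambda>_. 1)" unfolding character_on_def by simp
  moreover have "dual_ker \<alpha> = char_extensions ?B (\<lambda>_. 1)"
    unfolding dual_ker_def char_extensions_def dual_endo_def by (auto simp: fun_eq_iff)
  ultimately show "finite (dual_ker \<alpha>)" "card (dual_ker \<alpha>) = image_index \<alpha>"
    using char_extensions_card[OF _ _ B] card_image[OF inj] idx' by simp_all
qed

section \<open>The dual group as a measurable group\<close>

lemma dual_groupI:
  "(\<And>\<gamma> \<gamma>'. \<omega> (\<gamma> + \<gamma>') = \<omega> \<gamma> * \<omega> \<gamma>') \<Longrightarrow> (\<And>\<gamma>. cmod (\<omega> \<gamma>) = 1) \<Longrightarrow> \<omega> \<in> dual_group"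
  unfolding dual_group_def by blast

lemma char_mult_closed: "\<omega> \<in> dual_group \<Longrightarrow> \<zeta> \<in> dual_group \<Longrightarrow> char_mult \<omega> \<zeta> \<in> dual_group"
  unfolding char_mult_def by (rule dual_groupI) (simp_all add: dual_groupD norm_mult)

lemma char_inverse_closed: "\<omega> \<in> dual_group \<Longrightarrow> char_inverse \<omega> \<in> dual_group"
  unfolding char_inverse_def by (rule dual_groupI) (simp_all add: dual_groupD norm_inverse)

lemma char_mult_assoc: "char_mult (char_mult \<omega> \<zeta>) \<eta> = char_mult \<omega> (char_mult \<zeta> \<eta>)"
  unfolding char_mult_def by (simp add: mult.assoc)

lemma char_mult_commute: "char_mult \<omega> \<zeta> = char_mult \<zeta> \<omega>"
  unfolding char_mult_def by (simp add: mult.commute)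

lemma char_mult_inverse_cancel:
  assumes "\<omega> \<in> dual_group"
  shows "char_mult (char_inverse \<omega>) (char_mult \<omega> \<zeta>) = \<zeta>"
    and "char_mult \<omega> (char_mult (char_inverse \<omega>) \<zeta>) = \<zeta>"
  unfolding char_mult_def char_inverse_def using dual_groupD(3)[OF assms] by (simp_all add: fun_eq_iff)

lemma char_mult_one: "char_mult (\<lambda>_. 1) \<omega> = \<omega>"
  unfolding char_mult_def by simp

lemma dual_endo_mult: "dual_endo \<alpha> (char_mult \<omega> \<zeta>) = char_mult (dual_endo \<alpha> \<omega>) (dual_endo \<alpha> \<zeta>)"
  unfolding dual_endo_def char_mult_def by simp

lemma dual_endo_inverse: "dual_endo \<alpha> (char_inverse \<omega>) = char_inverse (dual_endo \<alpha> \<omega>)"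
  unfolding dual_endo_def char_inverse_def by simp

lemma space_dual_borel: "space dual_borel = dual_group"
  unfolding dual_borel_def by (simp add: space_restrict_space)

lemma borel_measurable_char [measurable]: "(\<lambda>\<omega>. \<omega> \<gamma>) \<in> borel_measurable dual_borel"
  unfolding dual_borel_def by (rule measurable_restrict_space1) (rule measurable_product_coordinates)

lemma measurable_dual_borelI:
  fixes f :: "'x \<Rightarrow> ('g :: {ab_group_add, countable}) character"
  assumes "\<And>\<gamma>. (\<lambda>x. f x \<gamma>) \<in> borel_measurable M" "\<And>x. x \<in> space M \<Longrightarrow> f x \<in> dual_group"
  shows "f \<in> M \<rightarrow>\<^sub>M dual_borel"
  unfolding dual_borel_def using assms
  by (intro measurable_restrict_space2 measurable_coordinatewise_then_product) auto

lemma measurable_char_mult [measurable (raw)]: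
  fixes f g :: "'x \<Rightarrow> ('g :: {ab_group_add, countable}) character"
  assumes f [measurable]: "f \<in> M \<rightarrow>\<^sub>M dual_borel" and g [measurable]: "g \<in> M \<rightarrow>\<^sub>M dual_borel"
  shows "(\<lambda>x. char_mult (f x) (g x)) \<in> M \<rightarrow>\<^sub>M dual_borel"
proof (rule measurable_dual_borelI)
  show "(\<lambda>x. char_mult (f x) (g x) \<gamma>) \<in> borel_measurable M" for \<gamma>
    unfolding char_mult_def
    by (intro borel_measurable_times measurable_compose[OF f borel_measurable_char]
        measurable_compose[OF g borel_measurable_char])
  show "char_mult (f x) (g x) \<in> dual_group" if "x \<in> space M" for x
    using measurable_space[OF f that] measurable_space[OF g that]
    by (simp add: space_dual_borel char_mult_closed)
qed

text \<open>Multiplicativity is a closed condition on a product of circles.\<close>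

lemma compact_dual_group: "compact (dual_group :: ('g :: ab_group_add) character set)"
proof -
  have "compact (PiE UNIV (\<lambda>_ :: 'g. sphere (0 :: complex) 1))"
    using compactin_PiE[of "\<lambda>_ :: 'g. euclidean" UNIV "\<lambda>_. sphere (0 :: complex) 1"]
    by (simp add: euclidean_product_topology)
  moreover have "closed {\<omega> :: 'g character. \<omega> (\<gamma> + \<gamma>') = \<omega> \<gamma> * \<omega> \<gamma>'}" for \<gamma> \<gamma>'
    by (intro closed_Collect_eq continuous_intros continuous_on_product_coordinates)
  then have "closed (\<Inter>\<gamma>. \<Inter>\<gamma>'. {\<omega> :: 'g character. \<omega> (\<gamma> + \<gamma>') = \<omega> \<gamma> * \<omega> \<gamma>'})" by blast
  moreover have eq: "(dual_group :: 'g character set) = PiE UNIV (\<lambda>_ :: 'g. sphere (0 :: complex) 1)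
      \<inter> (\<Inter>\<gamma>. \<Inter>\<gamma>'. {\<omega> :: 'g character. \<omega> (\<gamma> + \<gamma>') = \<omega> \<gamma> * \<omega> \<gamma>'})"
    unfolding dual_group_def PiE_def by (auto simp: dist_norm)
  ultimately show ?thesis unfolding eq by (intro compact_Int_closed)
qed

section \<open>Uniqueness of Fourier coefficients\<close>

text \<open>Test against the set where the function is positive.\<close>

lemma integral_indicators_zero_imp_AE_real:
  fixes h :: "'x \<Rightarrow> real"
  assumes h: "integrable M h" and z: "\<And>E. E \<in> sets M \<Longrightarrow> (\<integral>x. h x * indicator E x \<partial>M) = 0"
  shows "AE x in M. h x = 0"
proof -
  have *: "AE x in M. k x \<le> 0" if k: "integrable M k" and kz: "\<And>E. E \<in> sets M \<Longrightarrow> (\<integral>x. k x * indicator E x \<partial>M) = 0" for k :: "'x \<Rightarrow> real"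
  proof -
    have km [measurable]: "k \<in> borel_measurable M" using k by simp
    define E where "E = {x \<in> space M. 0 < k x}"
    have E [measurable]: "E \<in> sets M" unfolding E_def by measurable
    have "integrable M (\<lambda>x. k x * indicator E x)"
      using k E by (rule integrable_real_mult_indicator[rotated])
    moreover have "AE x in M. 0 \<le> k x * indicator E x"
      by (rule AE_I2) (auto simp: E_def indicator_def)
    ultimately have "AE x in M. k x * indicator E x = 0"
      using integral_nonneg_eq_0_iff_AE kz[OF E] by blast
    moreover have "AE x in M. x \<in> space M" by simp
    ultimately show ?thesis by eventually_elim (auto simp: E_def indicator_def split: if_splits)
  qed
  have "AE x in M. h x \<le> 0" using h z by (rule *)
  moreover have "AE x in M. - h x \<le> 0" using h z by (intro *) (auto)
  ultimately show ?thesis by eventually_elim simp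
qed

lemma integral_indicators_zero_imp_AE:
  fixes f :: "'x \<Rightarrow> complex"
  assumes f: "integrable M f" and z: "\<And>E. E \<in> sets M \<Longrightarrow> (\<integral>x. f x * of_real (indicator E x) \<partial>M) = 0"
  shows "AE x in M. f x = 0"
proof -
  have i: "integrable M (\<lambda>x. f x * of_real (indicator E x))" if E: "E \<in> sets M" for E
    by (rule Bochner_Integration.integrable_bound[OF f])
      (use f E in \<open>auto simp: indicator_def norm_mult\<close>)
  have "AE x in M. Re (f x) = 0"
  proof (rule integral_indicators_zero_imp_AE_real)
    show "(\<integral>x. Re (f x) * indicator E x \<partial>M) = 0" if "E \<in> sets M" for E
      using integral_Re[OF i[OF that]] z[OF that] by simp
  qed (use f in simp)
  moreover have "AE x in M. Im (f x) = 0"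
  proof (rule integral_indicators_zero_imp_AE_real)
    show "(\<integral>x. Im (f x) * indicator E x \<partial>M) = 0" if "E \<in> sets M" for E
      using integral_Im[OF i[OF that]] z[OF that] by simp
  qed (use f in simp)
  ultimately show ?thesis by eventually_elim (simp add: complex_eq_iff)
qed

definition fourier_null :: "('g :: ab_group_add) character measure \<Rightarrow> ('g character \<Rightarrow> complex) set" where
  "fourier_null \<mu> = {g. integrable \<mu> g \<and> (\<forall>\<gamma>. (\<integral>\<omega>. g \<omega> * \<omega> \<gamma> \<partial>\<mu>) = 0)}"

text \<open>
  Uniqueness of Fourier coefficients is the statement that \<^term>\<open>fourier_null \<mu>\<close> contains only null
  functions.  It is approached through the functions by which this space may be multiplied.  Unlike
  the functions that merely integrate to zero against it, they are closed under products, and they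
  contain the real and imaginary parts of the characters.
\<close>

definition fourier_multiplier :: "('g :: ab_group_add) character measure \<Rightarrow> ('g character \<Rightarrow> real) \<Rightarrow> bool" where
  "fourier_multiplier \<mu> p \<longleftrightarrow> (\<forall>g\<in>fourier_null \<mu>. (\<lambda>\<omega>. g \<omega> * of_real (p \<omega>)) \<in> fourier_null \<mu>)"

context
  fixes \<mu> :: "('g :: {ab_group_add, countable}) character measure"
  assumes sets_\<mu>: "sets \<mu> = sets dual_borel"
begin

lemma space_\<mu>: "space \<mu> = dual_group"
  using sets_eq_imp_space_eq[OF sets_\<mu>] space_dual_borel by simp

lemma char_measurable: "(\<lambda>\<omega>. \<omega> \<gamma>) \<in> borel_measurable \<mu>"
  using borel_measurable_char sets_\<mu> measurable_cong_sets by blast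

lemma char_mult_integrable:
  assumes "integrable \<mu> g"
  shows "integrable \<mu> (\<lambda>\<omega>. g \<omega> * \<omega> \<gamma>)"
proof (rule Bochner_Integration.integrable_bound[OF assms])
  show "(\<lambda>\<omega>. g \<omega> * \<omega> \<gamma>) \<in> borel_measurable \<mu>"
    using assms char_measurable by (intro borel_measurable_times) auto
  show "AE \<omega> in \<mu>. norm (g \<omega> * \<omega> \<gamma>) \<le> norm (g \<omega>)"
    by (rule AE_I2) (simp add: space_\<mu> norm_mult dual_groupD)
qed

lemma fourier_null_lin:
  assumes "g \<in> fourier_null \<mu>" "g' \<in> fourier_null \<mu>"
  shows "(\<lambda>\<omega>. a * g \<omega> + b * g' \<omega>) \<in> fourier_null \<mu>"
proof -
  have i: "integrable \<mu> g" "integrable \<mu> g'" using assms unfolding fourier_null_def by auto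
  have "(\<integral>\<omega>. (a * g \<omega> + b * g' \<omega>) * \<omega> \<gamma> \<partial>\<mu>) = 0" for \<gamma>
  proof -
    have "(\<integral>\<omega>. (a * g \<omega> + b * g' \<omega>) * \<omega> \<gamma> \<partial>\<mu>) = (\<integral>\<omega>. a * (g \<omega> * \<omega> \<gamma>) + b * (g' \<omega> * \<omega> \<gamma>) \<partial>\<mu>)"
      by (simp add: algebra_simps)
    also have "\<dots> = a * (\<integral>\<omega>. g \<omega> * \<omega> \<gamma> \<partial>\<mu>) + b * (\<integral>\<omega>. g' \<omega> * \<omega> \<gamma> \<partial>\<mu>)"
      using char_mult_integrable[OF i(1)] char_mult_integrable[OF i(2)] by simp
    finally show ?thesis using assms unfolding fourier_null_def by simp
  qed
  then show ?thesis using i unfolding fourier_null_def by simp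
qed

lemma fourier_null_char:
  assumes g: "g \<in> fourier_null \<mu>"
  shows "(\<lambda>\<omega>. g \<omega> * \<omega> \<gamma>) \<in> fourier_null \<mu>"
proof -
  have i: "integrable \<mu> g" using g unfolding fourier_null_def by auto
  have "(\<integral>\<omega>. (g \<omega> * \<omega> \<gamma>) * \<omega> \<gamma>' \<partial>\<mu>) = (\<integral>\<omega>. g \<omega> * \<omega> (\<gamma> + \<gamma>') \<partial>\<mu>)" for \<gamma>'
    by (rule Bochner_Integration.integral_cong) (simp_all add: space_\<mu> dual_groupD(1))
  then show ?thesis using g char_mult_integrable[OF i] unfolding fourier_null_def by simp
qed

lemma fourier_null_cong:
  assumes "g \<in> fourier_null \<mu>" "\<And>\<omega>. \<omega> \<in> dual_group \<Longrightarrow> g \<omega> = g' \<omega>"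
  shows "g' \<in> fourier_null \<mu>"
proof -
  have "integrable \<mu> g \<longleftrightarrow> integrable \<mu> g'"
    by (rule Bochner_Integration.integrable_cong) (use assms(2) space_\<mu> in auto)
  moreover have "(\<integral>\<omega>. g \<omega> * \<omega> \<gamma> \<partial>\<mu>) = (\<integral>\<omega>. g' \<omega> * \<omega> \<gamma> \<partial>\<mu>)" for \<gamma>
    by (rule Bochner_Integration.integral_cong) (use assms(2) space_\<mu> in auto)
  ultimately show ?thesis using assms(1) unfolding fourier_null_def by simp
qed

lemma fourier_multiplier_mult:
  "fourier_multiplier \<mu> p \<Longrightarrow> fourier_multiplier \<mu> q \<Longrightarrow> fourier_multiplier \<mu> (\<lambda>\<omega>. p \<omega> * q \<omega>)"
  unfolding fourier_multiplier_def by (simp add: mult.assoc[symmetric])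

lemma fourier_multiplier_lin:
  assumes "fourier_multiplier \<mu> p" "fourier_multiplier \<mu> q"
  shows "fourier_multiplier \<mu> (\<lambda>\<omega>. a * p \<omega> + b * q \<omega>)"
  unfolding fourier_multiplier_def
proof
  fix g assume "g \<in> fourier_null \<mu>"
  then have "(\<lambda>\<omega>. of_real a * (g \<omega> * of_real (p \<omega>)) + of_real b * (g \<omega> * of_real (q \<omega>))) \<in> fourier_null \<mu>"
    using assms unfolding fourier_multiplier_def by (intro fourier_null_lin) auto
  then show "(\<lambda>\<omega>. g \<omega> * of_real (a * p \<omega> + b * q \<omega>)) \<in> fourier_null \<mu>"
    by (rule fourier_null_cong) (simp add: algebra_simps)
qed

lemma fourier_multiplier_const: "fourier_multiplier \<mu> (\<lambda>_. a)"
  unfolding fourier_multiplier_def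
proof
  fix g assume "g \<in> fourier_null \<mu>"
  then show "(\<lambda>\<omega>. g \<omega> * of_real a) \<in> fourier_null \<mu>"
    using fourier_null_lin[of g g "of_real a" 0] by (simp add: mult.commute)
qed

lemma fourier_multiplier_Re_Im:
  shows "fourier_multiplier \<mu> (\<lambda>\<omega>. Re (\<omega> \<gamma>))" and "fourier_multiplier \<mu> (\<lambda>\<omega>. Im (\<omega> \<gamma>))"
proof -
  have c: "\<omega> (- \<gamma>) = cnj (\<omega> \<gamma>)" if "\<omega> \<in> dual_group" for \<omega> :: "'g character"
    by (rule dual_groupD(5)[OF that])
  show "fourier_multiplier \<mu> (\<lambda>\<omega>. Re (\<omega> \<gamma>))" unfolding fourier_multiplier_def
  proof
    fix g assume g: "g \<in> fourier_null \<mu>"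
    have "(\<lambda>\<omega>. (1/2) * (g \<omega> * \<omega> \<gamma>) + (1/2) * (g \<omega> * \<omega> (- \<gamma>))) \<in> fourier_null \<mu>"
      by (intro fourier_null_lin fourier_null_char g)
    then show "(\<lambda>\<omega>. g \<omega> * of_real (Re (\<omega> \<gamma>))) \<in> fourier_null \<mu>"
      by (rule fourier_null_cong) (simp add: c complex_eq_iff field_simps)
  qed
  show "fourier_multiplier \<mu> (\<lambda>\<omega>. Im (\<omega> \<gamma>))" unfolding fourier_multiplier_def
  proof
    fix g assume g: "g \<in> fourier_null \<mu>"
    have "(\<lambda>\<omega>. (-\<i>/2) * (g \<omega> * \<omega> \<gamma>) + (\<i>/2) * (g \<omega> * \<omega> (- \<gamma>))) \<in> fourier_null \<mu>"
      by (intro fourier_null_lin fourier_null_char g)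
    then show "(\<lambda>\<omega>. g \<omega> * of_real (Im (\<omega> \<gamma>))) \<in> fourier_null \<mu>"
      by (rule fourier_null_cong) (simp add: c complex_eq_iff field_simps)
  qed
qed

text \<open>Dominated convergence, applied to every Fourier coefficient.\<close>

lemma fourier_multiplier_limit:
  assumes p: "\<And>n :: nat. fourier_multiplier \<mu> (p n)" and m: "\<And>n. p n \<in> borel_measurable \<mu>"
    and b: "\<And>n \<omega>. \<omega> \<in> dual_group \<Longrightarrow> \<bar>p n \<omega>\<bar> \<le> b"
    and lim: "\<And>\<omega>. \<omega> \<in> dual_group \<Longrightarrow> (\<lambda>n. p n \<omega>) \<longlonglongrightarrow> q \<omega>"
  shows "fourier_multiplier \<mu> q"
  unfolding fourier_multiplier_def
proof
  fix g assume g: "g \<in> fourier_null \<mu>"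
  then have i: "integrable \<mu> g" unfolding fourier_null_def by simp
  have [measurable]: "g \<in> borel_measurable \<mu>" using i by simp
  note [measurable] = m char_measurable
  have [measurable]: "q \<in> borel_measurable \<mu>"
    by (rule borel_measurable_LIMSEQ_metric[OF m]) (use lim space_\<mu> in auto)
  have bound: "AE \<omega> in \<mu>. norm (g \<omega> * of_real (p n \<omega>)) \<le> norm (g \<omega>) * b" for n
    by (rule AE_I2) (use b space_\<mu> in \<open>auto simp: norm_mult intro!: mult_left_mono\<close>)
  have l: "AE \<omega> in \<mu>. (\<lambda>n. g \<omega> * of_real (p n \<omega>)) \<longlonglongrightarrow> g \<omega> * of_real (q \<omega>)"
    by (rule AE_I2) (use lim space_\<mu> in \<open>auto intro!: tendsto_intros\<close>)
  have ib: "integrable \<mu> (\<lambda>\<omega>. norm (g \<omega>) * b)" using i by (intro integrable_mult_left integrable_norm) auto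
  have "integrable \<mu> (\<lambda>\<omega>. g \<omega> * of_real (q \<omega>))"
    by (rule integrable_dominated_convergence[OF _ _ ib l bound]) auto
  moreover have "(\<integral>\<omega>. (g \<omega> * of_real (q \<omega>)) * \<omega> \<gamma> \<partial>\<mu>) = 0" for \<gamma>
  proof -
    have bound': "AE \<omega> in \<mu>. norm (g \<omega> * of_real (p n \<omega>) * \<omega> \<gamma>) \<le> norm (g \<omega>) * b" for n
    proof (rule AE_I2)
      fix \<omega> assume "\<omega> \<in> space \<mu>"
      then have \<omega>: "\<omega> \<in> dual_group" by (simp add: space_\<mu>)
      then have "norm (g \<omega> * of_real (p n \<omega>) * \<omega> \<gamma>) = norm (g \<omega>) * \<bar>p n \<omega>\<bar>"
        by (simp add: norm_mult dual_groupD)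
      then show "norm (g \<omega> * of_real (p n \<omega>) * \<omega> \<gamma>) \<le> norm (g \<omega>) * b"
        using b[OF \<omega>] by (simp add: mult_left_mono)
    qed
    have l': "AE \<omega> in \<mu>. (\<lambda>n. g \<omega> * of_real (p n \<omega>) * \<omega> \<gamma>) \<longlonglongrightarrow> g \<omega> * of_real (q \<omega>) * \<omega> \<gamma>"
      using l by eventually_elim (intro tendsto_mult_right)
    have "(\<lambda>n. \<integral>\<omega>. g \<omega> * of_real (p n \<omega>) * \<omega> \<gamma> \<partial>\<mu>) \<longlonglongrightarrow> (\<integral>\<omega>. g \<omega> * of_real (q \<omega>) * \<omega> \<gamma> \<partial>\<mu>)"
      by (rule integral_dominated_convergence[OF _ _ ib l' bound']) auto
    moreover have "(\<integral>\<omega>. g \<omega> * of_real (p n \<omega>) * \<omega> \<gamma> \<partial>\<mu>) = 0" for n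
      using p[of n] g unfolding fourier_multiplier_def fourier_null_def by auto
    ultimately show ?thesis by (simp add: LIMSEQ_const_iff)
  qed
  ultimately show "(\<lambda>\<omega>. g \<omega> * of_real (q \<omega>)) \<in> fourier_null \<mu>" unfolding fourier_null_def by simp
qed

lemma continuous_on_measurable: "continuous_on dual_group p \<Longrightarrow> (p :: _ \<Rightarrow> real) \<in> borel_measurable \<mu>"
  using borel_measurable_continuous_on_restrict[of dual_group p] sets_\<mu> measurable_cong_sets
  unfolding dual_borel_def by blast

text \<open>The continuous multipliers form an algebra that separates points, so every continuous
  function is a uniform limit of multipliers.\<close>

lemma fourier_multiplier_continuous:
  assumes p: "continuous_on dual_group p"
  shows "fourier_multiplier \<mu> p"
proof -
  define R where "R = {q. continuous_on (dual_group :: 'g character set) q \<and> fourier_multiplier \<mu> q}"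
  interpret function_ring_on R dual_group
  proof
    show "compact (dual_group :: 'g character set)" by (rule compact_dual_group)
    show "continuous_on dual_group f" if "f \<in> R" for f using that unfolding R_def by blast
    show "(\<lambda>x. f x + g x) \<in> R" if "f \<in> R" "g \<in> R" for f g
      using that fourier_multiplier_lin[of f g 1 1] unfolding R_def by (auto intro: continuous_intros)
    show "(\<lambda>x. f x * g x) \<in> R" if "f \<in> R" "g \<in> R" for f g
      using that fourier_multiplier_mult[of f g] unfolding R_def by (auto intro: continuous_intros)
    show "(\<lambda>_. a) \<in> R" for a unfolding R_def using fourier_multiplier_const by (auto intro: continuous_intros)
    show "\<exists>f\<in>R. f x \<noteq> f y" if "x \<noteq> y" for x y :: "'g character"
    proof -
      obtain \<gamma> where "x \<gamma> \<noteq> y \<gamma>" using \<open>x \<noteq> y\<close> by blast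
      then consider "Re (x \<gamma>) \<noteq> Re (y \<gamma>)" | "Im (x \<gamma>) \<noteq> Im (y \<gamma>)" by (auto simp: complex_eq_iff)
      then show ?thesis
      proof cases
        case 1
        have "(\<lambda>\<omega>. Re (\<omega> \<gamma>)) \<in> R" unfolding R_def
          by (auto intro!: continuous_intros fourier_multiplier_Re_Im continuous_on_product_coordinates
              intro: continuous_on_subset)
        then show ?thesis using 1 by (intro bexI[of _ "\<lambda>\<omega>. Re (\<omega> \<gamma>)"])
      next
        case 2
        have "(\<lambda>\<omega>. Im (\<omega> \<gamma>)) \<in> R" unfolding R_def
          by (auto intro!: continuous_intros fourier_multiplier_Re_Im continuous_on_product_coordinates
              intro: continuous_on_subset)
        then show ?thesis using 2 by (intro bexI[of _ "\<lambda>\<omega>. Im (\<omega> \<gamma>)"])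
      qed
    qed
  qed
  have "\<exists>q\<in>R. \<forall>\<omega>\<in>dual_group. \<bar>p \<omega> - q \<omega>\<bar> < 1 / real (Suc n)" for n
    by (rule Stone_Weierstrass_basic[OF p]) simp
  then obtain q where q: "\<And>n. q n \<in> R" and qp: "\<And>n \<omega>. \<omega> \<in> dual_group \<Longrightarrow> \<bar>p \<omega> - q n \<omega>\<bar> < 1 / real (Suc n)"
    by metis
  have "bounded (p ` dual_group)" by (intro compact_imp_bounded compact_continuous_image p compact_dual_group)
  then obtain b where b: "\<And>\<omega>. \<omega> \<in> dual_group \<Longrightarrow> \<bar>p \<omega>\<bar> \<le> b" unfolding bounded_iff by auto
  show ?thesis
  proof (rule fourier_multiplier_limit)
    show "fourier_multiplier \<mu> (q n)" for n using q unfolding R_def by blast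
    show "q n \<in> borel_measurable \<mu>" for n using q[of n] unfolding R_def by (intro continuous_on_measurable) auto
    show "\<bar>q n \<omega>\<bar> \<le> b + 1" if "\<omega> \<in> dual_group" for n \<omega>
    proof -
      have "1 / real (Suc n) \<le> 1" by simp
      then show ?thesis using b[OF that] qp[OF that, of n] by linarith
    qed
    show "(\<lambda>n. q n \<omega>) \<longlonglongrightarrow> p \<omega>" if "\<omega> \<in> dual_group" for \<omega>
    proof (rule LIM_zero_cancel, rule Lim_null_comparison)
      show "\<forall>\<^sub>F n in sequentially. norm (q n \<omega> - p \<omega>) \<le> 1 / real (Suc n)"
        using qp[OF that] by (intro always_eventually allI) (simp add: abs_minus_commute less_imp_le)
      show "(\<lambda>n. 1 / real (Suc n)) \<longlonglongrightarrow> 0" by (rule LIMSEQ_Suc[OF lim_1_over_n])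
    qed
  qed
qed

text \<open>The indicator of an open set is the bounded limit of the continuous functions \<open>min 1 (n d)\<close>, where \<open>d\<close> is the distance to the complement.\<close>

lemma fourier_multiplier_open:
  assumes U: "open U"
  shows "fourier_multiplier \<mu> (indicator U)"
proof (cases "U = UNIV")
  case True
  then show ?thesis using fourier_multiplier_const[of 1] by simp
next
  case False
  define p where "p n \<omega> = min 1 (real n * infdist \<omega> (- U))" for n \<omega>
  have c: "continuous_on dual_group (p n)" for n
    unfolding p_def by (intro continuous_intros)
  show ?thesis
  proof (rule fourier_multiplier_limit[of p 1])
    show "fourier_multiplier \<mu> (p n)" for n by (rule fourier_multiplier_continuous[OF c])
    show "p n \<in> borel_measurable \<mu>" for n by (rule continuous_on_measurable[OF c])
    show "\<bar>p n \<omega>\<bar> \<le> 1" for n \<omega> unfolding p_def by (auto simp: infdist_nonneg)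
    show "(\<lambda>n. p n \<omega>) \<longlonglongrightarrow> indicator U \<omega>" for \<omega>
    proof (cases "\<omega> \<in> U")
      case True
      then have pos: "0 < infdist \<omega> (- U)"
      proof -
        have "- U \<noteq> {}" using \<open>U \<noteq> UNIV\<close> by blast
        then have "infdist \<omega> (- U) \<noteq> 0"
          using True U in_closed_iff_infdist_zero[of "- U" \<omega>] by (simp add: closed_def)
        then show ?thesis using infdist_nonneg[of \<omega> "- U"] by linarith
      qed
      obtain N where N: "1 / infdist \<omega> (- U) < real N" using reals_Archimedean2 by blast
      have "p n \<omega> = 1" if "n \<ge> N" for n
      proof -
        have "1 / infdist \<omega> (- U) < real n" using N that by simp
        then have "1 < real n * infdist \<omega> (- U)" using pos by (simp add: pos_divide_less_eq)
        then show ?thesis unfolding p_def by simp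
      qed
      then have "\<forall>\<^sub>F n in sequentially. p n \<omega> = 1" unfolding eventually_sequentially by blast
      then show ?thesis using True by (simp add: tendsto_eventually)
    next
      case False
      then show ?thesis unfolding p_def by simp
    qed
  qed
qed

text \<open>Since multipliers are closed under products, the sets with multiplier indicator are closed under intersection as well as complement and monotone union; hence they form a \<open>\<sigma>\<close>-algebra.\<close>

lemma fourier_multiplier_borel:
  assumes "E \<in> sets borel"
  shows "fourier_multiplier \<mu> (indicator E)"
proof -
  have "E \<in> sigma_sets UNIV {S. open S}" using assms by (simp add: borel_def)
  then show ?thesis
  proof (induction E rule: sigma_sets.induct)
    case (Basic U)
    then show ?case using fourier_multiplier_open by simp
  next
    case Empty
    show ?case using fourier_multiplier_const[of 0] by (simp add: indicator_def)
  next
    case (Compl A)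
    have "indicator (UNIV - A) = (\<lambda>\<omega>. 1 * 1 + (-1) * (indicator A \<omega> :: real))"
      by (auto simp: indicator_def fun_eq_iff)
    then show ?case using fourier_multiplier_lin[where a = 1 and b = "-1", OF fourier_multiplier_const[of 1] Compl.IH] by simp
  next
    case (Union A)
    define p where "p n = (indicator (\<Union>i<n. A i) :: 'g character \<Rightarrow> real)" for n
    have p: "fourier_multiplier \<mu> (p n)" for n
    proof (induction n)
      case 0
      then show ?case using fourier_multiplier_const[of 0] unfolding p_def by (simp add: indicator_def)
    next
      case (Suc n)
      have "p (Suc n) = (\<lambda>\<omega>. 1 * p n \<omega> + 1 * (1 * indicator (A n) \<omega> + (-1) * (p n \<omega> * indicator (A n) \<omega>)))"
        unfolding p_def by (auto simp: indicator_def fun_eq_iff lessThan_Suc)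
      then show ?case
        using fourier_multiplier_lin[where a = 1 and b = 1, OF Suc.IH
            fourier_multiplier_lin[where a = 1 and b = "-1", OF Union.IH[of n]
              fourier_multiplier_mult[OF Suc.IH Union.IH[of n]]]] by simp
    qed
    have Am: "A i \<in> sets borel" for i using Union.hyps by (simp add: borel_def)
    show ?case
    proof (rule fourier_multiplier_limit[where b = 1, OF p])
      show "p n \<in> borel_measurable \<mu>" for n
      proof -
        have "p n \<in> borel_measurable borel" unfolding p_def using Am by (intro borel_measurable_indicator) auto
        then have "p n \<in> borel_measurable dual_borel" unfolding dual_borel_def by (rule measurable_restrict_space1)
        then show ?thesis using sets_\<mu> measurable_cong_sets by blast
      qed
      show "\<bar>p n \<omega>\<bar> \<le> 1" for n \<omega> unfolding p_def by (simp add: indicator_def)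
      show "(\<lambda>n. p n \<omega>) \<longlonglongrightarrow> indicator (\<Union>i. A i) \<omega>" for \<omega>
        unfolding p_def by (rule LIMSEQ_indicator_UN)
    qed
  qed
qed

text \<open>With all indicators among the multipliers, a function with vanishing Fourier coefficients integrates to zero over every measurable set.\<close>

lemma fourier_uniqueness:
  assumes f: "integrable \<mu> f" and z: "\<And>\<gamma>. (\<integral>\<omega>. f \<omega> * \<omega> \<gamma> \<partial>\<mu>) = 0"
  shows "AE \<omega> in \<mu>. f \<omega> = 0"
proof (rule integral_indicators_zero_imp_AE[OF f])
  fix E assume "E \<in> sets \<mu>"
  then obtain E' where E': "E' \<in> sets borel" "E = E' \<inter> dual_group"
    unfolding sets_\<mu> dual_borel_def by (auto simp: sets_restrict_space)
  have "(\<lambda>\<omega>. f \<omega> * of_real (indicator E' \<omega>)) \<in> fourier_null \<mu>"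
    using fourier_multiplier_borel[OF E'(1)] f z unfolding fourier_multiplier_def fourier_null_def by simp
  then have "(\<integral>\<omega>. f \<omega> * of_real (indicator E' \<omega>) * \<omega> 0 \<partial>\<mu>) = 0" unfolding fourier_null_def by simp
  moreover have "(\<integral>\<omega>. f \<omega> * of_real (indicator E \<omega>) \<partial>\<mu>) = (\<integral>\<omega>. f \<omega> * of_real (indicator E' \<omega>) * \<omega> 0 \<partial>\<mu>)"
    by (rule Bochner_Integration.integral_cong) (auto simp: space_\<mu> E'(2) dual_groupD(4) indicator_def)
  ultimately show "(\<integral>\<omega>. f \<omega> * of_real (indicator E \<omega>) \<partial>\<mu>) = 0" by simp
qed

end

section \<open>Averaging over the fibres of the dual endomorphism\<close>

locale dual_system =
  fixes \<alpha> :: "'g :: {ab_group_add, countable} \<Rightarrow> 'g"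
    and \<mu> :: "'g character measure"
    and c :: "'g character \<Rightarrow> 'g character"
  assumes admissible: "admissible_endo \<alpha>"
    and haar: "haar_measure \<mu>"
    and cross: "cross_section \<alpha> c"
begin

abbreviation index :: nat where "index \<equiv> image_index \<alpha>"

lemma index_pos: "0 < index"
  using admissible unfolding admissible_endo_def by simp

lemma sets_haar [measurable_cong]: "sets \<mu> = sets dual_borel"
  using haar unfolding haar_measure_def by simp

lemma space_haar: "space \<mu> = dual_group"
  using sets_eq_imp_space_eq[OF sets_haar] space_dual_borel by simp

sublocale prob_space \<mu>
  using haar unfolding haar_measure_def by simp

lemma endo_closed: "\<omega> \<in> dual_group \<Longrightarrow> dual_endo \<alpha> \<omega> \<in> dual_group"
  using admissible unfolding admissible_endo_def dual_endo_def dual_group_def by auto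

lemma endo_measurable [measurable]: "dual_endo \<alpha> \<in> dual_borel \<rightarrow>\<^sub>M dual_borel"
proof (rule measurable_dual_borelI)
  show "(\<lambda>\<omega>. dual_endo \<alpha> \<omega> \<gamma>) \<in> borel_measurable dual_borel" for \<gamma>
    unfolding dual_endo_def by (rule borel_measurable_char)
qed (simp add: space_dual_borel endo_closed)

lemma cross_measurable [measurable]: "c \<in> dual_borel \<rightarrow>\<^sub>M dual_borel"
  using cross unfolding cross_section_def by simp

lemma cross_closed: "\<omega> \<in> dual_group \<Longrightarrow> c \<omega> \<in> dual_group"
  using measurable_space[OF cross_measurable] by (simp add: space_dual_borel)

lemma endo_cross: "\<omega> \<in> dual_group \<Longrightarrow> dual_endo \<alpha> (c \<omega>) = \<omega>"
  using cross unfolding cross_section_def by simp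

lemma kerD: "\<kappa> \<in> dual_ker \<alpha> \<Longrightarrow> \<kappa> \<in> dual_group" "\<kappa> \<in> dual_ker \<alpha> \<Longrightarrow> dual_endo \<alpha> \<kappa> = (\<lambda>_. 1)"
  unfolding dual_ker_def by auto

lemma finite_ker: "finite (dual_ker \<alpha>)" and card_ker: "card (dual_ker \<alpha>) = index"
  using dual_ker_card[OF admissible] .

lemma translate_measurable [measurable]:
  assumes \<zeta>: "(\<zeta> :: 'g character) \<in> dual_group"
  shows "char_mult \<zeta> \<in> dual_borel \<rightarrow>\<^sub>M dual_borel"
proof -
  have "(\<lambda>_. \<zeta>) \<in> dual_borel \<rightarrow>\<^sub>M dual_borel"
    by (rule measurable_const) (simp only: space_dual_borel \<zeta>)
  then show ?thesis by (rule measurable_char_mult) (rule measurable_ident_sets[OF refl])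
qed

lemma distr_translate: "\<zeta> \<in> dual_group \<Longrightarrow> distr \<mu> \<mu> (char_mult \<zeta>) = \<mu>"
  using haar unfolding haar_measure_def by simp

lemma translate_measurable': "\<zeta> \<in> dual_group \<Longrightarrow> char_mult \<zeta> \<in> \<mu> \<rightarrow>\<^sub>M \<mu>"
  using translate_measurable by (simp cong: measurable_cong_sets add: sets_haar)

lemma endo_measurable': "dual_endo \<alpha> \<in> \<mu> \<rightarrow>\<^sub>M \<mu>"
  using endo_measurable by (simp cong: measurable_cong_sets add: sets_haar)

lemma nn_integral_translate:
  assumes "\<zeta> \<in> dual_group" "F \<in> borel_measurable \<mu>"
  shows "(\<integral>\<^sup>+\<omega>. F (char_mult \<zeta> \<omega>) \<partial>\<mu>) = (\<integral>\<^sup>+\<omega>. F \<omega> \<partial>\<mu>)"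
  using nn_integral_distr[OF translate_measurable'[OF assms(1)], of F] assms distr_translate by simp

text \<open>The image of Haar measure under the dual endomorphism is again Haar measure: averaging over
  translations of either argument of the map \<open>(x, y) \<mapsto> y \<cdot> \<alpha>\<^sup>* x\<close> gives the same integral.\<close>

lemma distr_endo: "distr \<mu> \<mu> (dual_endo \<alpha>) = \<mu>"
proof (rule measure_eqI)
  fix E assume "E \<in> sets (distr \<mu> \<mu> (dual_endo \<alpha>))"
  then have E [measurable]: "E \<in> sets \<mu>" by simp
  note [measurable] = endo_measurable'
  interpret P: pair_sigma_finite \<mu> \<mu> ..
  define F where "F \<omega> = (indicator E \<omega> :: ennreal)" for \<omega>
  have F [measurable]: "F \<in> borel_measurable \<mu>" unfolding F_def by measurable
  have "emeasure (distr \<mu> \<mu> (dual_endo \<alpha>)) E = (\<integral>\<^sup>+\<omega>. F \<omega> \<partial>distr \<mu> \<mu> (dual_endo \<alpha>))"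
    unfolding F_def using E by (simp add: nn_integral_indicator)
  also have "\<dots> = (\<integral>\<^sup>+\<omega>. F (dual_endo \<alpha> \<omega>) \<partial>\<mu>)" by (rule nn_integral_distr) auto
  also have "\<dots> = (\<integral>\<^sup>+y. (\<integral>\<^sup>+x. F (dual_endo \<alpha> x) \<partial>\<mu>) \<partial>\<mu>)" by (simp add: emeasure_space_1)
  also have "\<dots> = (\<integral>\<^sup>+y. (\<integral>\<^sup>+x. F (char_mult y (dual_endo \<alpha> x)) \<partial>\<mu>) \<partial>\<mu>)"
  proof (rule nn_integral_cong)
    fix y assume "y \<in> space \<mu>"
    then have y: "y \<in> dual_group" by (simp add: space_haar)
    have "(\<integral>\<^sup>+x. F (dual_endo \<alpha> x) \<partial>\<mu>) = (\<integral>\<^sup>+x. F (dual_endo \<alpha> (char_mult (c y) x)) \<partial>\<mu>)"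
      using nn_integral_translate[OF cross_closed[OF y], of "\<lambda>x. F (dual_endo \<alpha> x)"] by simp
    then show "(\<integral>\<^sup>+x. F (dual_endo \<alpha> x) \<partial>\<mu>) = (\<integral>\<^sup>+x. F (char_mult y (dual_endo \<alpha> x)) \<partial>\<mu>)"
      by (simp add: dual_endo_mult endo_cross[OF y])
  qed
  also have "\<dots> = (\<integral>\<^sup>+x. (\<integral>\<^sup>+y. F (char_mult y (dual_endo \<alpha> x)) \<partial>\<mu>) \<partial>\<mu>)"
  proof (rule P.Fubini')
    have "(\<lambda>p. char_mult (snd p) (dual_endo \<alpha> (fst p))) \<in> \<mu> \<Otimes>\<^sub>M \<mu> \<rightarrow>\<^sub>M dual_borel" by measurable
    then have "(\<lambda>p. char_mult (snd p) (dual_endo \<alpha> (fst p))) \<in> \<mu> \<Otimes>\<^sub>M \<mu> \<rightarrow>\<^sub>M \<mu>"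
      by (simp cong: measurable_cong_sets add: sets_haar)
    then show "case_prod (\<lambda>x y. F (char_mult y (dual_endo \<alpha> x))) \<in> borel_measurable (\<mu> \<Otimes>\<^sub>M \<mu>)"
      unfolding case_prod_beta' by (rule measurable_compose) (rule F)
  qed
  also have "\<dots> = (\<integral>\<^sup>+x. (\<integral>\<^sup>+y. F y \<partial>\<mu>) \<partial>\<mu>)"
  proof (rule nn_integral_cong)
    fix x assume "x \<in> space \<mu>"
    then show "(\<integral>\<^sup>+y. F (char_mult y (dual_endo \<alpha> x)) \<partial>\<mu>) = (\<integral>\<^sup>+y. F y \<partial>\<mu>)"
      using nn_integral_translate[of "dual_endo \<alpha> x" F] by (simp add: char_mult_commute space_haar endo_closed)
  qed
  also have "\<dots> = emeasure \<mu> E" unfolding F_def by (simp add: emeasure_space_1)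
  finally show "emeasure (distr \<mu> \<mu> (dual_endo \<alpha>)) E = emeasure \<mu> E" .
qed simp

text \<open>The cross-section parametrises every fibre by the kernel, which makes sums over fibres measurable functions of the base point.\<close>

lemma fibre_image:
  assumes \<omega>: "\<omega> \<in> dual_group"
  shows "fibre \<alpha> \<omega> = (\<lambda>\<kappa>. char_mult \<kappa> (c \<omega>)) ` dual_ker \<alpha>"
    and "inj_on (\<lambda>\<kappa>. char_mult \<kappa> (c \<omega>)) (dual_ker \<alpha>)"
proof -
  note cl = cross_closed[OF \<omega>]
  show "fibre \<alpha> \<omega> = (\<lambda>\<kappa>. char_mult \<kappa> (c \<omega>)) ` dual_ker \<alpha>"
  proof (intro equalityI subsetI)
    fix \<zeta> assume "\<zeta> \<in> fibre \<alpha> \<omega>"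
    then have \<zeta>: "\<zeta> \<in> dual_group" "dual_endo \<alpha> \<zeta> = \<omega>" unfolding fibre_def by auto
    let ?\<kappa> = "char_mult \<zeta> (char_inverse (c \<omega>))"
    have "dual_endo \<alpha> ?\<kappa> = (\<lambda>_. 1)"
      using endo_cross[OF \<omega>] \<zeta>(2) dual_groupD(3)[OF \<omega>]
      by (simp add: dual_endo_mult dual_endo_inverse) (simp add: char_mult_def char_inverse_def)
    then have "?\<kappa> \<in> dual_ker \<alpha>"
      unfolding dual_ker_def using \<zeta> cl by (simp add: char_mult_closed char_inverse_closed)
    moreover have "\<zeta> = char_mult ?\<kappa> (c \<omega>)"
      using char_mult_inverse_cancel(1)[OF cl, of \<zeta>]
      by (metis char_mult_assoc char_mult_commute)
    ultimately show "\<zeta> \<in> (\<lambda>\<kappa>. char_mult \<kappa> (c \<omega>)) ` dual_ker \<alpha>" by blast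
  next
    fix \<zeta> assume "\<zeta> \<in> (\<lambda>\<kappa>. char_mult \<kappa> (c \<omega>)) ` dual_ker \<alpha>"
    then obtain \<kappa> where \<kappa>: "\<kappa> \<in> dual_ker \<alpha>" "\<zeta> = char_mult \<kappa> (c \<omega>)" by blast
    then show "\<zeta> \<in> fibre \<alpha> \<omega>"
      unfolding fibre_def using cl endo_cross[OF \<omega>] kerD[OF \<kappa>(1)]
      by (simp add: char_mult_closed dual_endo_mult char_mult_one)
  qed
  show "inj_on (\<lambda>\<kappa>. char_mult \<kappa> (c \<omega>)) (dual_ker \<alpha>)"
  proof (rule inj_onI)
    fix \<kappa> \<kappa>' assume "char_mult \<kappa> (c \<omega>) = char_mult \<kappa>' (c \<omega>)"
    then show "\<kappa> = \<kappa>'" by (metis char_mult_commute char_mult_inverse_cancel(1)[OF cl])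
  qed
qed

lemma finite_fibre: "\<omega> \<in> dual_group \<Longrightarrow> finite (fibre \<alpha> \<omega>)"
  using fibre_image finite_ker by simp

lemma fibreD: "\<zeta> \<in> fibre \<alpha> \<omega> \<Longrightarrow> \<zeta> \<in> dual_group" "\<zeta> \<in> fibre \<alpha> \<omega> \<Longrightarrow> dual_endo \<alpha> \<zeta> = \<omega>"
  unfolding fibre_def by auto

lemma sum_fibre:
  "\<omega> \<in> dual_group \<Longrightarrow> (\<Sum>\<zeta>\<in>fibre \<alpha> \<omega>. F \<zeta>) = (\<Sum>\<kappa>\<in>dual_ker \<alpha>. F (char_mult \<kappa> (c \<omega>)))"
  using sum.reindex[OF fibre_image(2), of \<omega> F] by (simp add: fibre_image(1))

lemma sum_fibre_endo:
  assumes \<omega>: "\<omega> \<in> dual_group"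
  shows "(\<Sum>\<zeta>\<in>fibre \<alpha> (dual_endo \<alpha> \<omega>). F \<zeta>) = (\<Sum>\<kappa>\<in>dual_ker \<alpha>. F (char_mult \<kappa> \<omega>))"
proof -
  have "fibre \<alpha> (dual_endo \<alpha> \<omega>) = (\<lambda>\<kappa>. char_mult \<kappa> \<omega>) ` dual_ker \<alpha>"
  proof (intro equalityI subsetI)
    fix \<zeta> assume \<zeta>: "\<zeta> \<in> fibre \<alpha> (dual_endo \<alpha> \<omega>)"
    let ?\<kappa> = "char_mult \<zeta> (char_inverse \<omega>)"
    have "dual_endo \<alpha> ?\<kappa> = (\<lambda>_. 1)"
      using fibreD[OF \<zeta>] dual_groupD(3)[OF endo_closed[OF \<omega>]]
      by (simp add: dual_endo_mult dual_endo_inverse) (simp add: char_mult_def char_inverse_def)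
    then have "?\<kappa> \<in> dual_ker \<alpha>"
      unfolding dual_ker_def using fibreD[OF \<zeta>] \<omega> by (simp add: char_mult_closed char_inverse_closed)
    moreover have "\<zeta> = char_mult ?\<kappa> \<omega>"
      using char_mult_inverse_cancel(1)[OF \<omega>, of \<zeta>] by (metis char_mult_assoc char_mult_commute)
    ultimately show "\<zeta> \<in> (\<lambda>\<kappa>. char_mult \<kappa> \<omega>) ` dual_ker \<alpha>" by blast
  next
    fix \<zeta> assume "\<zeta> \<in> (\<lambda>\<kappa>. char_mult \<kappa> \<omega>) ` dual_ker \<alpha>"
    then obtain \<kappa> where \<kappa>: "\<kappa> \<in> dual_ker \<alpha>" "\<zeta> = char_mult \<kappa> \<omega>" by blast
    then show "\<zeta> \<in> fibre \<alpha> (dual_endo \<alpha> \<omega>)"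
      unfolding fibre_def using \<omega> kerD[OF \<kappa>(1)]
      by (simp add: char_mult_closed dual_endo_mult char_mult_one)
  qed
  moreover have "inj_on (\<lambda>\<kappa>. char_mult \<kappa> \<omega>) (dual_ker \<alpha>)"
    by (rule inj_onI) (metis char_mult_commute char_mult_inverse_cancel(1)[OF \<omega>])
  ultimately show ?thesis by (simp add: sum.reindex)
qed

lemma cross_ker_measurable:
  "\<kappa> \<in> dual_ker \<alpha> \<Longrightarrow> (\<lambda>\<omega>. char_mult \<kappa> (c \<omega>)) \<in> \<mu> \<rightarrow>\<^sub>M \<mu>"
  using measurable_compose[OF cross_measurable translate_measurable[OF kerD(1)]]
  by (simp cong: measurable_cong_sets add: sets_haar)

lemma fibre_sum_measurable:
  fixes F :: "_ \<Rightarrow> 'b :: {second_countable_topology, topological_comm_monoid_add}"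
  assumes "F \<in> borel_measurable \<mu>"
  shows "(\<lambda>\<omega>. \<Sum>\<zeta>\<in>fibre \<alpha> \<omega>. F \<zeta>) \<in> borel_measurable \<mu>"
proof -
  have "(\<lambda>\<omega>. \<Sum>\<kappa>\<in>dual_ker \<alpha>. F (char_mult \<kappa> (c \<omega>))) \<in> borel_measurable \<mu>"
    using assms by (intro borel_measurable_sum measurable_compose[OF cross_ker_measurable])
  then show ?thesis
    by (rule measurable_cong[THEN iffD1, rotated]) (simp add: sum_fibre space_haar)
qed

text \<open>Pull the fibre sum back along the dual endomorphism, which preserves Haar measure: over \<open>\<alpha>\<^sup>* \<omega>\<close> it becomes the sum over the translates of \<open>\<omega>\<close> by the kernel, and each of these \<open>N\<close> translates has the same integral.\<close>

lemma nn_integral_fibre: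
  assumes F: "F \<in> borel_measurable \<mu>"
  shows "(\<integral>\<^sup>+\<omega>. (\<Sum>\<zeta>\<in>fibre \<alpha> \<omega>. F \<zeta>) \<partial>\<mu>) = of_nat index * (\<integral>\<^sup>+\<omega>. F \<omega> \<partial>\<mu>)"
proof -
  let ?G = "\<lambda>\<omega>. \<Sum>\<zeta>\<in>fibre \<alpha> \<omega>. F \<zeta>"
  have G: "?G \<in> borel_measurable \<mu>" by (rule fibre_sum_measurable[OF F])
  have "(\<integral>\<^sup>+\<omega>. ?G \<omega> \<partial>\<mu>) = (\<integral>\<^sup>+\<omega>. ?G \<omega> \<partial>distr \<mu> \<mu> (dual_endo \<alpha>))" by (simp add: distr_endo)
  also have "\<dots> = (\<integral>\<^sup>+\<omega>. ?G (dual_endo \<alpha> \<omega>) \<partial>\<mu>)"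
    by (rule nn_integral_distr[OF endo_measurable']) (use G in simp)
  also have "\<dots> = (\<integral>\<^sup>+\<omega>. (\<Sum>\<kappa>\<in>dual_ker \<alpha>. F (char_mult \<kappa> \<omega>)) \<partial>\<mu>)"
    by (rule nn_integral_cong) (simp add: sum_fibre_endo space_haar)
  also have "\<dots> = (\<Sum>\<kappa>\<in>dual_ker \<alpha>. \<integral>\<^sup>+\<omega>. F (char_mult \<kappa> \<omega>) \<partial>\<mu>)"
    by (rule nn_integral_sum) (use F translate_measurable' kerD(1) in \<open>auto intro: measurable_compose\<close>)
  also have "\<dots> = of_nat index * (\<integral>\<^sup>+\<omega>. F \<omega> \<partial>\<mu>)"
    using nn_integral_translate[OF kerD(1) F] card_ker by simp
  finally show ?thesis .
qed

lemma integral_fibre: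
  fixes F :: "_ \<Rightarrow> complex"
  assumes F: "integrable \<mu> F"
  shows "integrable \<mu> (\<lambda>\<omega>. \<Sum>\<zeta>\<in>fibre \<alpha> \<omega>. F \<zeta>)"
    and "(\<integral>\<omega>. (\<Sum>\<zeta>\<in>fibre \<alpha> \<omega>. F \<zeta>) \<partial>\<mu>) = of_nat index * (\<integral>\<omega>. F \<omega> \<partial>\<mu>)"
proof -
  let ?G = "\<lambda>\<omega>. \<Sum>\<zeta>\<in>fibre \<alpha> \<omega>. F \<zeta>"
  have Fm: "F \<in> borel_measurable \<mu>" using F by simp
  have G: "?G \<in> borel_measurable \<mu>" by (rule fibre_sum_measurable[OF Fm])
  have ti: "integrable \<mu> (\<lambda>\<omega>. F (char_mult \<kappa> \<omega>))"
    "(\<integral>\<omega>. F (char_mult \<kappa> \<omega>) \<partial>\<mu>) = (\<integral>\<omega>. F \<omega> \<partial>\<mu>)" if "\<kappa> \<in> dual_ker \<alpha>" for \<kappa>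
    using integrable_distr_eq[OF translate_measurable'[OF kerD(1)[OF that]] Fm]
      integral_distr[OF translate_measurable'[OF kerD(1)[OF that]] Fm]
      distr_translate[OF kerD(1)[OF that]] F by simp_all
  have e: "?G (dual_endo \<alpha> \<omega>) = (\<Sum>\<kappa>\<in>dual_ker \<alpha>. F (char_mult \<kappa> \<omega>))" if "\<omega> \<in> space \<mu>" for \<omega>
    using sum_fibre_endo that by (simp add: space_haar)
  have "integrable \<mu> (\<lambda>\<omega>. ?G (dual_endo \<alpha> \<omega>)) \<longleftrightarrow> integrable \<mu> (\<lambda>\<omega>. \<Sum>\<kappa>\<in>dual_ker \<alpha>. F (char_mult \<kappa> \<omega>))"
    by (rule Bochner_Integration.integrable_cong) (use e in auto)
  then have "integrable \<mu> (\<lambda>\<omega>. ?G (dual_endo \<alpha> \<omega>))" using ti by simp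
  then show "integrable \<mu> ?G" using integrable_distr_eq[OF endo_measurable' G] by (simp add: distr_endo)
  have "(\<integral>\<omega>. ?G \<omega> \<partial>\<mu>) = (\<integral>\<omega>. ?G (dual_endo \<alpha> \<omega>) \<partial>\<mu>)"
    using integral_distr[OF endo_measurable' G] by (simp add: distr_endo)
  also have "\<dots> = (\<integral>\<omega>. (\<Sum>\<kappa>\<in>dual_ker \<alpha>. F (char_mult \<kappa> \<omega>)) \<partial>\<mu>)"
    by (rule Bochner_Integration.integral_cong) (use e in auto)
  also have "\<dots> = of_nat index * (\<integral>\<omega>. F \<omega> \<partial>\<mu>)" using ti card_ker by simp
  finally show "(\<integral>\<omega>. ?G \<omega> \<partial>\<mu>) = of_nat index * (\<integral>\<omega>. F \<omega> \<partial>\<mu>)" .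
qed

text \<open>The fibre sum of the indicator of a null set has integral zero.\<close>

lemma AE_fibre:
  assumes "AE \<omega> in \<mu>. P \<omega>"
  shows "AE \<omega> in \<mu>. \<forall>\<zeta>\<in>fibre \<alpha> \<omega>. P \<zeta>"
proof -
  obtain Z where Z: "Z \<in> sets \<mu>" "emeasure \<mu> Z = 0" "{\<omega>\<in>space \<mu>. \<not> P \<omega>} \<subseteq> Z"
    using assms by (auto elim: AE_E)
  have m: "(indicator Z :: _ \<Rightarrow> ennreal) \<in> borel_measurable \<mu>" using Z(1) by simp
  have "(\<integral>\<^sup>+\<omega>. (\<Sum>\<zeta>\<in>fibre \<alpha> \<omega>. indicator Z \<zeta> :: ennreal) \<partial>\<mu>) = 0"
    using nn_integral_fibre[OF m] Z(1,2) by simp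
  then have "AE \<omega> in \<mu>. (\<Sum>\<zeta>\<in>fibre \<alpha> \<omega>. indicator Z \<zeta> :: ennreal) = 0"
    using nn_integral_0_iff_AE[OF fibre_sum_measurable[OF m]] by simp
  moreover have "AE \<omega> in \<mu>. \<omega> \<in> space \<mu>" by simp
  ultimately show ?thesis
  proof eventually_elim
    case (elim \<omega>)
    have "indicator Z \<zeta> = (0 :: ennreal)" if "\<zeta> \<in> fibre \<alpha> \<omega>" for \<zeta>
      using elim finite_fibre[of \<omega>] that by (simp add: space_haar)
    then have "\<zeta> \<notin> Z" if "\<zeta> \<in> fibre \<alpha> \<omega>" for \<zeta> using that by (metis indicator_simps(1) zero_neq_one)
    then show ?case using Z(3) fibreD(1) space_haar by blast
  qed
qed

lemma AE_endo:
  assumes "AE \<omega> in \<mu>. P \<omega>"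
  shows "AE \<omega> in \<mu>. P (dual_endo \<alpha> \<omega>)"
proof -
  have "AE \<omega> in distr \<mu> \<mu> (dual_endo \<alpha>). P \<omega>" unfolding distr_endo by (rule assms)
  then show ?thesis by (rule AE_distrD[OF endo_measurable'])
qed

section \<open>Vector-valued square-integrable functions\<close>

text \<open>An element of the direct sum of the spaces over \<open>\<sigma> i\<close> is regarded as one function whose value at
  \<open>\<omega>\<close> is a vector with coordinates \<open>i\<close>, \<open>\<omega> \<in> \<sigma> i\<close>.\<close>

definition zext :: "(nat \<Rightarrow> 'g character set) \<Rightarrow> (nat \<Rightarrow> 'g character \<Rightarrow> complex) \<Rightarrow> nat \<Rightarrow> 'g character \<Rightarrow> complex" where
  "zext \<sigma> f i \<omega> = indicator (\<sigma> i) \<omega> *\<^sub>R f i \<omega>"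

definition pairing :: "(nat \<Rightarrow> 'g character set) \<Rightarrow> (nat \<Rightarrow> 'g character \<Rightarrow> complex)
    \<Rightarrow> (nat \<Rightarrow> 'g character \<Rightarrow> complex) \<Rightarrow> 'g character \<Rightarrow> complex" where
  "pairing \<sigma> f g \<omega> = (\<Sum>i. zext \<sigma> f i \<omega> * cnj (zext \<sigma> g i \<omega>))"

definition locally_finite :: "(nat \<Rightarrow> 'g character set) \<Rightarrow> bool" where
  "locally_finite \<sigma> \<longleftrightarrow> (\<forall>i. \<sigma> i \<in> sets dual_borel) \<and> (AE \<omega> in \<mu>. finite {i. \<omega> \<in> \<sigma> i})"

lemma locally_finiteD:
  assumes "locally_finite \<sigma>"
  shows "\<sigma> i \<in> sets \<mu>" and "\<sigma> i \<inter> space \<mu> \<in> sets \<mu>" and "AE \<omega> in \<mu>. finite {i. \<omega> \<in> \<sigma> i}"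
  using assms unfolding locally_finite_def by (auto simp: sets_haar intro!: sets.Int_space_eq2)

lemma pairing_finite:
  assumes "finite {i. \<omega> \<in> \<sigma> i}"
  shows "pairing \<sigma> f g \<omega> = (\<Sum>i | \<omega> \<in> \<sigma> i. f i \<omega> * cnj (g i \<omega>))"
proof -
  have "pairing \<sigma> f g \<omega> = (\<Sum>i | \<omega> \<in> \<sigma> i. zext \<sigma> f i \<omega> * cnj (zext \<sigma> g i \<omega>))"
    unfolding pairing_def by (rule suminf_finite[OF assms]) (simp add: zext_def)
  also have "\<dots> = (\<Sum>i | \<omega> \<in> \<sigma> i. f i \<omega> * cnj (g i \<omega>))"
    by (rule sum.cong) (simp_all add: zext_def)
  finally show ?thesis .
qed

lemma V0_measurable_iff:
  assumes "locally_finite \<sigma>"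
  shows "f i \<in> borel_measurable (V0_measure \<mu> \<sigma> i) \<longleftrightarrow> zext \<sigma> f i \<in> borel_measurable \<mu>"
  unfolding V0_measure_def zext_def
  using borel_measurable_restrict_space_iff[OF locally_finiteD(2)[OF assms], of "f i" i] by (simp add: zext_def)

lemma zext_measurable:
  assumes "locally_finite \<sigma>" "f \<in> L2_families UNIV (V0_measure \<mu> \<sigma>)"
  shows "zext \<sigma> f i \<in> borel_measurable \<mu>"
  using V0_measurable_iff[OF assms(1)] L2_familiesD(1)[OF assms(2)] by simp

lemma pairing_measurable:
  assumes "\<And>i. zext \<sigma> f i \<in> borel_measurable \<mu>" "\<And>i. zext \<sigma> g i \<in> borel_measurable \<mu>"
  shows "pairing \<sigma> f g \<in> borel_measurable \<mu>"
  unfolding pairing_def[abs_def] using assms by measurable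

text \<open>Local finiteness turns the series over the coordinates into a finite sum almost everywhere, so it may be exchanged with the integral.\<close>

lemma V0_inner:
  assumes \<sigma>: "locally_finite \<sigma>"
    and f: "f \<in> L2_families UNIV (V0_measure \<mu> \<sigma>)" and g: "g \<in> L2_families UNIV (V0_measure \<mu> \<sigma>)"
  shows "integrable \<mu> (pairing \<sigma> f g)"
    and "(\<Sum>\<^sub>\<infinity>i\<in>UNIV. \<integral>x. f i x * cnj (g i x) \<partial>V0_measure \<mu> \<sigma> i) = (\<integral>\<omega>. pairing \<sigma> f g \<omega> \<partial>\<mu>)"
proof -
  let ?h = "\<lambda>i \<omega>. zext \<sigma> f i \<omega> * cnj (zext \<sigma> g i \<omega>)"
  have h: "?h i = (\<lambda>\<omega>. indicator (\<sigma> i) \<omega> *\<^sub>R (f i \<omega> * cnj (g i \<omega>)))" for i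
    unfolding zext_def by (auto simp: indicator_def fun_eq_iff)
  note \<sigma>m = locally_finiteD(2)[OF \<sigma>]
  have int: "integrable \<mu> (?h i)" for i
    using L2_inner_integrable[OF f g, of i] integrable_restrict_space[OF \<sigma>m, of i "\<lambda>\<omega>. f i \<omega> * cnj (g i \<omega>)"]
    unfolding h V0_measure_def by simp
  have eq: "(\<integral>\<omega>. ?h i \<omega> \<partial>\<mu>) = (\<integral>x. f i x * cnj (g i x) \<partial>V0_measure \<mu> \<sigma> i)" for i
    unfolding h V0_measure_def using integral_restrict_space[OF \<sigma>m, of i "\<lambda>\<omega>. f i \<omega> * cnj (g i \<omega>)"] by simp
  have hn: "(\<lambda>\<omega>. norm (?h i \<omega>)) = (\<lambda>\<omega>. indicator (\<sigma> i) \<omega> *\<^sub>R norm (f i \<omega> * cnj (g i \<omega>)))" for i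
    unfolding zext_def by (auto simp: indicator_def fun_eq_iff)
  have "(\<integral>\<omega>. norm (?h i \<omega>) \<partial>\<mu>) = (\<integral>x. norm (f i x * cnj (g i x)) \<partial>V0_measure \<mu> \<sigma> i)" for i
    unfolding hn V0_measure_def
    using integral_restrict_space[OF \<sigma>m, of i "\<lambda>\<omega>. norm (f i \<omega> * cnj (g i \<omega>))"] by simp
  then have sn: "summable (\<lambda>i. \<integral>\<omega>. norm (?h i \<omega>) \<partial>\<mu>)"
    using summable_on_imp_summable[OF L2_inner_abs_summable(1)[OF f g]] by simp
  have ae: "AE \<omega> in \<mu>. summable (\<lambda>i. norm (?h i \<omega>))"
    using locally_finiteD(3)[OF \<sigma>]
  proof eventually_elim
    case (elim \<omega>)
    then show ?case by (rule summable_finite) (simp add: zext_def)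
  qed
  show "integrable \<mu> (pairing \<sigma> f g)"
    unfolding pairing_def[abs_def] by (rule integrable_suminf[OF int ae sn])
  have "(\<lambda>i. \<integral>\<omega>. ?h i \<omega> \<partial>\<mu>) sums (\<integral>\<omega>. pairing \<sigma> f g \<omega> \<partial>\<mu>)"
    unfolding pairing_def by (rule sums_integral[OF int ae sn])
  moreover have "(\<lambda>i. \<integral>\<omega>. ?h i \<omega> \<partial>\<mu>) sums (\<Sum>\<^sub>\<infinity>i\<in>UNIV. \<integral>x. f i x * cnj (g i x) \<partial>V0_measure \<mu> \<sigma> i)"
    unfolding eq by (rule has_sum_imp_sums[OF has_sum_infsum[OF L2_inner_abs_summable(3)[OF f g]]])
  ultimately show "(\<Sum>\<^sub>\<infinity>i\<in>UNIV. \<integral>x. f i x * cnj (g i x) \<partial>V0_measure \<mu> \<sigma> i) = (\<integral>\<omega>. pairing \<sigma> f g \<omega> \<partial>\<mu>)"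
    by (rule sums_unique2[symmetric])
qed

lemma pairing_self:
  assumes "finite {i. \<omega> \<in> \<sigma> i}"
  shows "pairing \<sigma> f f \<omega> = of_real (\<Sum>i | \<omega> \<in> \<sigma> i. (cmod (f i \<omega>))\<^sup>2)"
  unfolding pairing_finite[OF assms] of_real_sum
  by (intro sum.cong refl) (simp only: complex_norm_square)

text \<open>Converse to the integrability of the pairing: one finite integral of the pointwise square norm suffices for membership in the direct sum.\<close>

lemma V0_familyI:
  assumes \<sigma>: "locally_finite \<sigma>"
    and m: "\<And>i. zext \<sigma> f i \<in> borel_measurable \<mu>"
    and fin: "(\<integral>\<^sup>+\<omega>. ennreal (norm (pairing \<sigma> f f \<omega>)) \<partial>\<mu>) < \<infinity>"
  shows "f \<in> L2_families UNIV (V0_measure \<mu> \<sigma>)"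
proof -
  note \<sigma>m = locally_finiteD(2)[OF \<sigma>]
  let ?n = "\<lambda>i \<omega>. (cmod (zext \<sigma> f i \<omega>))\<^sup>2"
  have nm: "?n i \<in> borel_measurable \<mu>" for i using m by measurable
  have "AE \<omega> in \<mu>. ennreal (norm (pairing \<sigma> f f \<omega>)) = (\<Sum>i. ennreal (?n i \<omega>))"
    using locally_finiteD(3)[OF \<sigma>]
  proof eventually_elim
    case (elim \<omega>)
    have "(\<Sum>i. ennreal (?n i \<omega>)) = (\<Sum>i | \<omega> \<in> \<sigma> i. ennreal (?n i \<omega>))"
      by (rule suminf_finite[OF elim]) (simp add: zext_def)
    also have "\<dots> = ennreal (\<Sum>i | \<omega> \<in> \<sigma> i. ?n i \<omega>)" by (rule sum_ennreal) simp
    also have "(\<Sum>i | \<omega> \<in> \<sigma> i. ?n i \<omega>) = (\<Sum>i | \<omega> \<in> \<sigma> i. (cmod (f i \<omega>))\<^sup>2)"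
      by (rule sum.cong) (simp_all add: zext_def)
    also have "\<dots> = norm (pairing \<sigma> f f \<omega>)" unfolding pairing_self[OF elim] norm_of_real
      by (simp add: sum_nonneg)
    finally show ?case ..
  qed
  then have "(\<integral>\<^sup>+\<omega>. ennreal (norm (pairing \<sigma> f f \<omega>)) \<partial>\<mu>) = (\<integral>\<^sup>+\<omega>. (\<Sum>i. ennreal (?n i \<omega>)) \<partial>\<mu>)"
    by (rule nn_integral_cong_AE)
  also have "\<dots> = (\<Sum>i. \<integral>\<^sup>+\<omega>. ennreal (?n i \<omega>) \<partial>\<mu>)" by (rule nn_integral_suminf) (use nm in measurable)
  finally have S: "(\<Sum>i. \<integral>\<^sup>+\<omega>. ennreal (?n i \<omega>) \<partial>\<mu>) < \<infinity>" using fin by simp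
  have each: "(\<integral>\<^sup>+\<omega>. ennreal (?n i \<omega>) \<partial>\<mu>) < \<infinity>" for i
  proof -
    have "(\<integral>\<^sup>+\<omega>. ennreal (?n i \<omega>) \<partial>\<mu>) \<le> (\<Sum>i. \<integral>\<^sup>+\<omega>. ennreal (?n i \<omega>) \<partial>\<mu>)"
      using sum_le_suminf[of "\<lambda>i. \<integral>\<^sup>+\<omega>. ennreal (?n i \<omega>) \<partial>\<mu>" "{i}"] by simp
    then show ?thesis using S by (rule le_less_trans)
  qed
  have nint: "integrable \<mu> (?n i)" for i
    using nm each by (intro integrableI_bounded) simp_all
  have e: "?n i = (\<lambda>\<omega>. indicator (\<sigma> i) \<omega> *\<^sub>R (cmod (f i \<omega>))\<^sup>2)" for i
    unfolding zext_def by (auto simp: indicator_def fun_eq_iff)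
  have fi: "integrable (V0_measure \<mu> \<sigma> i) (\<lambda>\<omega>. (cmod (f i \<omega>))\<^sup>2)" for i
    using nint[of i] unfolding V0_measure_def e integrable_restrict_space[OF \<sigma>m] .
  have fe: "(\<integral>\<omega>. (cmod (f i \<omega>))\<^sup>2 \<partial>V0_measure \<mu> \<sigma> i) = (\<integral>\<omega>. ?n i \<omega> \<partial>\<mu>)" for i
    unfolding V0_measure_def e integral_restrict_space[OF \<sigma>m] ..
  have "(\<integral>\<^sup>+\<omega>. ennreal (?n i \<omega>) \<partial>\<mu>) = ennreal (\<integral>\<omega>. ?n i \<omega> \<partial>\<mu>)" for i
    by (rule nn_integral_eq_integral[OF nint]) simp
  then have "(\<Sum>i. ennreal (\<integral>\<omega>. ?n i \<omega> \<partial>\<mu>)) \<noteq> \<infinity>" using S by simp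
  then have "summable (\<lambda>i. \<integral>\<omega>. ?n i \<omega> \<partial>\<mu>)"
    by (intro summable_suminf_not_top) (simp_all add: integral_nonneg_AE)
  then have "(\<lambda>i. \<integral>\<omega>. ?n i \<omega> \<partial>\<mu>) summable_on UNIV"
    by (intro norm_summable_imp_summable_on) (simp add: integral_nonneg_AE)
  then show ?thesis unfolding L2_families_def
    using fi fe V0_measurable_iff[OF \<sigma>] m by simp
qed

text \<open>The inner product of the two vectors that collect all values over the fibre of \<open>\<omega>\<close>.\<close>

definition fibre_pairing :: "(nat \<Rightarrow> 'g character set) \<Rightarrow> (nat \<Rightarrow> 'g character \<Rightarrow> complex)
    \<Rightarrow> (nat \<Rightarrow> 'g character \<Rightarrow> complex) \<Rightarrow> 'g character \<Rightarrow> complex" where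
  "fibre_pairing \<sigma> f g \<omega> = (\<Sum>\<zeta>\<in>fibre \<alpha> \<omega>. pairing \<sigma> f g \<zeta>)"

text \<open>Up to the factor \<open>N\<close> the inner product is the integral of the inner products over fibres.  This is the bridge from the direct sum to finite-dimensional vectors.\<close>

lemma V0_inner_fibre:
  assumes \<sigma>: "locally_finite \<sigma>"
    and f: "f \<in> L2_families UNIV (V0_measure \<mu> \<sigma>)" and g: "g \<in> L2_families UNIV (V0_measure \<mu> \<sigma>)"
  shows "integrable \<mu> (fibre_pairing \<sigma> f g)"
    and "of_nat index * (\<Sum>\<^sub>\<infinity>i\<in>UNIV. \<integral>x. f i x * cnj (g i x) \<partial>V0_measure \<mu> \<sigma> i) = (\<integral>\<omega>. fibre_pairing \<sigma> f g \<omega> \<partial>\<mu>)"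
  using integral_fibre[OF V0_inner(1)[OF \<sigma> f g]] V0_inner(2)[OF \<sigma> f g]
  unfolding fibre_pairing_def[abs_def] by simp_all

end

section \<open>Ruelle operators\<close>

context dual_system
begin

lemma supported_matrixD:
  assumes "supported_matrix \<mu> \<sigma> A"
  shows "A k j \<in> borel_measurable \<mu>" and "AE \<omega> in \<mu>. \<omega> \<notin> \<sigma> j \<longrightarrow> A k j \<omega> = 0"
  using assms unfolding supported_matrix_def by (auto simp: measurable_cong_sets[OF sets_haar refl])

lemma zext_supported_measurable:
  assumes "locally_finite \<sigma>" "\<And>j. f j \<in> borel_measurable \<mu>"
  shows "zext \<sigma> f j \<in> borel_measurable \<mu>"
proof -
  have [measurable]: "\<sigma> j \<in> sets \<mu>" "f j \<in> borel_measurable \<mu>" using locally_finiteD(1)[OF assms(1)] assms(2) by auto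
  show ?thesis unfolding zext_def[abs_def] by measurable
qed

text \<open>
  Over such a point every series in the definition of a Ruelle operator is a finite sum, so that
  pointwise identities are finite linear algebra.  Local finiteness makes almost every point regular.
\<close>

definition regular :: "(nat \<Rightarrow> 'g character set) \<Rightarrow> (nat \<Rightarrow> 'g character set) \<Rightarrow> 'g character \<Rightarrow> bool" where
  "regular \<sigma> E \<omega> \<longleftrightarrow> \<omega> \<in> dual_group \<and> finite {k. \<omega> \<in> E k} \<and> (\<forall>\<zeta>\<in>fibre \<alpha> \<omega>. finite {j. \<zeta> \<in> \<sigma> j})"

lemma AE_dual_group: "AE \<omega> in \<mu>. \<omega> \<in> dual_group"
  using AE_space[of \<mu>] by (simp add: space_haar)

lemma AE_regular:
  assumes "locally_finite \<sigma>" "locally_finite E"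
  shows "AE \<omega> in \<mu>. regular \<sigma> E \<omega>"
  using AE_dual_group locally_finiteD(3)[OF assms(2)] AE_fibre[OF locally_finiteD(3)[OF assms(1)]]
  unfolding regular_def by eventually_elim simp

lemma AE_fibre_imp:
  assumes "AE \<omega> in \<mu>. \<forall>\<zeta>\<in>fibre \<alpha> \<omega>. Q \<zeta>"
  shows "AE \<zeta> in \<mu>. Q \<zeta>"
  using AE_endo[OF assms] AE_dual_group by eventually_elim (simp add: fibre_def)

lemma fibre_pairing_finite:
  assumes "regular \<sigma> E \<omega>"
  shows "fibre_pairing \<sigma> f g \<omega> = (\<Sum>\<zeta>\<in>fibre \<alpha> \<omega>. \<Sum>j | \<zeta> \<in> \<sigma> j. f j \<zeta> * cnj (g j \<zeta>))"
  unfolding fibre_pairing_def using assms unfolding regular_def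
  by (intro sum.cong refl pairing_finite) simp

lemma fibre_pairing_cnj:
  assumes "regular \<sigma> E \<omega>"
  shows "fibre_pairing \<sigma> g f \<omega> = cnj (fibre_pairing \<sigma> f g \<omega>)"
  unfolding fibre_pairing_finite[OF assms] by (simp add: mult.commute)

text \<open>On a fibre the function \<open>f\<close> enters only through its value at the base point, so the image is the combination of the rows of \<open>A\<close> with coefficients \<open>f k \<omega>\<close>.\<close>

lemma ruelle_at_fibre:
  assumes "regular \<sigma> E \<omega>" "\<zeta> \<in> fibre \<alpha> \<omega>"
  shows "ruelle_fun \<alpha> E A f j \<zeta> = (\<Sum>k | \<omega> \<in> E k. A k j \<zeta> * f k \<omega>)"
proof -
  have fin: "finite {k. \<omega> \<in> E k}" using assms(1) unfolding regular_def by simp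
  have "ruelle_fun \<alpha> E A f j \<zeta> = (\<Sum>k. A k j \<zeta> * (if \<omega> \<in> E k then f k \<omega> else 0))"
    unfolding ruelle_fun_def fibreD(2)[OF assms(2)] ..
  also have "\<dots> = (\<Sum>k | \<omega> \<in> E k. A k j \<zeta> * (if \<omega> \<in> E k then f k \<omega> else 0))"
    by (rule suminf_finite[OF fin]) simp
  finally show ?thesis by simp
qed

lemma fibre_pairing_ruelle_right:
  assumes r: "regular \<sigma> E \<omega>"
  shows "fibre_pairing \<sigma> x (ruelle_fun \<alpha> E A f) \<omega> = (\<Sum>k | \<omega> \<in> E k. cnj (f k \<omega>) * fibre_pairing \<sigma> x (A k) \<omega>)"
proof -
  have "fibre_pairing \<sigma> x (ruelle_fun \<alpha> E A f) \<omega>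
      = (\<Sum>\<zeta>\<in>fibre \<alpha> \<omega>. \<Sum>j | \<zeta> \<in> \<sigma> j. \<Sum>k | \<omega> \<in> E k. cnj (f k \<omega>) * (x j \<zeta> * cnj (A k j \<zeta>)))"
    unfolding fibre_pairing_finite[OF r]
    by (intro sum.cong refl) (simp add: ruelle_at_fibre[OF r] sum_distrib_left mult_ac)
  also have "\<dots> = (\<Sum>\<zeta>\<in>fibre \<alpha> \<omega>. \<Sum>k | \<omega> \<in> E k. \<Sum>j | \<zeta> \<in> \<sigma> j. cnj (f k \<omega>) * (x j \<zeta> * cnj (A k j \<zeta>)))"
    by (intro sum.cong refl sum.swap)
  also have "\<dots> = (\<Sum>k | \<omega> \<in> E k. \<Sum>\<zeta>\<in>fibre \<alpha> \<omega>. \<Sum>j | \<zeta> \<in> \<sigma> j. cnj (f k \<omega>) * (x j \<zeta> * cnj (A k j \<zeta>)))"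
    by (rule sum.swap)
  finally show ?thesis unfolding fibre_pairing_finite[OF r] by (simp add: sum_distrib_left)
qed

lemma fibre_pairing_ruelle_left:
  assumes r: "regular \<sigma> E \<omega>"
  shows "fibre_pairing \<sigma> (ruelle_fun \<alpha> E A f) x \<omega> = (\<Sum>k | \<omega> \<in> E k. f k \<omega> * fibre_pairing \<sigma> (A k) x \<omega>)"
proof -
  have "fibre_pairing \<sigma> (ruelle_fun \<alpha> E A f) x \<omega> = cnj (fibre_pairing \<sigma> x (ruelle_fun \<alpha> E A f) \<omega>)"
    by (rule fibre_pairing_cnj[OF r])
  also have "\<dots> = (\<Sum>k | \<omega> \<in> E k. f k \<omega> * cnj (fibre_pairing \<sigma> x (A k) \<omega>))"
    unfolding fibre_pairing_ruelle_right[OF r] by simp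
  also have "\<dots> = (\<Sum>k | \<omega> \<in> E k. f k \<omega> * fibre_pairing \<sigma> (A k) x \<omega>)"
    by (intro sum.cong refl) (simp add: fibre_pairing_cnj[OF r, symmetric])
  finally show ?thesis .
qed

lemma ruelle_measurable:
  assumes A: "\<And>k j. A k j \<in> borel_measurable \<mu>" and E: "locally_finite E"
    and f: "f \<in> L2_families UNIV (V0_measure \<mu> E)"
  shows "ruelle_fun \<alpha> E A f j \<in> borel_measurable \<mu>"
proof -
  have z: "zext E f k \<omega> = (if \<omega> \<in> E k then f k \<omega> else 0)" for k \<omega> by (simp add: zext_def)
  have e: "ruelle_fun \<alpha> E A f j = (\<lambda>\<omega>. \<Sum>k. A k j \<omega> * zext E f k (dual_endo \<alpha> \<omega>))"
    unfolding ruelle_fun_def[abs_def] z ..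
  have "(\<lambda>\<omega>. zext E f k (dual_endo \<alpha> \<omega>)) \<in> borel_measurable \<mu>" for k
    by (rule measurable_compose[OF endo_measurable' zext_measurable[OF E f]])
  then show ?thesis unfolding e using A by measurable
qed

lemma ruelle_cong:
  assumes "\<And>k. AE \<omega> in \<mu>. \<omega> \<in> E k \<longrightarrow> f k \<omega> = f' k \<omega>"
  shows "AE \<omega> in \<mu>. \<forall>j. ruelle_fun \<alpha> E A f j \<omega> = ruelle_fun \<alpha> E A f' j \<omega>"
proof -
  have "AE \<omega> in \<mu>. \<forall>k. \<omega> \<in> E k \<longrightarrow> f k \<omega> = f' k \<omega>" using assms by (simp add: AE_all_countable)
  from AE_endo[OF this] show ?thesis
  proof eventually_elim
    case (elim \<omega>)
    then have "(\<lambda>k. A k j \<omega> * (if dual_endo \<alpha> \<omega> \<in> E k then f k (dual_endo \<alpha> \<omega>) else 0))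
        = (\<lambda>k. A k j \<omega> * (if dual_endo \<alpha> \<omega> \<in> E k then f' k (dual_endo \<alpha> \<omega>) else 0))" for j
      by (auto simp: fun_eq_iff)
    then show ?case unfolding ruelle_fun_def by simp
  qed
qed

lemma ruelle_lin:
  assumes "locally_finite E"
  shows "AE \<omega> in \<mu>. \<forall>j. ruelle_fun \<alpha> E A (\<lambda>k \<omega>. f k \<omega> + g k \<omega>) j \<omega>
      = ruelle_fun \<alpha> E A f j \<omega> + ruelle_fun \<alpha> E A g j \<omega>"
    and "AE \<omega> in \<mu>. \<forall>j. ruelle_fun \<alpha> E A (\<lambda>k \<omega>. a * f k \<omega>) j \<omega> = a * ruelle_fun \<alpha> E A f j \<omega>"
    and "AE \<omega> in \<mu>. \<forall>j. ruelle_fun \<alpha> E A (\<lambda>k \<omega>. \<omega> \<gamma> * f k \<omega>) j \<omega> = \<omega> (\<alpha> \<gamma>) * ruelle_fun \<alpha> E A f j \<omega>"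
proof -
  have R: "AE \<omega> in \<mu>. regular E E (dual_endo \<alpha> \<omega>) \<and> \<omega> \<in> fibre \<alpha> (dual_endo \<alpha> \<omega>)"
    using AE_endo[OF AE_regular[OF assms assms]] AE_dual_group
    by eventually_elim (simp add: fibre_def)
  show "AE \<omega> in \<mu>. \<forall>j. ruelle_fun \<alpha> E A (\<lambda>k \<omega>. f k \<omega> + g k \<omega>) j \<omega>
      = ruelle_fun \<alpha> E A f j \<omega> + ruelle_fun \<alpha> E A g j \<omega>"
    using R
  proof eventually_elim
    case (elim \<omega>)
    then show ?case using ruelle_at_fibre[of E E "dual_endo \<alpha> \<omega>" \<omega>]
      by (simp add: algebra_simps sum.distrib)
  qed
  show "AE \<omega> in \<mu>. \<forall>j. ruelle_fun \<alpha> E A (\<lambda>k \<omega>. a * f k \<omega>) j \<omega> = a * ruelle_fun \<alpha> E A f j \<omega>"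
    using R
  proof eventually_elim
    case (elim \<omega>)
    then show ?case using ruelle_at_fibre[of E E "dual_endo \<alpha> \<omega>" \<omega>]
      by (simp add: mult_ac sum_distrib_left)
  qed
  show "AE \<omega> in \<mu>. \<forall>j. ruelle_fun \<alpha> E A (\<lambda>k \<omega>. \<omega> \<gamma> * f k \<omega>) j \<omega> = \<omega> (\<alpha> \<gamma>) * ruelle_fun \<alpha> E A f j \<omega>"
    using R
  proof eventually_elim
    case (elim \<omega>)
    have "dual_endo \<alpha> \<omega> \<gamma> = \<omega> (\<alpha> \<gamma>)" unfolding dual_endo_def ..
    then show ?case using elim ruelle_at_fibre[of E E "dual_endo \<alpha> \<omega>" \<omega>]
      by (simp add: mult_ac sum_distrib_left)
  qed
qed

text \<open>Over almost every point \<open>\<omega>\<close> the rows \<open>k\<close> with \<open>\<omega> \<in> E k\<close> are orthogonal vectors of square length \<open>N\<close> and the other rows vanish.  Filters and complementary filters are the two instances.\<close>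

definition isometric_matrix :: "(nat \<Rightarrow> 'g character set) \<Rightarrow> (nat \<Rightarrow> 'g character set) \<Rightarrow> 'g filter_matrix \<Rightarrow> bool" where
  "isometric_matrix \<sigma> E A \<longleftrightarrow> (\<forall>k j. A k j \<in> borel_measurable \<mu>) \<and>
     (AE \<omega> in \<mu>. \<forall>k k'. fibre_pairing \<sigma> (A k) (A k') \<omega> = (if k = k' \<and> \<omega> \<in> E k then of_nat index else 0))"

lemma isometric_matrix_measurable: "isometric_matrix \<sigma> E A \<Longrightarrow> A k j \<in> borel_measurable \<mu>"
  unfolding isometric_matrix_def by blast

lemma ruelle_fibre_pairing:
  assumes r: "regular \<sigma> E \<omega>"
    and A: "\<forall>k k'. fibre_pairing \<sigma> (A k) (A k') \<omega> = (if k = k' \<and> \<omega> \<in> E k then of_nat index else 0)"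
  shows "fibre_pairing \<sigma> (ruelle_fun \<alpha> E A f) (ruelle_fun \<alpha> E A f') \<omega> = of_nat index * pairing E f f' \<omega>"
proof -
  have fin: "finite {k. \<omega> \<in> E k}" using r unfolding regular_def by simp
  have "fibre_pairing \<sigma> (A k) (ruelle_fun \<alpha> E A f') \<omega> = cnj (f' k \<omega>) * of_nat index" if "\<omega> \<in> E k" for k
  proof -
    have "fibre_pairing \<sigma> (A k) (ruelle_fun \<alpha> E A f') \<omega>
        = (\<Sum>k' | \<omega> \<in> E k'. if k' = k then cnj (f' k \<omega>) * of_nat index else 0)"
      unfolding fibre_pairing_ruelle_right[OF r] using A that by (intro sum.cong refl) auto
    also have "\<dots> = cnj (f' k \<omega>) * of_nat index" using fin that by simp
    finally show ?thesis .
  qed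
  then show ?thesis unfolding fibre_pairing_ruelle_left[OF r] pairing_finite[OF fin]
    by (simp add: sum_distrib_left mult_ac)
qed

lemma AE_ruelle_fibre_pairing:
  assumes "locally_finite \<sigma>" "locally_finite E" "isometric_matrix \<sigma> E A"
  shows "AE \<omega> in \<mu>. fibre_pairing \<sigma> (ruelle_fun \<alpha> E A f) (ruelle_fun \<alpha> E A f') \<omega> = of_nat index * pairing E f f' \<omega>"
proof -
  have "AE \<omega> in \<mu>. \<forall>k k'. fibre_pairing \<sigma> (A k) (A k') \<omega> = (if k = k' \<and> \<omega> \<in> E k then of_nat index else 0)"
    using assms(3) unfolding isometric_matrix_def by blast
  with AE_regular[OF assms(1,2)] show ?thesis by eventually_elim (rule ruelle_fibre_pairing)
qed

lemma norm_fibre_pairing_self: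
  assumes r: "regular \<sigma> E \<omega>"
  shows "ennreal (norm (fibre_pairing \<sigma> f f \<omega>)) = (\<Sum>\<zeta>\<in>fibre \<alpha> \<omega>. ennreal (norm (pairing \<sigma> f f \<zeta>)))"
proof -
  have p: "pairing \<sigma> f f \<zeta> = of_real (norm (pairing \<sigma> f f \<zeta>))" if "\<zeta> \<in> fibre \<alpha> \<omega>" for \<zeta>
  proof -
    have "finite {j. \<zeta> \<in> \<sigma> j}" using r that unfolding regular_def by blast
    then show ?thesis unfolding pairing_self[OF \<open>finite {j. \<zeta> \<in> \<sigma> j}\<close>] norm_of_real
      by (simp add: sum_nonneg)
  qed
  have "fibre_pairing \<sigma> f f \<omega> = of_real (\<Sum>\<zeta>\<in>fibre \<alpha> \<omega>. norm (pairing \<sigma> f f \<zeta>))"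
    unfolding fibre_pairing_def of_real_sum using p by (intro sum.cong refl) simp
  then have "norm (fibre_pairing \<sigma> f f \<omega>) = (\<Sum>\<zeta>\<in>fibre \<alpha> \<omega>. norm (pairing \<sigma> f f \<zeta>))"
    by (simp add: norm_of_real sum_nonneg del: of_real_sum)
  then show ?thesis by simp
qed

lemma nn_integral_fibre_pairing_self:
  assumes \<sigma>: "locally_finite \<sigma>" and m: "\<And>j. zext \<sigma> f j \<in> borel_measurable \<mu>"
  shows "(\<integral>\<^sup>+\<omega>. ennreal (norm (fibre_pairing \<sigma> f f \<omega>)) \<partial>\<mu>) = of_nat index * (\<integral>\<^sup>+\<omega>. ennreal (norm (pairing \<sigma> f f \<omega>)) \<partial>\<mu>)"
proof -
  have "(\<integral>\<^sup>+\<omega>. ennreal (norm (fibre_pairing \<sigma> f f \<omega>)) \<partial>\<mu>)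
      = (\<integral>\<^sup>+\<omega>. (\<Sum>\<zeta>\<in>fibre \<alpha> \<omega>. ennreal (norm (pairing \<sigma> f f \<zeta>))) \<partial>\<mu>)"
  proof (rule nn_integral_cong_AE)
    show "AE \<omega> in \<mu>. ennreal (norm (fibre_pairing \<sigma> f f \<omega>)) = (\<Sum>\<zeta>\<in>fibre \<alpha> \<omega>. ennreal (norm (pairing \<sigma> f f \<zeta>)))"
      using AE_regular[OF \<sigma> \<sigma>] by eventually_elim (rule norm_fibre_pairing_self)
  qed
  also have "\<dots> = of_nat index * (\<integral>\<^sup>+\<omega>. ennreal (norm (pairing \<sigma> f f \<omega>)) \<partial>\<mu>)"
    using pairing_measurable[OF m m] by (intro nn_integral_fibre) simp
  finally show ?thesis .
qed

lemma of_nat_index_mult_finite: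
  assumes "(of_nat index :: ennreal) * x < \<infinity>"
  shows "x < \<infinity>"
  using assms index_pos by (auto simp: ennreal_mult_less_top)

text \<open>By orthogonality of the rows, the square norm of the image over a fibre is \<open>N\<close> times that of \<open>f\<close> at the base point.\<close>

lemma ruelle_family:
  assumes \<sigma>: "locally_finite \<sigma>" and E: "locally_finite E" and A: "isometric_matrix \<sigma> E A"
    and f: "f \<in> L2_families UNIV (V0_measure \<mu> E)"
  shows "ruelle_fun \<alpha> E A f \<in> L2_families UNIV (V0_measure \<mu> \<sigma>)"
proof (rule V0_familyI[OF \<sigma>])
  let ?R = "ruelle_fun \<alpha> E A f"
  show m: "zext \<sigma> ?R j \<in> borel_measurable \<mu>" for j
    by (rule zext_supported_measurable[OF \<sigma> ruelle_measurable[OF isometric_matrix_measurable[OF A] E f]])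
  have "of_nat index * (\<integral>\<^sup>+\<omega>. ennreal (norm (pairing \<sigma> ?R ?R \<omega>)) \<partial>\<mu>)
      = (\<integral>\<^sup>+\<omega>. ennreal (norm (fibre_pairing \<sigma> ?R ?R \<omega>)) \<partial>\<mu>)"
    using nn_integral_fibre_pairing_self[OF \<sigma> m] by simp
  also have "\<dots> = (\<integral>\<^sup>+\<omega>. ennreal (norm (of_nat index * pairing E f f \<omega>)) \<partial>\<mu>)"
  proof (rule nn_integral_cong_AE)
    show "AE \<omega> in \<mu>. ennreal (norm (fibre_pairing \<sigma> ?R ?R \<omega>)) = ennreal (norm (of_nat index * pairing E f f \<omega>))"
      using AE_ruelle_fibre_pairing[OF \<sigma> E A, of f f] by eventually_elim simp
  qed
  also have "\<dots> < \<infinity>"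
  proof -
    have "integrable \<mu> (\<lambda>\<omega>. of_nat index * pairing E f f \<omega>)" using V0_inner(1)[OF E f f] by simp
    then show ?thesis unfolding integrable_iff_bounded by simp
  qed
  finally show "(\<integral>\<^sup>+\<omega>. ennreal (norm (pairing \<sigma> ?R ?R \<omega>)) \<partial>\<mu>) < \<infinity>"
    by (rule of_nat_index_mult_finite)
qed

lemma ruelle_inner:
  assumes \<sigma>: "locally_finite \<sigma>" and E: "locally_finite E" and A: "isometric_matrix \<sigma> E A"
    and f: "f \<in> L2_families UNIV (V0_measure \<mu> E)" and f': "f' \<in> L2_families UNIV (V0_measure \<mu> E)"
  shows "(\<Sum>\<^sub>\<infinity>j\<in>UNIV. \<integral>x. ruelle_fun \<alpha> E A f j x * cnj (ruelle_fun \<alpha> E A f' j x) \<partial>V0_measure \<mu> \<sigma> j)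
    = (\<Sum>\<^sub>\<infinity>k\<in>UNIV. \<integral>x. f k x * cnj (f' k x) \<partial>V0_measure \<mu> E k)"
proof -
  let ?R = "ruelle_fun \<alpha> E A"
  note fam = ruelle_family[OF \<sigma> E A f] ruelle_family[OF \<sigma> E A f']
  have "of_nat index * (\<Sum>\<^sub>\<infinity>j\<in>UNIV. \<integral>x. ?R f j x * cnj (?R f' j x) \<partial>V0_measure \<mu> \<sigma> j)
      = (\<integral>\<omega>. fibre_pairing \<sigma> (?R f) (?R f') \<omega> \<partial>\<mu>)"
    by (rule V0_inner_fibre(2)[OF \<sigma> fam])
  also have "\<dots> = (\<integral>\<omega>. of_nat index * pairing E f f' \<omega> \<partial>\<mu>)"
    using V0_inner_fibre(1)[OF \<sigma> fam] V0_inner(1)[OF E f f'] AE_ruelle_fibre_pairing[OF \<sigma> E A, of f f']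
    by (intro integral_cong_AE) auto
  also have "\<dots> = of_nat index * (\<Sum>\<^sub>\<infinity>k\<in>UNIV. \<integral>x. f k x * cnj (f' k x) \<partial>V0_measure \<mu> E k)"
    using V0_inner(2)[OF E f f'] by simp
  finally show ?thesis using index_pos by simp
qed

lemma ruelle_orthogonal:
  assumes \<sigma>: "locally_finite \<sigma>" and E: "locally_finite E" and E': "locally_finite E'"
    and A: "isometric_matrix \<sigma> E A" and B: "isometric_matrix \<sigma> E' B"
    and AB: "AE \<omega> in \<mu>. \<forall>k i. fibre_pairing \<sigma> (A k) (B i) \<omega> = 0"
    and f: "f \<in> L2_families UNIV (V0_measure \<mu> E)" and f': "f' \<in> L2_families UNIV (V0_measure \<mu> E')"
  shows "(\<Sum>\<^sub>\<infinity>j\<in>UNIV. \<integral>x. ruelle_fun \<alpha> E A f j x * cnj (ruelle_fun \<alpha> E' B f' j x) \<partial>V0_measure \<mu> \<sigma> j) = 0"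
proof -
  let ?R = "ruelle_fun \<alpha> E A f" and ?S = "ruelle_fun \<alpha> E' B f'"
  note fam = ruelle_family[OF \<sigma> E A f] ruelle_family[OF \<sigma> E' B f']
  have "AE \<omega> in \<mu>. fibre_pairing \<sigma> ?R ?S \<omega> = 0"
    using AE_regular[OF \<sigma> E] AE_regular[OF \<sigma> E'] AB
    by eventually_elim (simp add: fibre_pairing_ruelle_left fibre_pairing_ruelle_right)
  then have "(\<integral>\<omega>. fibre_pairing \<sigma> ?R ?S \<omega> \<partial>\<mu>) = 0" by (rule integral_eq_zero_AE)
  then show ?thesis using V0_inner_fibre(2)[OF \<sigma> fam] index_pos by simp
qed

text \<open>Over almost every point the two matrices form an orthogonal system of vectors on the finite set
  of pairs \<open>(\<zeta>, j)\<close>, \<open>\<zeta>\<close> in the fibre and \<open>\<zeta> \<in> \<sigma> j\<close>.  Equality of the cardinalities makes it an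
  orthogonal basis, so a vector orthogonal to the rows of \<open>B\<close> is a combination of the rows of \<open>A\<close>.\<close>

lemma orthogonal_rows:
  fixes A B :: "'g filter_matrix"
  assumes r: "regular \<sigma> E \<omega>" "regular \<sigma> E' \<omega>"
    and A: "\<forall>k k'. fibre_pairing \<sigma> (A k) (A k') \<omega> = (if k = k' \<and> \<omega> \<in> E k then of_nat index else 0)"
    and B: "\<forall>k k'. fibre_pairing \<sigma> (B k) (B k') \<omega> = (if k = k' \<and> \<omega> \<in> E' k then of_nat index else 0)"
    and AB: "\<forall>k i. fibre_pairing \<sigma> (A k) (B i) \<omega> = 0"
    and card: "card {i. \<omega> \<in> E' i} + card {k. \<omega> \<in> E k} = (\<Sum>\<zeta>\<in>fibre \<alpha> \<omega>. card {j. \<zeta> \<in> \<sigma> j})"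
    and x: "\<forall>i. fibre_pairing \<sigma> x (B i) \<omega> = 0"
    and \<zeta>: "\<zeta> \<in> fibre \<alpha> \<omega>" "\<zeta> \<in> \<sigma> j"
  shows "x j \<zeta> = ruelle_fun \<alpha> E A (\<lambda>k \<omega>. fibre_pairing \<sigma> x (A k) \<omega> / of_nat index) j \<zeta>"
proof -
  let ?P = "SIGMA \<zeta>:fibre \<alpha> \<omega>. {j. \<zeta> \<in> \<sigma> j}"
  let ?A = "{i. \<omega> \<in> E' i} <+> {k. \<omega> \<in> E k}"
  define u where "u a = (case a of Inl i \<Rightarrow> (\<lambda>(\<zeta>, j). B i j \<zeta>) | Inr k \<Rightarrow> (\<lambda>(\<zeta>, j). A k j \<zeta>))" for a
  have fin: "finite (fibre \<alpha> \<omega>)" "finite {i. \<omega> \<in> E' i}" "finite {k. \<omega> \<in> E k}"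
    "\<forall>\<zeta>\<in>fibre \<alpha> \<omega>. finite {j. \<zeta> \<in> \<sigma> j}"
    using r finite_fibre unfolding regular_def by auto
  have pair: "(\<Sum>(\<zeta>, j)\<in>?P. f j \<zeta> * cnj (g j \<zeta>)) = fibre_pairing \<sigma> f g \<omega>" for f g
    unfolding fibre_pairing_finite[OF r(1)] using fin by (subst sum.Sigma) auto
  have pair': "(\<Sum>p\<in>?P. (case p of (\<zeta>, j) \<Rightarrow> f j \<zeta>) * cnj (case p of (\<zeta>, j) \<Rightarrow> g j \<zeta>)) = fibre_pairing \<sigma> f g \<omega>" for f g
    unfolding pair[symmetric] by (intro sum.cong refl) auto
  have BA: "fibre_pairing \<sigma> (B i) (A k) \<omega> = 0" for i k
    using fibre_pairing_cnj[OF r(1), of "B i" "A k"] AB by simp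
  have orth: "(\<Sum>q\<in>?P. u a q * cnj (u b q)) = (if a = b then of_real (real index) else 0)"
    if "a \<in> ?A" "b \<in> ?A" for a b
    using that A B AB BA by (cases a; cases b) (auto simp: u_def pair')
  have cardA: "card ?A = card ?P" using card fin by (simp add: card_Plus card_SigmaI)
  have "of_real (real index) * (case (\<zeta>, j) of (\<zeta>, j) \<Rightarrow> x j \<zeta>)
      = (\<Sum>a\<in>?A. (\<Sum>p\<in>?P. (case p of (\<zeta>, j) \<Rightarrow> x j \<zeta>) * cnj (u a p)) * u a (\<zeta>, j))"
    by (rule orthogonal_complete[OF _ _ _ orth cardA]) (use fin index_pos \<zeta> in auto)
  also have "\<dots> = (\<Sum>k | \<omega> \<in> E k. fibre_pairing \<sigma> x (A k) \<omega> * A k j \<zeta>)"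
    using fin x by (simp add: sum.Plus u_def pair')
  finally have "x j \<zeta> = (\<Sum>k | \<omega> \<in> E k. fibre_pairing \<sigma> x (A k) \<omega> * A k j \<zeta>) / of_nat index"
    using index_pos by (simp add: field_simps)
  also have "\<dots> = ruelle_fun \<alpha> E A (\<lambda>k \<omega>. fibre_pairing \<sigma> x (A k) \<omega> / of_nat index) j \<zeta>"
    unfolding ruelle_at_fibre[OF r(1) \<zeta>(1)] by (simp add: sum_divide_distrib mult.commute)
  finally show ?thesis .
qed

text \<open>The coefficients of the pointwise expansion are the pairings of \<open>x\<close> with the rows of \<open>A\<close>; their square norm is controlled by that of \<open>x\<close>, so they form an element of the direct sum.\<close>

lemma ruelle_surjective:
  assumes \<sigma>: "locally_finite \<sigma>" and E: "locally_finite E" and E': "locally_finite E'"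
    and A: "isometric_matrix \<sigma> E A" and B: "isometric_matrix \<sigma> E' B"
    and AB: "AE \<omega> in \<mu>. \<forall>k i. fibre_pairing \<sigma> (A k) (B i) \<omega> = 0"
    and card: "AE \<omega> in \<mu>. card {i. \<omega> \<in> E' i} + card {k. \<omega> \<in> E k} = (\<Sum>\<zeta>\<in>fibre \<alpha> \<omega>. card {j. \<zeta> \<in> \<sigma> j})"
    and x: "x \<in> L2_families UNIV (V0_measure \<mu> \<sigma>)"
    and xB: "AE \<omega> in \<mu>. \<forall>i. fibre_pairing \<sigma> x (B i) \<omega> = 0"
  shows "\<exists>b\<in>L2_families UNIV (V0_measure \<mu> E). \<forall>j. AE \<omega> in \<mu>. \<omega> \<in> \<sigma> j \<longrightarrow> x j \<omega> = ruelle_fun \<alpha> E A b j \<omega>"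
proof -
  define b where "b k \<omega> = fibre_pairing \<sigma> x (A k) \<omega> / of_nat index" for k \<omega>
  let ?R = "ruelle_fun \<alpha> E A b"
  have gA: "AE \<omega> in \<mu>. \<forall>k k'. fibre_pairing \<sigma> (A k) (A k') \<omega> = (if k = k' \<and> \<omega> \<in> E k then of_nat index else 0)"
    and gB: "AE \<omega> in \<mu>. \<forall>k k'. fibre_pairing \<sigma> (B k) (B k') \<omega> = (if k = k' \<and> \<omega> \<in> E' k then of_nat index else 0)"
    using A B unfolding isometric_matrix_def by auto
  have good: "AE \<omega> in \<mu>. \<forall>\<zeta>\<in>fibre \<alpha> \<omega>. \<forall>j. \<zeta> \<in> \<sigma> j \<longrightarrow> x j \<zeta> = ?R j \<zeta>"
    using AE_regular[OF \<sigma> E] AE_regular[OF \<sigma> E'] gA gB AB card xB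
  proof eventually_elim
    case (elim \<omega>)
    show ?case using orthogonal_rows[OF elim] unfolding b_def by blast
  qed
  have bm: "b k \<in> borel_measurable \<mu>" for k
  proof -
    have "pairing \<sigma> x (A k) \<in> borel_measurable \<mu>"
      by (intro pairing_measurable zext_measurable[OF \<sigma> x]
          zext_supported_measurable[OF \<sigma> isometric_matrix_measurable[OF A]])
    then show ?thesis unfolding b_def[abs_def] fibre_pairing_def
      by (intro borel_measurable_divide fibre_sum_measurable) auto
  qed
  have "b \<in> L2_families UNIV (V0_measure \<mu> E)"
  proof (rule V0_familyI[OF E zext_supported_measurable[OF E bm]])
    have "AE \<omega> in \<mu>. ennreal (norm (fibre_pairing \<sigma> x x \<omega>)) = of_nat index * ennreal (norm (pairing E b b \<omega>))"
      using good AE_regular[OF \<sigma> E] gA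
    proof eventually_elim
      case (elim \<omega>)
      have "fibre_pairing \<sigma> x x \<omega> = fibre_pairing \<sigma> ?R ?R \<omega>"
        unfolding fibre_pairing_finite[OF elim(2)] using elim(1) by (intro sum.cong refl) auto
      also have "\<dots> = of_nat index * pairing E b b \<omega>" by (rule ruelle_fibre_pairing[OF elim(2,3)])
      finally show ?case by (simp add: norm_mult ennreal_mult ennreal_of_nat_eq_real_of_nat)
    qed
    then have "(\<integral>\<^sup>+\<omega>. ennreal (norm (fibre_pairing \<sigma> x x \<omega>)) \<partial>\<mu>)
        = (\<integral>\<^sup>+\<omega>. of_nat index * ennreal (norm (pairing E b b \<omega>)) \<partial>\<mu>)" by (rule nn_integral_cong_AE)
    also have "\<dots> = of_nat index * (\<integral>\<^sup>+\<omega>. ennreal (norm (pairing E b b \<omega>)) \<partial>\<mu>)"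
    proof (rule nn_integral_cmult)
      have "pairing E b b \<in> borel_measurable \<mu>"
        by (intro pairing_measurable zext_supported_measurable[OF E bm])
      then show "(\<lambda>\<omega>. ennreal (norm (pairing E b b \<omega>))) \<in> borel_measurable \<mu>" by simp
    qed
    finally show "(\<integral>\<^sup>+\<omega>. ennreal (norm (pairing E b b \<omega>)) \<partial>\<mu>) < \<infinity>"
      using V0_inner_fibre(1)[OF \<sigma> x x] of_nat_index_mult_finite unfolding integrable_iff_bounded by metis
  qed
  moreover have "AE \<zeta> in \<mu>. \<forall>j. \<zeta> \<in> \<sigma> j \<longrightarrow> x j \<zeta> = ?R j \<zeta>" by (rule AE_fibre_imp[OF good])
  then have "\<forall>j. AE \<omega> in \<mu>. \<omega> \<in> \<sigma> j \<longrightarrow> x j \<omega> = ?R j \<omega>" by (simp add: AE_all_countable)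
  ultimately show ?thesis by blast
qed

end

section \<open>Unitary maps between direct sums of L2 spaces\<close>

text \<open>Maps on classes are handled through maps \<open>\<Phi>\<close> on families, for which linearity has to hold almost everywhere.  Injectivity follows from the preservation of inner products.\<close>

lemma L2_unitary_mapI:
  assumes T: "\<And>f. f \<in> L2_families I M \<Longrightarrow> T (L2_class I M f) = L2_class I' M' (\<Phi> f)"
    and fam: "\<And>f. f \<in> L2_families I M \<Longrightarrow> \<Phi> f \<in> L2_families I' M'"
    and add: "\<And>f g i. f \<in> L2_families I M \<Longrightarrow> g \<in> L2_families I M \<Longrightarrow> i \<in> I'
      \<Longrightarrow> AE x in M' i. \<Phi> (\<lambda>i x. f i x + g i x) i x = \<Phi> f i x + \<Phi> g i x"
    and scale: "\<And>a f i. f \<in> L2_families I M \<Longrightarrow> i \<in> I'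
      \<Longrightarrow> AE x in M' i. \<Phi> (\<lambda>i x. a * f i x) i x = a * \<Phi> f i x"
    and inner: "\<And>f g. f \<in> L2_families I M \<Longrightarrow> g \<in> L2_families I M
      \<Longrightarrow> (\<Sum>\<^sub>\<infinity>i\<in>I'. \<integral>x. \<Phi> f i x * cnj (\<Phi> g i x) \<partial>M' i) = (\<Sum>\<^sub>\<infinity>i\<in>I. \<integral>x. f i x * cnj (g i x) \<partial>M i)"
    and S: "S = T ` hcarrier (L2_sum I M)"
  shows "unitary_map (L2_sum I M) (subspace_hspace (L2_sum I' M') S) T"
proof -
  have inj: "inj_on T (hcarrier (L2_sum I M))"
  proof (rule inj_onI)
    fix F G assume "F \<in> hcarrier (L2_sum I M)" "G \<in> hcarrier (L2_sum I M)" and e: "T F = T G"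
    then obtain f g where f: "f \<in> L2_families I M" "F = L2_class I M f"
      and g: "g \<in> L2_families I M" "G = L2_class I M g" using L2_sum_carrier by metis
    have fam_g: "(\<lambda>i x. (-1) * g i x) \<in> L2_families I M" by (rule L2_families_scale[OF g(1)])
    define h where "h = (\<lambda>i x. f i x + (-1) * g i x)"
    have h: "h \<in> L2_families I M" unfolding h_def by (rule L2_families_add[OF f(1) fam_g])
    have cls: "L2_class I' M' (\<Phi> f) = L2_class I' M' (\<Phi> g)" using e f g T by simp
    have "AE x in M' i. \<Phi> h i x * cnj (\<Phi> h i x) = 0" if i: "i \<in> I'" for i
      using add[OF f(1) fam_g i] scale[OF g(1) i, of "-1"] L2_class_eqD[OF fam[OF f(1)] cls i]
      unfolding h_def by eventually_elim simp
    then have "(\<integral>x. \<Phi> h i x * cnj (\<Phi> h i x) \<partial>M' i) = 0" if "i \<in> I'" for i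
      using that by (intro integral_eq_zero_AE) auto
    then have "(\<Sum>\<^sub>\<infinity>i\<in>I. \<integral>x. h i x * cnj (h i x) \<partial>M i) = 0"
      unfolding inner[OF h h, symmetric] by (intro infsum_0) auto
    then have "(\<Sum>\<^sub>\<infinity>i\<in>I. \<integral>x. (f i x - g i x) * cnj (f i x - g i x) \<partial>M i) = 0"
      unfolding h_def by simp
    then show "F = G" unfolding f g by (rule L2_definite[OF f(1) g(1)])
  qed
  show ?thesis unfolding unitary_map_def
  proof (intro conjI ballI allI)
    show "bij_betw T (hcarrier (L2_sum I M)) (hcarrier (subspace_hspace (L2_sum I' M') S))"
      using inj S by (simp add: bij_betw_def)
  next
    fix F G assume F: "F \<in> hcarrier (L2_sum I M)" and G: "G \<in> hcarrier (L2_sum I M)"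
    then obtain f g where f: "f \<in> L2_families I M" "F = L2_class I M f"
      and g: "g \<in> L2_families I M" "G = L2_class I M g" using L2_sum_carrier by metis
    show "T (hadd (L2_sum I M) F G) = hadd (subspace_hspace (L2_sum I' M') S) (T F) (T G)"
      using f g by (simp add: L2_add_class T L2_families_add fam L2_class_cong[OF add])
    show "hinner (subspace_hspace (L2_sum I' M') S) (T F) (T G) = hinner (L2_sum I M) F G"
      using f g by (simp add: L2_inner_class T fam inner)
  next
    fix a F assume F: "F \<in> hcarrier (L2_sum I M)"
    then obtain f where f: "f \<in> L2_families I M" "F = L2_class I M f" using L2_sum_carrier by metis
    show "T (hscale (L2_sum I M) a F) = hscale (subspace_hspace (L2_sum I' M') S) a (T F)"
      using f by (simp add: L2_scale_class T L2_families_scale fam L2_class_cong[OF scale])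
  qed
qed

lemma modulate_class:
  assumes f: "f \<in> L2_families J L"
  shows "modulate J L \<gamma> (L2_class J L f) = L2_class J L (\<lambda>i \<omega>. \<omega> \<gamma> * f i \<omega>)"
  unfolding modulate_def
proof (rule L2_class_cong)
  fix i assume "i \<in> J"
  from L2_rep_AE[OF f this] show "AE x in L i. x \<gamma> * L2_rep (L2_class J L f) i x = x \<gamma> * f i x"
    by eventually_elim simp
qed

section \<open>Dilation\<close>

text \<open>The measure spaces to which dilation is applied: a Borel subset of the dual group with the Borel sets inside it, and any measure.\<close>

definition dual_part :: "('g :: ab_group_add) character measure \<Rightarrow> bool" where
  "dual_part \<nu> \<longleftrightarrow> space \<nu> \<in> sets dual_borel \<and> sets \<nu> = sets (restrict_space dual_borel (space \<nu>))"

lemma dual_part_restrict: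
  assumes "sets \<mu> = sets dual_borel" "E \<in> sets dual_borel"
  shows "dual_part (restrict_space \<mu> E)" and "space (restrict_space \<mu> E) = E"
proof -
  have "space \<mu> = dual_group" using sets_eq_imp_space_eq[OF assms(1)] by (simp add: space_dual_borel)
  moreover have "E \<subseteq> dual_group" using sets.sets_into_space[OF assms(2)] by (simp add: space_dual_borel)
  ultimately show s: "space (restrict_space \<mu> E) = E" by (auto simp: space_restrict_space)
  show "dual_part (restrict_space \<mu> E)"
    unfolding dual_part_def s using assms by (simp add: sets_restrict_space)
qed

context
  fixes \<nu> :: "('g :: ab_group_add) character measure"
  assumes \<nu>: "dual_part \<nu>"
begin

lemma dual_part_subset: "space \<nu> \<subseteq> dual_group"
  using \<nu> sets.sets_into_space[of "space \<nu>" dual_borel] unfolding dual_part_def by (simp add: space_dual_borel)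

lemma sets_dual_part: "sets \<nu> = sets (restrict_space dual_borel (space \<nu>))"
  using \<nu> unfolding dual_part_def by blast

lemma dual_part_sets:
  assumes "E \<in> sets dual_borel"
  shows "E \<inter> space \<nu> \<in> sets \<nu>"
proof -
  have "E \<inter> space \<nu> \<in> sets (restrict_space dual_borel (space \<nu>))"
    unfolding sets_restrict_space using assms by blast
  then show ?thesis by (simp only: sets_dual_part[symmetric])
qed

lemma dual_part_measurable:
  assumes "f \<in> dual_borel \<rightarrow>\<^sub>M K"
  shows "f \<in> \<nu> \<rightarrow>\<^sub>M K"
proof -
  have "f \<in> restrict_space dual_borel (space \<nu>) \<rightarrow>\<^sub>M K" by (rule measurable_restrict_space1[OF assms])
  then show ?thesis by (simp only: measurable_cong_sets[OF sets_dual_part[symmetric] refl])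
qed

lemma dual_part_measurable_into:
  assumes "f \<in> K \<rightarrow>\<^sub>M dual_borel" "\<And>x. x \<in> space K \<Longrightarrow> f x \<in> space \<nu>"
  shows "f \<in> K \<rightarrow>\<^sub>M \<nu>"
proof -
  have "f \<in> K \<rightarrow>\<^sub>M restrict_space dual_borel (space \<nu>)"
    using assms by (intro measurable_restrict_space2) auto
  then show ?thesis by (simp only: measurable_cong_sets[OF refl sets_dual_part[symmetric]])
qed

end

lemma modulate_family:
  assumes M: "\<And>i. i \<in> I \<Longrightarrow> dual_part (M i)" and f: "f \<in> L2_families I M"
  shows "(\<lambda>i \<omega>. \<omega> \<gamma> * f i \<omega>) \<in> L2_families I M"
proof (rule L2_families_cong[OF f])
  fix i assume i: "i \<in> I"
  have "(\<lambda>\<omega>. \<omega> \<gamma>) \<in> borel_measurable (M i)"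
    by (rule dual_part_measurable[OF M[OF i] borel_measurable_char])
  then show "(\<lambda>\<omega>. \<omega> \<gamma> * f i \<omega>) \<in> borel_measurable (M i)"
    using L2_familiesD(1)[OF f i] by (rule borel_measurable_times)
  show "AE x in M i. cmod (x \<gamma> * f i x) = cmod (f i x)"
    by (rule AE_I2) (use dual_part_subset[OF M[OF i]] in \<open>auto simp: norm_mult dual_groupD\<close>)
qed

lemma scale_measure_of_nat: "scale_measure (of_nat n) M = density M (\<lambda>_. ennreal (real n))"
  by (rule measure_eqI) (simp_all add: emeasure_density_const ennreal_of_nat_eq_real_of_nat)

context dual_system
begin

text \<open>The branch of the inverse of the dual endomorphism whose values have defect \<open>\<zeta>\<close>.\<close>

definition sheet :: "'g character \<Rightarrow> 'g character \<Rightarrow> 'g character" where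
  "sheet \<zeta> \<omega> = char_mult (char_inverse \<zeta>) (c \<omega>)"

text \<open>On this part of the space the dual endomorphism is injective, with inverse \<open>sheet \<zeta>\<close>.\<close>

definition sheet_part :: "'g character measure \<Rightarrow> 'g character \<Rightarrow> 'g character set" where
  "sheet_part \<nu> \<zeta> = {\<omega> \<in> space \<nu>. cs_defect \<alpha> c \<omega> = \<zeta>}"

lemma defect_measurable: "cs_defect \<alpha> c \<in> dual_borel \<rightarrow>\<^sub>M dual_borel"
proof -
  have "(\<lambda>\<omega> :: 'g character. char_inverse \<omega>) \<in> dual_borel \<rightarrow>\<^sub>M dual_borel"
  proof (rule measurable_dual_borelI)
    show "(\<lambda>\<omega>. char_inverse \<omega> \<gamma>) \<in> borel_measurable dual_borel" for \<gamma> :: 'g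
      unfolding char_inverse_def by (intro borel_measurable_inverse borel_measurable_char)
  qed (simp add: space_dual_borel char_inverse_closed)
  moreover have "(\<lambda>\<omega>. c (dual_endo \<alpha> \<omega>)) \<in> dual_borel \<rightarrow>\<^sub>M dual_borel"
    by (rule measurable_compose[OF endo_measurable cross_measurable])
  ultimately show ?thesis unfolding cs_defect_def[abs_def] by (rule measurable_char_mult[rotated])
qed

lemma defect_in_ker: "\<omega> \<in> dual_group \<Longrightarrow> cs_defect \<alpha> c \<omega> \<in> dual_ker \<alpha>"
proof -
  assume \<omega>: "\<omega> \<in> dual_group"
  have "dual_endo \<alpha> (cs_defect \<alpha> c \<omega>) = (\<lambda>_. 1)"
    unfolding cs_defect_def dual_endo_mult dual_endo_inverse endo_cross[OF endo_closed[OF \<omega>]]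
    using dual_groupD(3)[OF endo_closed[OF \<omega>]] by (simp add: char_mult_def char_inverse_def)
  moreover have "cs_defect \<alpha> c \<omega> \<in> dual_group"
    using measurable_space[OF defect_measurable] \<omega> by (simp add: space_dual_borel)
  ultimately show ?thesis unfolding dual_ker_def by simp
qed

lemma sheet_defect:
  assumes "\<omega> \<in> dual_group"
  shows "sheet (cs_defect \<alpha> c \<omega>) (dual_endo \<alpha> \<omega>) = \<omega>"
proof -
  have nz: "\<omega> \<gamma> \<noteq> 0" "c (dual_endo \<alpha> \<omega>) \<gamma> \<noteq> 0" for \<gamma>
    using dual_groupD(3)[OF assms] dual_groupD(3)[OF cross_closed[OF endo_closed[OF assms]]] by auto
  show ?thesis unfolding sheet_def cs_defect_def char_mult_def char_inverse_def
    using nz by (simp add: fun_eq_iff field_simps)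
qed

lemma sheet_properties:
  assumes \<zeta>: "\<zeta> \<in> dual_ker \<alpha>" and \<omega>: "\<omega> \<in> dual_group"
  shows "sheet \<zeta> \<omega> \<in> dual_group" and "dual_endo \<alpha> (sheet \<zeta> \<omega>) = \<omega>" and "cs_defect \<alpha> c (sheet \<zeta> \<omega>) = \<zeta>"
proof -
  show "sheet \<zeta> \<omega> \<in> dual_group"
    unfolding sheet_def by (intro char_mult_closed char_inverse_closed kerD(1)[OF \<zeta>] cross_closed \<omega>)
  show e: "dual_endo \<alpha> (sheet \<zeta> \<omega>) = \<omega>"
    unfolding sheet_def dual_endo_mult dual_endo_inverse kerD(2)[OF \<zeta>] endo_cross[OF \<omega>]
    by (simp add: char_mult_def char_inverse_def)
  have nz: "\<zeta> \<gamma> \<noteq> 0" "c \<omega> \<gamma> \<noteq> 0" for \<gamma>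
    using dual_groupD(3)[OF kerD(1)[OF \<zeta>]] dual_groupD(3)[OF cross_closed[OF \<omega>]] by auto
  show "cs_defect \<alpha> c (sheet \<zeta> \<omega>) = \<zeta>"
    unfolding cs_defect_def e unfolding sheet_def char_mult_def char_inverse_def
    using nz by (simp add: fun_eq_iff field_simps)
qed

lemma sheet_measurable: "\<zeta> \<in> dual_ker \<alpha> \<Longrightarrow> sheet \<zeta> \<in> dual_borel \<rightarrow>\<^sub>M dual_borel"
  unfolding sheet_def[abs_def]
  by (rule measurable_compose[OF cross_measurable translate_measurable[OF char_inverse_closed[OF kerD(1)]]])

context
  fixes \<nu> :: "'g character measure" and \<zeta> :: "'g character"
  assumes \<nu>: "dual_part \<nu>" and \<zeta>: "\<zeta> \<in> dual_ker \<alpha>"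
begin

lemma sheet_part_sets: "sheet_part \<nu> \<zeta> \<in> sets \<nu>"
proof -
  have "{\<zeta>} \<inter> dual_group \<in> sets dual_borel" 
    unfolding dual_borel_def sets_restrict_space by (rule image_eqI[of _ _ "{\<zeta>}"]) auto
  then have "cs_defect \<alpha> c -` ({\<zeta>} \<inter> dual_group) \<inter> space dual_borel \<in> sets dual_borel"
    by (rule measurable_sets[OF defect_measurable])
  then have "(cs_defect \<alpha> c -` ({\<zeta>} \<inter> dual_group) \<inter> dual_group) \<inter> space \<nu> \<in> sets \<nu>"
    using dual_part_sets[OF \<nu>] by (simp add: space_dual_borel)
  also have "(cs_defect \<alpha> c -` ({\<zeta>} \<inter> dual_group) \<inter> dual_group) \<inter> space \<nu> = sheet_part \<nu> \<zeta>"
    unfolding sheet_part_def using dual_part_subset[OF \<nu>] kerD(1)[OF \<zeta>] by auto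
  finally show ?thesis .
qed

lemma sheet_part_subset: "sheet_part \<nu> \<zeta> \<subseteq> space \<nu>"
  unfolding sheet_part_def by blast

lemma sheet_endo: "\<omega> \<in> sheet_part \<nu> \<zeta> \<Longrightarrow> sheet \<zeta> (dual_endo \<alpha> \<omega>) = \<omega>"
  using sheet_defect dual_part_subset[OF \<nu>] unfolding sheet_part_def by blast

lemma endo_sheet_part: "dual_endo \<alpha> ` sheet_part \<nu> \<zeta> = {\<omega> \<in> dual_group. sheet \<zeta> \<omega> \<in> space \<nu>}"
proof (intro equalityI subsetI)
  fix \<omega> assume "\<omega> \<in> dual_endo \<alpha> ` sheet_part \<nu> \<zeta>"
  then obtain \<eta> where \<eta>: "\<eta> \<in> sheet_part \<nu> \<zeta>" "\<omega> = dual_endo \<alpha> \<eta>" by blast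
  then have "\<eta> \<in> space \<nu>" "\<eta> \<in> dual_group" using sheet_part_subset dual_part_subset[OF \<nu>] by auto
  then show "\<omega> \<in> {\<omega> \<in> dual_group. sheet \<zeta> \<omega> \<in> space \<nu>}"
    using \<eta> sheet_endo[OF \<eta>(1)] endo_closed by simp
next
  fix \<omega> assume "\<omega> \<in> {\<omega> \<in> dual_group. sheet \<zeta> \<omega> \<in> space \<nu>}"
  then have \<omega>: "\<omega> \<in> dual_group" "sheet \<zeta> \<omega> \<in> space \<nu>" by auto
  have "sheet \<zeta> \<omega> \<in> sheet_part \<nu> \<zeta>"
    unfolding sheet_part_def using \<omega>(2) sheet_properties(3)[OF \<zeta> \<omega>(1)] by simp
  then show "\<omega> \<in> dual_endo \<alpha> ` sheet_part \<nu> \<zeta>"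
    using sheet_properties(2)[OF \<zeta> \<omega>(1)] by (metis image_eqI)
qed

abbreviation "dil \<equiv> dil_measure \<alpha> c \<nu> \<zeta>"

lemma dil_measure_density:
  "dil = density (distr (restrict_space \<nu> (sheet_part \<nu> \<zeta>))
      (restrict_space dual_borel (dual_endo \<alpha> ` sheet_part \<nu> \<zeta>)) (dual_endo \<alpha>)) (\<lambda>_. ennreal (real index))"
  unfolding dil_measure_def Let_def sheet_part_def scale_measure_of_nat ..

lemma space_dil: "space dil = {\<omega> \<in> dual_group. sheet \<zeta> \<omega> \<in> space \<nu>}"
  unfolding dil_measure_density endo_sheet_part by (auto simp: space_restrict_space space_dual_borel)

lemma sets_dil: "sets dil = sets (restrict_space dual_borel (space dil))"
  unfolding space_dil endo_sheet_part[symmetric] unfolding dil_measure_density by simp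

lemma dual_part_dil: "dual_part dil"
  unfolding dual_part_def
proof
  have "space \<nu> \<in> sets dual_borel" using \<nu> unfolding dual_part_def by blast
  then have "sheet \<zeta> -` space \<nu> \<inter> space dual_borel \<in> sets dual_borel"
    by (rule measurable_sets[OF sheet_measurable[OF \<zeta>]])
  also have "sheet \<zeta> -` space \<nu> \<inter> space dual_borel = space dil"
    unfolding space_dil by (auto simp: space_dual_borel)
  finally show "space dil \<in> sets dual_borel" .
  show "sets dil = sets (restrict_space dual_borel (space dil))" by (rule sets_dil)
qed

lemma endo_measurable_dil: "dual_endo \<alpha> \<in> restrict_space \<nu> (sheet_part \<nu> \<zeta>) \<rightarrow>\<^sub>M dil"
proof (rule dual_part_measurable_into[OF dual_part_dil])
  show "dual_endo \<alpha> \<in> restrict_space \<nu> (sheet_part \<nu> \<zeta>) \<rightarrow>\<^sub>M dual_borel"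
    by (intro measurable_restrict_space1 dual_part_measurable[OF \<nu>] endo_measurable)
  show "dual_endo \<alpha> \<omega> \<in> space dil" if "\<omega> \<in> space (restrict_space \<nu> (sheet_part \<nu> \<zeta>))" for \<omega>
    using that unfolding space_dil endo_sheet_part[symmetric] by (auto simp: space_restrict_space)
qed

lemma sheet_measurable_dil: "sheet \<zeta> \<in> dil \<rightarrow>\<^sub>M \<nu>"
  by (rule dual_part_measurable_into[OF \<nu> dual_part_measurable[OF dual_part_dil sheet_measurable[OF \<zeta>]]])
     (simp add: space_dil)

abbreviation "dil_base \<equiv> distr (restrict_space \<nu> (sheet_part \<nu> \<zeta>))
      (restrict_space dual_borel (dual_endo \<alpha> ` sheet_part \<nu> \<zeta>)) (dual_endo \<alpha>)"

lemma sets_dil_base: "sets dil_base = sets dil"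
  unfolding dil_measure_density by simp

lemma endo_measurable_base: "dual_endo \<alpha> \<in> restrict_space \<nu> (sheet_part \<nu> \<zeta>) \<rightarrow>\<^sub>M
    restrict_space dual_borel (dual_endo \<alpha> ` sheet_part \<nu> \<zeta>)"
  using endo_measurable_dil sets_dil_base
    measurable_cong_sets[of "restrict_space \<nu> (sheet_part \<nu> \<zeta>)" _ dil "restrict_space dual_borel (dual_endo \<alpha> ` sheet_part \<nu> \<zeta>)"]
  by simp

lemma sheet_part_inter: "sheet_part \<nu> \<zeta> \<inter> space \<nu> \<in> sets \<nu>"
  using sheet_part_sets by (simp add: sets.Int_space_eq2)

lemma nn_integral_dil:
  assumes F: "F \<in> borel_measurable dil"
  shows "(\<integral>\<^sup>+\<omega>. F \<omega> \<partial>dil) = ennreal (real index) * (\<integral>\<^sup>+\<omega>. F (dual_endo \<alpha> \<omega>) * indicator (sheet_part \<nu> \<zeta>) \<omega> \<partial>\<nu>)"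
proof -
  have F': "F \<in> borel_measurable dil_base" by (simp only: measurable_cong_sets[OF sets_dil_base refl] F)
  have F'': "F \<in> borel_measurable (restrict_space dual_borel (dual_endo \<alpha> ` sheet_part \<nu> \<zeta>))" using F' by simp
  have "(\<integral>\<^sup>+\<omega>. F \<omega> \<partial>dil) = (\<integral>\<^sup>+\<omega>. ennreal (real index) * F \<omega> \<partial>dil_base)"
    unfolding dil_measure_density by (rule nn_integral_density[OF _ F']) simp
  also have "\<dots> = ennreal (real index) * (\<integral>\<^sup>+\<omega>. F \<omega> \<partial>dil_base)" by (rule nn_integral_cmult[OF F'])
  also have "(\<integral>\<^sup>+\<omega>. F \<omega> \<partial>dil_base) = (\<integral>\<^sup>+\<omega>. F (dual_endo \<alpha> \<omega>) \<partial>restrict_space \<nu> (sheet_part \<nu> \<zeta>))"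
    by (rule nn_integral_distr[OF endo_measurable_base F'])
  also have "\<dots> = (\<integral>\<^sup>+\<omega>. F (dual_endo \<alpha> \<omega>) * indicator (sheet_part \<nu> \<zeta>) \<omega> \<partial>\<nu>)"
    by (rule nn_integral_restrict_space[OF sheet_part_inter])
  finally show ?thesis .
qed

lemma integral_dil:
  fixes F :: "_ \<Rightarrow> 'b :: {banach, second_countable_topology}"
  assumes F: "F \<in> borel_measurable dil"
  shows "integrable dil F \<longleftrightarrow> integrable \<nu> (\<lambda>\<omega>. indicator (sheet_part \<nu> \<zeta>) \<omega> *\<^sub>R F (dual_endo \<alpha> \<omega>))"
    and "(\<integral>\<omega>. F \<omega> \<partial>dil) = real index *\<^sub>R (\<integral>\<omega>. indicator (sheet_part \<nu> \<zeta>) \<omega> *\<^sub>R F (dual_endo \<alpha> \<omega>) \<partial>\<nu>)"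
proof -
  have F': "F \<in> borel_measurable dil_base" by (simp only: measurable_cong_sets[OF sets_dil_base refl] F)
  have F'': "F \<in> borel_measurable (restrict_space dual_borel (dual_endo \<alpha> ` sheet_part \<nu> \<zeta>))" using F' by simp
  have "integrable dil F \<longleftrightarrow> integrable dil_base (\<lambda>\<omega>. real index *\<^sub>R F \<omega>)"
    unfolding dil_measure_density by (rule integrable_density[OF F']) simp_all
  also have "\<dots> \<longleftrightarrow> integrable dil_base F"
  proof
    assume "integrable dil_base (\<lambda>\<omega>. real index *\<^sub>R F \<omega>)"
    then have "integrable dil_base (\<lambda>\<omega>. (1 / real index) *\<^sub>R (real index *\<^sub>R F \<omega>))"
      by (rule integrable_scaleR_right)
    then show "integrable dil_base F" using index_pos by simp
  qed (rule integrable_scaleR_right)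
  also have "\<dots> \<longleftrightarrow> integrable (restrict_space \<nu> (sheet_part \<nu> \<zeta>)) (\<lambda>\<omega>. F (dual_endo \<alpha> \<omega>))"
    by (rule integrable_distr_eq[OF endo_measurable_base F''])
  also have "\<dots> \<longleftrightarrow> integrable \<nu> (\<lambda>\<omega>. indicator (sheet_part \<nu> \<zeta>) \<omega> *\<^sub>R F (dual_endo \<alpha> \<omega>))"
    by (rule integrable_restrict_space[OF sheet_part_inter])
  finally show "integrable dil F \<longleftrightarrow> integrable \<nu> (\<lambda>\<omega>. indicator (sheet_part \<nu> \<zeta>) \<omega> *\<^sub>R F (dual_endo \<alpha> \<omega>))" .
  have "(\<integral>\<omega>. F \<omega> \<partial>dil) = (\<integral>\<omega>. real index *\<^sub>R F \<omega> \<partial>dil_base)"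
    unfolding dil_measure_density by (rule integral_density[OF F']) simp_all
  also have "\<dots> = real index *\<^sub>R (\<integral>\<omega>. F \<omega> \<partial>dil_base)" by simp
  also have "(\<integral>\<omega>. F \<omega> \<partial>dil_base) = (\<integral>\<omega>. F (dual_endo \<alpha> \<omega>) \<partial>restrict_space \<nu> (sheet_part \<nu> \<zeta>))"
    by (rule integral_distr[OF endo_measurable_base F''])
  also have "\<dots> = (\<integral>\<omega>. indicator (sheet_part \<nu> \<zeta>) \<omega> *\<^sub>R F (dual_endo \<alpha> \<omega>) \<partial>\<nu>)"
    by (rule integral_restrict_space[OF sheet_part_inter])
  finally show "(\<integral>\<omega>. F \<omega> \<partial>dil) = real index *\<^sub>R (\<integral>\<omega>. indicator (sheet_part \<nu> \<zeta>) \<omega> *\<^sub>R F (dual_endo \<alpha> \<omega>) \<partial>\<nu>)" .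
qed

lemma integral_dil_sheet:
  fixes F :: "_ \<Rightarrow> 'b :: {banach, second_countable_topology}"
  assumes F: "F \<in> borel_measurable \<nu>"
  shows "integrable dil (\<lambda>\<omega>. F (sheet \<zeta> \<omega>)) \<longleftrightarrow> integrable \<nu> (\<lambda>\<omega>. indicator (sheet_part \<nu> \<zeta>) \<omega> *\<^sub>R F \<omega>)"
    and "(\<integral>\<omega>. F (sheet \<zeta> \<omega>) \<partial>dil) = real index *\<^sub>R (\<integral>\<omega>. indicator (sheet_part \<nu> \<zeta>) \<omega> *\<^sub>R F \<omega> \<partial>\<nu>)"
proof -
  have m: "(\<lambda>\<omega>. F (sheet \<zeta> \<omega>)) \<in> borel_measurable dil"
    by (rule measurable_compose[OF sheet_measurable_dil F])
  have e: "(\<lambda>\<omega>. indicator (sheet_part \<nu> \<zeta>) \<omega> *\<^sub>R F (sheet \<zeta> (dual_endo \<alpha> \<omega>)))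
      = (\<lambda>\<omega>. indicator (sheet_part \<nu> \<zeta>) \<omega> *\<^sub>R F \<omega>)"
    by (auto simp: fun_eq_iff indicator_def sheet_endo)
  show "integrable dil (\<lambda>\<omega>. F (sheet \<zeta> \<omega>)) \<longleftrightarrow> integrable \<nu> (\<lambda>\<omega>. indicator (sheet_part \<nu> \<zeta>) \<omega> *\<^sub>R F \<omega>)"
    and "(\<integral>\<omega>. F (sheet \<zeta> \<omega>) \<partial>dil) = real index *\<^sub>R (\<integral>\<omega>. indicator (sheet_part \<nu> \<zeta>) \<omega> *\<^sub>R F \<omega> \<partial>\<nu>)"
    using integral_dil[OF m] unfolding e by blast+
qed

text \<open>Null sets are preserved because the dilated measure is \<open>N\<close> times an image of a restriction.\<close>

lemma AE_dil:
  assumes "AE \<omega> in \<nu>. Q \<omega>"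
  shows "AE \<omega> in dil. Q (sheet \<zeta> \<omega>)"
proof -
  obtain Z where Z: "Z \<in> sets \<nu>" "emeasure \<nu> Z = 0" "{\<omega>\<in>space \<nu>. \<not> Q \<omega>} \<subseteq> Z"
    using assms by (auto elim: AE_E)
  let ?B = "sheet \<zeta> -` Z \<inter> space dil"
  have B: "?B \<in> sets dil" using Z(1) by (rule measurable_sets[OF sheet_measurable_dil])
  have "emeasure dil ?B = (\<integral>\<^sup>+\<omega>. indicator ?B \<omega> \<partial>dil)" using B by simp
  also have "\<dots> = ennreal (real index) * (\<integral>\<^sup>+\<omega>. indicator ?B (dual_endo \<alpha> \<omega>) * indicator (sheet_part \<nu> \<zeta>) \<omega> \<partial>\<nu>)"
    by (rule nn_integral_dil) (use B in simp)
  also have "\<dots> \<le> ennreal (real index) * (\<integral>\<^sup>+\<omega>. indicator Z \<omega> \<partial>\<nu>)"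
    by (intro mult_left_mono nn_integral_mono) (auto simp: indicator_def sheet_endo)
  also have "\<dots> = 0" using Z by simp
  finally have "?B \<in> null_sets dil" using B by (simp add: null_sets_def)
  moreover have "{\<omega> \<in> space dil. \<not> Q (sheet \<zeta> \<omega>)} \<subseteq> ?B"
    using Z(3) measurable_space[OF sheet_measurable_dil] by auto
  ultimately show ?thesis by (rule AE_I')
qed

end

definition dil_fun :: "('g dil_index \<Rightarrow> 'g character \<Rightarrow> complex) \<Rightarrow> 'g dil_index \<Rightarrow> 'g character \<Rightarrow> complex" where
  "dil_fun f = (\<lambda>(k, zs) \<omega>. f (k, tl zs) (char_mult (char_inverse (hd zs)) (c \<omega>)) / of_real (sqrt (real index)))"

definition dil_index :: "'g dil_index \<times> 'g character \<Rightarrow> 'g dil_index" where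
  "dil_index = (\<lambda>(i, \<zeta>). (fst i, \<zeta> # snd i))"

lemma dil_index_bij: "bij_betw dil_index (I \<times> dual_ker \<alpha>) (dil_indices \<alpha> I)"
  unfolding bij_betw_def
proof
  show "inj_on dil_index (I \<times> dual_ker \<alpha>)" unfolding dil_index_def by (rule inj_onI) auto
  show "dil_index ` (I \<times> dual_ker \<alpha>) = dil_indices \<alpha> I"
    unfolding dil_index_def dil_indices_def by (force simp: image_iff)
qed

lemma dil_fun_index: "dil_fun f (dil_index (i, \<zeta>)) \<omega> = f i (sheet \<zeta> \<omega>) / of_real (sqrt (real index))"
  unfolding dil_fun_def dil_index_def sheet_def by simp

lemma dil_measures_index: "dil_measures \<alpha> c M (dil_index (i, \<zeta>)) = dil_measure \<alpha> c (M i) \<zeta>"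
  unfolding dil_measures_def dil_index_def by simp

lemma dil_indicesE:
  assumes "i' \<in> dil_indices \<alpha> I"
  obtains i \<zeta> where "i \<in> I" "\<zeta> \<in> dual_ker \<alpha>" "i' = dil_index (i, \<zeta>)"
  using assms dil_index_bij[of I] unfolding bij_betw_def by blast

lemma dil_index_mem: "i \<in> I \<Longrightarrow> \<zeta> \<in> dual_ker \<alpha> \<Longrightarrow> dil_index (i, \<zeta>) \<in> dil_indices \<alpha> I"
  using bij_betwE[OF dil_index_bij[of I]] by simp

text \<open>The sheets partition the space according to the value of the defect.\<close>

lemma sum_sheets:
  fixes F :: "_ \<Rightarrow> 'b :: real_vector"
  assumes "dual_part \<nu>" "\<omega> \<in> space \<nu>"
  shows "(\<Sum>\<zeta>\<in>dual_ker \<alpha>. indicator (sheet_part \<nu> \<zeta>) \<omega> *\<^sub>R F \<zeta>) = F (cs_defect \<alpha> c \<omega>)"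
proof -
  have k: "cs_defect \<alpha> c \<omega> \<in> dual_ker \<alpha>"
    using dual_part_subset[OF assms(1)] assms(2) by (intro defect_in_ker) blast
  have "(\<Sum>\<zeta>\<in>dual_ker \<alpha>. indicator (sheet_part \<nu> \<zeta>) \<omega> *\<^sub>R F \<zeta>)
      = (\<Sum>\<zeta>\<in>dual_ker \<alpha>. if \<zeta> = cs_defect \<alpha> c \<omega> then F \<zeta> else 0)"
    using assms(2) by (intro sum.cong refl) (auto simp: sheet_part_def indicator_def)
  also have "\<dots> = F (cs_defect \<alpha> c \<omega>)" using k finite_ker by simp
  finally show ?thesis .
qed

lemma integral_sheets:
  fixes F :: "_ \<Rightarrow> 'b :: {banach, second_countable_topology}"
  assumes \<nu>: "dual_part \<nu>" and F: "integrable \<nu> F"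
  shows "(\<integral>\<omega>. F \<omega> \<partial>\<nu>) = (\<Sum>\<zeta>\<in>dual_ker \<alpha>. \<integral>\<omega>. indicator (sheet_part \<nu> \<zeta>) \<omega> *\<^sub>R F \<omega> \<partial>\<nu>)"
proof -
  have i: "integrable \<nu> (\<lambda>\<omega>. indicator (sheet_part \<nu> \<zeta>) \<omega> *\<^sub>R F \<omega>)" if "\<zeta> \<in> dual_ker \<alpha>" for \<zeta>
    by (rule integrable_mult_indicator[OF sheet_part_sets[OF \<nu> that] F])
  have "(\<integral>\<omega>. F \<omega> \<partial>\<nu>) = (\<integral>\<omega>. (\<Sum>\<zeta>\<in>dual_ker \<alpha>. indicator (sheet_part \<nu> \<zeta>) \<omega> *\<^sub>R F \<omega>) \<partial>\<nu>)"
  proof (rule Bochner_Integration.integral_cong[OF refl])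
    fix \<omega> assume "\<omega> \<in> space \<nu>"
    then show "F \<omega> = (\<Sum>\<zeta>\<in>dual_ker \<alpha>. indicator (sheet_part \<nu> \<zeta>) \<omega> *\<^sub>R F \<omega>)"
      using sum_sheets[OF \<nu>, of \<omega> "\<lambda>_. F \<omega>"] by simp
  qed
  then show ?thesis using i by simp
qed

context
  fixes I :: "'g dil_index set" and M :: "'g dil_index \<Rightarrow> 'g character measure"
  assumes M: "\<And>i. i \<in> I \<Longrightarrow> dual_part (M i)"
begin

lemma dual_part_dil_measures: "i \<in> dil_indices \<alpha> I \<Longrightarrow> dual_part (dil_measures \<alpha> c M i)"
  by (erule dil_indicesE) (simp add: dil_measures_index dual_part_dil M)

lemma dil_fun_measurable:
  assumes "f \<in> L2_families I M" "i \<in> I" "\<zeta> \<in> dual_ker \<alpha>"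
  shows "dil_fun f (dil_index (i, \<zeta>)) \<in> borel_measurable (dil_measure \<alpha> c (M i) \<zeta>)"
  unfolding dil_fun_index[abs_def]
  by (intro borel_measurable_divide borel_measurable_const
      measurable_compose[OF sheet_measurable_dil[OF M[OF assms(2)] assms(3)] L2_familiesD(1)[OF assms(1,2)]])

lemma sqrt_index_sq: "complex_of_real (sqrt (real index)) * complex_of_real (sqrt (real index)) = of_nat index"
  by (simp flip: of_real_mult)

lemma dil_fun_inner_index:
  assumes f: "f \<in> L2_families I M" and g: "g \<in> L2_families I M" and i: "i \<in> I" and \<zeta>: "\<zeta> \<in> dual_ker \<alpha>"
  shows "(\<integral>\<omega>. dil_fun f (dil_index (i, \<zeta>)) \<omega> * cnj (dil_fun g (dil_index (i, \<zeta>)) \<omega>) \<partial>dil_measure \<alpha> c (M i) \<zeta>)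
    = (\<integral>\<omega>. indicator (sheet_part (M i) \<zeta>) \<omega> *\<^sub>R (f i \<omega> * cnj (g i \<omega>)) \<partial>M i)"
proof -
  define F where "F \<omega> = (f i \<omega> * cnj (g i \<omega>)) / of_nat index" for \<omega>
  have Fm: "F \<in> borel_measurable (M i)"
    using L2_familiesD(1)[OF f i] L2_familiesD(1)[OF g i] unfolding F_def[abs_def] by measurable
  have "dil_fun f (dil_index (i, \<zeta>)) \<omega> * cnj (dil_fun g (dil_index (i, \<zeta>)) \<omega>) = F (sheet \<zeta> \<omega>)" for \<omega>
    unfolding dil_fun_index F_def by (simp add: sqrt_index_sq)
  then have "(\<integral>\<omega>. dil_fun f (dil_index (i, \<zeta>)) \<omega> * cnj (dil_fun g (dil_index (i, \<zeta>)) \<omega>) \<partial>dil_measure \<alpha> c (M i) \<zeta>)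
      = real index *\<^sub>R (\<integral>\<omega>. indicator (sheet_part (M i) \<zeta>) \<omega> *\<^sub>R F \<omega> \<partial>M i)"
    using integral_dil_sheet(2)[OF M[OF i] \<zeta> Fm] by simp
  also have "\<dots> = (\<integral>\<omega>. real index *\<^sub>R (indicator (sheet_part (M i) \<zeta>) \<omega> *\<^sub>R F \<omega>) \<partial>M i)"
    by (rule integral_scaleR_right[symmetric])
  also have "\<dots> = (\<integral>\<omega>. indicator (sheet_part (M i) \<zeta>) \<omega> *\<^sub>R (f i \<omega> * cnj (g i \<omega>)) \<partial>M i)"
    by (rule Bochner_Integration.integral_cong) (use index_pos in \<open>auto simp: F_def scaleR_conv_of_real\<close>)
  finally show ?thesis .
qed

lemma dil_fun_norm_index:
  assumes f: "f \<in> L2_families I M" and i: "i \<in> I" and \<zeta>: "\<zeta> \<in> dual_ker \<alpha>"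
  shows "integrable (dil_measure \<alpha> c (M i) \<zeta>) (\<lambda>\<omega>. (cmod (dil_fun f (dil_index (i, \<zeta>)) \<omega>))\<^sup>2)"
    and "(\<integral>\<omega>. (cmod (dil_fun f (dil_index (i, \<zeta>)) \<omega>))\<^sup>2 \<partial>dil_measure \<alpha> c (M i) \<zeta>)
      = (\<integral>\<omega>. indicator (sheet_part (M i) \<zeta>) \<omega> *\<^sub>R (cmod (f i \<omega>))\<^sup>2 \<partial>M i)"
proof -
  define F where "F \<omega> = (cmod (f i \<omega>))\<^sup>2 / real index" for \<omega>
  have Fm: "F \<in> borel_measurable (M i)"
    using L2_familiesD(1)[OF f i] unfolding F_def[abs_def] by measurable
  have e: "(\<lambda>\<omega>. (cmod (dil_fun f (dil_index (i, \<zeta>)) \<omega>))\<^sup>2) = (\<lambda>\<omega>. F (sheet \<zeta> \<omega>))"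
    unfolding dil_fun_index F_def by (simp add: norm_divide power_divide)
  have Fi: "integrable (M i) (\<lambda>\<omega>. indicator (sheet_part (M i) \<zeta>) \<omega> *\<^sub>R F \<omega>)"
    unfolding F_def using L2_familiesD(2)[OF f i]
    by (intro integrable_mult_indicator[OF sheet_part_sets[OF M[OF i] \<zeta>]]) simp
  show "integrable (dil_measure \<alpha> c (M i) \<zeta>) (\<lambda>\<omega>. (cmod (dil_fun f (dil_index (i, \<zeta>)) \<omega>))\<^sup>2)"
    unfolding e using integral_dil_sheet(1)[OF M[OF i] \<zeta> Fm] Fi by blast
  have "(\<integral>\<omega>. F (sheet \<zeta> \<omega>) \<partial>dil_measure \<alpha> c (M i) \<zeta>)
      = (\<integral>\<omega>. real index *\<^sub>R (indicator (sheet_part (M i) \<zeta>) \<omega> *\<^sub>R F \<omega>) \<partial>M i)"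
    using integral_dil_sheet(2)[OF M[OF i] \<zeta> Fm] by simp
  also have "\<dots> = (\<integral>\<omega>. indicator (sheet_part (M i) \<zeta>) \<omega> *\<^sub>R (cmod (f i \<omega>))\<^sup>2 \<partial>M i)"
    by (rule Bochner_Integration.integral_cong) (use index_pos in \<open>auto simp: F_def\<close>)
  finally show "(\<integral>\<omega>. (cmod (dil_fun f (dil_index (i, \<zeta>)) \<omega>))\<^sup>2 \<partial>dil_measure \<alpha> c (M i) \<zeta>)
      = (\<integral>\<omega>. indicator (sheet_part (M i) \<zeta>) \<omega> *\<^sub>R (cmod (f i \<omega>))\<^sup>2 \<partial>M i)" unfolding e .
qed

lemma summable_on_sheets_iff:
  fixes a :: "'g dil_index \<Rightarrow> real"
  assumes nn: "\<And>i. i \<in> dil_indices \<alpha> I \<Longrightarrow> 0 \<le> a i"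
  shows "a summable_on dil_indices \<alpha> I \<longleftrightarrow> (\<lambda>i. \<Sum>\<zeta>\<in>dual_ker \<alpha>. a (dil_index (i, \<zeta>))) summable_on I"
proof -
  have nn': "norm (a (dil_index (i, \<zeta>))) = a (dil_index (i, \<zeta>))" if "i \<in> I" "\<zeta> \<in> dual_ker \<alpha>" for i \<zeta>
    using nn[OF dil_index_mem[OF that]] by simp
  have "a summable_on dil_indices \<alpha> I \<longleftrightarrow> (\<lambda>p. a (dil_index p)) summable_on (I \<times> dual_ker \<alpha>)"
    by (rule summable_on_reindex_bij_betw[OF dil_index_bij, symmetric])
  also have "\<dots> \<longleftrightarrow> (\<lambda>p. norm (a (dil_index p))) summable_on (I \<times> dual_ker \<alpha>)"
    using nn' by (intro summable_on_cong) auto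
  also have "\<dots> \<longleftrightarrow> (\<lambda>i. norm (\<Sum>\<^sub>\<infinity>\<zeta>\<in>dual_ker \<alpha>. norm (a (dil_index (i, \<zeta>))))) summable_on I"
    using finite_ker by (subst Infinite_Sum.abs_summable_on_Sigma_iff) (simp add: summable_on_finite)
  also have "\<dots> \<longleftrightarrow> (\<lambda>i. \<Sum>\<zeta>\<in>dual_ker \<alpha>. a (dil_index (i, \<zeta>))) summable_on I"
  proof (rule summable_on_cong)
    fix i assume i: "i \<in> I"
    have "(\<Sum>\<^sub>\<infinity>\<zeta>\<in>dual_ker \<alpha>. norm (a (dil_index (i, \<zeta>)))) = (\<Sum>\<zeta>\<in>dual_ker \<alpha>. a (dil_index (i, \<zeta>)))"
      using finite_ker nn'[OF i] by (simp del: real_norm_def)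
    moreover have "0 \<le> (\<Sum>\<zeta>\<in>dual_ker \<alpha>. a (dil_index (i, \<zeta>)))"
      using nn dil_index_mem[OF i] by (intro sum_nonneg) blast
    ultimately show "norm (\<Sum>\<^sub>\<infinity>\<zeta>\<in>dual_ker \<alpha>. norm (a (dil_index (i, \<zeta>)))) = (\<Sum>\<zeta>\<in>dual_ker \<alpha>. a (dil_index (i, \<zeta>)))"
      by simp
  qed
  finally show ?thesis .
qed

lemma dil_fun_family:
  assumes f: "f \<in> L2_families I M"
  shows "dil_fun f \<in> L2_families (dil_indices \<alpha> I) (dil_measures \<alpha> c M)"
proof -
  let ?a = "\<lambda>i. \<integral>\<omega>. (cmod (dil_fun f i \<omega>))\<^sup>2 \<partial>dil_measures \<alpha> c M i"
  have "(\<Sum>\<zeta>\<in>dual_ker \<alpha>. ?a (dil_index (i, \<zeta>))) = (\<integral>\<omega>. (cmod (f i \<omega>))\<^sup>2 \<partial>M i)" if i: "i \<in> I" for i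
    unfolding integral_sheets[OF M[OF i] L2_familiesD(2)[OF f i]]
    by (intro sum.cong refl) (simp only: dil_measures_index dil_fun_norm_index(2)[OF f i])
  moreover have "(\<lambda>i. \<integral>\<omega>. (cmod (f i \<omega>))\<^sup>2 \<partial>M i) summable_on I" using f unfolding L2_families_def by blast
  ultimately have "(\<lambda>i. \<Sum>\<zeta>\<in>dual_ker \<alpha>. ?a (dil_index (i, \<zeta>))) summable_on I" by (simp cong: summable_on_cong)
  then have "?a summable_on dil_indices \<alpha> I" by (subst summable_on_sheets_iff) simp_all
  moreover have "dil_fun f i' \<in> borel_measurable (dil_measures \<alpha> c M i') \<and>
      integrable (dil_measures \<alpha> c M i') (\<lambda>\<omega>. (cmod (dil_fun f i' \<omega>))\<^sup>2)" if i': "i' \<in> dil_indices \<alpha> I" for i'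
  proof -
    obtain i \<zeta> where i: "i \<in> I" "\<zeta> \<in> dual_ker \<alpha>" "i' = dil_index (i, \<zeta>)" using i' by (rule dil_indicesE)
    show ?thesis unfolding i(3) dil_measures_index
      using dil_fun_measurable[OF f i(1,2)] dil_fun_norm_index(1)[OF f i(1,2)] by simp
  qed
  ultimately show ?thesis unfolding L2_families_def by blast
qed

lemma dil_fun_inner:
  assumes f: "f \<in> L2_families I M" and g: "g \<in> L2_families I M"
  shows "(\<Sum>\<^sub>\<infinity>i\<in>dil_indices \<alpha> I. \<integral>\<omega>. dil_fun f i \<omega> * cnj (dil_fun g i \<omega>) \<partial>dil_measures \<alpha> c M i)
    = (\<Sum>\<^sub>\<infinity>i\<in>I. \<integral>\<omega>. f i \<omega> * cnj (g i \<omega>) \<partial>M i)"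
proof -
  let ?a = "\<lambda>i. \<integral>\<omega>. dil_fun f i \<omega> * cnj (dil_fun g i \<omega>) \<partial>dil_measures \<alpha> c M i"
  have "?a summable_on dil_indices \<alpha> I"
    by (rule L2_inner_abs_summable(3)[OF dil_fun_family[OF f] dil_fun_family[OF g]])
  then have s: "(\<lambda>p. ?a (dil_index p)) summable_on (I \<times> dual_ker \<alpha>)"
    using summable_on_reindex_bij_betw[OF dil_index_bij, where f = ?a] by blast
  have "infsum ?a (dil_indices \<alpha> I) = (\<Sum>\<^sub>\<infinity>p\<in>I \<times> dual_ker \<alpha>. ?a (dil_index p))"
    by (rule infsum_reindex_bij_betw[OF dil_index_bij, symmetric])
  also have "\<dots> = (\<Sum>\<^sub>\<infinity>i\<in>I. \<Sum>\<^sub>\<infinity>\<zeta>\<in>dual_ker \<alpha>. ?a (dil_index (i, \<zeta>)))"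
    by (rule infsum_Sigma_banach[OF s, symmetric])
  also have "\<dots> = (\<Sum>\<^sub>\<infinity>i\<in>I. \<integral>\<omega>. f i \<omega> * cnj (g i \<omega>) \<partial>M i)"
  proof (rule infsum_cong)
    fix i assume i: "i \<in> I"
    show "(\<Sum>\<^sub>\<infinity>\<zeta>\<in>dual_ker \<alpha>. ?a (dil_index (i, \<zeta>))) = (\<integral>\<omega>. f i \<omega> * cnj (g i \<omega>) \<partial>M i)"
      unfolding integral_sheets[OF M[OF i] L2_inner_integrable[OF f g i]] infsum_finite[OF finite_ker] dil_measures_index
      by (intro sum.cong refl) (rule dil_fun_inner_index[OF f g i])
  qed
  finally show ?thesis .
qed

text \<open>The inverse of \<^const>\<open>dil_fun\<close>: the defect of a point tells on which sheet it lies.\<close>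

definition dil_lift :: "('g dil_index \<Rightarrow> 'g character \<Rightarrow> complex) \<Rightarrow> 'g dil_index \<Rightarrow> 'g character \<Rightarrow> complex" where
  "dil_lift F i \<omega> = of_real (sqrt (real index)) * F (dil_index (i, cs_defect \<alpha> c \<omega>)) (dual_endo \<alpha> \<omega>)"

lemma dil_fun_lift:
  assumes "\<zeta> \<in> dual_ker \<alpha>" "\<omega> \<in> dual_group"
  shows "dil_fun (dil_lift F) (dil_index (i, \<zeta>)) \<omega> = F (dil_index (i, \<zeta>)) \<omega>"
  unfolding dil_fun_index dil_lift_def using sheet_properties[OF assms] index_pos by simp

lemma dil_lift_family:
  assumes F: "F \<in> L2_families (dil_indices \<alpha> I) (dil_measures \<alpha> c M)"
  shows "dil_lift F \<in> L2_families I M"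
proof -
  let ?b = "\<lambda>i. \<integral>\<omega>. (cmod (F i \<omega>))\<^sup>2 \<partial>dil_measures \<alpha> c M i"
  have Fm: "F (dil_index (i, \<zeta>)) \<in> borel_measurable (dil_measure \<alpha> c (M i) \<zeta>)"
    and Fi: "integrable (dil_measure \<alpha> c (M i) \<zeta>) (\<lambda>\<omega>. (cmod (F (dil_index (i, \<zeta>)) \<omega>))\<^sup>2)"
    if "i \<in> I" "\<zeta> \<in> dual_ker \<alpha>" for i \<zeta>
    using L2_familiesD[OF F dil_index_mem[OF that]] unfolding dil_measures_index by auto
  have key: "dil_lift F i \<in> borel_measurable (M i) \<and> integrable (M i) (\<lambda>\<omega>. (cmod (dil_lift F i \<omega>))\<^sup>2)
      \<and> (\<integral>\<omega>. (cmod (dil_lift F i \<omega>))\<^sup>2 \<partial>M i) = (\<Sum>\<zeta>\<in>dual_ker \<alpha>. ?b (dil_index (i, \<zeta>)))" if i: "i \<in> I" for i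
  proof (intro conjI)
    let ?S = "sheet_part (M i)"
    define t where "t \<zeta> \<omega> = indicator (?S \<zeta>) \<omega> *\<^sub>R (of_real (sqrt (real index)) * F (dil_index (i, \<zeta>)) (dual_endo \<alpha> \<omega>))" for \<zeta> \<omega>
    define q where "q \<zeta> \<omega> = indicator (?S \<zeta>) \<omega> *\<^sub>R (real index * (cmod (F (dil_index (i, \<zeta>)) (dual_endo \<alpha> \<omega>)))\<^sup>2)" for \<zeta> \<omega>
    have tm: "t \<zeta> \<in> borel_measurable (M i)" if \<zeta>: "\<zeta> \<in> dual_ker \<alpha>" for \<zeta>
    proof -
      have "(\<lambda>\<omega>. of_real (sqrt (real index)) * F (dil_index (i, \<zeta>)) (dual_endo \<alpha> \<omega>)) \<in> borel_measurable (restrict_space (M i) (?S \<zeta>))"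
        by (intro borel_measurable_times borel_measurable_const
            measurable_compose[OF endo_measurable_dil[OF M[OF i] \<zeta>] Fm[OF i \<zeta>]])
      then show ?thesis unfolding t_def[abs_def]
        by (rule borel_measurable_restrict_space_iff[OF sheet_part_inter[OF M[OF i] \<zeta>], THEN iffD1])
    qed
    have ts: "(\<Sum>\<zeta>\<in>dual_ker \<alpha>. t \<zeta> \<omega>) = dil_lift F i \<omega>" if "\<omega> \<in> space (M i)" for \<omega>
      unfolding t_def dil_lift_def by (rule sum_sheets[OF M[OF i] that])
    have "(\<lambda>\<omega>. \<Sum>\<zeta>\<in>dual_ker \<alpha>. t \<zeta> \<omega>) \<in> borel_measurable (M i)" using tm by (rule borel_measurable_sum)
    then show "dil_lift F i \<in> borel_measurable (M i)" by (rule measurable_cong[THEN iffD1, rotated]) (rule ts)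
    have qs: "(\<Sum>\<zeta>\<in>dual_ker \<alpha>. q \<zeta> \<omega>) = (cmod (dil_lift F i \<omega>))\<^sup>2" if "\<omega> \<in> space (M i)" for \<omega>
    proof -
      have "(\<Sum>\<zeta>\<in>dual_ker \<alpha>. q \<zeta> \<omega>) = real index * (cmod (F (dil_index (i, cs_defect \<alpha> c \<omega>)) (dual_endo \<alpha> \<omega>)))\<^sup>2"
        unfolding q_def by (rule sum_sheets[OF M[OF i] that])
      then show ?thesis unfolding dil_lift_def by (simp add: norm_mult power_mult_distrib)
    qed
    have sqm: "(\<lambda>\<omega>. (cmod (F (dil_index (i, \<zeta>)) \<omega>))\<^sup>2) \<in> borel_measurable (dil_measure \<alpha> c (M i) \<zeta>)" if "\<zeta> \<in> dual_ker \<alpha>" for \<zeta>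
      using Fi[OF i that] by simp
    have q_eq: "q \<zeta> = (\<lambda>\<omega>. real index * (indicator (?S \<zeta>) \<omega> *\<^sub>R (cmod (F (dil_index (i, \<zeta>)) (dual_endo \<alpha> \<omega>)))\<^sup>2))" for \<zeta>
      unfolding q_def by auto
    have qi: "integrable (M i) (q \<zeta>)" if \<zeta>: "\<zeta> \<in> dual_ker \<alpha>" for \<zeta>
      unfolding q_eq using integral_dil(1)[OF M[OF i] \<zeta> sqm[OF \<zeta>]] Fi[OF i \<zeta>]
      by (intro integrable_mult_right) blast
    have qI: "(\<integral>\<omega>. q \<zeta> \<omega> \<partial>M i) = ?b (dil_index (i, \<zeta>))" if \<zeta>: "\<zeta> \<in> dual_ker \<alpha>" for \<zeta>
      unfolding q_eq dil_measures_index integral_dil(2)[OF M[OF i] \<zeta> sqm[OF \<zeta>]] by simp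
    have "integrable (M i) (\<lambda>\<omega>. \<Sum>\<zeta>\<in>dual_ker \<alpha>. q \<zeta> \<omega>)" using qi by (rule Bochner_Integration.integrable_sum)
    then show "integrable (M i) (\<lambda>\<omega>. (cmod (dil_lift F i \<omega>))\<^sup>2)"
      by (rule Bochner_Integration.integrable_cong[THEN iffD1, OF refl, rotated]) (rule qs)
    have "(\<integral>\<omega>. (cmod (dil_lift F i \<omega>))\<^sup>2 \<partial>M i) = (\<integral>\<omega>. (\<Sum>\<zeta>\<in>dual_ker \<alpha>. q \<zeta> \<omega>) \<partial>M i)"
      using qs by (intro Bochner_Integration.integral_cong) auto
    also have "\<dots> = (\<Sum>\<zeta>\<in>dual_ker \<alpha>. \<integral>\<omega>. q \<zeta> \<omega> \<partial>M i)" using qi by (rule Bochner_Integration.integral_sum)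
    also have "\<dots> = (\<Sum>\<zeta>\<in>dual_ker \<alpha>. ?b (dil_index (i, \<zeta>)))" using qI by (intro sum.cong refl) simp
    finally show "(\<integral>\<omega>. (cmod (dil_lift F i \<omega>))\<^sup>2 \<partial>M i) = (\<Sum>\<zeta>\<in>dual_ker \<alpha>. ?b (dil_index (i, \<zeta>)))" .
  qed
  have "?b summable_on dil_indices \<alpha> I" using F unfolding L2_families_def by blast
  then have "(\<lambda>i. \<Sum>\<zeta>\<in>dual_ker \<alpha>. ?b (dil_index (i, \<zeta>))) summable_on I"
    by (subst (asm) summable_on_sheets_iff) simp_all
  then have "(\<lambda>i. \<integral>\<omega>. (cmod (dil_lift F i \<omega>))\<^sup>2 \<partial>M i) summable_on I"
    using key by (simp cong: summable_on_cong)
  then show ?thesis using key unfolding L2_families_def by blast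
qed

lemma dil_op_class:
  assumes f: "f \<in> L2_families I M"
  shows "dil_op \<alpha> c I M (L2_class I M f) = L2_class (dil_indices \<alpha> I) (dil_measures \<alpha> c M) (dil_fun f)"
proof -
  have "dil_op \<alpha> c I M (L2_class I M f)
      = L2_class (dil_indices \<alpha> I) (dil_measures \<alpha> c M) (dil_fun (L2_rep (L2_class I M f)))"
    unfolding dil_op_def dil_fun_def ..
  also have "\<dots> = L2_class (dil_indices \<alpha> I) (dil_measures \<alpha> c M) (dil_fun f)"
  proof (rule L2_class_cong)
    fix i' assume "i' \<in> dil_indices \<alpha> I"
    then obtain i \<zeta> where i: "i \<in> I" "\<zeta> \<in> dual_ker \<alpha>" "i' = dil_index (i, \<zeta>)" by (rule dil_indicesE)
    show "AE x in dil_measures \<alpha> c M i'. dil_fun (L2_rep (L2_class I M f)) i' x = dil_fun f i' x"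
      unfolding i(3) dil_measures_index dil_fun_index
      using AE_dil[OF M[OF i(1)] i(2) L2_rep_AE[OF f i(1)]] by eventually_elim simp
  qed
  finally show ?thesis .
qed

text \<open>Passing from one space to its sheets splits a square norm into finitely many parts; the factor \<open>N\<close> in the measure compensates the factor \<open>1 / sqrt N\<close> in the operator.\<close>

lemma dil_op_unitary:
  "unitary_map (L2_sum I M) (L2_sum (dil_indices \<alpha> I) (dil_measures \<alpha> c M)) (dil_op \<alpha> c I M)"
proof -
  let ?T = "dil_op \<alpha> c I M" and ?K = "L2_sum (dil_indices \<alpha> I) (dil_measures \<alpha> c M)"
  have S: "hcarrier ?K = ?T ` hcarrier (L2_sum I M)"
  proof (intro equalityI subsetI)
    fix G assume "G \<in> hcarrier ?K"
    then obtain F where F: "F \<in> L2_families (dil_indices \<alpha> I) (dil_measures \<alpha> c M)"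
      "G = L2_class (dil_indices \<alpha> I) (dil_measures \<alpha> c M) F" using L2_sum_carrier by metis
    have "?T (L2_class I M (dil_lift F)) = L2_class (dil_indices \<alpha> I) (dil_measures \<alpha> c M) (dil_fun (dil_lift F))"
      by (rule dil_op_class[OF dil_lift_family[OF F(1)]])
    also have "\<dots> = G" unfolding F(2)
    proof (rule L2_class_cong)
      fix i' assume "i' \<in> dil_indices \<alpha> I"
      then obtain i \<zeta> where i: "i \<in> I" "\<zeta> \<in> dual_ker \<alpha>" "i' = dil_index (i, \<zeta>)" by (rule dil_indicesE)
      show "AE x in dil_measures \<alpha> c M i'. dil_fun (dil_lift F) i' x = F i' x"
        unfolding i(3) dil_measures_index
        by (rule AE_I2) (simp add: space_dil[OF M[OF i(1)] i(2)] dil_fun_lift[OF i(2)])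
    qed
    finally show "G \<in> ?T ` hcarrier (L2_sum I M)"
      using L2_class_in_carrier[OF dil_lift_family[OF F(1)]] by (metis image_eqI)
  next
    fix G assume "G \<in> ?T ` hcarrier (L2_sum I M)"
    then obtain F where F: "F \<in> hcarrier (L2_sum I M)" "G = ?T F" by blast
    obtain f where f: "f \<in> L2_families I M" "F = L2_class I M f" using F(1) L2_sum_carrier by metis
    show "G \<in> hcarrier ?K"
      unfolding F(2) f(2) dil_op_class[OF f(1)] by (rule L2_class_in_carrier[OF dil_fun_family[OF f(1)]])
  qed
  have "unitary_map (L2_sum I M) (subspace_hspace ?K (hcarrier ?K)) ?T"
  proof (rule L2_unitary_mapI[where \<Phi> = dil_fun])
    show "AE x in dil_measures \<alpha> c M i. dil_fun (\<lambda>i x. f i x + g i x) i x = dil_fun f i x + dil_fun g i x" for f g i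
      by (rule AE_I2) (simp add: dil_fun_def add_divide_distrib split: prod.split)
    show "AE x in dil_measures \<alpha> c M i. dil_fun (\<lambda>i x. a * f i x) i x = a * dil_fun f i x" for a f i
      by (rule AE_I2) (simp add: dil_fun_def split: prod.split)
  qed (use S dil_op_class dil_fun_family dil_fun_inner in auto)
  then show ?thesis by simp
qed

text \<open>On every sheet \<open>(sheet \<zeta> \<omega>) (\<alpha> \<gamma>) = \<omega> \<gamma>\<close>.\<close>

lemma dil_op_modulate:
  assumes F: "F \<in> hcarrier (L2_sum I M)"
  shows "dil_op \<alpha> c I M (modulate I M (\<alpha> \<gamma>) F)
    = modulate (dil_indices \<alpha> I) (dil_measures \<alpha> c M) \<gamma> (dil_op \<alpha> c I M F)"
proof -
  obtain f where f: "f \<in> L2_families I M" "F = L2_class I M f" using F L2_sum_carrier by metis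
  have fm: "(\<lambda>i \<omega>. \<omega> (\<alpha> \<gamma>) * f i \<omega>) \<in> L2_families I M"
    by (rule modulate_family[of I M, OF M f(1)])
  have "L2_class (dil_indices \<alpha> I) (dil_measures \<alpha> c M) (dil_fun (\<lambda>i \<omega>. \<omega> (\<alpha> \<gamma>) * f i \<omega>))
      = L2_class (dil_indices \<alpha> I) (dil_measures \<alpha> c M) (\<lambda>i \<omega>. \<omega> \<gamma> * dil_fun f i \<omega>)"
  proof (rule L2_class_cong)
    fix i' assume "i' \<in> dil_indices \<alpha> I"
    then obtain i \<zeta> where i: "i \<in> I" "\<zeta> \<in> dual_ker \<alpha>" "i' = dil_index (i, \<zeta>)" by (rule dil_indicesE)
    have e: "sheet \<zeta> \<omega> (\<alpha> \<gamma>) = \<omega> \<gamma>" if "\<omega> \<in> dual_group" for \<omega>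
      using fun_cong[OF sheet_properties(2)[OF i(2) that], of \<gamma>] by (simp add: dual_endo_def)
    show "AE x in dil_measures \<alpha> c M i'. dil_fun (\<lambda>i \<omega>. \<omega> (\<alpha> \<gamma>) * f i \<omega>) i' x = x \<gamma> * dil_fun f i' x"
      unfolding i(3) dil_measures_index
      by (rule AE_I2) (simp add: space_dil[OF M[OF i(1)] i(2)] dil_fun_index e)
  qed
  then show ?thesis
    unfolding f(2) modulate_class[OF f(1)] dil_op_class[OF fm] dil_op_class[OF f(1)]
      modulate_class[OF dil_fun_family[OF f(1)]] .
qed

end

end

section \<open>Multiplicity functions\<close>

lemma multiplicity_ge:
  assumes "decseq \<sigma>" "\<omega> \<in> \<sigma> i"
  shows "enat (Suc i) \<le> multiplicity_fun \<sigma> \<omega>"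
proof -
  have "\<omega> \<in> \<sigma> j" if "j \<le> i" for j using decseqD[OF assms(1) that] assms(2) by blast
  then have "(\<Sum>j\<in>{..i}. if \<omega> \<in> \<sigma> j then 1 else 0 :: enat) = (\<Sum>j\<in>{..i}. 1)" by (intro sum.cong) auto
  also have "\<dots> = enat (Suc i)" by (simp add: of_nat_eq_enat)
  finally have "enat (Suc i) = (\<Sum>j\<in>{..i}. if \<omega> \<in> \<sigma> j then 1 else 0 :: enat)" ..
  also have "\<dots> \<le> multiplicity_fun \<sigma> \<omega>"
    unfolding multiplicity_fun_def by (intro sum_le_suminf summableI) auto
  finally show ?thesis .
qed

lemma multiplicity_finite:
  assumes "finite {i. \<omega> \<in> \<sigma> i}"
  shows "multiplicity_fun \<sigma> \<omega> = enat (card {i. \<omega> \<in> \<sigma> i})"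
proof -
  have "multiplicity_fun \<sigma> \<omega> = (\<Sum>i | \<omega> \<in> \<sigma> i. if \<omega> \<in> \<sigma> i then 1 else 0)"
    unfolding multiplicity_fun_def by (rule suminf_finite[OF assms]) simp
  then show ?thesis by (simp add: of_nat_eq_enat)
qed

lemma decseq_finite:
  assumes "decseq \<sigma>" "\<omega> \<notin> \<sigma> i"
  shows "{j. \<omega> \<in> \<sigma> j} \<subseteq> {..<i}"
proof
  fix j assume "j \<in> {j. \<omega> \<in> \<sigma> j}"
  then have "\<not> i \<le> j" using decseqD[OF assms(1), of i j] assms(2) by blast
  then show "j \<in> {..<i}" by simp
qed

lemma multiplicity_ge_iff:
  assumes "decseq \<sigma>"
  shows "enat (Suc i) \<le> multiplicity_fun \<sigma> \<omega> \<longleftrightarrow> \<omega> \<in> \<sigma> i"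
proof
  assume le: "enat (Suc i) \<le> multiplicity_fun \<sigma> \<omega>"
  show "\<omega> \<in> \<sigma> i"
  proof (rule ccontr)
    assume "\<omega> \<notin> \<sigma> i"
    then have s: "{j. \<omega> \<in> \<sigma> j} \<subseteq> {..<i}" by (rule decseq_finite[OF assms])
    then have "card {j. \<omega> \<in> \<sigma> j} \<le> i" using card_mono[OF _ s] by simp
    then show False using le multiplicity_finite[OF finite_subset[OF s]] by simp
  qed
qed (rule multiplicity_ge[OF assms])

lemma multiplicity_finite_iff:
  assumes "decseq \<sigma>"
  shows "multiplicity_fun \<sigma> \<omega> \<noteq> \<infinity> \<longleftrightarrow> finite {i. \<omega> \<in> \<sigma> i}"
proof
  assume "multiplicity_fun \<sigma> \<omega> \<noteq> \<infinity>"
  then obtain n where n: "multiplicity_fun \<sigma> \<omega> = enat n" by auto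
  then have "\<omega> \<notin> \<sigma> n" using multiplicity_ge_iff[OF assms, of n \<omega>] by simp
  then show "finite {i. \<omega> \<in> \<sigma> i}" using decseq_finite[OF assms] finite_subset by blast
qed (simp add: multiplicity_finite)

lemma level_set_multiplicity:
  assumes "decseq \<sigma>" "\<And>i. \<sigma> i \<in> sets dual_borel"
  shows "level_set (multiplicity_fun \<sigma>) = \<sigma>"
proof
  fix i
  have "\<sigma> i \<subseteq> dual_group" using sets.sets_into_space[OF assms(2)[of i]] by (simp add: space_dual_borel)
  then show "level_set (multiplicity_fun \<sigma>) i = \<sigma> i"
    unfolding level_set_def multiplicity_ge_iff[OF assms(1)] by blast
qed

text \<open>The upper level sets determine the sets where the function takes a given finite or infinite value.\<close>

lemma measurable_enat_iff:
  fixes f :: "'x \<Rightarrow> enat"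
  shows "f \<in> M \<rightarrow>\<^sub>M count_space UNIV \<longleftrightarrow> (\<forall>i. {x \<in> space M. enat (Suc i) \<le> f x} \<in> sets M)"
proof
  assume [measurable]: "f \<in> M \<rightarrow>\<^sub>M count_space UNIV"
  show "\<forall>i. {x \<in> space M. enat (Suc i) \<le> f x} \<in> sets M" by measurable
next
  assume A: "\<forall>i. {x \<in> space M. enat (Suc i) \<le> f x} \<in> sets M"
  have ge: "{x \<in> space M. enat n \<le> f x} \<in> sets M" for n
  proof (cases n)
    case 0
    then show ?thesis by (simp add: zero_enat_def[symmetric])
  next
    case (Suc i)
    then show ?thesis using A by simp
  qed
  have "f -` {a} \<inter> space M \<in> sets M" for a
  proof (cases a)
    case (enat n)
    have "f -` {a} \<inter> space M = {x \<in> space M. enat n \<le> f x} - {x \<in> space M. enat (Suc n) \<le> f x}"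
    proof -
      have "f x = enat n \<longleftrightarrow> enat n \<le> f x \<and> \<not> enat (Suc n) \<le> f x" for x by (cases "f x") auto
      then show ?thesis unfolding enat by auto
    qed
    then show ?thesis using ge by simp
  next
    case infinity
    have "f -` {a} \<inter> space M = (\<Inter>n. {x \<in> space M. enat n \<le> f x})"
    proof -
      have "f x = \<infinity> \<longleftrightarrow> (\<forall>n. enat n \<le> f x)" for x
      proof (cases "f x")
        case (enat k)
        then have "\<not> enat (Suc k) \<le> f x" by simp
        then show ?thesis using enat by (metis enat.distinct(1))
      qed simp
      then show ?thesis unfolding infinity by auto
    qed
    then show ?thesis using ge by simp
  qed
  then show "f \<in> M \<rightarrow>\<^sub>M count_space UNIV"
    by (subst measurable_count_space_eq2_countable) auto
qed

lemma measurable_count_space_binop: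
  fixes f g :: "'x \<Rightarrow> 'b :: countable"
  assumes f: "f \<in> M \<rightarrow>\<^sub>M count_space UNIV" and g: "g \<in> M \<rightarrow>\<^sub>M count_space UNIV"
  shows "(\<lambda>x. b (f x) (g x)) \<in> M \<rightarrow>\<^sub>M count_space UNIV"
proof (rule measurable_compose_countable[where f = "\<lambda>i x. b i (g x)" and g = f, OF _ f])
  show "(\<lambda>x. b i (g x)) \<in> M \<rightarrow>\<^sub>M count_space UNIV" for i
    by (rule measurable_compose[OF g]) simp
qed

context dual_system
begin

lemma fibre_multiplicity_measurable:
  assumes m: "m \<in> \<mu> \<rightarrow>\<^sub>M count_space (UNIV :: enat set)"
  shows "(\<lambda>\<omega>. \<Sum>\<zeta>\<in>fibre \<alpha> \<omega>. m \<zeta>) \<in> \<mu> \<rightarrow>\<^sub>M count_space UNIV"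
proof -
  have t: "(\<lambda>\<omega>. m (char_mult \<kappa> (c \<omega>))) \<in> \<mu> \<rightarrow>\<^sub>M count_space UNIV" if "\<kappa> \<in> dual_ker \<alpha>" for \<kappa>
    by (rule measurable_compose[OF cross_ker_measurable[OF that] m])
  have "(\<lambda>\<omega>. \<Sum>\<kappa>\<in>K. m (char_mult \<kappa> (c \<omega>))) \<in> \<mu> \<rightarrow>\<^sub>M count_space UNIV" if "finite K" "K \<subseteq> dual_ker \<alpha>" for K
    using that
  proof (induction K rule: finite_induct)
    case (insert \<kappa> K)
    have "(\<lambda>\<omega>. m (char_mult \<kappa> (c \<omega>)) + (\<Sum>\<kappa>\<in>K. m (char_mult \<kappa> (c \<omega>)))) \<in> \<mu> \<rightarrow>\<^sub>M count_space UNIV"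
      using insert t by (intro measurable_count_space_binop[where b = "(+)"]) auto
    then show ?case using insert by simp
  qed simp
  from this[OF finite_ker subset_refl] show ?thesis
    by (rule measurable_cong[THEN iffD1, rotated]) (simp add: sum_fibre space_haar)
qed

lemma level_set_compl_measurable:
  assumes "decseq \<sigma>" "\<And>i. \<sigma> i \<in> sets dual_borel"
  shows "level_set (compl_multiplicity \<alpha> (multiplicity_fun \<sigma>)) k \<in> sets dual_borel"
proof -
  let ?m = "multiplicity_fun \<sigma>"
  have "{\<omega> \<in> space \<mu>. enat (Suc i) \<le> ?m \<omega>} = \<sigma> i" for i
    using fun_cong[OF level_set_multiplicity[OF assms], of i] unfolding level_set_def space_haar .
  then have m: "?m \<in> \<mu> \<rightarrow>\<^sub>M count_space UNIV"
    unfolding measurable_enat_iff using assms(2) by (simp add: sets_haar)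
  have "(\<lambda>\<omega>. compl_multiplicity \<alpha> ?m \<omega>) \<in> \<mu> \<rightarrow>\<^sub>M count_space UNIV"
    unfolding compl_multiplicity_def
    by (rule measurable_count_space_binop[OF fibre_multiplicity_measurable[OF m] m, where b = "(-)"])
  then have "{\<omega> \<in> space \<mu>. enat (Suc k) \<le> compl_multiplicity \<alpha> ?m \<omega>} \<in> sets \<mu>"
    unfolding measurable_enat_iff by blast
  then show ?thesis unfolding level_set_def space_haar sets_haar .
qed

text \<open>At a regular point all multiplicities are finite, so the subtraction in \<^const>\<open>compl_multiplicity\<close> is one of natural numbers.  It is truncated, but by \<open>rows_card_le\<close> never below zero.\<close>

lemma compl_level_sets:
  assumes dec: "decseq \<sigma>" and r: "regular \<sigma> \<sigma> \<omega>"
  shows "{k. \<omega> \<in> level_set (compl_multiplicity \<alpha> (multiplicity_fun \<sigma>)) k}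
    = {..<(\<Sum>\<zeta>\<in>fibre \<alpha> \<omega>. card {j. \<zeta> \<in> \<sigma> j}) - card {i. \<omega> \<in> \<sigma> i}}"
proof -
  have fin: "finite {i. \<omega> \<in> \<sigma> i}" "\<And>\<zeta>. \<zeta> \<in> fibre \<alpha> \<omega> \<Longrightarrow> finite {j. \<zeta> \<in> \<sigma> j}" and \<omega>: "\<omega> \<in> dual_group"
    using r unfolding regular_def by auto
  have "(\<Sum>\<zeta>\<in>fibre \<alpha> \<omega>. multiplicity_fun \<sigma> \<zeta>) = (\<Sum>\<zeta>\<in>fibre \<alpha> \<omega>. enat (card {j. \<zeta> \<in> \<sigma> j}))"
    using multiplicity_finite[OF fin(2)] by (intro sum.cong) auto
  also have "\<dots> = enat (\<Sum>\<zeta>\<in>fibre \<alpha> \<omega>. card {j. \<zeta> \<in> \<sigma> j})"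
    by (simp flip: of_nat_eq_enat)
  finally have "compl_multiplicity \<alpha> (multiplicity_fun \<sigma>) \<omega>
      = enat ((\<Sum>\<zeta>\<in>fibre \<alpha> \<omega>. card {j. \<zeta> \<in> \<sigma> j}) - card {i. \<omega> \<in> \<sigma> i})"
    unfolding compl_multiplicity_def multiplicity_finite[OF fin(1)] by simp
  then show ?thesis unfolding level_set_def using \<omega> by auto
qed

text \<open>Orthogonal rows over a point cannot outnumber the pairs \<open>(\<zeta>, j)\<close> with \<open>\<zeta>\<close> in the fibre and \<open>\<zeta> \<in> \<sigma> j\<close>.  For a filter this is the inequality \<open>m \<omega> \<le> (\<Sum>\<zeta>. m \<zeta>)\<close>.\<close>

lemma rows_card_le:
  fixes A :: "'g filter_matrix"
  assumes r: "regular \<sigma> E \<omega>"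
    and A: "\<forall>k k'. fibre_pairing \<sigma> (A k) (A k') \<omega> = (if k = k' \<and> \<omega> \<in> E k then of_nat index else 0)"
  shows "card {k. \<omega> \<in> E k} \<le> (\<Sum>\<zeta>\<in>fibre \<alpha> \<omega>. card {j. \<zeta> \<in> \<sigma> j})"
proof -
  let ?P = "SIGMA \<zeta>:fibre \<alpha> \<omega>. {j. \<zeta> \<in> \<sigma> j}"
  have fin: "finite (fibre \<alpha> \<omega>)" "finite {k. \<omega> \<in> E k}" "\<forall>\<zeta>\<in>fibre \<alpha> \<omega>. finite {j. \<zeta> \<in> \<sigma> j}"
    using r finite_fibre unfolding regular_def by auto
  have "(\<Sum>p\<in>?P. (case p of (\<zeta>, j) \<Rightarrow> A k j \<zeta>) * cnj (case p of (\<zeta>, j) \<Rightarrow> A k' j \<zeta>))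
      = fibre_pairing \<sigma> (A k) (A k') \<omega>" for k k'
  proof -
    have "fibre_pairing \<sigma> (A k) (A k') \<omega> = (\<Sum>(\<zeta>, j)\<in>?P. A k j \<zeta> * cnj (A k' j \<zeta>))"
      unfolding fibre_pairing_finite[OF r] using fin by (subst sum.Sigma) auto
    also have "\<dots> = (\<Sum>p\<in>?P. (case p of (\<zeta>, j) \<Rightarrow> A k j \<zeta>) * cnj (case p of (\<zeta>, j) \<Rightarrow> A k' j \<zeta>))"
      by (intro sum.cong refl) auto
    finally show ?thesis ..
  qed
  then have "card {k. \<omega> \<in> E k} \<le> card ?P"
    using A fin index_pos
    by (intro orthogonal_card_le(1)[where c = "real index" and u = "\<lambda>k p. case p of (\<zeta>, j) \<Rightarrow> A k j \<zeta>"]) auto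
  then show ?thesis using fin by (simp add: card_SigmaI)
qed

lemma fibre_pairing_supported:
  assumes A: "supported_matrix \<mu> \<sigma> A" and B: "supported_matrix \<mu> \<sigma> B"
  shows "AE \<omega> in \<mu>. \<forall>k k'. fibre_pairing \<sigma> (A k) (B k') \<omega> = (\<Sum>\<zeta>\<in>fibre \<alpha> \<omega>. \<Sum>j. A k j \<zeta> * cnj (B k' j \<zeta>))"
proof -
  have "AE \<omega> in \<mu>. \<forall>k j. \<omega> \<notin> \<sigma> j \<longrightarrow> A k j \<omega> = 0" "AE \<omega> in \<mu>. \<forall>k j. \<omega> \<notin> \<sigma> j \<longrightarrow> B k j \<omega> = 0"
    using supported_matrixD(2)[OF A] supported_matrixD(2)[OF B] by (simp_all add: AE_all_countable)
  from AE_fibre[OF this(1)] AE_fibre[OF this(2)] show ?thesis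
  proof eventually_elim
    case (elim \<omega>)
    have "zext \<sigma> (A k) j \<zeta> = A k j \<zeta>" "zext \<sigma> (B k) j \<zeta> = B k j \<zeta>" if "\<zeta> \<in> fibre \<alpha> \<omega>" for \<zeta> k j
      using elim that by (auto simp: zext_def indicator_def)
    then show ?case unfolding fibre_pairing_def pairing_def by simp
  qed
qed

end

section \<open>Closed subspaces as Hilbert spaces\<close>

text \<open>This makes the direct sum modelling \<open>V\<^sub>0\<close> a Hilbert space by transport, without a separate completeness proof for spaces of classes.\<close>

lemma (in hilbert_space) closed_subspace_hilbert:
  assumes S: "closed_subspace H S"
  shows "hilbert_space (subspace_hspace H S)"
proof -
  have C: "f \<in> hcarrier H" if "f \<in> S" for f using subspace_carrier[OF S that] .
  note cl = subspace_closed[OF S]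
  have z: "hzero H \<in> S" using S unfolding closed_subspace_def by blast
  show ?thesis
  proof
    fix X :: "nat \<Rightarrow> 'a"
    assume X: "\<And>n. X n \<in> hcarrier (subspace_hspace H S)"
      and cau: "\<And>e. 0 < e \<Longrightarrow> \<exists>M. \<forall>m\<ge>M. \<forall>n\<ge>M. hdist (subspace_hspace H S) (X m) (X n) < e"
    have d: "hdist (subspace_hspace H S) = hdist H" by (simp add: hdist_def hnorm_def fun_eq_iff)
    have XS: "\<And>n. X n \<in> S" using X by simp
    obtain f where f: "f \<in> hcarrier H" "(\<lambda>n. hdist H (X n) f) \<longlonglongrightarrow> 0"
      using complete[of X] XS C cau unfolding d by metis
    have "f \<in> S" using S XS f unfolding closed_subspace_def by blast
    then show "\<exists>f\<in>hcarrier (subspace_hspace H S). (\<lambda>n. hdist (subspace_hspace H S) (X n) f) \<longlonglongrightarrow> 0"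
      using f(2) unfolding d by auto
  qed (use C cl z in \<open>auto simp: add_assoc add_zero add_inverse scale_add_right scale_add_left scale_scale
        scale_one inner_add inner_scale inner_nonneg intro: add_commute inner_cnj inner_definite\<close>)
qed

section \<open>The filter constructed from a generalized multiresolution analysis\<close>

locale filter_gmra = dual_system \<alpha> \<mu> c + gmra \<H> \<alpha> \<pi> \<delta> V
  for \<alpha> :: "'g :: {ab_group_add, countable} \<Rightarrow> 'g"
    and \<mu> :: "'g character measure"
    and c :: "'g character \<Rightarrow> 'g character"
    and \<H> :: "'a hspace"
    and \<pi> :: "'g \<Rightarrow> 'a \<Rightarrow> 'a"
    and \<delta> :: "'a \<Rightarrow> 'a"
    and V :: "int \<Rightarrow> 'a set" +
  fixes \<sigma> :: "nat \<Rightarrow> 'g character set"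
    and J :: "'a \<Rightarrow> (nat \<Rightarrow> 'g character \<Rightarrow> complex) set"
    and h :: "'g filter_matrix"
  assumes model: "multiplicity_model \<mu> \<H> \<pi> (V 0) \<sigma> J"
    and finite_multiplicity: "AE \<omega> in \<mu>. multiplicity_fun \<sigma> \<omega> \<noteq> \<infinity>"
    and constructed: "constructed_filter \<mu> \<H> \<delta> (V 0) \<sigma> J h"
begin

abbreviation K :: "(nat \<Rightarrow> 'g character \<Rightarrow> complex) set hspace" where
  "K \<equiv> V0_space \<mu> \<sigma>"

abbreviation \<nu> :: "nat \<Rightarrow> 'g character measure" where
  "\<nu> \<equiv> V0_measure \<mu> \<sigma>"

abbreviation cls :: "(nat \<Rightarrow> 'g character \<Rightarrow> complex) \<Rightarrow> (nat \<Rightarrow> 'g character \<Rightarrow> complex) set" where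
  "cls \<equiv> L2_class UNIV \<nu>"

abbreviation fam :: "(nat \<Rightarrow> 'g character \<Rightarrow> complex) set" where
  "fam \<equiv> L2_families UNIV \<nu>"

abbreviation D :: "'a \<Rightarrow> 'a" where
  "D \<equiv> inv_into (hcarrier \<H>) \<delta>"

lemma K_eq: "K = L2_sum UNIV \<nu>" unfolding V0_space_def ..

lemma \<sigma>_sets: "\<sigma> i \<in> sets dual_borel" and \<sigma>_dec: "decseq \<sigma>"
  and J_unitary: "unitary_map (subspace_hspace \<H> (V 0)) K J"
  using model unfolding multiplicity_model_def by auto

lemma J_pi: "f \<in> V 0 \<Longrightarrow> J (\<pi> \<gamma> f) = modulate UNIV \<nu> \<gamma> (J f)"
  using model unfolding multiplicity_model_def by blast

lemma LF: "locally_finite \<sigma>"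
  unfolding locally_finite_def using \<sigma>_sets finite_multiplicity multiplicity_finite_iff[OF \<sigma>_dec] by simp

lemma dual_part_\<nu>: "dual_part (\<nu> i)"
  unfolding V0_measure_def by (rule dual_part_restrict(1)[OF sets_haar \<sigma>_sets])

lemma level_set_eq: "level_set (multiplicity_fun \<sigma>) = \<sigma>"
  by (rule level_set_multiplicity[OF \<sigma>_dec \<sigma>_sets])

lemma V_carrier: "f \<in> V j \<Longrightarrow> f \<in> hcarrier \<H>"
  using subspace_carrier[OF closed] .

lemma V_zero: "hzero \<H> \<in> V j"
  using closed unfolding closed_subspace_def by blast

lemma V_mono: "i \<le> j \<Longrightarrow> V i \<subseteq> V j"
proof (induction j rule: int_ge_induct)
  case (step j)
  then show ?case using nested[of j] by blast
qed simp

lemma D_unitary: "unitary_map \<H> \<H> D"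
  by (rule unitary_map_inv[OF unitary add_closed scale_closed])

lemmas \<delta>D = unitary_mapD[OF unitary] and DD = unitary_mapD[OF D_unitary] and JD = unitary_mapD[OF J_unitary, simplified]

lemma D_\<delta>: "f \<in> hcarrier \<H> \<Longrightarrow> D (\<delta> f) = f"
  using \<delta>D(1) by (rule bij_betw_inv_into_left)

lemma \<delta>_D: "f \<in> hcarrier \<H> \<Longrightarrow> \<delta> (D f) = f"
  using \<delta>D(1) by (rule bij_betw_inv_into_right)

lemma D_V: "D ` V (j + 1) = V j"
proof -
  have "D ` V (j + 1) = (\<lambda>f. D (\<delta> f)) ` V j" unfolding dilate image_image ..
  also have "\<dots> = V j" using D_\<delta>[OF V_carrier] by (simp add: image_def)
  finally show ?thesis .
qed

lemma D_V0: "f \<in> V 0 \<Longrightarrow> D f \<in> V 0"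
  using V_mono[of "-1" 0] D_V[of "-1"] by auto

lemma rep_unitary: "unitary_map \<H> \<H> (\<pi> \<gamma>)"
  using rep unfolding unitary_rep_def by blast

lemmas \<pi>D = unitary_mapD[OF rep_unitary]

lemma \<pi>_inverse: "f \<in> hcarrier \<H> \<Longrightarrow> \<pi> \<gamma> (\<pi> (- \<gamma>) f) = f" "f \<in> hcarrier \<H> \<Longrightarrow> \<pi> (- \<gamma>) (\<pi> \<gamma> f) = f"
  using rep unfolding unitary_rep_def by (metis add.right_inverse) (metis add.left_inverse rep unitary_rep_def)

lemma D_\<pi>: "f \<in> hcarrier \<H> \<Longrightarrow> D (\<pi> \<gamma> f) = \<pi> (\<alpha> \<gamma>) (D f)"
  using dilation[OF DD(2), of f \<gamma>] \<delta>_D[of f] by simp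

lemma K_hilbert: "hilbert_space K"
proof (rule hilbert_space_transfer[OF closed_subspace_hilbert[OF closed] J_unitary])
  have z: "hzero \<H> \<in> V 0" by (rule V_zero)
  have "J (hscale \<H> 0 (hzero \<H>)) = hscale K 0 (J (hzero \<H>))" using JD(4)[OF z] .
  also have "\<dots> = hzero K" using L2_scale_zero[of "J (hzero \<H>)" UNIV \<nu>] JD(2)[OF z] by (simp add: K_eq)
  finally show "hzero K = J (hzero (subspace_hspace \<H> (V 0)))" using scale_zero[OF zero_closed] by simp
qed

text \<open>The inverse dilation, seen in the model of \<open>V\<^sub>0\<close>.\<close>

definition S :: "(nat \<Rightarrow> 'g character \<Rightarrow> complex) set \<Rightarrow> (nat \<Rightarrow> 'g character \<Rightarrow> complex) set" where
  "S F = J (D (inv_into (V 0) J F))"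

lemma J_inv: "F \<in> hcarrier K \<Longrightarrow> inv_into (V 0) J F \<in> V 0" "F \<in> hcarrier K \<Longrightarrow> J (inv_into (V 0) J F) = F"
  "f \<in> V 0 \<Longrightarrow> inv_into (V 0) J (J f) = f"
  using JD(1) by (auto simp: bij_betw_def inv_into_into f_inv_into_f)

lemma S_J: "f \<in> V 0 \<Longrightarrow> S (J f) = J (D f)"
  unfolding S_def by (simp add: J_inv)

lemma S_closed: "F \<in> hcarrier K \<Longrightarrow> S F \<in> hcarrier K"
  unfolding S_def by (intro JD(2) D_V0 J_inv(1))

lemma S_inner: "F \<in> hcarrier K \<Longrightarrow> G \<in> hcarrier K \<Longrightarrow> hinner K (S F) (S G) = hinner K F G"
proof -
  assume F: "F \<in> hcarrier K" and G: "G \<in> hcarrier K"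
  let ?f = "inv_into (V 0) J F" and ?g = "inv_into (V 0) J G"
  have m: "?f \<in> V 0" "?g \<in> V 0" using J_inv(1) F G by auto
  have "hinner K (S F) (S G) = hinner \<H> (D ?f) (D ?g)" unfolding S_def by (rule JD(5)[OF D_V0[OF m(1)] D_V0[OF m(2)]])
  also have "\<dots> = hinner \<H> ?f ?g" by (rule DD(5)[OF V_carrier[OF m(1)] V_carrier[OF m(2)]])
  also have "\<dots> = hinner K (J ?f) (J ?g)" by (rule JD(5)[OF m, symmetric])
  finally show "hinner K (S F) (S G) = hinner K F G" using J_inv(2) F G by simp
qed

lemma S_modulate:
  assumes F: "F \<in> hcarrier K"
  shows "S (modulate UNIV \<nu> \<gamma> F) = modulate UNIV \<nu> (\<alpha> \<gamma>) (S F)"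
proof -
  let ?f = "inv_into (V 0) J F"
  have f: "?f \<in> V 0" and Jf: "J ?f = F" using J_inv F by auto
  have "S (modulate UNIV \<nu> \<gamma> F) = S (J (\<pi> \<gamma> ?f))" using J_pi[OF f] Jf by simp
  also have "\<dots> = J (\<pi> (\<alpha> \<gamma>) (D ?f))" using S_J[OF invariant[OF f]] D_\<pi>[OF V_carrier[OF f]] by simp
  also have "\<dots> = modulate UNIV \<nu> (\<alpha> \<gamma>) (S F)" unfolding S_def by (rule J_pi[OF D_V0[OF f]])
  finally show ?thesis .
qed

text \<open>Representatives of the unit vectors from which the filter is constructed; their translates \<open>shift \<gamma>\<close> detect the Fourier coefficients of each coordinate.\<close>

definition unit_family :: "nat \<Rightarrow> nat \<Rightarrow> 'g character \<Rightarrow> complex" where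
  "unit_family i j \<omega> = (if j = i \<and> \<omega> \<in> \<sigma> i then 1 else 0)"

definition shift :: "'g \<Rightarrow> (nat \<Rightarrow> 'g character \<Rightarrow> complex) \<Rightarrow> nat \<Rightarrow> 'g character \<Rightarrow> complex" where
  "shift \<gamma> f j \<omega> = \<omega> \<gamma> * f j \<omega>"

lemma shift_family: "f \<in> fam \<Longrightarrow> shift \<gamma> f \<in> fam"
  unfolding shift_def[abs_def] by (rule modulate_family[of UNIV \<nu>, OF dual_part_\<nu>])

lemma modulate_cls: "f \<in> fam \<Longrightarrow> modulate UNIV \<nu> \<gamma> (cls f) = cls (shift \<gamma> f)"
  unfolding shift_def[abs_def] by (rule modulate_class)

lemma cls_in_K: "f \<in> fam \<Longrightarrow> cls f \<in> hcarrier K"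
  unfolding K_eq by (rule L2_class_in_carrier)

lemma K_cases:
  assumes "F \<in> hcarrier K" obtains f where "f \<in> fam" "F = cls f"
  using assms unfolding K_eq L2_sum_carrier by blast

lemma K_inner:
  assumes f: "f \<in> fam" and g: "g \<in> fam"
  shows "hinner K (cls f) (cls g) = (\<integral>\<omega>. pairing \<sigma> f g \<omega> \<partial>\<mu>)"
    and "of_nat index * hinner K (cls f) (cls g) = (\<integral>\<omega>. fibre_pairing \<sigma> f g \<omega> \<partial>\<mu>)"
  unfolding K_eq L2_inner_class[OF f g] by (rule V0_inner(2)[OF LF f g]) (rule V0_inner_fibre(2)[OF LF f g])

lemmas K_inner_fibre = K_inner(2)

lemma pairing_unit:
  assumes "finite {i. \<omega> \<in> \<sigma> i}"
  shows "pairing \<sigma> f (shift \<gamma> (unit_family i)) \<omega> = (if \<omega> \<in> \<sigma> i then cnj (\<omega> \<gamma>) * f i \<omega> else 0)"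
proof -
  have "pairing \<sigma> f (shift \<gamma> (unit_family i)) \<omega>
      = (\<Sum>j | \<omega> \<in> \<sigma> j. if j = i then cnj (\<omega> \<gamma>) * f i \<omega> else 0)"
    unfolding pairing_finite[OF assms] by (intro sum.cong refl) (auto simp: shift_def unit_family_def)
  then show ?thesis using assms by simp
qed

lemma unit_family: "unit_family i \<in> fam"
proof (rule V0_familyI[OF LF])
  have [measurable]: "\<sigma> j \<in> sets \<mu>" for j using \<sigma>_sets by (simp add: sets_haar)
  show "zext \<sigma> (unit_family i) j \<in> borel_measurable \<mu>" for j
    unfolding zext_def[abs_def] unit_family_def by measurable
  have "AE \<omega> in \<mu>. ennreal (norm (pairing \<sigma> (unit_family i) (unit_family i) \<omega>)) \<le> 1"
    using locally_finiteD(3)[OF LF] AE_dual_group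
  proof eventually_elim
    case (elim \<omega>)
    have "pairing \<sigma> (unit_family i) (unit_family i) \<omega> = (\<Sum>j | \<omega> \<in> \<sigma> j. if j = i then 1 else 0)"
      unfolding pairing_finite[OF elim(1)] by (intro sum.cong refl) (auto simp: unit_family_def)
    then show ?case using elim(1) by simp
  qed
  then have "(\<integral>\<^sup>+\<omega>. ennreal (norm (pairing \<sigma> (unit_family i) (unit_family i) \<omega>)) \<partial>\<mu>) \<le> (\<integral>\<^sup>+\<omega>. 1 \<partial>\<mu>)"
    by (rule nn_integral_mono_AE)
  also have "\<dots> < \<infinity>" by (simp add: emeasure_space_1)
  finally show "(\<integral>\<^sup>+\<omega>. ennreal (norm (pairing \<sigma> (unit_family i) (unit_family i) \<omega>)) \<partial>\<mu>) < \<infinity>" .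
qed

lemma unit_vector_eq: "unit_vector \<mu> \<sigma> i = cls (unit_family i)"
  unfolding unit_vector_def unit_family_def[abs_def] ..

lemma h_supported: "supported_matrix \<mu> \<sigma> h" and S_unit: "S (cls (unit_family i)) = cls (h i)"
  using constructed unfolding constructed_filter_def S_def unit_vector_eq by auto

lemma h_family: "h i \<in> fam"
proof -
  have "cls (h i) \<in> hcarrier K" using S_closed[OF cls_in_K[OF unit_family]] S_unit by simp
  then obtain f where f: "f \<in> fam" "cls (h i) = cls f" by (rule K_cases)
  show ?thesis
  proof (rule L2_families_cong[OF f(1)])
    fix j
    show "h i j \<in> borel_measurable (\<nu> j)"
      unfolding V0_measurable_iff[OF LF]
      by (rule zext_supported_measurable[OF LF supported_matrixD(1)[OF h_supported]])
    have "AE x in \<nu> j. f j x = h i j x" by (rule L2_class_eqD[OF f(1) f(2)[symmetric]]) simp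
    then show "AE x in \<nu> j. cmod (h i j x) = cmod (f j x)" by eventually_elim simp
  qed
qed

lemma S_shift_unit: "S (cls (shift \<gamma> (unit_family i))) = cls (shift (\<alpha> \<gamma>) (h i))"
  using S_modulate[OF cls_in_K[OF unit_family], of \<gamma> i] S_unit[of i]
  by (simp add: modulate_cls unit_family h_family)

lemma fibre_pairing_shift:
  assumes "regular \<sigma> \<sigma> \<omega>"
  shows "fibre_pairing \<sigma> f (shift (\<alpha> \<gamma>) g) \<omega> = cnj (\<omega> \<gamma>) * fibre_pairing \<sigma> f g \<omega>"
proof -
  have "\<zeta> (\<alpha> \<gamma>) = \<omega> \<gamma>" if "\<zeta> \<in> fibre \<alpha> \<omega>" for \<zeta>
    using fun_cong[OF fibreD(2)[OF that], of \<gamma>] by (simp add: dual_endo_def)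
  then show ?thesis unfolding fibre_pairing_finite[OF assms] sum_distrib_left
    by (intro sum.cong refl) (simp add: shift_def mult_ac)
qed

text \<open>The inner products of \<open>y\<close> with the translates of the \<open>k\<close>-th row of the filter are the Fourier
  coefficients of the fibre pairing of \<open>y\<close> with this row.\<close>

lemma inner_filter_row:
  assumes y: "y \<in> fam"
  shows "of_nat index * hinner K (cls y) (S (cls (shift (- \<gamma>) (unit_family k))))
    = (\<integral>\<omega>. fibre_pairing \<sigma> y (h k) \<omega> * \<omega> \<gamma> \<partial>\<mu>)"
proof -
  have "of_nat index * hinner K (cls y) (S (cls (shift (- \<gamma>) (unit_family k))))
      = (\<integral>\<omega>. fibre_pairing \<sigma> y (shift (\<alpha> (- \<gamma>)) (h k)) \<omega> \<partial>\<mu>)"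
    unfolding S_shift_unit by (rule K_inner_fibre[OF y shift_family[OF h_family]])
  also have "\<dots> = (\<integral>\<omega>. fibre_pairing \<sigma> y (h k) \<omega> * \<omega> \<gamma> \<partial>\<mu>)"
  proof (rule integral_cong_AE)
    show "fibre_pairing \<sigma> y (shift (\<alpha> (- \<gamma>)) (h k)) \<in> borel_measurable \<mu>"
      using V0_inner_fibre(1)[OF LF y shift_family[OF h_family]] by simp
    show "(\<lambda>\<omega>. fibre_pairing \<sigma> y (h k) \<omega> * \<omega> \<gamma>) \<in> borel_measurable \<mu>"
      using V0_inner_fibre(1)[OF LF y h_family] char_measurable[OF sets_haar]
      by (intro borel_measurable_times) auto
    show "AE \<omega> in \<mu>. fibre_pairing \<sigma> y (shift (\<alpha> (- \<gamma>)) (h k)) \<omega> = fibre_pairing \<sigma> y (h k) \<omega> * \<omega> \<gamma>"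
      using AE_regular[OF LF LF]
    proof eventually_elim
      case (elim \<omega>)
      then have "\<omega> \<in> dual_group" unfolding regular_def by simp
      then have "cnj (\<omega> (- \<gamma>)) = \<omega> \<gamma>" by (simp add: dual_groupD(5))
      then show ?case unfolding fibre_pairing_shift[OF elim] by simp
    qed
  qed
  finally show ?thesis .
qed

lemma inner_unit:
  assumes f: "f \<in> fam"
  shows "hinner K (cls f) (cls (shift (- \<gamma>) (unit_family k))) = (\<integral>\<omega>. zext \<sigma> f k \<omega> * \<omega> \<gamma> \<partial>\<mu>)"
proof -
  have "hinner K (cls f) (cls (shift (- \<gamma>) (unit_family k))) = (\<integral>\<omega>. pairing \<sigma> f (shift (- \<gamma>) (unit_family k)) \<omega> \<partial>\<mu>)"
    by (rule K_inner(1)[OF f shift_family[OF unit_family]])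
  also have "\<dots> = (\<integral>\<omega>. zext \<sigma> f k \<omega> * \<omega> \<gamma> \<partial>\<mu>)"
  proof (rule integral_cong_AE)
    show "pairing \<sigma> f (shift (- \<gamma>) (unit_family k)) \<in> borel_measurable \<mu>"
      using V0_inner(1)[OF LF f shift_family[OF unit_family]] by simp
    show "(\<lambda>\<omega>. zext \<sigma> f k \<omega> * \<omega> \<gamma>) \<in> borel_measurable \<mu>"
      using zext_measurable[OF LF f] char_measurable[OF sets_haar] by (intro borel_measurable_times) auto
    show "AE \<omega> in \<mu>. pairing \<sigma> f (shift (- \<gamma>) (unit_family k)) \<omega> = zext \<sigma> f k \<omega> * \<omega> \<gamma>"
      using AE_dual_group locally_finiteD(3)[OF LF]
    proof eventually_elim
      case (elim \<omega>)
      then have "cnj (\<omega> (- \<gamma>)) = \<omega> \<gamma>" by (simp add: dual_groupD(5))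
      then show ?case unfolding pairing_unit[OF elim(2)] by (simp add: zext_def)
    qed
  qed
  finally show ?thesis .
qed

lemma zext_integrable:
  assumes f: "f \<in> fam"
  shows "integrable \<mu> (zext \<sigma> f k)"
proof -
  have "integrable \<mu> (pairing \<sigma> f (shift 0 (unit_family k)))"
    by (rule V0_inner(1)[OF LF f shift_family[OF unit_family]])
  moreover have "AE \<omega> in \<mu>. pairing \<sigma> f (shift 0 (unit_family k)) \<omega> = zext \<sigma> f k \<omega>"
    using AE_dual_group locally_finiteD(3)[OF LF]
    by eventually_elim (simp add: pairing_unit dual_groupD zext_def)
  ultimately show ?thesis
    using integrable_cong_AE[OF _ zext_measurable[OF LF f]] by (metis borel_measurable_integrable)
qed

lemma AE_fourier_eq:
  assumes f: "integrable \<mu> f" and g: "integrable \<mu> g"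
    and e: "\<And>\<gamma>. (\<integral>\<omega>. f \<omega> * \<omega> \<gamma> \<partial>\<mu>) = (\<integral>\<omega>. g \<omega> * \<omega> \<gamma> \<partial>\<mu>)"
  shows "AE \<omega> in \<mu>. f \<omega> = g \<omega>"
proof -
  have "AE \<omega> in \<mu>. f \<omega> - g \<omega> = 0"
  proof (rule fourier_uniqueness[OF sets_haar])
    show "integrable \<mu> (\<lambda>\<omega>. f \<omega> - g \<omega>)" using f g by simp
    show "(\<integral>\<omega>. (f \<omega> - g \<omega>) * \<omega> \<gamma> \<partial>\<mu>) = 0" for \<gamma>
      using e[of \<gamma>] char_mult_integrable[OF sets_haar f, of \<gamma>] char_mult_integrable[OF sets_haar g, of \<gamma>]
      by (simp add: left_diff_distrib)
  qed
  then show ?thesis by eventually_elim simp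
qed

text \<open>If \<open>y\<close> represents \<open>S F\<close>, its pairings with the rows of the filter recover \<open>F\<close>, because \<open>S\<close> is
  isometric and the translates of the unit vectors determine Fourier coefficients.\<close>

lemma fibre_pairing_filter:
  assumes f: "f \<in> fam" and y: "y \<in> fam" and Sf: "S (cls f) = cls y"
  shows "AE \<omega> in \<mu>. \<forall>k. fibre_pairing \<sigma> y (h k) \<omega> = of_nat index * zext \<sigma> f k \<omega>"
  unfolding AE_all_countable
proof
  fix k
  show "AE \<omega> in \<mu>. fibre_pairing \<sigma> y (h k) \<omega> = of_nat index * zext \<sigma> f k \<omega>"
  proof (rule AE_fourier_eq)
    show "integrable \<mu> (fibre_pairing \<sigma> y (h k))" by (rule V0_inner_fibre(1)[OF LF y h_family])
    show "integrable \<mu> (\<lambda>\<omega>. of_nat index * zext \<sigma> f k \<omega>)" using zext_integrable[OF f] by simp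
    fix \<gamma>
    have "(\<integral>\<omega>. fibre_pairing \<sigma> y (h k) \<omega> * \<omega> \<gamma> \<partial>\<mu>)
        = of_nat index * hinner K (S (cls f)) (S (cls (shift (- \<gamma>) (unit_family k))))"
      unfolding Sf by (rule inner_filter_row[OF y, symmetric])
    also have "\<dots> = of_nat index * (\<integral>\<omega>. zext \<sigma> f k \<omega> * \<omega> \<gamma> \<partial>\<mu>)"
      using S_inner[OF cls_in_K[OF f] cls_in_K[OF shift_family[OF unit_family]]] inner_unit[OF f] by simp
    finally show "(\<integral>\<omega>. fibre_pairing \<sigma> y (h k) \<omega> * \<omega> \<gamma> \<partial>\<mu>) = (\<integral>\<omega>. of_nat index * zext \<sigma> f k \<omega> * \<omega> \<gamma> \<partial>\<mu>)"
      by (simp add: mult.assoc)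
  qed
qed

text \<open>The filter equation holds because the rows of the filter are the values of an isometry at the unit vectors.\<close>

lemma filter_isometric: "isometric_matrix \<sigma> \<sigma> h"
proof -
  have "AE \<omega> in \<mu>. \<forall>i k. fibre_pairing \<sigma> (h i) (h k) \<omega> = of_nat index * zext \<sigma> (unit_family i) k \<omega>"
    using fibre_pairing_filter[OF unit_family h_family S_unit] by (simp add: AE_all_countable)
  then have "AE \<omega> in \<mu>. \<forall>k k'. fibre_pairing \<sigma> (h k) (h k') \<omega> = (if k = k' \<and> \<omega> \<in> \<sigma> k then of_nat index else 0)"
    by eventually_elim (auto simp: zext_def unit_family_def)
  then show ?thesis unfolding isometric_matrix_def using supported_matrixD(1)[OF h_supported] by blast
qed

text \<open>The operator transported from \<open>\<delta>\<^sup>-\<^sup>1\<close> is the Ruelle operator of the filter: both are isometric, and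
  the previous identity gives the inner product of their values at \<open>f\<close> as the square norm of \<open>f\<close>.\<close>

lemma S_eq_ruelle:
  assumes f: "f \<in> fam"
  shows "S (cls f) = cls (ruelle_fun \<alpha> \<sigma> h f)"
proof -
  interpret KH: hilbert_space K by (rule K_hilbert)
  let ?R = "ruelle_fun \<alpha> \<sigma> h f"
  have R: "?R \<in> fam" by (rule ruelle_family[OF LF LF filter_isometric f])
  obtain y where y: "y \<in> fam" "S (cls f) = cls y" using S_closed[OF cls_in_K[OF f]] by (rule K_cases)
  let ?n = "hinner K (cls f) (cls f)"
  have yy: "hinner K (cls y) (cls y) = ?n" unfolding y(2)[symmetric] by (rule S_inner[OF cls_in_K[OF f] cls_in_K[OF f]])
  have RR: "hinner K (cls ?R) (cls ?R) = ?n"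
    unfolding K_eq L2_inner_class[OF R R] L2_inner_class[OF f f] by (rule ruelle_inner[OF LF LF filter_isometric f f])
  have "of_nat index * hinner K (cls y) (cls ?R) = (\<integral>\<omega>. fibre_pairing \<sigma> y ?R \<omega> \<partial>\<mu>)"
    by (rule K_inner_fibre[OF y(1) R])
  also have "\<dots> = (\<integral>\<omega>. of_nat index * pairing \<sigma> f f \<omega> \<partial>\<mu>)"
  proof (rule integral_cong_AE)
    show "fibre_pairing \<sigma> y ?R \<in> borel_measurable \<mu>" using V0_inner_fibre(1)[OF LF y(1) R] by simp
    show "(\<lambda>\<omega>. of_nat index * pairing \<sigma> f f \<omega>) \<in> borel_measurable \<mu>" using V0_inner(1)[OF LF f f] by simp
    show "AE \<omega> in \<mu>. fibre_pairing \<sigma> y ?R \<omega> = of_nat index * pairing \<sigma> f f \<omega>"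
      using AE_regular[OF LF LF] fibre_pairing_filter[OF f y]
    proof eventually_elim
      case (elim \<omega>)
      have fin: "finite {k. \<omega> \<in> \<sigma> k}" using elim(1) unfolding regular_def by simp
      show ?case unfolding fibre_pairing_ruelle_right[OF elim(1)] pairing_finite[OF fin] sum_distrib_left
        using elim(2) by (intro sum.cong refl) (simp add: zext_def)
    qed
  qed
  also have "\<dots> = of_nat index * ?n" using K_inner(1)[OF f f] by simp
  finally have yR: "hinner K (cls y) (cls ?R) = ?n" using index_pos by simp
  have Ry: "hinner K (cls ?R) (cls y) = ?n"
    using KH.inner_cnj[OF cls_in_K[OF y(1)] cls_in_K[OF R]] KH.inner_cnj[OF cls_in_K[OF f] cls_in_K[OF f]] yR by simp
  show ?thesis unfolding y(2)
  proof (rule KH.hdist_zero_imp_eq[OF cls_in_K[OF y(1)] cls_in_K[OF R]])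
    show "Re (hinner K (KH.hsub (cls y) (cls ?R)) (KH.hsub (cls y) (cls ?R))) = 0"
      using cls_in_K[OF y(1)] cls_in_K[OF R] by (simp add: KH.hilbert_simps yy RR yR Ry)
  qed
qed

lemma S_H_eq:
  assumes F: "F \<in> hcarrier K"
  shows "S_H \<alpha> \<mu> (multiplicity_fun \<sigma>) h F = S F"
proof -
  have r: "L2_rep F \<in> fam" "cls (L2_rep F) = F" using L2_class_rep[OF F[unfolded K_eq]] by auto
  show ?thesis unfolding S_H_def level_set_eq using S_eq_ruelle[OF r(1)] r(2) by simp
qed

text \<open>Orthogonality to the range only has to be tested on the translates of the unit vectors, whose images are the translates of the rows.\<close>

lemma orthogonal_to_range:
  assumes x: "x \<in> fam" and o: "\<And>F. F \<in> hcarrier K \<Longrightarrow> hinner K (cls x) (S F) = 0"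
  shows "AE \<omega> in \<mu>. \<forall>i. fibre_pairing \<sigma> x (h i) \<omega> = 0"
  unfolding AE_all_countable
proof
  fix i
  show "AE \<omega> in \<mu>. fibre_pairing \<sigma> x (h i) \<omega> = 0"
  proof (rule fourier_uniqueness[OF sets_haar])
    show "integrable \<mu> (fibre_pairing \<sigma> x (h i))" by (rule V0_inner_fibre(1)[OF LF x h_family])
    fix \<gamma>
    have "hinner K (cls x) (S (cls (shift (- \<gamma>) (unit_family i)))) = 0"
      by (rule o[OF cls_in_K[OF shift_family[OF unit_family]]])
    then show "(\<integral>\<omega>. fibre_pairing \<sigma> x (h i) \<omega> * \<omega> \<gamma> \<partial>\<mu>) = 0"
      using inner_filter_row[OF x, of \<gamma> i] by simp
  qed
qed

end

section \<open>Equivalence with the canonical analysis\<close>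

locale complementary_gmra = filter_gmra \<alpha> \<mu> c \<H> \<pi> \<delta> V \<sigma> J h
  for \<alpha> :: "'g :: {ab_group_add, countable} \<Rightarrow> 'g"
    and \<mu> :: "'g character measure"
    and c :: "'g character \<Rightarrow> 'g character"
    and \<H> :: "'a hspace"
    and \<pi> :: "'g \<Rightarrow> 'a \<Rightarrow> 'a"
    and \<delta> :: "'a \<Rightarrow> 'a"
    and V :: "int \<Rightarrow> 'a set"
    and \<sigma> :: "nat \<Rightarrow> 'g character set"
    and J :: "'a \<Rightarrow> (nat \<Rightarrow> 'g character \<Rightarrow> complex) set"
    and h :: "'g filter_matrix" +
  fixes g :: "'g filter_matrix"
  assumes complementary: "complementary_filter \<alpha> \<mu> (multiplicity_fun \<sigma>) h g"
begin

abbreviation m :: "'g character \<Rightarrow> enat" where "m \<equiv> multiplicity_fun \<sigma>"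

abbreviation E :: "nat \<Rightarrow> 'g character set" where "E \<equiv> level_set (compl_multiplicity \<alpha> m)"

lemma LF_E: "locally_finite E"
  unfolding locally_finite_def
proof
  show "\<forall>i. E i \<in> sets dual_borel" using level_set_compl_measurable[OF \<sigma>_dec \<sigma>_sets] by blast
  show "AE \<omega> in \<mu>. finite {i. \<omega> \<in> E i}"
    using AE_regular[OF LF LF] by eventually_elim (simp add: compl_level_sets[OF \<sigma>_dec])
qed

lemma g_supported: "supported_matrix \<mu> \<sigma> g"
  using complementary unfolding complementary_filter_def level_set_eq by blast

lemma g_isometric: "isometric_matrix \<sigma> E g"
proof -
  have "AE \<omega> in \<mu>. \<forall>k k'. (\<Sum>\<zeta>\<in>fibre \<alpha> \<omega>. \<Sum>j. g k j \<zeta> * cnj (g k' j \<zeta>))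
      = (if k = k' \<and> \<omega> \<in> E k then of_nat index else 0)"
    using complementary unfolding complementary_filter_def by (simp add: AE_all_countable)
  with fibre_pairing_supported[OF g_supported g_supported]
  have "AE \<omega> in \<mu>. \<forall>k k'. fibre_pairing \<sigma> (g k) (g k') \<omega> = (if k = k' \<and> \<omega> \<in> E k then of_nat index else 0)"
    by eventually_elim simp
  then show ?thesis unfolding isometric_matrix_def using supported_matrixD(1)[OF g_supported] by blast
qed

lemma g_h_orthogonal: "AE \<omega> in \<mu>. \<forall>k i. fibre_pairing \<sigma> (g k) (h i) \<omega> = 0"
proof -
  have "AE \<omega> in \<mu>. \<forall>k i. (\<Sum>\<zeta>\<in>fibre \<alpha> \<omega>. \<Sum>j. g k j \<zeta> * cnj (h i j \<zeta>)) = 0"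
    using complementary unfolding complementary_filter_def by (simp add: AE_all_countable)
  with fibre_pairing_supported[OF g_supported h_supported] show ?thesis by eventually_elim simp
qed

text \<open>The filter bounds \<open>m\<close> by the fibre sum, so the complementary multiplicity is an honest difference and the two matrices have together as many rows as there are coordinates.\<close>

lemma multiplicity_balance:
  "AE \<omega> in \<mu>. card {i. \<omega> \<in> \<sigma> i} + card {k. \<omega> \<in> E k} = (\<Sum>\<zeta>\<in>fibre \<alpha> \<omega>. card {j. \<zeta> \<in> \<sigma> j})"
proof -
  have "AE \<omega> in \<mu>. \<forall>k k'. fibre_pairing \<sigma> (h k) (h k') \<omega> = (if k = k' \<and> \<omega> \<in> \<sigma> k then of_nat index else 0)"
    using filter_isometric unfolding isometric_matrix_def by blast
  with AE_regular[OF LF LF] show ?thesis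
  proof eventually_elim
    case (elim \<omega>)
    show ?case unfolding compl_level_sets[OF \<sigma>_dec elim(1)] using rows_card_le[OF elim] by simp
  qed
qed

abbreviation W :: "nat \<Rightarrow> ('g dil_index \<Rightarrow> 'g character \<Rightarrow> complex) set hspace" where
  "W \<equiv> W_space \<alpha> c \<mu> m"

abbreviation WI :: "nat \<Rightarrow> 'g dil_index set" where "WI \<equiv> W_indices \<alpha>"

abbreviation WM :: "nat \<Rightarrow> 'g dil_index \<Rightarrow> 'g character measure" where "WM \<equiv> W_measures \<alpha> c \<mu> m"

lemma WM_dual_part: "i \<in> WI n \<Longrightarrow> dual_part (WM n i)"
proof (induction n arbitrary: i)
  case 0
  then obtain k where "i = (k, [])" by auto
  then show ?case using LF_E dual_part_restrict(1)[OF sets_haar] unfolding locally_finite_def by simp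
next
  case (Suc n)
  show ?case using dual_part_dil_measures[of "WI n" "WM n" i] Suc by simp
qed

lemma W_modulate_closed:
  assumes "F \<in> hcarrier (W n)"
  shows "modulate (WI n) (WM n) \<gamma> F \<in> hcarrier (W n)"
proof -
  obtain f where f: "f \<in> L2_families (WI n) (WM n)" "F = L2_class (WI n) (WM n) f"
    using assms unfolding W_space_def L2_sum_carrier by blast
  have "(\<lambda>i \<omega>. \<omega> \<gamma> * f i \<omega>) \<in> L2_families (WI n) (WM n)"
    by (rule modulate_family[of "WI n" "WM n", OF WM_dual_part f(1)])
  then show ?thesis unfolding f(2) modulate_class[OF f(1)] W_space_def by (rule L2_class_in_carrier)
qed

definition row :: "('g dil_index \<Rightarrow> 'g character \<Rightarrow> complex) \<Rightarrow> nat \<Rightarrow> 'g character \<Rightarrow> complex" where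
  "row f k = f (k, [])"

lemma row_bij: "bij_betw (\<lambda>k. (k, [])) UNIV (WI 0)"
  by (auto simp: bij_betw_def inj_on_def)

lemma WM_0: "WM 0 (k, []) = V0_measure \<mu> E k"
  by (simp add: V0_measure_def)

lemma row_family_iff: "f \<in> L2_families (WI 0) (WM 0) \<longleftrightarrow> row f \<in> L2_families UNIV (V0_measure \<mu> E)"
proof -
  have "(\<lambda>i. \<integral>x. (cmod (f i x))\<^sup>2 \<partial>WM 0 i) summable_on WI 0
      \<longleftrightarrow> (\<lambda>k. \<integral>x. (cmod (row f k x))\<^sup>2 \<partial>V0_measure \<mu> E k) summable_on UNIV"
    unfolding summable_on_reindex_bij_betw[OF row_bij, symmetric] WM_0 row_def ..
  moreover have "(\<forall>i\<in>WI 0. P i) \<longleftrightarrow> (\<forall>k. P (k, []))" for P :: "'g dil_index \<Rightarrow> bool" by auto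
  ultimately show ?thesis unfolding L2_families_def by (simp add: WM_0 row_def del: W_measures.simps)
qed

lemma row_inner:
  "(\<Sum>\<^sub>\<infinity>i\<in>WI 0. \<integral>x. f i x * cnj (f' i x) \<partial>WM 0 i) = (\<Sum>\<^sub>\<infinity>k\<in>UNIV. \<integral>x. row f k x * cnj (row f' k x) \<partial>V0_measure \<mu> E k)"
  unfolding infsum_reindex_bij_betw[OF row_bij, symmetric] WM_0 row_def ..

lemma AE_V0:
  assumes "locally_finite \<tau>"
  shows "(AE x in V0_measure \<mu> \<tau> j. P x) \<longleftrightarrow> (AE x in \<mu>. x \<in> \<tau> j \<longrightarrow> P x)"
  unfolding V0_measure_def by (rule AE_restrict_space_iff[OF locally_finiteD(2)[OF assms]])

lemma AE_\<nu>: "AE x in \<mu>. \<forall>j. P j x \<Longrightarrow> AE x in \<nu> j. P j x"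
  unfolding AE_V0[OF LF] by (erule eventually_mono) blast

abbreviation SG where "SG \<equiv> S_G \<alpha> \<mu> m g"

lemma SG_class:
  assumes f: "f \<in> L2_families (WI 0) (WM 0)"
  shows "SG (L2_class (WI 0) (WM 0) f) = cls (ruelle_fun \<alpha> E g (row f))"
proof -
  let ?f' = "L2_rep (L2_class (WI 0) (WM 0) f)"
  have "AE \<omega> in \<mu>. \<omega> \<in> E k \<longrightarrow> ?f' (k, []) \<omega> = row f k \<omega>" for k
  proof -
    have "AE \<omega> in WM 0 (k, []). ?f' (k, []) \<omega> = f (k, []) \<omega>" by (rule L2_rep_AE[OF f]) simp
    then show ?thesis unfolding WM_0 AE_V0[OF LF_E] row_def .
  qed
  then have "AE \<omega> in \<mu>. \<forall>j. ruelle_fun \<alpha> E g (\<lambda>k. ?f' (k, [])) j \<omega> = ruelle_fun \<alpha> E g (row f) j \<omega>"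
    by (rule ruelle_cong)
  then show ?thesis unfolding S_G_def level_set_eq by (intro L2_class_cong AE_\<nu>)
qed

definition range_compl :: "(nat \<Rightarrow> 'g character \<Rightarrow> complex) set set" where
  "range_compl = ortho_compl_in K (hcarrier K) (S ` hcarrier K)"

text \<open>The complementary Ruelle operator is onto the orthogonal complement of the range of \<open>S\<close>: inclusion by orthogonality of the rows, equality by their number.\<close>

lemma SG_range: "SG ` hcarrier (W 0) = range_compl"
proof (intro equalityI subsetI)
  fix G assume "G \<in> SG ` hcarrier (W 0)"
  then obtain f where f: "f \<in> L2_families (WI 0) (WM 0)" "G = SG (L2_class (WI 0) (WM 0) f)"
    unfolding W_space_def by (auto simp only: L2_sum_carrier image_iff)
  let ?R = "ruelle_fun \<alpha> E g (row f)"
  have rf: "row f \<in> L2_families UNIV (V0_measure \<mu> E)" using f(1) row_family_iff by blast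
  have R: "?R \<in> fam" by (rule ruelle_family[OF LF LF_E g_isometric rf])
  have G: "G = cls ?R" unfolding f(2) by (rule SG_class[OF f(1)])
  have "hinner K G (S F) = 0" if F: "F \<in> hcarrier K" for F
  proof -
    obtain x where x: "x \<in> fam" "F = cls x" using F by (rule K_cases)
    have Sx: "ruelle_fun \<alpha> \<sigma> h x \<in> fam" by (rule ruelle_family[OF LF LF filter_isometric x(1)])
    show ?thesis unfolding G x(2) S_eq_ruelle[OF x(1)] K_eq L2_inner_class[OF R Sx]
      by (rule ruelle_orthogonal[OF LF LF_E LF g_isometric filter_isometric g_h_orthogonal rf x(1)])
  qed
  then show "G \<in> range_compl" unfolding range_compl_def ortho_compl_in_def using G cls_in_K[OF R] by auto
next
  fix G assume "G \<in> range_compl"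
  then have G: "G \<in> hcarrier K" and o: "\<And>F. F \<in> hcarrier K \<Longrightarrow> hinner K G (S F) = 0"
    unfolding range_compl_def ortho_compl_in_def by auto
  obtain x where x: "x \<in> fam" "G = cls x" using G by (rule K_cases)
  have xh: "AE \<omega> in \<mu>. \<forall>i. fibre_pairing \<sigma> x (h i) \<omega> = 0"
    by (rule orthogonal_to_range[OF x(1)]) (rule o[unfolded x(2)])
  obtain b where b: "b \<in> L2_families UNIV (V0_measure \<mu> E)"
    "\<And>j. AE \<omega> in \<mu>. \<omega> \<in> \<sigma> j \<longrightarrow> x j \<omega> = ruelle_fun \<alpha> E g b j \<omega>"
    using ruelle_surjective[OF LF LF_E LF g_isometric filter_isometric g_h_orthogonal multiplicity_balance x(1) xh]
    by blast
  define f where "f i = b (fst i)" for i :: "'g dil_index"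
  have "row f = b" unfolding row_def f_def by simp
  then have f: "f \<in> L2_families (WI 0) (WM 0)" using b(1) row_family_iff by simp
  have "SG (L2_class (WI 0) (WM 0) f) = cls (ruelle_fun \<alpha> E g b)" using SG_class[OF f] \<open>row f = b\<close> by simp
  also have "\<dots> = G" unfolding x(2)
  proof (rule L2_class_cong)
    fix j
    show "AE \<omega> in \<nu> j. ruelle_fun \<alpha> E g b j \<omega> = x j \<omega>"
      unfolding AE_V0[OF LF] using b(2)[of j] by eventually_elim simp
  qed
  finally show "G \<in> SG ` hcarrier (W 0)"
    unfolding W_space_def using L2_class_in_carrier[OF f] by (metis image_eqI)
qed

lemma SG_unitary: "unitary_map (W 0) (subspace_hspace K range_compl) SG"
proof -
  have rf: "row f \<in> L2_families UNIV (V0_measure \<mu> E)" if "f \<in> L2_families (WI 0) (WM 0)" for f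
    using that row_family_iff by blast
  have "unitary_map (L2_sum (WI 0) (WM 0)) (subspace_hspace (L2_sum UNIV \<nu>) range_compl) SG"
  proof (rule L2_unitary_mapI[where \<Phi> = "\<lambda>f. ruelle_fun \<alpha> E g (row f)"])
    show "SG (L2_class (WI 0) (WM 0) f) = cls (ruelle_fun \<alpha> E g (row f))"
      if "f \<in> L2_families (WI 0) (WM 0)" for f using SG_class[OF that] .
    show "ruelle_fun \<alpha> E g (row f) \<in> fam" if "f \<in> L2_families (WI 0) (WM 0)" for f
      by (rule ruelle_family[OF LF LF_E g_isometric rf[OF that]])
    show "AE x in \<nu> j. ruelle_fun \<alpha> E g (row (\<lambda>i x. f i x + f' i x)) j x
        = ruelle_fun \<alpha> E g (row f) j x + ruelle_fun \<alpha> E g (row f') j x" for f f' j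
      using AE_\<nu>[OF ruelle_lin(1)[OF LF_E, of g "row f" "row f'"]] unfolding row_def .
    show "AE x in \<nu> j. ruelle_fun \<alpha> E g (row (\<lambda>i x. a * f i x)) j x = a * ruelle_fun \<alpha> E g (row f) j x" for a f j
      using AE_\<nu>[OF ruelle_lin(2)[OF LF_E, of g a "row f"]] unfolding row_def .
    show "(\<Sum>\<^sub>\<infinity>j\<in>UNIV. \<integral>x. ruelle_fun \<alpha> E g (row f) j x * cnj (ruelle_fun \<alpha> E g (row f') j x) \<partial>\<nu> j)
        = (\<Sum>\<^sub>\<infinity>i\<in>WI 0. \<integral>x. f i x * cnj (f' i x) \<partial>WM 0 i)"
      if "f \<in> L2_families (WI 0) (WM 0)" "f' \<in> L2_families (WI 0) (WM 0)" for f f'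
      unfolding row_inner by (rule ruelle_inner[OF LF LF_E g_isometric rf[OF that(1)] rf[OF that(2)]])
    show "range_compl = SG ` hcarrier (L2_sum (WI 0) (WM 0))" using SG_range unfolding W_space_def by simp
  qed
  then show ?thesis unfolding W_space_def K_eq .
qed

lemma SG_modulate:
  assumes "F \<in> hcarrier (W 0)"
  shows "SG (modulate (WI 0) (WM 0) \<gamma> F) = modulate UNIV \<nu> (\<alpha> \<gamma>) (SG F)"
proof -
  obtain f where f: "f \<in> L2_families (WI 0) (WM 0)" "F = L2_class (WI 0) (WM 0) f"
    using assms unfolding W_space_def L2_sum_carrier by blast
  have f': "(\<lambda>i \<omega>. \<omega> \<gamma> * f i \<omega>) \<in> L2_families (WI 0) (WM 0)"
    by (rule modulate_family[of "WI 0" "WM 0", OF WM_dual_part f(1)])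
  have R: "ruelle_fun \<alpha> E g (row f) \<in> fam"
    by (rule ruelle_family[OF LF LF_E g_isometric row_family_iff[THEN iffD1, OF f(1)]])
  have "AE x in \<nu> j. ruelle_fun \<alpha> E g (row (\<lambda>i \<omega>. \<omega> \<gamma> * f i \<omega>)) j x = x (\<alpha> \<gamma>) * ruelle_fun \<alpha> E g (row f) j x" for j
    using AE_\<nu>[OF ruelle_lin(3)[OF LF_E, of g \<gamma> "row f"]] unfolding row_def .
  then show ?thesis
    unfolding f(2) modulate_class[OF f(1)] SG_class[OF f(1)] SG_class[OF f'] modulate_class[OF R]
    by (rule L2_class_cong)
qed

definition Wsub :: "nat \<Rightarrow> 'a set" where
  "Wsub n = ortho_compl_in \<H> (V (int (Suc n))) (V (int n))"

lemma Wsub_carrier: "f \<in> Wsub n \<Longrightarrow> f \<in> hcarrier \<H>"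
  unfolding Wsub_def ortho_compl_in_def using V_carrier by blast

lemma Wsub_subset: "Wsub n \<subseteq> V (int n + 1)"
  unfolding Wsub_def ortho_compl_in_def by (auto simp: add.commute)

text \<open>The inverse dilation carries \<open>V\<^sub>1\<close> to \<open>V\<^sub>0\<close> and \<open>V\<^sub>0\<close> to the range of \<open>S\<close>, hence their orthogonal difference to the complement of that range.\<close>

lemma JD_range: "(\<lambda>f. J (D f)) ` Wsub 0 = range_compl"
proof -
  have D1: "D ` V 1 = V 0" using D_V[of 0] by simp
  have inner: "hinner K (J (D f)) (J (D f')) = hinner \<H> f f'" if "f \<in> V 1" "f' \<in> V 1" for f f'
  proof -
    have "D f \<in> V 0" "D f' \<in> V 0" using that D1 by auto
    then show ?thesis using JD(5) DD(5)[OF V_carrier[OF that(1)] V_carrier[OF that(2)]] by simp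
  qed
  have V01: "V 0 \<subseteq> V 1" using nested[of 0] by simp
  have SK: "S ` hcarrier K = (\<lambda>f. J (D f)) ` V 0"
  proof -
    have "hcarrier K = J ` V 0" using JD(1) by (simp add: bij_betw_def)
    then show ?thesis using S_J by (simp add: image_image cong: image_cong)
  qed
  have KJ: "hcarrier K = (\<lambda>f. J (D f)) ` V 1"
  proof -
    have "(\<lambda>f. J (D f)) ` V 1 = J ` (D ` V 1)" by (simp only: image_image)
    then show ?thesis using D1 JD(1) by (simp add: bij_betw_def)
  qed
  have W0: "Wsub 0 = {f \<in> V 1. \<forall>f'\<in>V 0. hinner \<H> f f' = 0}" unfolding Wsub_def ortho_compl_in_def by simp
  have "J (D f) \<in> range_compl \<longleftrightarrow> f \<in> Wsub 0" if f: "f \<in> V 1" for f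
    unfolding W0 range_compl_def ortho_compl_in_def SK using f V01 inner[OF f] KJ by (auto simp: subset_iff)
  moreover have "range_compl \<subseteq> (\<lambda>f. J (D f)) ` V 1"
    unfolding KJ[symmetric] range_compl_def ortho_compl_in_def by blast
  moreover have "Wsub 0 \<subseteq> V 1" using Wsub_subset[of 0] by simp
  ultimately show ?thesis by blast
qed

lemma JD_unitary: "unitary_map (subspace_hspace \<H> (Wsub 0)) (subspace_hspace K range_compl) (\<lambda>f. J (D f))"
proof -
  have D1: "D ` V 1 = V 0" using D_V[of 0] by simp
  have "unitary_map (subspace_hspace \<H> (V 1)) (subspace_hspace \<H> (V 0)) D"
    by (rule unitary_map_restrict[OF D_unitary _ D1]) (use V_carrier in blast)
  then have "unitary_map (subspace_hspace \<H> (V 1)) K (\<lambda>f. J (D f))"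
    using J_unitary by (rule unitary_map_comp)
  from unitary_map_restrict[OF this, of "Wsub 0" range_compl] show ?thesis
    using JD_range Wsub_subset[of 0] by simp
qed

lemma D_Wsub: "D ` Wsub (Suc n) = Wsub n"
proof -
  have DV: "D ` V (int (Suc k)) = V (int k)" for k using D_V[of "int k"] by (simp add: add.commute)
  have i: "D f \<in> Wsub n \<longleftrightarrow> f \<in> Wsub (Suc n)" if f: "f \<in> V (int (Suc (Suc n)))" for f
  proof -
    have "D f \<in> V (int (Suc n))" using f DV[of "Suc n"] by blast
    moreover have "(\<forall>k\<in>V (int n). hinner \<H> (D f) k = 0) \<longleftrightarrow> (\<forall>k\<in>V (int (Suc n)). hinner \<H> f k = 0)"
    proof -
      have "(\<forall>k\<in>V (int n). hinner \<H> (D f) k = 0) \<longleftrightarrow> (\<forall>k\<in>V (int (Suc n)). hinner \<H> (D f) (D k) = 0)"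
        unfolding DV[of n, symmetric] by blast
      then show ?thesis using DD(5)[OF V_carrier[OF f] V_carrier] by simp
    qed
    ultimately show ?thesis unfolding Wsub_def ortho_compl_in_def using f by simp
  qed
  have "Wsub n \<subseteq> D ` V (int (Suc (Suc n)))" unfolding DV Wsub_def ortho_compl_in_def by blast
  moreover have "Wsub (Suc n) \<subseteq> V (int (Suc (Suc n)))" unfolding Wsub_def ortho_compl_in_def by blast
  ultimately show ?thesis using i by blast
qed

text \<open>The model of \<open>W\<^sub>n = V\<^sub>n\<^sub>+\<^sub>1 \<ominus> V\<^sub>n\<close>: for \<open>n = 0\<close> it is read off through the complementary Ruelle operator, and one application of the dilation of the analysis is matched with one application of the dilation by \<open>\<alpha>\<^sup>*\<close>.\<close>

primrec R :: "nat \<Rightarrow> 'a \<Rightarrow> ('g dil_index \<Rightarrow> 'g character \<Rightarrow> complex) set" where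
  "R 0 = (\<lambda>f. inv_into (hcarrier (W 0)) SG (J (D f)))"
| "R (Suc n) = (\<lambda>f. dil_op \<alpha> c (WI n) (WM n) (R n (D f)))"

lemma W_closed:
  "F \<in> hcarrier (W n) \<Longrightarrow> G \<in> hcarrier (W n) \<Longrightarrow> hadd (W n) F G \<in> hcarrier (W n)"
  "F \<in> hcarrier (W n) \<Longrightarrow> hscale (W n) a F \<in> hcarrier (W n)"
  unfolding W_space_def by (rule L2_sum_closed; assumption)+

lemma dil_unitary: "unitary_map (W n) (W (Suc n)) (dil_op \<alpha> c (WI n) (WM n))"
  unfolding W_space_def using dil_op_unitary[of "WI n" "WM n", OF WM_dual_part] by simp

lemma R_unitary: "unitary_map (subspace_hspace \<H> (Wsub n)) (W n) (R n)"
proof (induction n)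
  case 0
  have "unitary_map (subspace_hspace K range_compl) (W 0) (inv_into (hcarrier (W 0)) SG)"
    by (rule unitary_map_inv[OF SG_unitary]) (rule W_closed; assumption)+
  from unitary_map_comp[OF JD_unitary this] show ?case by simp
next
  case (Suc n)
  have "unitary_map (subspace_hspace \<H> (Wsub (Suc n))) (subspace_hspace \<H> (Wsub n)) D"
    by (rule unitary_map_restrict[OF D_unitary _ D_Wsub]) (use Wsub_carrier in blast)
  from unitary_map_comp[OF unitary_map_comp[OF this Suc] dil_unitary] show ?case by simp
qed

lemmas RD = unitary_mapD[OF R_unitary, simplified]

lemma V_rep: "f \<in> V (int n) \<Longrightarrow> \<pi> \<gamma> f \<in> V (int n)"
proof (induction n arbitrary: f \<gamma>)
  case 0
  then show ?case using invariant by simp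
next
  case (Suc n)
  have "V (int (Suc n)) = \<delta> ` V (int n)" using dilate[of "int n"] by (simp add: add.commute)
  then obtain f' where f': "f' \<in> V (int n)" "f = \<delta> f'" using Suc.prems by blast
  have "\<pi> \<gamma> f = \<delta> (D (\<pi> \<gamma> (\<delta> f')))" using \<delta>_D \<pi>D(2) V_carrier[OF Suc.prems] f'(2) by simp
  also have "\<dots> = \<delta> (\<pi> (\<alpha> \<gamma>) f')" using dilation[OF V_carrier[OF f'(1)]] by simp
  finally show ?case using Suc.IH[OF f'(1)] \<open>V (int (Suc n)) = \<delta> ` V (int n)\<close> by simp
qed

lemma rep_adjoint: "f \<in> hcarrier \<H> \<Longrightarrow> k \<in> hcarrier \<H> \<Longrightarrow> hinner \<H> (\<pi> \<gamma> f) k = hinner \<H> f (\<pi> (- \<gamma>) k)"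
  using \<pi>D(5)[of f "\<pi> (- \<gamma>) k" \<gamma>] \<pi>D(2)[of k "- \<gamma>"] \<pi>_inverse(1)[of k \<gamma>] by simp

lemma Wsub_rep: "f \<in> Wsub n \<Longrightarrow> \<pi> \<gamma> f \<in> Wsub n"
  unfolding Wsub_def ortho_compl_in_def
  using V_rep[of f "Suc n" \<gamma>] rep_adjoint[OF V_carrier V_carrier] V_rep[of _ n "- \<gamma>"] by auto

text \<open>Both steps of the recursion replace \<open>\<gamma>\<close> by \<open>\<alpha> \<gamma>\<close> on one side and undo it on the other: \<open>\<delta>\<^sup>-\<^sup>1\<close> by the dilation relation, the Ruelle operator and the dilation operator by evaluation on fibres.\<close>

lemma R_rep: "f \<in> Wsub n \<Longrightarrow> R n (\<pi> \<gamma> f) = modulate (WI n) (WM n) \<gamma> (R n f)"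
proof (induction n arbitrary: f \<gamma>)
  case 0
  note SGD = unitary_mapD[OF SG_unitary, simplified]
  have fV: "D f \<in> V 0" using 0 Wsub_subset[of 0] D_V[of 0] by auto
  have SR: "SG (R 0 k) = J (D k)" if "k \<in> Wsub 0" for k
  proof -
    have "J (D k) \<in> SG ` hcarrier (W 0)" unfolding SG_range using JD_range that by blast
    then show ?thesis by (simp add: f_inv_into_f)
  qed
  have "SG (modulate (WI 0) (WM 0) \<gamma> (R 0 f)) = modulate UNIV \<nu> (\<alpha> \<gamma>) (J (D f))"
    using SG_modulate[OF RD(2)[OF 0]] SR[OF 0] by simp
  also have "\<dots> = J (\<pi> (\<alpha> \<gamma>) (D f))" by (rule J_pi[OF fV, symmetric])
  also have "\<dots> = SG (R 0 (\<pi> \<gamma> f))" using SR[OF Wsub_rep[OF 0]] D_\<pi>[OF Wsub_carrier[OF 0]] by simp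
  finally have "SG (R 0 (\<pi> \<gamma> f)) = SG (modulate (WI 0) (WM 0) \<gamma> (R 0 f))" ..
  then show ?case
    using bij_betw_imp_inj_on[OF SGD(1)] RD(2)[OF Wsub_rep[OF 0]] W_modulate_closed[OF RD(2)[OF 0]] by (meson inj_onD)
next
  case (Suc n)
  have Df: "D f \<in> Wsub n" using D_Wsub Suc.prems by blast
  have "R (Suc n) (\<pi> \<gamma> f) = dil_op \<alpha> c (WI n) (WM n) (modulate (WI n) (WM n) (\<alpha> \<gamma>) (R n (D f)))"
    using Suc.IH[OF Df] D_\<pi>[OF Wsub_carrier[OF Suc.prems]] by simp
  also have "\<dots> = modulate (WI (Suc n)) (WM (Suc n)) \<gamma> (R (Suc n) f)"
    using dil_op_modulate[of "WI n" "WM n", OF WM_dual_part RD(2)[OF Df, unfolded W_space_def]] by simp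
  finally show ?case .
qed

definition P :: "nat \<Rightarrow> 'a \<Rightarrow> 'a" where
  "P n f = hproj (V (int n)) f"

definition Q :: "nat \<Rightarrow> 'a \<Rightarrow> 'a" where
  "Q n f = hsub (P (Suc n) f) (P n f)"

lemma P: "f \<in> hcarrier \<H> \<Longrightarrow> P n f \<in> V (int n)" "f \<in> hcarrier \<H> \<Longrightarrow> P n f \<in> hcarrier \<H>"
  "f \<in> hcarrier \<H> \<Longrightarrow> k \<in> V (int n) \<Longrightarrow> hinner \<H> (P n f) k = hinner \<H> f k"
  unfolding P_def using hproj[OF closed] by auto

lemma P_eqI:
  "\<lbrakk>f \<in> hcarrier \<H>; p \<in> V (int n); \<And>k. k \<in> V (int n) \<Longrightarrow> hinner \<H> p k = hinner \<H> f k\<rbrakk> \<Longrightarrow> P n f = p"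
  unfolding P_def by (rule hproj_eqI[OF closed])

lemma Q_Wsub:
  assumes f: "f \<in> hcarrier \<H>"
  shows "Q n f \<in> Wsub n"
proof -
  have s: "V (int n) \<subseteq> V (int (Suc n))" by (rule V_mono) simp
  have "Q n f \<in> V (int (Suc n))"
    unfolding Q_def using P(1)[OF f, of "Suc n"] P(1)[OF f, of n] s
    by (intro subspace_closed[OF closed]) auto
  moreover have "hinner \<H> (Q n f) k = 0" if k: "k \<in> V (int n)" for k
  proof -
    have k': "k \<in> V (int (Suc n))" using k s by blast
    have "hinner \<H> (P (Suc n) f) k = hinner \<H> (P n f) k" by (simp only: P(3)[OF f k'] P(3)[OF f k])
    then show ?thesis unfolding Q_def using P(2)[OF f] V_carrier[OF k] by (simp add: hilbert_simps)
  qed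
  ultimately show ?thesis unfolding Wsub_def ortho_compl_in_def by blast
qed

lemma P_rep:
  assumes f: "f \<in> hcarrier \<H>"
  shows "P n (\<pi> \<gamma> f) = \<pi> \<gamma> (P n f)"
proof (rule P_eqI[OF \<pi>D(2)[OF f] V_rep[OF P(1)[OF f]]])
  fix k assume k: "k \<in> V (int n)"
  show "hinner \<H> (\<pi> \<gamma> (P n f)) k = hinner \<H> (\<pi> \<gamma> f) k"
    unfolding rep_adjoint[OF P(2)[OF f] V_carrier[OF k]] rep_adjoint[OF f V_carrier[OF k]]
    by (rule P(3)[OF f V_rep[OF k]])
qed

lemma Q_rep: "f \<in> hcarrier \<H> \<Longrightarrow> Q n (\<pi> \<gamma> f) = \<pi> \<gamma> (Q n f)"
  unfolding Q_def by (simp add: P_rep \<pi>D P(2) scale_closed)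

text \<open>The inverse dilation shifts the filtration by one step.\<close>

lemma P_D:
  assumes f: "f \<in> hcarrier \<H>"
  shows "P n (D f) = D (P (Suc n) f)"
proof -
  have DV: "D ` V (int (Suc n)) = V (int n)" using D_V[of "int n"] by (simp add: add.commute)
  show ?thesis
  proof (rule P_eqI[OF DD(2)[OF f]])
    show "D (P (Suc n) f) \<in> V (int n)" using DV P(1)[OF f, of "Suc n"] by blast
    fix k assume "k \<in> V (int n)"
    then obtain k' where k': "k' \<in> V (int (Suc n))" "k = D k'" unfolding DV[symmetric] by blast
    show "hinner \<H> (D (P (Suc n) f)) k = hinner \<H> (D f) k"
      unfolding k'(2) DD(5)[OF P(2)[OF f] V_carrier[OF k'(1)]] DD(5)[OF f V_carrier[OF k'(1)]]
      by (rule P(3)[OF f k'(1)])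
  qed
qed

lemma Q_D: "f \<in> hcarrier \<H> \<Longrightarrow> Q n (D f) = D (Q (Suc n) f)"
  unfolding Q_def by (simp add: P_D DD P(2) scale_closed)

definition U :: "'a \<Rightarrow> 'g can_vector" where
  "U = filtration_map (\<lambda>n. V (int n)) J R"

lemma U_eq: "U f = (J (P 0 f), \<lambda>n. R n (Q n f))"
  unfolding U_def filtration_map_def P_def Q_def by simp

abbreviation Can :: "'g can_vector hspace" where "Can \<equiv> can_space \<alpha> c \<mu> m"

abbreviation T :: "'g can_vector \<Rightarrow> 'g can_vector" where "T \<equiv> can_T \<alpha> c \<mu> m h g"

lemma Can_eq: "Can = hsum K W"
  unfolding can_space_def level_set_eq ..

lemma U_unitary: "unitary_map \<H> Can U"
  unfolding Can_eq U_def
proof (rule filtration_unitary)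
  show "closed_subspace \<H> (V (int n))" for n by (rule closed)
  show "V (int n) \<subseteq> V (int (Suc n))" for n by (rule V_mono) simp
  show "\<exists>k\<in>\<Union>n. V (int n). hdist \<H> f k < e" if fe: "f \<in> hcarrier \<H>" "0 < e" for f e
  proof -
    obtain k j where k: "k \<in> V j" "hdist \<H> f k < e" using dense_union[OF fe] by blast
    have "k \<in> V (int (nat j))" using V_mono[of j "int (nat j)"] k(1) by auto
    then show ?thesis using k(2) by blast
  qed
  show "unitary_map (subspace_hspace \<H> (V (int 0))) K J" using J_unitary by simp
  show "unitary_map (subspace_hspace \<H> (ortho_compl_in \<H> (V (int (Suc n))) (V (int n)))) (W n) (R n)" for n
    using R_unitary[of n] unfolding Wsub_def .
qed

lemmas UD = unitary_mapD[OF U_unitary]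

lemma U_rep: "f \<in> hcarrier \<H> \<Longrightarrow> can_rep \<alpha> c \<mu> m \<gamma> (U f) = U (\<pi> \<gamma> f)"
  unfolding U_eq can_rep_def level_set_eq
  using J_pi[OF P(1)[of f 0, simplified]] R_rep[OF Q_Wsub[of f]] by (simp add: P_rep Q_rep)

text \<open>In the first coordinate, the two summands of \<open>T\<close> are the images under \<open>\<delta>\<^sup>-\<^sup>1\<close> of the components of \<open>f\<close> in \<open>V\<^sub>0\<close> and in \<open>W\<^sub>0\<close>, which together make up the projection to \<open>V\<^sub>1\<close>.  In the other coordinates \<open>T\<close> undoes the last step of the recursion defining \<open>R\<close>.\<close>

lemma T_U:
  assumes f: "f \<in> hcarrier \<H>"
  shows "T (U f) = U (D f)"
proof -
  have P0: "P 0 f \<in> V 0" using P(1)[OF f, of 0] by simp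
  have SR: "SG (R 0 (Q 0 f)) = J (D (Q 0 f))"
  proof -
    have "J (D (Q 0 f)) \<in> SG ` hcarrier (W 0)" unfolding SG_range using JD_range Q_Wsub[OF f, of 0] by blast
    then show ?thesis by (simp add: f_inv_into_f)
  qed
  have DQ0: "D (Q 0 f) \<in> V 0" using Q_Wsub[OF f, of 0] Wsub_subset[of 0] D_V[of 0] by auto
  have "hadd K (S_H \<alpha> \<mu> m h (J (P 0 f))) (SG (R 0 (Q 0 f))) = hadd K (J (D (P 0 f))) (J (D (Q 0 f)))"
    using S_H_eq[OF JD(2)[OF P0]] S_J[OF P0] SR by simp
  also have "\<dots> = J (hadd \<H> (D (P 0 f)) (D (Q 0 f)))" by (rule JD(3)[OF D_V0[OF P0] DQ0, symmetric])
  also have "hadd \<H> (D (P 0 f)) (D (Q 0 f)) = D (hadd \<H> (P 0 f) (Q 0 f))"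
    using DD(3)[OF P(2)[OF f] Wsub_carrier[OF Q_Wsub[OF f]]] by simp
  also have "hadd \<H> (P 0 f) (Q 0 f) = P (Suc 0) f"
  proof (rule vec_eqI)
    fix k assume "k \<in> hcarrier \<H>"
    then show "hinner \<H> (hadd \<H> (P 0 f) (Q 0 f)) k = hinner \<H> (P (Suc 0) f) k"
      unfolding Q_def using P(2)[OF f] by (simp add: hilbert_simps)
  qed (use P(2)[OF f] Wsub_carrier[OF Q_Wsub[OF f]] add_closed in auto)
  also have "D (P (Suc 0) f) = P 0 (D f)" using P_D[OF f, of 0] by simp
  finally have first: "hadd K (S_H \<alpha> \<mu> m h (J (P 0 f))) (SG (R 0 (Q 0 f))) = J (P 0 (D f))" .
  have second: "inv_into (hcarrier (W n)) (dil_op \<alpha> c (WI n) (WM n)) (R (Suc n) (Q (Suc n) f)) = R n (Q n (D f))" for n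
  proof -
    have "D (Q (Suc n) f) \<in> Wsub n" using D_Wsub Q_Wsub[OF f] by blast
    then have "R n (D (Q (Suc n) f)) \<in> hcarrier (W n)" by (rule RD(2))
    then have "inv_into (hcarrier (W n)) (dil_op \<alpha> c (WI n) (WM n)) (R (Suc n) (Q (Suc n) f)) = R n (D (Q (Suc n) f))"
      using bij_betw_inv_into_left[OF unitary_mapD(1)[OF dil_unitary]] by simp
    then show ?thesis using Q_D[OF f] by simp
  qed
  show ?thesis unfolding U_eq can_T_def level_set_eq using first second by simp
qed

lemma T_inj: "inj_on T (hcarrier Can)"
proof (rule inj_onI)
  fix x y assume "x \<in> hcarrier Can" "y \<in> hcarrier Can" and e: "T x = T y"
  then obtain f k where f: "f \<in> hcarrier \<H>" "x = U f" and k: "k \<in> hcarrier \<H>" "y = U k"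
    using bij_betw_imp_surj_on[OF UD(1)] by (metis imageE)
  have "U (D f) = U (D k)" using e T_U f k by simp
  then have "D f = D k" using bij_betw_imp_inj_on[OF UD(1)] DD(2) f(1) k(1) by (meson inj_onD)
  then have "f = k" using \<delta>_D f(1) k(1) by metis
  then show "x = y" using f k by simp
qed

lemma delta_U: "f \<in> hcarrier \<H> \<Longrightarrow> can_delta \<alpha> c \<mu> m h g (U f) = U (\<delta> f)"
  unfolding can_delta_def
  using inv_into_f_f[OF T_inj UD(2)[OF \<delta>D(2)], of f] T_U[OF \<delta>D(2), of f] D_\<delta>[of f] by simp

lemma W_zero: "hzero (W n) = R n (hzero \<H>)" and K_zero: "hzero K = J (hzero \<H>)"
proof -
  have z: "hzero \<H> \<in> Wsub n"
    unfolding Wsub_def ortho_compl_in_def using V_zero V_carrier by (auto simp: inner_zero_left)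
  have "R n (hscale \<H> 0 (hzero \<H>)) = hscale (W n) 0 (R n (hzero \<H>))" using RD(4)[OF z] .
  also have "\<dots> = hzero (W n)" using L2_scale_zero RD(2)[OF z] unfolding W_space_def by blast
  finally show "hzero (W n) = R n (hzero \<H>)" using scale_zero[OF zero_closed] by simp
  have z0: "hzero \<H> \<in> V 0" by (rule V_zero)
  have "J (hscale \<H> 0 (hzero \<H>)) = hscale K 0 (J (hzero \<H>))" using JD(4)[OF z0] .
  also have "\<dots> = hzero K" using L2_scale_zero JD(2)[OF z0] unfolding K_eq by blast
  finally show "hzero K = J (hzero \<H>)" using scale_zero[OF zero_closed] by simp
qed

lemma U_V0: "f \<in> V 0 \<Longrightarrow> U f = (J f, \<lambda>n. hzero (W n))"
proof -
  assume f: "f \<in> V 0"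
  have P: "P n f = f" for n
    unfolding P_def using hproj_ident[OF closed] V_mono[of 0 "int n"] f by auto
  show ?thesis unfolding U_eq Q_def P W_zero using add_inverse[OF V_carrier[OF f]] by simp
qed

lemma Can_zero: "hzero Can = U (hzero \<H>)"
  unfolding U_V0[OF V_zero] Can_eq hsum_def K_zero by simp

lemma T_power: "(T ^^ k) ` (U ` V j) = U ` V (j - int k)"
proof (induction k)
  case (Suc k)
  have "(T ^^ Suc k) ` (U ` V j) = T ` (U ` V (j - int k))" unfolding Suc.IH[symmetric] by (simp add: image_comp)
  also have "\<dots> = U ` (D ` V (j - int k))"
    unfolding image_image using T_U[OF V_carrier] by (intro image_cong) auto
  also have "D ` V (j - int k) = V (j - int (Suc k))" using D_V[of "j - int k - 1"] by (simp add: algebra_simps)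
  finally show ?case .
qed simp

lemma delta_power: "(can_delta \<alpha> c \<mu> m h g ^^ k) ` (U ` V j) = U ` V (j + int k)"
proof (induction k)
  case (Suc k)
  let ?d = "can_delta \<alpha> c \<mu> m h g"
  have "(?d ^^ Suc k) ` (U ` V j) = ?d ` (U ` V (j + int k))" unfolding Suc.IH[symmetric] by (simp add: image_comp)
  also have "\<dots> = U ` (\<delta> ` V (j + int k))"
    unfolding image_image using delta_U[OF V_carrier] by (intro image_cong) auto
  also have "\<delta> ` V (j + int k) = V (j + int (Suc k))" using dilate[of "j + int k"] by (simp add: algebra_simps)
  finally show ?case .
qed simp

text \<open>The powers of \<open>T\<close> with negative exponent are powers of the canonical dilation, so both signs of \<open>j\<close> reduce to an intertwining relation.\<close>

lemma can_V_eq: "can_V \<alpha> c \<mu> m h g j = U ` V j"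
proof -
  have base: "{(v, \<lambda>n. hzero (W n)) | v. v \<in> hcarrier (V0_space \<mu> (level_set m))} = U ` V 0"
  proof -
    have "hcarrier K = J ` V 0" using JD(1) by (simp add: bij_betw_def)
    then have "{(v, \<lambda>n. hzero (W n)) | v. v \<in> hcarrier K} = (\<lambda>f. (J f, \<lambda>n. hzero (W n))) ` V 0" by auto
    also have "\<dots> = U ` V 0" using U_V0 by (intro image_cong) auto
    finally show ?thesis unfolding level_set_eq .
  qed
  show ?thesis
  proof (cases "0 \<le> - j")
    case True
    then show ?thesis unfolding can_V_def base int_power_def using T_power[of "nat (- j)" 0] by simp
  next
    case False
    then show ?thesis unfolding can_V_def base int_power_def
      using delta_power[of "nat j" 0] by (simp add: can_delta_def)
  qed
qed

lemma equivalent_canonical: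
  "gmra_equivalent \<alpha> \<H> \<pi> \<delta> V Can (can_rep \<alpha> c \<mu> m) (can_delta \<alpha> c \<mu> m h g) (can_V \<alpha> c \<mu> m h g)"
proof -
  have G: "gmra \<H> \<alpha> \<pi> \<delta> V" by (rule gmra_axioms)
  have "gmra Can \<alpha> (can_rep \<alpha> c \<mu> m) (can_delta \<alpha> c \<mu> m h g) (can_V \<alpha> c \<mu> m h g)"
    by (rule gmra_transfer[OF G U_unitary Can_zero U_rep delta_U can_V_eq])
  then show ?thesis
    unfolding gmra_equivalent_def using G U_unitary can_V_eq U_rep delta_U by (metis (full_types))
qed

end

theorem theorem12:
  fixes \<alpha> :: "'g :: {ab_group_add, countable} \<Rightarrow> 'g"
    and \<mu> :: "'g character measure"
    and c :: "'g character \<Rightarrow> 'g character"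
    and \<H> :: "'a hspace"
    and \<pi> :: "'g \<Rightarrow> 'a \<Rightarrow> 'a"
    and \<delta> :: "'a \<Rightarrow> 'a"
    and V :: "int \<Rightarrow> 'a set"
    and \<sigma> :: "nat \<Rightarrow> 'g character set"
    and m :: "'g character \<Rightarrow> enat"
    and J :: "'a \<Rightarrow> (nat \<Rightarrow> 'g character \<Rightarrow> complex) set"
    and H G :: "'g filter_matrix"
  assumes "admissible_endo \<alpha>"
    and "haar_measure \<mu>"
    and "cross_section \<alpha> c"
    and "gmra \<H> \<alpha> \<pi> \<delta> V"
    and "\<And>\<nu>. associated_measure (subspace_hspace \<H> (V 0)) \<pi> \<nu> \<Longrightarrow> absolutely_continuous \<mu> \<nu>"
    and "\<And>\<nu>. associated_measure (subspace_hspace \<H> (ortho_compl_in \<H> (V 1) (V 0))) \<pi> \<nu>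
           \<Longrightarrow> absolutely_continuous \<mu> \<nu>"
    and "multiplicity_model \<mu> \<H> \<pi> (V 0) \<sigma> J"
    and "m = multiplicity_fun \<sigma>"
    and "AE \<omega> in \<mu>. m \<omega> \<noteq> \<infinity>"
    and "constructed_filter \<mu> \<H> \<delta> (V 0) \<sigma> J H"
    and "complementary_filter \<alpha> \<mu> m H G"
  shows "gmra_equivalent \<alpha> \<H> \<pi> \<delta> V
           (can_space \<alpha> c \<mu> m) (can_rep \<alpha> c \<mu> m) (can_delta \<alpha> c \<mu> m H G) (can_V \<alpha> c \<mu> m H G)"
proof -
  have "complementary_gmra \<alpha> \<mu> c \<H> \<pi> \<delta> V \<sigma> J H G"
    using assms
    by (intro complementary_gmra.intro complementary_gmra_axioms.intro filter_gmra.intro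
        filter_gmra_axioms.intro dual_system.intro) simp_all
  then show ?thesis
    unfolding \<open>m = multiplicity_fun \<sigma>\<close> by (rule complementary_gmra.equivalent_canonical)
qed

end
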